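(* For $d\ge2$ let $\alpha_d=\frac{\mathbb 1-F}{d(d-1)}$ be the antisymmetric state on $\mathbb C^d\otimes\mathbb C^d$. Then $$D^{\mathbb{SEP},\infty}(\alpha_d\|\mathcal S)\le\log_2\Big(1+\frac2d\Big)\xrightarrow[d\to\infty]{}0,$$ while $D^\infty(\alpha_d\|\mathcal S)\ge\frac12\log_2\frac43$ for all $d\geq 2$. Consequently $D^{\mathbb{SEP},\infty}(\alpha_d\|\mathcal S)<D^\infty(\alpha_d\|\mathcal S)$ for all $d\ge13$. More precisely, for all $d\ge13$, $$\mathrm{Stein}_{\mathbb{SEP}}(\alpha_d\|\mathcal S)=D^{\mathbb{SEP},\infty}(\alpha_d\|\mathcal S)<\tfrac12\log_2\tfrac43\le D^\infty(\alpha_d\|\mathcal S)=\mathrm{Stein}_{\mathbb{ALL}}(\alpha_d\|\mathcal S),$$ and $\mathrm{Stein}_{\mathbb{SEP}}(\alpha_d\|\mathcal S)\to0$ as $d\to\infty$.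
   Context: $F$ is the swap operator, $F|\psi\rangle|\phi\rangle=|\phi\rangle|\psi\rangle$. $\mathcal S=\mathcal S(A\!:\!B)$ is the set of separable states (finite convex combinations of product states) on a finite-dimensional bipartite system $AB$; $\mathrm{cone}(\mathcal S)=\{\lambda\sigma:\lambda\ge0,\sigma\in\mathcal S\}$; $\mathcal S_n=\mathcal S(A^n\!:\!B^n)$. $\mathbb{ALL}$ is the set of all finite-outcome POVMs; $\mathbb{SEP}$ is the set of POVMs $(E_x)_x$ with all $E_x\in\mathrm{cone}(\mathcal S)$. $D(\rho\|\sigma)=\mathrm{Tr}[\rho(\log_2\rho-\log_2\sigma)]$ ($+\infty$ unless $\mathrm{supp}\,\rho\subseteq\mathrm{supp}\,\sigma$). $D^{\mathbb{SEP}}(\rho\|\sigma)=\sup_{(E_x)_x\in\mathbb{SEP}}\sum_x\mathrm{Tr}[\rho E_x]\log_2\frac{\mathrm{Tr}[\rho E_x]}{\mathrm{Tr}[\sigma E_x]}$. For $\mathbb D\in\{D,D^{\mathbb{SEP}}\}$: $\mathbb D(\rho\|\mathcal S)=\inf_{\sigma\in\mathcal S}\mathbb D(\rho\|\sigma)$ and $\mathbb D^\infty(\rho\|\mathcal S)=\lim_{n\to\infty}\frac1n\mathbb D(\rho^{\otimes n}\|\mathcal S_n)$ (the limits exist); one writes $D^{\mathbb{SEP},\infty}=(D^{\mathbb{SEP}})^\infty$. For $\mathbb M\in\{\mathbb{SEP},\mathbb{ALL}\}$ and $\varepsilon\in[0,1)$, $D_H^{\mathbb M,\varepsilon}(\rho\|\sigma)=-\log_2\inf\{\mathrm{Tr}E\sigma:\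 0\le E\le\mathbb 1,\ (E,\mathbb 1-E)\in\mathbb M,\ \mathrm{Tr}E\rho\ge1-\varepsilon\}$, and $\mathrm{Stein}_{\mathbb M}(\rho\|\mathcal S)=\lim_{\varepsilon\to0^+}\liminf_{n\to\infty}\frac1n\inf_{\sigma_n\in\mathcal S_n}D_H^{\mathbb M,\varepsilon}(\rho^{\otimes n}\|\sigma_n)$. *)

theory Defs
  imports
    "Jordan_Normal_Form.Schur_Decomposition"
    "Jordan_Normal_Form.Matrix_Kernel"
    "HOL-Library.Extended_Real"
begin

definition mat_trace :: "complex mat \<Rightarrow> complex" where
  "mat_trace A = (\<Sum>i<dim_row A. A $$ (i, i))"

definition psd :: "nat \<Rightarrow> complex mat \<Rightarrow> bool" where
  "psd n A \<longleftrightarrow> A \<in> carrier_mat n n \<and> mat_adjoint A = A \<and>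
     (\<forall>v\<in>carrier_vec n. 0 \<le> Re ((A *\<^sub>v v) \<bullet>c v))"

definition density :: "nat \<Rightarrow> complex mat \<Rightarrow> bool" where
  "density n \<rho> \<longleftrightarrow> psd n \<rho> \<and> mat_trace \<rho> = 1"

definition unitary_mat :: "nat \<Rightarrow> complex mat \<Rightarrow> bool" where
  "unitary_mat n U \<longleftrightarrow> U \<in> carrier_mat n n \<and> U * mat_adjoint U = 1\<^sub>m n \<and> mat_adjoint U * U = 1\<^sub>m n"

text \<open>Sum of a finite family of \<open>m \<times> m\<close> matrices (the type of matrices of all sizes
  is not a monoid, so the big operator is not available).\<close>

definition sum_mats :: "nat \<Rightarrow> ('i \<Rightarrow> complex mat) \<Rightarrow> 'i list \<Rightarrow> complex mat" where
  "sum_mats m f is = mat m m (\<lambda>ij. \<Sum>i\<leftarrow>is. f i $$ ij)"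

text \<open>Functional calculus for Hermitian matrices: \<open>f(U diag(x) U\<^sup>\<dagger>) = U diag(f(x)) U\<^sup>\<dagger>\<close>, which does
  not depend on the chosen diagonalization. As \<open>log 2 0 = 0\<close> in HOL, \<open>mat_log2\<close> is the logarithm
  on the support and zero on the kernel.\<close>

definition mat_fun :: "(real \<Rightarrow> real) \<Rightarrow> complex mat \<Rightarrow> complex mat" where
  "mat_fun f A = (THE B. \<exists>U x. unitary_mat (dim_row A) U \<and>
     A = U * mat_diag (dim_row A) (\<lambda>i. complex_of_real (x i)) * mat_adjoint U \<and>
     B = U * mat_diag (dim_row A) (\<lambda>i. complex_of_real (f (x i))) * mat_adjoint U)"

definition mat_log2 :: "complex mat \<Rightarrow> complex mat" where
  "mat_log2 = mat_fun (log 2)"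

definition mat_supp :: "complex mat \<Rightarrow> complex vec set" where
  "mat_supp A = {v \<in> carrier_vec (dim_col A). \<forall>w\<in>mat_kernel A. v \<bullet>c w = 0}"

text \<open>The basis vector \<open>e\<^sub>i \<otimes> e\<^sub>j\<close> of \<open>\<complex>\<^sup>m \<otimes> \<complex>\<^sup>n\<close> has index \<open>i * n + j\<close>.\<close>

definition kron_vec :: "complex vec \<Rightarrow> complex vec \<Rightarrow> complex vec" where
  "kron_vec v w = vec (dim_vec v * dim_vec w) (\<lambda>i. v $ (i div dim_vec w) * w $ (i mod dim_vec w))"

definition kron :: "complex mat \<Rightarrow> complex mat \<Rightarrow> complex mat" where
  "kron A B = mat (dim_row A * dim_row B) (dim_col A * dim_col B)
     (\<lambda>(i, j). A $$ (i div dim_row B, j div dim_col B) * B $$ (i mod dim_row B, j mod dim_col B))"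

fun kron_pow :: "complex mat \<Rightarrow> nat \<Rightarrow> complex mat" where
  "kron_pow A 0 = 1\<^sub>m 1"
| "kron_pow A (Suc n) = kron A (kron_pow A n)"

text \<open>\<open>kron_pow \<rho> n\<close> acts on \<open>(A \<otimes> B)\<^sup>\<otimes>\<^sup>n\<close>, with factors ordered \<open>A B A B \<dots>\<close>. The function
  \<open>interleave dA dB n\<close> sends the indices \<open>a\<close> (of \<open>A\<^sup>\<otimes>\<^sup>n\<close>) and \<open>b\<close> (of \<open>B\<^sup>\<otimes>\<^sup>n\<close>) to the
  corresponding index of \<open>(A \<otimes> B)\<^sup>\<otimes>\<^sup>n\<close>, and \<open>bip_pow dA dB \<rho> n\<close> is the n-fold tensor power
  of \<open>\<rho>\<close>, as an operator on \<open>A\<^sup>\<otimes>\<^sup>n \<otimes> B\<^sup>\<otimes>\<^sup>n\<close>; see \<open>regroup_product\<close> below.\<close>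

fun interleave :: "nat \<Rightarrow> nat \<Rightarrow> nat \<Rightarrow> nat \<Rightarrow> nat \<Rightarrow> nat" where
  "interleave dA dB 0 a b = 0"
| "interleave dA dB (Suc n) a b =
     (a div dA ^ n * dB + b div dB ^ n) * (dA * dB) ^ n
     + interleave dA dB n (a mod dA ^ n) (b mod dB ^ n)"

definition regroup :: "nat \<Rightarrow> nat \<Rightarrow> nat \<Rightarrow> complex mat \<Rightarrow> complex mat" where
  "regroup dA dB n X = mat (dA ^ n * dB ^ n) (dA ^ n * dB ^ n)
     (\<lambda>(i, j). X $$ (interleave dA dB n (i div dB ^ n) (i mod dB ^ n),
                     interleave dA dB n (j div dB ^ n) (j mod dB ^ n)))"

definition bip_pow :: "nat \<Rightarrow> nat \<Rightarrow> complex mat \<Rightarrow> nat \<Rightarrow> complex mat" where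
  "bip_pow dA dB \<rho> n = regroup dA dB n (kron_pow \<rho> n)"

definition sep_states :: "nat \<Rightarrow> nat \<Rightarrow> complex mat set" where
  "sep_states dA dB = {\<sigma>. \<exists>(k::nat) p \<rho> \<tau>.
     (\<forall>i<k. 0 \<le> p i \<and> density dA (\<rho> i) \<and> density dB (\<tau> i)) \<and> (\<Sum>i<k. p i) = 1 \<and>
     \<sigma> = sum_mats (dA * dB) (\<lambda>i. complex_of_real (p i) \<cdot>\<^sub>m kron (\<rho> i) (\<tau> i)) [0..<k]}"

definition cone_of :: "complex mat set \<Rightarrow> complex mat set" where
  "cone_of S = {complex_of_real c \<cdot>\<^sub>m \<sigma> | c \<sigma>. 0 \<le> c \<and> \<sigma> \<in> S}"

text \<open>Classes of measurements on a system with local dimensions \<open>dA\<close>, \<open>dB\<close>; a POVM is the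
  list of its effects.\<close>

definition ALL_meas :: "nat \<Rightarrow> nat \<Rightarrow> complex mat list set" where
  "ALL_meas dA dB = {Es. (\<forall>E\<in>set Es. psd (dA * dB) E) \<and>
     sum_mats (dA * dB) (\<lambda>E. E) Es = 1\<^sub>m (dA * dB)}"

definition SEP_meas :: "nat \<Rightarrow> nat \<Rightarrow> complex mat list set" where
  "SEP_meas dA dB = {Es \<in> ALL_meas dA dB. \<forall>E\<in>set Es. E \<in> cone_of (sep_states dA dB)}"

definition rel_entropy :: "complex mat \<Rightarrow> complex mat \<Rightarrow> ereal" where
  "rel_entropy \<rho> \<sigma> =
     (if mat_supp \<rho> \<subseteq> mat_supp \<sigma> then ereal (Re (mat_trace (\<rho> * (mat_log2 \<rho> - mat_log2 \<sigma>)))) else \<infinity>)"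

text \<open>\<open>p log (p / q)\<close> with the usual conventions \<open>0 log (0 / q) = 0\<close> and \<open>p log (p / 0) = \<infinity>\<close> for \<open>p > 0\<close>.\<close>

definition kl_term :: "real \<Rightarrow> real \<Rightarrow> ereal" where
  "kl_term p q = (if p = 0 then 0 else if q = 0 then \<infinity> else ereal (p * log 2 (p / q)))"

definition measured_rel_entropy :: "complex mat list set \<Rightarrow> complex mat \<Rightarrow> complex mat \<Rightarrow> ereal" where
  "measured_rel_entropy M \<rho> \<sigma> =
     (SUP Es\<in>M. \<Sum>E\<leftarrow>Es. kl_term (Re (mat_trace (\<rho> * E))) (Re (mat_trace (\<sigma> * E))))"

text \<open>A divergence may depend on the bipartition of the system, whence the two dimension
  arguments of \<open>DD\<close>.\<close>

definition regularized_div ::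
  "(nat \<Rightarrow> nat \<Rightarrow> complex mat \<Rightarrow> complex mat \<Rightarrow> ereal) \<Rightarrow> nat \<Rightarrow> nat \<Rightarrow> complex mat \<Rightarrow> ereal" where
  "regularized_div DD dA dB \<rho> =
     lim (\<lambda>n. ereal (1 / real n) *
       (INF \<sigma>\<in>sep_states (dA ^ n) (dB ^ n). DD (dA ^ n) (dB ^ n) (bip_pow dA dB \<rho> n) \<sigma>))"

definition D_reg :: "nat \<Rightarrow> nat \<Rightarrow> complex mat \<Rightarrow> ereal" where
  "D_reg = regularized_div (\<lambda>_ _. rel_entropy)"

definition D_SEP_reg :: "nat \<Rightarrow> nat \<Rightarrow> complex mat \<Rightarrow> ereal" where
  "D_SEP_reg = regularized_div (\<lambda>a b. measured_rel_entropy (SEP_meas a b))"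

definition D_H :: "complex mat list set \<Rightarrow> real \<Rightarrow> complex mat \<Rightarrow> complex mat \<Rightarrow> ereal" where
  "D_H M \<epsilon> \<rho> \<sigma> =
     (let n = dim_row \<rho>;
          \<beta> = Inf {Re (mat_trace (E * \<sigma>)) | E. psd n E \<and> psd n (1\<^sub>m n - E) \<and>
                [E, 1\<^sub>m n - E] \<in> M \<and> Re (mat_trace (E * \<rho>)) \<ge> 1 - \<epsilon>}
      in if \<beta> = 0 then \<infinity> else ereal (- log 2 \<beta>))"

definition stein :: "(nat \<Rightarrow> nat \<Rightarrow> complex mat list set) \<Rightarrow> nat \<Rightarrow> nat \<Rightarrow> complex mat \<Rightarrow> ereal" where
  "stein M dA dB \<rho> =
     Lim (at_right 0) (\<lambda>\<epsilon>. liminf (\<lambda>n. ereal (1 / real n) *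
       (INF \<sigma>\<in>sep_states (dA ^ n) (dB ^ n). D_H (M (dA ^ n) (dB ^ n)) \<epsilon> (bip_pow dA dB \<rho> n) \<sigma>)))"

definition swap_op :: "nat \<Rightarrow> complex mat" where
  "swap_op d = mat (d * d) (d * d)
     (\<lambda>(i, j). if i div d = j mod d \<and> i mod d = j div d then 1 else 0)"

definition antisym_state :: "nat \<Rightarrow> complex mat" where
  "antisym_state d = complex_of_real (1 / (real d * (real d - 1))) \<cdot>\<^sub>m (1\<^sub>m (d * d) - swap_op d)"

lemma swap_op_kron_vec:
  assumes v: "v \<in> carrier_vec d" and w: "w \<in> carrier_vec d"
  shows "swap_op d *\<^sub>v kron_vec v w = kron_vec w v"
proof (rule eq_vecI)
  have dv: "dim_vec v = d" and dw: "dim_vec w = d" using v w by auto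
  show "dim_vec (swap_op d *\<^sub>v kron_vec v w) = dim_vec (kron_vec w v)"
    using v w by (simp add: swap_op_def kron_vec_def)
  fix i assume "i < dim_vec (kron_vec w v)"
  hence i: "i < d * d" using v w by (simp add: kron_vec_def)
  hence d: "0 < d" by (cases d) auto
  define j0 where "j0 = (i mod d) * d + i div d"
  have q: "i div d < d" using i by (simp add: less_mult_imp_div_less)
  have r: "i mod d < d" using d by simp
  have "j0 < (i mod d + 1) * d" using q by (simp add: j0_def)
  also have "\<dots> \<le> d * d" using r by (intro mult_right_mono) auto
  finally have j0: "j0 < d * d" .
  have key: "(i div d = j mod d \<and> i mod d = j div d) \<longleftrightarrow> j = j0" for j
  proof
    assume a: "i div d = j mod d \<and> i mod d = j div d"
    have "j = j div d * d + j mod d" by simp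
    thus "j = j0" using a by (simp add: j0_def)
  next
    assume "j = j0" thus "i div d = j mod d \<and> i mod d = j div d"
      using q r d by (simp add: j0_def)
  qed
  have "(swap_op d *\<^sub>v kron_vec v w) $ i
      = (\<Sum>j = 0..<d * d. (if j = j0 then 1 else 0) * kron_vec v w $ j)"
    using i v w by (simp add: swap_op_def scalar_prod_def kron_vec_def key)
  also have "\<dots> = kron_vec v w $ j0"
    using j0 by (simp add: if_distrib[of "\<lambda>x. x * _"] cong: if_cong)
  also have "\<dots> = kron_vec w v $ i"
    using i j0 q r d dv dw by (simp add: kron_vec_def) (simp add: j0_def)
  finally show "(swap_op d *\<^sub>v kron_vec v w) $ i = kron_vec w v $ i" .
qed

lemma kron_carrier:
  assumes "A \<in> carrier_mat a a" "B \<in> carrier_mat b b"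
  shows "kron A B \<in> carrier_mat (a * b) (a * b)"
  using assms by (simp add: kron_def)

lemma kron_pow_carrier:
  assumes "A \<in> carrier_mat a a"
  shows "kron_pow A n \<in> carrier_mat (a ^ n) (a ^ n)"
  by (induction n) (use assms in \<open>auto simp: kron_def\<close>)

lemma kron_index:
  assumes "A \<in> carrier_mat a a" "B \<in> carrier_mat b b" "i < a * b" "j < a * b"
  shows "kron A B $$ (i, j) = A $$ (i div b, j div b) * B $$ (i mod b, j mod b)"
  using assms by (simp add: kron_def)

lemma div_mod_power_less:
  fixes a d :: nat
  assumes "a < d * d ^ n"
  shows "a div d ^ n < d" "a mod d ^ n < d ^ n"
proof -
  show "a div d ^ n < d" using assms by (simp add: less_mult_imp_div_less)
  have "0 < d ^ n" using assms by (cases "d ^ n = 0") auto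
  thus "a mod d ^ n < d ^ n" by simp
qed

lemma pair_index_less:
  fixes x m y k :: nat
  assumes "x < m" "y < k" shows "x * k + y < m * k"
proof -
  have "x * k + y < (x + 1) * k" using assms by simp
  also have "\<dots> \<le> m * k" using assms by (intro mult_right_mono) auto
  finally show ?thesis .
qed

lemma interleave_less:
  assumes "a < dA ^ n" "b < dB ^ n"
  shows "interleave dA dB n a b < (dA * dB) ^ n"
  using assms
proof (induction n arbitrary: a b)
  case (Suc n)
  have "a div dA ^ n * dB + b div dB ^ n < dA * dB"
    using Suc.prems by (intro pair_index_less div_mod_power_less) auto
  moreover have "interleave dA dB n (a mod dA ^ n) (b mod dB ^ n) < (dA * dB) ^ n"
    using Suc.prems by (intro Suc.IH div_mod_power_less[of _ dA] div_mod_power_less[of _ dB]) auto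
  ultimately show ?case using pair_index_less by simp
qed simp

lemma kron_pow_interleave:
  assumes A: "A \<in> carrier_mat dA dA" and B: "B \<in> carrier_mat dB dB"
    and "a < dA ^ n" "a' < dA ^ n" "b < dB ^ n" "b' < dB ^ n"
  shows "kron_pow (kron A B) n $$ (interleave dA dB n a b, interleave dA dB n a' b')
    = kron_pow A n $$ (a, a') * kron_pow B n $$ (b, b')"
  using assms(3-)
proof (induction n arbitrary: a a' b b')
  case (Suc n)
  note AB = kron_carrier[OF A B]
  note C = kron_pow_carrier[OF AB, of n] kron_pow_carrier[OF A, of n] kron_pow_carrier[OF B, of n]
  define x y x' y' where "x = a div dA ^ n" and "y = b div dB ^ n"
    and "x' = a' div dA ^ n" and "y' = b' div dB ^ n"
  define s t s' t' where "s = a mod dA ^ n" and "t = b mod dB ^ n"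
    and "s' = a' mod dA ^ n" and "t' = b' mod dB ^ n"
  have lt: "x < dA" "x' < dA" "y < dB" "y' < dB"
      "s < dA ^ n" "s' < dA ^ n" "t < dB ^ n" "t' < dB ^ n"
    using Suc.prems div_mod_power_less unfolding x_def y_def x'_def y'_def s_def t_def s'_def t'_def
    by auto
  define u u' where "u = interleave dA dB n s t" and "u' = interleave dA dB n s' t'"
  have u: "u < (dA * dB) ^ n" "u' < (dA * dB) ^ n"
    unfolding u_def u'_def using lt by (auto intro: interleave_less)
  hence pos: "(dA * dB) ^ n \<noteq> 0" by (metis less_nat_zero_code)
  have xy: "x * dB + y < dA * dB" "x' * dB + y' < dA * dB" using lt by (auto intro: pair_index_less)
  have eq: "interleave dA dB (Suc n) a b = (x * dB + y) * (dA * dB) ^ n + u"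
    "interleave dA dB (Suc n) a' b' = (x' * dB + y') * (dA * dB) ^ n + u'"
    by (simp_all add: x_def y_def x'_def y'_def u_def u'_def s_def t_def s'_def t'_def)
  have "kron_pow (kron A B) (Suc n) $$ (interleave dA dB (Suc n) a b, interleave dA dB (Suc n) a' b')
      = kron A B $$ (x * dB + y, x' * dB + y') * kron_pow (kron A B) n $$ (u, u')"
    unfolding eq kron_pow.simps
    by (subst kron_index[OF AB C(1)])
      (use u xy pos pair_index_less[OF xy(1) u(1)] pair_index_less[OF xy(2) u(2)] in
        \<open>simp_all add: div_mult_self3[OF pos] div_less[OF u(1)] div_less[OF u(2)] del: power_mult_distrib mult_eq_0_iff power_eq_0_iff\<close>)
  also have "kron A B $$ (x * dB + y, x' * dB + y') = A $$ (x, x') * B $$ (y, y')"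
    by (subst kron_index[OF A B]) (use xy lt in auto)
  also have "kron_pow (kron A B) n $$ (u, u') = kron_pow A n $$ (s, s') * kron_pow B n $$ (t, t')"
    unfolding u_def u'_def using lt by (intro Suc.IH)
  also have "A $$ (x, x') * B $$ (y, y') * (kron_pow A n $$ (s, s') * kron_pow B n $$ (t, t'))
      = kron_pow A (Suc n) $$ (a, a') * kron_pow B (Suc n) $$ (b, b')"
    using Suc.prems by (simp add: kron_index[OF A C(2)] kron_index[OF B C(3)]
        x_def y_def x'_def y'_def s_def t_def s'_def t'_def)
  finally show ?case .
qed simp

lemma regroup_product:
  assumes A: "A \<in> carrier_mat dA dA" and B: "B \<in> carrier_mat dB dB"
  shows "regroup dA dB n (kron_pow (kron A B) n) = kron (kron_pow A n) (kron_pow B n)"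
proof (rule eq_matI)
  note C = kron_pow_carrier[OF A, of n] kron_pow_carrier[OF B, of n]
  note K = kron_carrier[OF C]
  show "dim_row (regroup dA dB n (kron_pow (kron A B) n)) = dim_row (kron (kron_pow A n) (kron_pow B n))"
    "dim_col (regroup dA dB n (kron_pow (kron A B) n)) = dim_col (kron (kron_pow A n) (kron_pow B n))"
    using K by (simp_all add: regroup_def)
  fix i j assume "i < dim_row (kron (kron_pow A n) (kron_pow B n))"
    "j < dim_col (kron (kron_pow A n) (kron_pow B n))"
  hence ij: "i < dA ^ n * dB ^ n" "j < dA ^ n * dB ^ n" using K by auto
  hence "0 < dB ^ n" by (cases "dB ^ n = 0") auto
  thus "regroup dA dB n (kron_pow (kron A B) n) $$ (i, j) = kron (kron_pow A n) (kron_pow B n) $$ (i, j)"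
    using ij by (simp add: regroup_def kron_index[OF C] kron_pow_interleave[OF A B] less_mult_imp_div_less)
qed

end

theory Submission
  imports Defs "Jordan_Normal_Form.Spectral_Radius" "HOL-Combinatorics.Permutations"
    "HOL-Analysis.L2_Norm" "HOL-Real_Asymp.Real_Asymp"
begin

text \<open>Upper bound: on separable effects, \<open>\<alpha>\<^sub>d\<^sup>\<otimes>\<^sup>n\<close> is dominated by \<open>(1 + 2 / d)\<^sup>n\<close> times the \<open>n\<close>-th power of a
  separable Werner state, because the partial transpose of the latter is, up to scaling, the absolute value of
  the partial transpose of the former.

  Stein exponent for separable measurements: instead of a minimax theorem, the proof uses that all
  separable states, once symmetrized under local unitaries and permutations of the copies, are dominated by a polynomial factor
  times one separable state. A nearly optimal separable measurement against that state yields a likelihood ratio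
  whose expectation is at most one under every separable state. This is a condition on product vectors only, so it
  is inherited by independent repetitions, and Chernoff's bound gives a test with exponent arbitrarily close to
  \<open>D\<^sup>S\<^sup>E\<^sup>P\<close> per copy. The converse is data processing to two outcomes.

  Unrestricted measurements: a symmetrized separable state commutes with \<open>\<alpha>\<^sub>d\<^sup>\<otimes>\<^sup>n\<close> and is constant on its
  support, so the relative entropy and the testing exponent are both governed by the largest overlap \<open>h\<^sub>n\<close> of a separable state
  with the \<open>n\<close>-fold antisymmetric projection. The sequence \<open>h\<^sub>n\<close> is supermultiplicative, and \<open>h\<^sub>n\<^sup>2 \<le> (3 / 4)\<^sup>n\<close> follows by
  Cauchy-Schwarz from an identity in the group algebra of the permutations of three tensor factors.\<close>

section \<open>Positive semidefinite matrices and relative entropy\<close>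

text \<open>Subadditivity of \<open>min_mrel d n\<close> in \<open>n\<close> is not evident, since
  an optimal separable measurement on a product need not be a product. The limit defining
  \<open>D_SEP_reg\<close> is therefore obtained together with the Stein exponent, by squeezing; on
  the unrestricted side \<open>- log 2 (max_overlap d n)\<close> is subadditive and Fekete's lemma
  applies. Separable effects see an operator only through its values on product vectors, so the
  central inequalities are stated there and not as operator inequalities. Symmetrization uses a
  finite monomial group instead of all local unitaries: averages are finite sums and separability
  stays visible. The price is three blocks per copy instead of two, which still leaves the
  antisymmetric space as one block and polynomially many types. Origin of the constants:
  \<open>1 + 2 / d\<close> is the trace norm of the partial transpose of \<alpha>. With
  \<open>P = (1 - (12)) / 2\<close>, the compressed transposition \<open>P (13) P\<close> has
  eigenvalues \<open>-1\<close> and \<open>1 / 2\<close> on the range of \<open>P\<close>; the shift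
  \<open>1 / 4\<close> centres them at \<open>-3 / 4\<close> and \<open>3 / 4\<close>. The factor
  \<open>1 / 2\<close> in front of the logarithm comes from one use of Cauchy-Schwarz, which bounds
  the square of the overlap.\<close>

lemma mat_adjoint_dim [simp]:
  "dim_row (mat_adjoint A) = dim_col A" "dim_col (mat_adjoint A) = dim_row A"
  by (simp_all add: mat_adjoint_def)

lemma mat_adjoint_carrier [simp]: "A \<in> carrier_mat n m \<Longrightarrow> mat_adjoint A \<in> carrier_mat m n"
  by auto

lemma mat_adjoint_index [simp]:
  fixes A :: "complex mat"
  shows "i < dim_col A \<Longrightarrow> j < dim_row A \<Longrightarrow> mat_adjoint A $$ (i, j) = cnj (A $$ (j, i))"
  by (simp add: mat_adjoint_def mat_of_rows_def)

lemma mult_index: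
  assumes "A \<in> carrier_mat n m" "B \<in> carrier_mat m l" "i < n" "j < l"
  shows "(A * B) $$ (i, j) = (\<Sum>k<m. A $$ (i, k) * B $$ (k, j))"
  using assms by (simp add: scalar_prod_def atLeast0LessThan)

lemma mult_mat_vec_index:
  assumes "A \<in> carrier_mat n m" "v \<in> carrier_vec m" "i < n"
  shows "(A *\<^sub>v v) $ i = (\<Sum>k<m. A $$ (i, k) * v $ k)"
  using assms by (simp add: scalar_prod_def atLeast0LessThan)

lemma cscalar_prod_index:
  fixes v w :: "complex vec"
  assumes "v \<in> carrier_vec n" "w \<in> carrier_vec n"
  shows "v \<bullet>c w = (\<Sum>k<n. v $ k * cnj (w $ k))"
  using assms by (simp add: scalar_prod_def atLeast0LessThan)

lemma mat_trace_mult: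
  assumes "A \<in> carrier_mat n n" "B \<in> carrier_mat n n"
  shows "mat_trace (A * B) = (\<Sum>i<n. \<Sum>j<n. A $$ (i, j) * B $$ (j, i))"
  using assms by (auto simp: mat_trace_def mult_index[OF assms] intro!: sum.cong simp del: index_mult_mat(1))

lemma mat_trace_comm:
  assumes "A \<in> carrier_mat n n" "B \<in> carrier_mat n n"
  shows "mat_trace (A * B) = mat_trace (B * A)"
  by (simp add: mat_trace_mult[OF assms] mat_trace_mult[OF assms(2,1)])
     (subst sum.swap, simp add: mult.commute)

text \<open>Vectors are plain functions on indices, so that product vectors and digit-wise
  expressions can be inserted without carrier conditions; values from \<open>n\<close> on are
  ignored.\<close>

definition quad :: "nat \<Rightarrow> complex mat \<Rightarrow> (nat \<Rightarrow> complex) \<Rightarrow> complex" where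
  "quad n A z = (\<Sum>i<n. \<Sum>j<n. cnj (z i) * A $$ (i, j) * z j)"

lemma quad_cong: "(\<And>i. i < n \<Longrightarrow> z i = z' i) \<Longrightarrow> quad n A z = quad n A z'"
  by (auto simp: quad_def intro!: sum.cong)

lemma quad_vec:
  assumes "A \<in> carrier_mat n n" "v \<in> carrier_vec n"
  shows "(A *\<^sub>v v) \<bullet>c v = quad n A (\<lambda>i. v $ i)"
proof -
  have "(A *\<^sub>v v) \<bullet>c v = (\<Sum>i<n. (A *\<^sub>v v) $ i * cnj (v $ i))"
    using assms by (intro cscalar_prod_index) auto
  also have "\<dots> = quad n A (\<lambda>i. v $ i)"
    unfolding quad_def
    by (intro sum.cong refl)
      (simp add: mult_mat_vec_index[OF assms] sum_distrib_left sum_distrib_right mult_ac del: index_mult_mat_vec)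
  finally show ?thesis .
qed

lemma hermitian_iff:
  fixes A :: "complex mat"
  assumes "A \<in> carrier_mat n n"
  shows "mat_adjoint A = A \<longleftrightarrow> (\<forall>i<n. \<forall>j<n. cnj (A $$ (i, j)) = A $$ (j, i))"
proof
  assume h: "mat_adjoint A = A"
  show "\<forall>i<n. \<forall>j<n. cnj (A $$ (i, j)) = A $$ (j, i)"
  proof (intro allI impI)
    fix i j assume "i < n" "j < n"
    thus "cnj (A $$ (i, j)) = A $$ (j, i)"
      using mat_adjoint_index[of j A i] assms by (simp add: h)
  qed
next
  assume "\<forall>i<n. \<forall>j<n. cnj (A $$ (i, j)) = A $$ (j, i)"
  thus "mat_adjoint A = A" using assms by (intro eq_matI) auto
qed

lemma psd_iff:
  "psd n A \<longleftrightarrow> A \<in> carrier_mat n n \<and> (\<forall>i<n. \<forall>j<n. cnj (A $$ (i, j)) = A $$ (j, i)) \<and>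
     (\<forall>z. 0 \<le> Re (quad n A z))"
proof (cases "A \<in> carrier_mat n n")
  case True
  have "(\<forall>v\<in>carrier_vec n. 0 \<le> Re ((A *\<^sub>v v) \<bullet>c v)) \<longleftrightarrow> (\<forall>z. 0 \<le> Re (quad n A z))"
  proof safe
    fix z assume a: "\<forall>v\<in>carrier_vec n. 0 \<le> Re ((A *\<^sub>v v) \<bullet>c v)"
    have "quad n A z = quad n A (\<lambda>i. vec n z $ i)" by (rule quad_cong) simp
    thus "0 \<le> Re (quad n A z)" using a[rule_format, of "vec n z"] quad_vec[OF True] by simp
  qed (simp add: quad_vec[OF True])
  thus ?thesis using True by (auto simp: psd_def hermitian_iff[OF True])
qed (simp add: psd_def)

lemma psd_carrier: "psd n A \<Longrightarrow> A \<in> carrier_mat n n" by (simp add: psd_def)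

lemma psd_quad_ge: "psd n A \<Longrightarrow> 0 \<le> Re (quad n A z)" by (simp add: psd_iff)

lemma quad_mult_one:
  "quad n (1\<^sub>m n) z = of_real (\<Sum>i<n. (cmod (z i))\<^sup>2)"
  unfolding quad_def of_real_sum
proof (intro sum.cong refl)
  fix i assume i: "i \<in> {..<n}"
  have "(\<Sum>j<n. cnj (z i) * 1\<^sub>m n $$ (i, j) * z j) = (\<Sum>j<n. if j = i then cnj (z i) * z i else 0)"
    using i by (intro sum.cong) auto
  thus "(\<Sum>j<n. cnj (z i) * 1\<^sub>m n $$ (i, j) * z j) = complex_of_real ((cmod (z i))\<^sup>2)"
    using i by (simp add: complex_norm_square mult.commute del: of_real_power)
qed

section \<open>Unitary matrices and the spectral theorem\<close>

lemma unitary_matI: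
  assumes "U \<in> carrier_mat n n"
    and "\<And>i j. i < n \<Longrightarrow> j < n \<Longrightarrow> (\<Sum>k<n. cnj (U $$ (k, i)) * U $$ (k, j)) = (if i = j then 1 else 0)"
  shows "unitary_mat n U"
proof -
  have ad: "mat_adjoint U \<in> carrier_mat n n" using assms(1) by simp
  have 1: "mat_adjoint U * U = 1\<^sub>m n"
  proof (rule eq_matI)
    fix i j assume "i < dim_row (1\<^sub>m n)" "j < dim_col (1\<^sub>m n)"
    hence ij: "i < n" "j < n" by auto
    have "(mat_adjoint U * U) $$ (i, j) = (\<Sum>k<n. cnj (U $$ (k, i)) * U $$ (k, j))"
      unfolding mult_index[OF ad assms(1) ij] using ij assms(1) by (intro sum.cong) auto
    thus "(mat_adjoint U * U) $$ (i, j) = 1\<^sub>m n $$ (i, j)" using assms(2) ij by simp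
  qed (use assms(1) in auto)
  show ?thesis unfolding unitary_mat_def
    using mat_mult_left_right_inverse[OF ad assms(1) 1] 1 assms(1) by simp
qed

lemma unitary_matD:
  assumes "unitary_mat n U"
  shows "U \<in> carrier_mat n n"
    and "\<And>i j. i < n \<Longrightarrow> j < n \<Longrightarrow> (\<Sum>k<n. cnj (U $$ (k, i)) * U $$ (k, j)) = (if i = j then 1 else 0)"
    and "\<And>i j. i < n \<Longrightarrow> j < n \<Longrightarrow> (\<Sum>k<n. U $$ (i, k) * cnj (U $$ (j, k))) = (if i = j then 1 else 0)"
proof -
  show U: "U \<in> carrier_mat n n" using assms by (simp add: unitary_mat_def)
  hence ad: "mat_adjoint U \<in> carrier_mat n n" by simp
  fix i j assume ij: "i < n" "j < n"
  have "(\<Sum>k<n. cnj (U $$ (k, i)) * U $$ (k, j)) = (mat_adjoint U * U) $$ (i, j)"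
    unfolding mult_index[OF ad U ij] using ij U by (intro sum.cong) auto
  thus "(\<Sum>k<n. cnj (U $$ (k, i)) * U $$ (k, j)) = (if i = j then 1 else 0)"
    using assms ij by (simp add: unitary_mat_def)
  have "(\<Sum>k<n. U $$ (i, k) * cnj (U $$ (j, k))) = (U * mat_adjoint U) $$ (i, j)"
    unfolding mult_index[OF U ad ij] using ij U by (intro sum.cong) auto
  thus "(\<Sum>k<n. U $$ (i, k) * cnj (U $$ (j, k))) = (if i = j then 1 else 0)"
    using assms ij by (simp add: unitary_mat_def)
qed

lemma conj_diag_index:
  assumes "U \<in> carrier_mat n n" "i < n" "j < n"
  shows "(U * mat_diag n x * mat_adjoint U) $$ (i, j) = (\<Sum>k<n. U $$ (i, k) * x k * cnj (U $$ (j, k)))"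
proof -
  have 1: "U * mat_diag n x = mat n n (\<lambda>(i, j). U $$ (i, j) * x j)"
    by (rule mat_diag_mult_right[OF assms(1)])
  have "(U * mat_diag n x * mat_adjoint U) $$ (i, j) =
      (\<Sum>k<n. (U * mat_diag n x) $$ (i, k) * mat_adjoint U $$ (k, j))"
    using assms by (intro mult_index) auto
  also have "\<dots> = (\<Sum>k<n. U $$ (i, k) * x k * cnj (U $$ (j, k)))"
    unfolding 1 using assms by (intro sum.cong) auto
  finally show ?thesis .
qed

lemma unitary_mat_mult:
  assumes "unitary_mat n U" "unitary_mat n V"
  shows "unitary_mat n (U * V)"
proof -
  note U = unitary_matD[OF assms(1)] and V = unitary_matD[OF assms(2)]
  show ?thesis
  proof (rule unitary_matI)
    show "U * V \<in> carrier_mat n n" using U(1) V(1) by simp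
    fix i j assume ij: "i < n" "j < n"
    have "(\<Sum>k<n. cnj ((U * V) $$ (k, i)) * (U * V) $$ (k, j))
        = (\<Sum>k<n. \<Sum>a<n. \<Sum>b<n. (cnj (U $$ (k, a)) * U $$ (k, b)) * (cnj (V $$ (a, i)) * V $$ (b, j)))"
      by (intro sum.cong refl)
        (simp add: mult_index[OF U(1) V(1)] ij sum_product del: index_mult_mat(1), simp add: mult_ac)
    also have "\<dots> = (\<Sum>a<n. \<Sum>b<n. (\<Sum>k<n. cnj (U $$ (k, a)) * U $$ (k, b)) * (cnj (V $$ (a, i)) * V $$ (b, j)))"
      by (subst sum.swap, rule sum.cong[OF refl], subst sum.swap, simp add: sum_distrib_right)
    also have "\<dots> = (\<Sum>a<n. \<Sum>b<n. if a = b then cnj (V $$ (a, i)) * V $$ (b, j) else 0)"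
      by (intro sum.cong refl) (simp add: U(2))
    also have "\<dots> = (\<Sum>a<n. cnj (V $$ (a, i)) * V $$ (a, j))" by simp
    finally show "(\<Sum>k<n. cnj ((U * V) $$ (k, i)) * (U * V) $$ (k, j)) = (if i = j then 1 else 0)"
      using V(2)[OF ij] by simp
  qed
qed

lemma mat_adjoint_mult:
  fixes A B :: "complex mat"
  assumes "A \<in> carrier_mat n m" "B \<in> carrier_mat m l"
  shows "mat_adjoint (A * B) = mat_adjoint B * mat_adjoint A"
proof (rule eq_matI)
  fix i j assume "i < dim_row (mat_adjoint B * mat_adjoint A)" "j < dim_col (mat_adjoint B * mat_adjoint A)"
  hence ij: "i < l" "j < n" using assms by auto
  have "(mat_adjoint B * mat_adjoint A) $$ (i, j) = (\<Sum>k<m. mat_adjoint B $$ (i, k) * mat_adjoint A $$ (k, j))"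
    using assms ij by (intro mult_index) auto
  also have "\<dots> = (\<Sum>k<m. cnj (A $$ (j, k) * B $$ (k, i)))"
    using assms ij by (intro sum.cong) auto
  also have "\<dots> = cnj ((A * B) $$ (j, i))" using mult_index[OF assms ij(2,1)] by simp
  finally show "mat_adjoint (A * B) $$ (i, j) = (mat_adjoint B * mat_adjoint A) $$ (i, j)"
    using assms ij by simp
qed (use assms in auto)

lemma mat_adjoint_adjoint [simp]:
  fixes A :: "complex mat"
  shows "mat_adjoint (mat_adjoint A) = A"
  by (rule eq_matI) auto

text \<open>An eigenvector is completed to a basis and orthogonalized; Gram-Schmidt keeps the first
  vector, and normalizing the columns afterwards only rescales it.\<close>

lemma unit_eigenvector_completion:
  fixes A :: "complex mat"
  assumes A: "A \<in> carrier_mat n n" and n: "n > 0"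
  obtains W e where "unitary_mat n W" "\<And>i. i < n \<Longrightarrow> (\<Sum>k<n. A $$ (i, k) * W $$ (k, 0)) = e * W $$ (i, 0)"
proof -
  from spectrum_non_empty[OF A] n obtain e where "eigenvalue A e" by (auto simp: spectrum_def)
  then obtain v where v: "v \<in> carrier_vec n" "v \<noteq> 0\<^sub>v n" "A *\<^sub>v v = e \<cdot>\<^sub>v v"
    using A by (auto simp: eigenvalue_def eigenvector_def)
  interpret cof_vec_space n "TYPE(complex)" .
  define b where "b = basis_completion v"
  from basis_completion[OF v(1,2), folded b_def]
  have b: "distinct b" "\<not> lin_dep (set b)" "set b \<subseteq> carrier_vec n" "hd b = v" "length b = n" by auto
  from b(4,5) n obtain vs where bv: "b = v # vs" by (cases b) auto
  define ws where "ws = gram_schmidt n b"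
  from gram_schmidt_result[OF b(3,1,2) refl, folded ws_def]
  have ws: "set ws \<subseteq> carrier_vec n" "corthogonal ws" "length ws = n" by (auto simp: b)
  from gram_schmidt_hd[OF v(1), of vs, folded bv] have hdws: "hd ws = v" unfolding ws_def .
  define s where "s i = (\<Sum>k<n. (cmod (ws ! i $ k))\<^sup>2)" for i
  have dot: "ws ! i \<bullet>c ws ! j = (\<Sum>k<n. ws ! i $ k * cnj (ws ! j $ k))" if "i < n" "j < n" for i j
    using ws that by (intro cscalar_prod_index) (auto simp: subset_iff)
  have sdot: "ws ! i \<bullet>c ws ! i = complex_of_real (s i)" if "i < n" for i
    by (simp add: dot[OF that that] s_def complex_norm_square del: of_real_power)
  have orth: "ws ! i \<bullet>c ws ! j = 0 \<longleftrightarrow> i \<noteq> j" if "i < n" "j < n" for i j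
    using corthogonalD[OF ws(2)] ws(3) that by auto
  have s0: "s i > 0" if "i < n" for i
  proof -
    have "s i \<noteq> 0" using orth[OF that that] sdot[OF that] by auto
    moreover have "s i \<ge> 0" by (simp add: s_def sum_nonneg)
    ultimately show ?thesis by simp
  qed
  define W where "W = mat n n (\<lambda>(k, i). ws ! i $ k / complex_of_real (sqrt (s i)))"
  have "unitary_mat n W"
  proof (rule unitary_matI)
    show "W \<in> carrier_mat n n" by (simp add: W_def)
    fix i j assume ij: "i < n" "j < n"
    have "(\<Sum>k<n. cnj (W $$ (k, i)) * W $$ (k, j))
      = (\<Sum>k<n. ws ! j $ k * cnj (ws ! i $ k)) / (complex_of_real (sqrt (s i)) * complex_of_real (sqrt (s j)))"
      unfolding sum_divide_distrib using ij by (intro sum.cong) (auto simp: W_def)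
    also have "\<dots> = (ws ! j \<bullet>c ws ! i) / (complex_of_real (sqrt (s i)) * complex_of_real (sqrt (s j)))"
      by (simp add: dot[OF ij(2,1)])
    also have "\<dots> = (if i = j then 1 else 0)"
    proof (cases "i = j")
      case True
      have "complex_of_real (sqrt (s i)) * complex_of_real (sqrt (s i)) = complex_of_real (s i)"
        using s0[OF ij(1)] by (simp flip: of_real_mult)
      thus ?thesis using True s0[OF ij(1)] sdot[OF ij(1)] by simp
    next
      case False thus ?thesis using orth[OF ij(2,1)] by simp
    qed
    finally show "(\<Sum>k<n. cnj (W $$ (k, i)) * W $$ (k, j)) = (if i = j then 1 else 0)" .
  qed
  moreover have "(\<Sum>k<n. A $$ (i, k) * W $$ (k, 0)) = e * W $$ (i, 0)" if i: "i < n" for i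
  proof -
    have w0: "ws ! 0 = v" using hdws ws(3) n by (cases ws) auto
    have "(\<Sum>k<n. A $$ (i, k) * W $$ (k, 0)) = (\<Sum>k<n. A $$ (i, k) * v $ k) / complex_of_real (sqrt (s 0))"
      unfolding sum_divide_distrib using n i by (intro sum.cong) (auto simp: W_def w0)
    also have "(\<Sum>k<n. A $$ (i, k) * v $ k) = e * v $ i"
      using mult_mat_vec_index[OF A v(1) i] v i by simp
    finally show ?thesis using n i by (simp add: W_def w0)
  qed
  ultimately show ?thesis by (rule that)
qed

text \<open>Deflation: in an orthonormal basis that starts with an eigenvector, the first column is
  a multiple of the first unit vector. Hermiticity gives the same for the first row, and the
  remaining corner is handled by induction.\<close>

theorem hermitian_diagonalizable:
  fixes A :: "complex mat"
  assumes "A \<in> carrier_mat n n" "mat_adjoint A = A"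
  shows "\<exists>U x. unitary_mat n U \<and> A = U * mat_diag n (\<lambda>i. complex_of_real (x i)) * mat_adjoint U"
  using assms
proof (induction n arbitrary: A)
  case 0
  have "unitary_mat 0 (1\<^sub>m 0)" by (rule unitary_matI) auto
  thus ?case using 0 by (intro exI[of _ "1\<^sub>m 0"]) (auto intro!: eq_matI)
next
  case (Suc n A)
  let ?N = "Suc n"
  note A = Suc.prems(1)
  obtain W e where W: "unitary_mat ?N W"
    and e: "\<And>i. i < ?N \<Longrightarrow> (\<Sum>k<?N. A $$ (i, k) * W $$ (k, 0)) = e * W $$ (i, 0)"
    using unit_eigenvector_completion[OF A] by auto
  note Wc = unitary_matD[OF W]
  have ad: "mat_adjoint W \<in> carrier_mat ?N ?N" using Wc(1) by simp
  define B where "B = mat_adjoint W * A * W"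
  have B: "B \<in> carrier_mat ?N ?N" using ad A Wc(1) by (auto simp: B_def)
  have Bh: "mat_adjoint B = B"
    using ad A Wc(1) Suc.prems(2)
    by (simp add: B_def mat_adjoint_mult[of _ ?N ?N _ ?N] assoc_mult_mat[of _ ?N ?N _ ?N _ ?N])
  note Bh' = Bh[unfolded hermitian_iff[OF B], rule_format]
  have AB: "A = W * B * mat_adjoint W"
  proof -
    have WW: "W * mat_adjoint W = 1\<^sub>m ?N" using W by (simp add: unitary_mat_def)
    have "W * B = W * (mat_adjoint W * (A * W))" by (simp only: B_def assoc_mult_mat[OF ad A Wc(1)])
    also have "\<dots> = (W * mat_adjoint W) * (A * W)"
      using ad A Wc(1) by (intro assoc_mult_mat[symmetric]) auto
    also have "\<dots> = A * W" using A Wc(1) WW by simp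
    finally have "W * B * mat_adjoint W = A * (W * mat_adjoint W)" by (simp only: assoc_mult_mat[OF A Wc(1) ad])
    thus ?thesis using WW A by simp
  qed
  have B0: "B $$ (i, 0) = (if i = 0 then e else 0)" if i: "i < ?N" for i
  proof -
    have "B = mat_adjoint W * (A * W)" by (simp only: B_def assoc_mult_mat[OF ad A Wc(1)])
    hence "B $$ (i, 0) = (\<Sum>k<?N. mat_adjoint W $$ (i, k) * (A * W) $$ (k, 0))"
      using ad A Wc(1) i by (simp only:) (intro mult_index, auto)
    also have "\<dots> = (\<Sum>k<?N. cnj (W $$ (k, i)) * (e * W $$ (k, 0)))"
      using i A Wc(1) by (intro sum.cong refl) (simp add: mult_index[OF A Wc(1)] e del: index_mult_mat(1) sum.lessThan_Suc)
    also have "\<dots> = e * (\<Sum>k<?N. cnj (W $$ (k, i)) * W $$ (k, 0))"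
      by (simp add: sum_distrib_left mult_ac del: sum.lessThan_Suc)
    finally show ?thesis using Wc(2)[OF i, of 0] by simp
  qed
  \<comment> \<open>The eigenvalue is a diagonal entry of a Hermitian matrix. Its reality is needed
    for the first row, and because the diagonal of the result must consist of reals.\<close>
  have e_real: "e = complex_of_real (Re e)"
    using Bh'[of 0 0] B0[of 0] by (simp add: complex_eq_iff)
  have B0': "B $$ (0, j) = (if j = 0 then e else 0)" if "j < ?N" for j
    using Bh'[of j 0] B0[OF that] that e_real by (cases "j = 0") (auto simp: complex_eq_iff)
  define C where "C = mat n n (\<lambda>(i, j). B $$ (Suc i, Suc j))"
  have C: "C \<in> carrier_mat n n" by (simp add: C_def)
  have "mat_adjoint C = C" unfolding hermitian_iff[OF C] using Bh' by (simp add: C_def)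
  from Suc.IH[OF C this] obtain V y where V: "unitary_mat n V"
    and CV: "C = V * mat_diag n (\<lambda>i. complex_of_real (y i)) * mat_adjoint V" by blast
  note Vc = unitary_matD[OF V]
  define V' where "V' = mat ?N ?N (\<lambda>(i, j). if i = 0 \<or> j = 0 then (if i = j then 1 else 0) else V $$ (i - 1, j - 1))"
  define x where "x i = (case i of 0 \<Rightarrow> Re e | Suc k \<Rightarrow> y k)" for i
  have V'c: "V' \<in> carrier_mat ?N ?N" by (simp add: V'_def)
  have V'0: "V' $$ (0, j) = (if j = 0 then 1 else 0)" "V' $$ (j, 0) = (if j = 0 then 1 else 0)" if "j < ?N" for j
    using that by (auto simp: V'_def)
  have V'S: "V' $$ (Suc i, Suc j) = V $$ (i, j)" if "i < n" "j < n" for i j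
    using that by (auto simp: V'_def)
  have uV': "unitary_mat ?N V'"
  proof (rule unitary_matI[OF V'c])
    fix i j assume ij: "i < ?N" "j < ?N"
    show "(\<Sum>k<?N. cnj (V' $$ (k, i)) * V' $$ (k, j)) = (if i = j then 1 else 0)"
      using ij Vc(2)
      by (cases i; cases j) (auto simp: sum.lessThan_Suc_shift V'0 V'S simp del: sum.lessThan_Suc)
  qed
  have "B = V' * mat_diag ?N (\<lambda>i. complex_of_real (x i)) * mat_adjoint V'"
  proof (rule eq_matI)
    fix i j assume "i < dim_row (V' * mat_diag ?N (\<lambda>i. complex_of_real (x i)) * mat_adjoint V')"
      "j < dim_col (V' * mat_diag ?N (\<lambda>i. complex_of_real (x i)) * mat_adjoint V')"
    hence ij: "i < ?N" "j < ?N" using V'c by auto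
    have CC: "B $$ (Suc i, Suc j) = (\<Sum>k<n. V $$ (i, k) * complex_of_real (y k) * cnj (V $$ (j, k)))"
      if "i < n" "j < n" for i j
      using conj_diag_index[OF Vc(1) that, of "\<lambda>i. complex_of_real (y i)"] that
      unfolding CV[symmetric] by (simp add: C_def)
    show "B $$ (i, j) = (V' * mat_diag ?N (\<lambda>i. complex_of_real (x i)) * mat_adjoint V') $$ (i, j)"
      unfolding conj_diag_index[OF V'c ij]
      using ij e_real by (cases i; cases j)
        (auto simp: sum.lessThan_Suc_shift V'0 V'S B0 B0' CC x_def simp del: sum.lessThan_Suc)
  qed (use B V'c in auto)
  hence "A = W * (V' * mat_diag ?N (\<lambda>i. complex_of_real (x i)) * mat_adjoint V') * mat_adjoint W"
    using AB by simp
  also have "\<dots> = (W * V') * mat_diag ?N (\<lambda>i. complex_of_real (x i)) * mat_adjoint (W * V')"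
  proof -
    let ?D = "mat_diag ?N (\<lambda>i. complex_of_real (x i))"
    have c: "?D \<in> carrier_mat ?N ?N" "mat_adjoint V' \<in> carrier_mat ?N ?N"
      "V' * ?D \<in> carrier_mat ?N ?N" "W * V' * ?D \<in> carrier_mat ?N ?N"
      using V'c Wc(1) by (auto intro!: mult_carrier_mat[of _ ?N ?N])
    have "W * (V' * ?D * mat_adjoint V') = W * (V' * ?D) * mat_adjoint V'"
      by (rule assoc_mult_mat[OF Wc(1) c(3,2), symmetric])
    also have "W * (V' * ?D) = W * V' * ?D" by (rule assoc_mult_mat[OF Wc(1) V'c c(1), symmetric])
    finally show ?thesis unfolding mat_adjoint_mult[OF Wc(1) V'c]
      using assoc_mult_mat[OF c(4,2) ad] by simp
  qed
  finally show ?case using unitary_mat_mult[OF W uV'] by blast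
qed

lemma conj_diag_carrier [simp]:
  "U \<in> carrier_mat n n \<Longrightarrow> U * mat_diag n x * mat_adjoint U \<in> carrier_mat n n"
  by (simp add: mult_carrier_mat[of _ n n])

lemma conj_diag_right:
  assumes U: "unitary_mat n U" and ij: "i < n" "j < n"
  shows "(\<Sum>k<n. (U * mat_diag n x * mat_adjoint U) $$ (i, k) * U $$ (k, j)) = x j * U $$ (i, j)"
proof -
  note Uc = unitary_matD[OF U]
  have "(\<Sum>k<n. (U * mat_diag n x * mat_adjoint U) $$ (i, k) * U $$ (k, j))
      = (\<Sum>k<n. \<Sum>l<n. U $$ (i, l) * x l * (cnj (U $$ (k, l)) * U $$ (k, j)))"
    using ij by (intro sum.cong refl) (simp add: conj_diag_index[OF Uc(1)] sum_distrib_left sum_distrib_right mult_ac)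
  also have "\<dots> = (\<Sum>l<n. U $$ (i, l) * x l * (\<Sum>k<n. cnj (U $$ (k, l)) * U $$ (k, j)))"
    by (subst sum.swap) (simp add: sum_distrib_left)
  also have "\<dots> = (\<Sum>l<n. if l = j then U $$ (i, l) * x l else 0)"
    using ij by (intro sum.cong refl) (simp add: Uc(2))
  finally show ?thesis using ij by simp
qed

lemma conj_diag_left:
  assumes U: "unitary_mat n U" and ij: "i < n" "j < n"
  shows "(\<Sum>k<n. cnj (U $$ (k, i)) * (U * mat_diag n x * mat_adjoint U) $$ (k, j)) = x i * cnj (U $$ (j, i))"
proof -
  note Uc = unitary_matD[OF U]
  have "(\<Sum>k<n. cnj (U $$ (k, i)) * (U * mat_diag n x * mat_adjoint U) $$ (k, j))
      = (\<Sum>k<n. \<Sum>l<n. cnj (U $$ (j, l)) * x l * (cnj (U $$ (k, i)) * U $$ (k, l)))"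
    using ij by (intro sum.cong refl) (simp add: conj_diag_index[OF Uc(1)] sum_distrib_left sum_distrib_right mult_ac)
  also have "\<dots> = (\<Sum>l<n. cnj (U $$ (j, l)) * x l * (\<Sum>k<n. cnj (U $$ (k, i)) * U $$ (k, l)))"
    by (subst sum.swap) (simp add: sum_distrib_left)
  also have "\<dots> = (\<Sum>l<n. if l = i then cnj (U $$ (j, l)) * x l else 0)"
    using ij by (intro sum.cong refl) (auto simp: Uc(2))
  finally show ?thesis using ij by simp
qed

text \<open>Well-definedness of the functional calculus. For two diagonalizations of
  \<open>A\<close>, the overlap matrix \<open>w\<close> of their eigenbases intertwines the two
  diagonal matrices, hence also their images under \<open>f\<close>.\<close>

lemma mat_fun_conj_diag:
  assumes U: "unitary_mat n U"
  shows "mat_fun f (U * mat_diag n (\<lambda>i. complex_of_real (x i)) * mat_adjoint U) =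
    U * mat_diag n (\<lambda>i. complex_of_real (f (x i))) * mat_adjoint U"
proof -
  note Uc = unitary_matD[OF U]
  define A where "A = U * mat_diag n (\<lambda>i. complex_of_real (x i)) * mat_adjoint U"
  have dim: "dim_row A = n" using Uc(1) by (simp add: A_def)
  have uniq: "B = U * mat_diag n (\<lambda>i. complex_of_real (f (x i))) * mat_adjoint U"
    if V: "unitary_mat n V" and AV: "A = V * mat_diag n (\<lambda>i. complex_of_real (y i)) * mat_adjoint V"
      and B: "B = V * mat_diag n (\<lambda>i. complex_of_real (f (y i))) * mat_adjoint V" for B V y
  proof -
    note Vc = unitary_matD[OF V]
    define w where "w i j = (\<Sum>k<n. cnj (V $$ (k, i)) * U $$ (k, j))" for i j
    have comm: "complex_of_real (y i) * w i j = w i j * complex_of_real (x j)" if ij: "i < n" "j < n" for i j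
    proof -
      have "complex_of_real (y i) * w i j = (\<Sum>l<n. (\<Sum>k<n. cnj (V $$ (k, i)) * A $$ (k, l)) * U $$ (l, j))"
        unfolding AV w_def sum_distrib_left
        by (intro sum.cong refl) (simp add: conj_diag_left[OF V] ij)
      also have "\<dots> = (\<Sum>k<n. cnj (V $$ (k, i)) * (\<Sum>l<n. A $$ (k, l) * U $$ (l, j)))"
        unfolding sum_distrib_left sum_distrib_right by (subst sum.swap) (simp add: mult_ac)
      also have "\<dots> = w i j * complex_of_real (x j)"
        unfolding A_def w_def sum_distrib_right
        by (intro sum.cong refl, subst conj_diag_right[OF U]) (use ij in auto)
      finally show ?thesis .
    qed
    \<comment> \<open>Wherever \<open>w i j\<close> is nonzero, \<open>comm\<close> forces
      \<open>y i = x j\<close>, so that any function takes equal values there.\<close>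
    have commf: "complex_of_real (f (y i)) * w i j = w i j * complex_of_real (f (x j))" if "i < n" "j < n" for i j
      using comm[OF that] by (cases "w i j = 0") auto
    have Uw: "U $$ (i, k) = (\<Sum>a<n. V $$ (i, a) * w a k)" if "i < n" "k < n" for i k
    proof -
      have "(\<Sum>a<n. V $$ (i, a) * w a k) = (\<Sum>l<n. (\<Sum>a<n. V $$ (i, a) * cnj (V $$ (l, a))) * U $$ (l, k))"
        unfolding w_def sum_distrib_left sum_distrib_right by (subst sum.swap) (simp add: mult_ac)
      also have "\<dots> = (\<Sum>l<n. if l = i then U $$ (l, k) else 0)"
        using that by (intro sum.cong refl) (auto simp: Vc(3))
      finally show ?thesis using that by simp
    qed
    have wU: "(\<Sum>k<n. w a k * cnj (U $$ (j, k))) = cnj (V $$ (j, a))" if "a < n" "j < n" for a j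
    proof -
      have "(\<Sum>k<n. w a k * cnj (U $$ (j, k))) = (\<Sum>l<n. cnj (V $$ (l, a)) * (\<Sum>k<n. U $$ (l, k) * cnj (U $$ (j, k))))"
        unfolding w_def sum_distrib_left sum_distrib_right by (subst sum.swap) (simp add: mult_ac)
      also have "\<dots> = (\<Sum>l<n. if l = j then cnj (V $$ (l, a)) else 0)"
        using that by (intro sum.cong refl) (auto simp: Uc(3))
      finally show ?thesis using that by simp
    qed
    show ?thesis
    proof (rule eq_matI)
      fix i j assume "i < dim_row (U * mat_diag n (\<lambda>i. complex_of_real (f (x i))) * mat_adjoint U)"
        "j < dim_col (U * mat_diag n (\<lambda>i. complex_of_real (f (x i))) * mat_adjoint U)"
      hence ij: "i < n" "j < n" using Uc(1) by auto
      have "(\<Sum>k<n. U $$ (i, k) * complex_of_real (f (x k)) * cnj (U $$ (j, k)))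
          = (\<Sum>k<n. \<Sum>a<n. V $$ (i, a) * (w a k * complex_of_real (f (x k))) * cnj (U $$ (j, k)))"
        by (intro sum.cong refl, subst Uw) (use ij in \<open>auto simp: sum_distrib_left sum_distrib_right mult_ac\<close>)
      also have "\<dots> = (\<Sum>k<n. \<Sum>a<n. V $$ (i, a) * (complex_of_real (f (y a)) * w a k) * cnj (U $$ (j, k)))"
        by (intro sum.cong refl) (simp add: commf)
      also have "\<dots> = (\<Sum>a<n. V $$ (i, a) * complex_of_real (f (y a)) * (\<Sum>k<n. w a k * cnj (U $$ (j, k))))"
        by (subst sum.swap) (simp add: sum_distrib_left mult_ac)
      also have "\<dots> = (\<Sum>a<n. V $$ (i, a) * complex_of_real (f (y a)) * cnj (V $$ (j, a)))"
        by (intro sum.cong refl) (simp add: wU ij)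
      finally show "B $$ (i, j) = (U * mat_diag n (\<lambda>i. complex_of_real (f (x i))) * mat_adjoint U) $$ (i, j)"
        unfolding B conj_diag_index[OF Uc(1) ij] conj_diag_index[OF Vc(1) ij] by simp
    qed (use Uc(1) Vc(1) B in auto)
  qed
  show ?thesis
    unfolding mat_fun_def A_def[symmetric] dim
  proof (rule the_equality)
    show "\<exists>U' x'. unitary_mat n U' \<and> A = U' * mat_diag n (\<lambda>i. complex_of_real (x' i)) * mat_adjoint U' \<and>
       U * mat_diag n (\<lambda>i. complex_of_real (f (x i))) * mat_adjoint U =
       U' * mat_diag n (\<lambda>i. complex_of_real (f (x' i))) * mat_adjoint U'"
      using U A_def by blast
  qed (use uniq in blast)
qed

text \<open>Turns traces against functions of a Hermitian matrix into classical sums, weighted by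
  the quadratic form of \<open>R\<close> at the eigenvectors.\<close>

lemma mat_trace_conj_diag:
  assumes R: "R \<in> carrier_mat n n" and U: "U \<in> carrier_mat n n"
  shows "mat_trace (R * (U * mat_diag n g * mat_adjoint U)) = (\<Sum>j<n. g j * quad n R (\<lambda>i. U $$ (i, j)))"
proof -
  have "mat_trace (R * (U * mat_diag n g * mat_adjoint U)) =
      (\<Sum>i<n. \<Sum>k<n. \<Sum>j<n. g j * (cnj (U $$ (i, j)) * R $$ (i, k) * U $$ (k, j)))"
    unfolding mat_trace_mult[OF R conj_diag_carrier[OF U]]
    by (intro sum.cong refl) (simp add: conj_diag_index[OF U] sum_distrib_left mult_ac)
  also have "\<dots> = (\<Sum>i<n. \<Sum>j<n. \<Sum>k<n. g j * (cnj (U $$ (i, j)) * R $$ (i, k) * U $$ (k, j)))"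
    by (rule sum.cong[OF refl], rule sum.swap)
  also have "\<dots> = (\<Sum>j<n. \<Sum>i<n. \<Sum>k<n. g j * (cnj (U $$ (i, j)) * R $$ (i, k) * U $$ (k, j)))"
    by (rule sum.swap)
  finally show ?thesis by (simp add: quad_def sum_distrib_left)
qed

lemma quad_conj_diag:
  assumes U: "unitary_mat n U" and R: "R \<in> carrier_mat n n" and j: "j < n"
  shows "quad n (R * (U * mat_diag n x * mat_adjoint U)) (\<lambda>i. U $$ (i, j)) = x j * quad n R (\<lambda>i. U $$ (i, j))"
proof -
  note Uc = unitary_matD[OF U]
  let ?S = "U * mat_diag n x * mat_adjoint U"
  have S: "?S \<in> carrier_mat n n" using Uc(1) by simp
  have "quad n (R * ?S) (\<lambda>i. U $$ (i, j)) =
      (\<Sum>i<n. \<Sum>k<n. \<Sum>l<n. cnj (U $$ (i, j)) * R $$ (i, l) * (?S $$ (l, k) * U $$ (k, j)))"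
    unfolding quad_def
    by (intro sum.cong refl) (simp add: mult_index[OF R S] sum_distrib_left sum_distrib_right mult_ac del: index_mult_mat(1))
  also have "\<dots> = (\<Sum>i<n. \<Sum>l<n. cnj (U $$ (i, j)) * R $$ (i, l) * (\<Sum>k<n. ?S $$ (l, k) * U $$ (k, j)))"
    unfolding sum_distrib_left by (rule sum.cong[OF refl], rule sum.swap)
  also have "\<dots> = (\<Sum>i<n. \<Sum>l<n. cnj (U $$ (i, j)) * R $$ (i, l) * (x j * U $$ (l, j)))"
    by (intro sum.cong refl) (simp add: conj_diag_right[OF U] j)
  finally show ?thesis by (simp add: quad_def sum_distrib_left mult_ac)
qed

lemma quad_conj_diag_col:
  assumes U: "unitary_mat n U" and j: "j < n"
  shows "quad n (U * mat_diag n x * mat_adjoint U) (\<lambda>i. U $$ (i, j)) = x j"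
proof -
  note Uc = unitary_matD[OF U]
  have "quad n (U * mat_diag n x * mat_adjoint U) (\<lambda>i. U $$ (i, j)) = (\<Sum>i<n. cnj (U $$ (i, j)) * (x j * U $$ (i, j)))"
    unfolding quad_def
    by (intro sum.cong refl) (simp add: mult.assoc flip: sum_distrib_left, simp add: conj_diag_right[OF U] j)
  also have "\<dots> = x j * (\<Sum>i<n. cnj (U $$ (i, j)) * U $$ (i, j))" by (simp add: sum_distrib_left mult_ac)
  finally show ?thesis by (simp add: Uc(2) j)
qed

lemma psd_diagonalizable:
  assumes "psd n A"
  obtains U x where "unitary_mat n U" "A = U * mat_diag n (\<lambda>i. complex_of_real (x i)) * mat_adjoint U"
    "\<And>i. i < n \<Longrightarrow> 0 \<le> x i"
proof -
  from hermitian_diagonalizable[of A n] assms obtain U x where U: "unitary_mat n U"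
    and A: "A = U * mat_diag n (\<lambda>i. complex_of_real (x i)) * mat_adjoint U"
    by (auto simp: psd_def)
  have "0 \<le> x i" if "i < n" for i
    using psd_quad_ge[OF assms, of "\<lambda>k. U $$ (k, i)"] quad_conj_diag_col[OF U that] by (simp add: A)
  thus ?thesis using that U A by blast
qed

text \<open>The vectors \<open>b l\<close> are the eigenvectors scaled by the square roots of their
  eigenvalues.\<close>

lemma psd_factor:
  assumes "psd n A"
  obtains b where "\<And>i j. i < n \<Longrightarrow> j < n \<Longrightarrow> A $$ (i, j) = (\<Sum>l<n. b l i * cnj (b l j))"
proof -
  from psd_diagonalizable[OF assms] obtain U x where U: "unitary_mat n U"
    and A: "A = U * mat_diag n (\<lambda>i. complex_of_real (x i)) * mat_adjoint U"
    and x: "\<And>i. i < n \<Longrightarrow> 0 \<le> x i" by metis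
  show ?thesis
  proof (rule that[of "\<lambda>l i. U $$ (i, l) * complex_of_real (sqrt (x l))"])
    fix i j assume "i < n" "j < n"
    show "A $$ (i, j) = (\<Sum>l<n. U $$ (i, l) * complex_of_real (sqrt (x l)) * cnj (U $$ (j, l) * complex_of_real (sqrt (x l))))"
      unfolding A conj_diag_index[OF unitary_matD(1)[OF U] \<open>i < n\<close> \<open>j < n\<close>]
    proof (intro sum.cong refl)
      fix l assume "l \<in> {..<n}"
      hence "complex_of_real (x l) = complex_of_real (sqrt (x l)) * complex_of_real (sqrt (x l))"
        using x by (simp flip: of_real_mult)
      thus "U $$ (i, l) * complex_of_real (x l) * cnj (U $$ (j, l)) =
          U $$ (i, l) * complex_of_real (sqrt (x l)) * cnj (U $$ (j, l) * complex_of_real (sqrt (x l)))"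
        by (simp add: mult_ac)
    qed
  qed
qed

lemma quad_factor:
  assumes "\<And>i j. i < n \<Longrightarrow> j < n \<Longrightarrow> A $$ (i, j) = (\<Sum>l\<in>L. b l i * cnj (b l j))"
  shows "quad n A z = of_real (\<Sum>l\<in>L. (cmod (\<Sum>i<n. cnj (z i) * b l i))\<^sup>2)"
proof -
  have "quad n A z = (\<Sum>i<n. \<Sum>j<n. \<Sum>l\<in>L. (cnj (z i) * b l i) * cnj (cnj (z j) * b l j))"
    unfolding quad_def by (intro sum.cong refl) (simp add: assms sum_distrib_left sum_distrib_right mult_ac)
  also have "\<dots> = (\<Sum>i<n. \<Sum>l\<in>L. \<Sum>j<n. (cnj (z i) * b l i) * cnj (cnj (z j) * b l j))"
    by (rule sum.cong[OF refl], rule sum.swap)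
  also have "\<dots> = (\<Sum>l\<in>L. \<Sum>i<n. \<Sum>j<n. (cnj (z i) * b l i) * cnj (cnj (z j) * b l j))"
    by (rule sum.swap)
  also have "\<dots> = (\<Sum>l\<in>L. (\<Sum>i<n. cnj (z i) * b l i) * cnj (\<Sum>i<n. cnj (z i) * b l i))"
    by (simp add: sum_product)
  finally show ?thesis by (simp add: complex_norm_square del: of_real_power cnj_sum)
qed

lemma psd_factorI:
  assumes "A \<in> carrier_mat n n"
    and "\<And>i j. i < n \<Longrightarrow> j < n \<Longrightarrow> A $$ (i, j) = (\<Sum>l\<in>L. b l i * cnj (b l j))"
  shows "psd n A"
  unfolding psd_iff using assms(1) by (auto simp: quad_factor[OF assms(2)] assms(2) mult_ac sum_nonneg)

text \<open>Writing \<open>A\<close> as a sum of rank-one terms turns the trace into a sum of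
  quadratic forms of \<open>B\<close>.\<close>

lemma mat_trace_psd_mult:
  assumes A: "psd n A" and B: "psd n B"
  shows "0 \<le> Re (mat_trace (A * B))"
proof -
  from psd_factor[OF A] obtain b where b: "\<And>i j. i < n \<Longrightarrow> j < n \<Longrightarrow> A $$ (i, j) = (\<Sum>l<n. b l i * cnj (b l j))"
    by metis
  have "mat_trace (A * B) = (\<Sum>i<n. \<Sum>j<n. \<Sum>l<n. cnj (b l j) * B $$ (j, i) * b l i)"
    unfolding mat_trace_mult[OF psd_carrier[OF A] psd_carrier[OF B]]
    by (intro sum.cong refl) (simp add: b sum_distrib_left sum_distrib_right mult_ac)
  also have "\<dots> = (\<Sum>i<n. \<Sum>l<n. \<Sum>j<n. cnj (b l j) * B $$ (j, i) * b l i)"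
    by (rule sum.cong[OF refl], rule sum.swap)
  also have "\<dots> = (\<Sum>l<n. \<Sum>i<n. \<Sum>j<n. cnj (b l j) * B $$ (j, i) * b l i)" by (rule sum.swap)
  also have "\<dots> = (\<Sum>l<n. quad n B (b l))"
    unfolding quad_def by (rule sum.cong[OF refl], rule sum.swap)
  finally show ?thesis using psd_quad_ge[OF B] by (simp add: sum_nonneg)
qed

lemma psd_one: "psd n (1\<^sub>m n)"
  unfolding psd_iff quad_mult_one by (auto simp: sum_nonneg)

lemma mat_trace_minus:
  "A \<in> carrier_mat n n \<Longrightarrow> B \<in> carrier_mat n n \<Longrightarrow> mat_trace (A - B) = mat_trace A - mat_trace B"
  by (auto simp: mat_trace_def sum_subtractf)

section \<open>Relative entropy of a state with flat spectrum\<close>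

lemma psd_diag_weights:
  assumes R: "density n R" and U: "unitary_mat n U"
  shows "(\<Sum>j<n. quad n R (\<lambda>i. U $$ (i, j))) = 1"
proof -
  note Uc = unitary_matD[OF U]
  have Rc: "R \<in> carrier_mat n n" using R by (simp add: density_def psd_def)
  have "U * mat_diag n (\<lambda>_. 1) * mat_adjoint U = 1\<^sub>m n" using U Uc(1) by (simp add: unitary_mat_def)
  thus ?thesis using mat_trace_conj_diag[OF Rc Uc(1), of "\<lambda>_. 1"] R Rc by (simp add: density_def)
qed

text \<open>The hypothesis puts all spectral weight of \<open>R\<close> on the eigenvalue
  \<open>c\<close> of \<open>S\<close>. With \<open>S = R\<close> this also evaluates the entropy
  term of a flat state.\<close>

lemma trace_mat_log2_eigen:
  assumes R: "density n R" and S: "psd n S" and RS: "R * S = complex_of_real c \<cdot>\<^sub>m R"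
  shows "Re (mat_trace (R * mat_log2 S)) = log 2 c"
proof -
  have Rc: "R \<in> carrier_mat n n" and Rp: "psd n R" using R by (simp_all add: density_def psd_def)
  from psd_diagonalizable[OF S] obtain U x where U: "unitary_mat n U"
    and A: "S = U * mat_diag n (\<lambda>i. complex_of_real (x i)) * mat_adjoint U" by metis
  define w where "w j = quad n R (\<lambda>i. U $$ (i, j))" for j
  have sw: "(\<Sum>j<n. w j) = 1" unfolding w_def by (rule psd_diag_weights[OF R U])
  have eig: "complex_of_real (log 2 (x j)) * w j = complex_of_real (log 2 c) * w j" if "j < n" for j
  proof -
    have "complex_of_real (x j) * w j = quad n (R * S) (\<lambda>i. U $$ (i, j))"
      unfolding A w_def by (rule quad_conj_diag[OF U Rc that, symmetric])
    also have "\<dots> = complex_of_real c * w j"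
      unfolding RS w_def quad_def using Rc by (simp add: sum_distrib_left mult_ac)
    finally show ?thesis by (cases "w j = 0") auto
  qed
  have "mat_trace (R * mat_log2 S) = (\<Sum>j<n. complex_of_real (log 2 (x j)) * w j)"
    unfolding A mat_log2_def mat_fun_conj_diag[OF U] w_def
    by (rule mat_trace_conj_diag[OF Rc unitary_matD(1)[OF U]])
  also have "\<dots> = complex_of_real (log 2 c)" using sw by (simp add: eig flip: sum_distrib_left)
  finally show ?thesis by simp
qed

lemma mat_log2_carrier:
  assumes "psd n S"
  shows "mat_log2 S \<in> carrier_mat n n"
proof -
  from psd_diagonalizable[OF assms] obtain U x where U: "unitary_mat n U"
    and A: "S = U * mat_diag n (\<lambda>i. complex_of_real (x i)) * mat_adjoint U" by metis
  show ?thesis using unitary_matD(1)[OF U] by (simp add: A mat_log2_def mat_fun_conj_diag[OF U])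
qed

lemma rel_entropy_supp:
  assumes R: "psd n R" and S: "psd n S" and sub: "mat_supp R \<subseteq> mat_supp S"
  shows "rel_entropy R S = ereal (Re (mat_trace (R * mat_log2 R)) - Re (mat_trace (R * mat_log2 S)))"
proof -
  note c = psd_carrier[OF R] mat_log2_carrier[OF R] mat_log2_carrier[OF S]
  have "R * (mat_log2 R - mat_log2 S) = R * mat_log2 R - R * mat_log2 S"
    by (rule mult_minus_distrib_mat[OF c])
  hence "mat_trace (R * (mat_log2 R - mat_log2 S)) = mat_trace (R * mat_log2 R) - mat_trace (R * mat_log2 S)"
    using c by (simp only:) (intro mat_trace_minus[of _ n] mult_carrier_mat[of _ n n], auto)
  thus ?thesis using sub by (simp add: rel_entropy_def)
qed

lemma rel_entropy_flat_eigen: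
  assumes R: "density n R" and RR: "R * R = complex_of_real r \<cdot>\<^sub>m R"
    and S: "psd n S" and RS: "R * S = complex_of_real c \<cdot>\<^sub>m R" and sub: "mat_supp R \<subseteq> mat_supp S"
  shows "rel_entropy R S = ereal (log 2 r - log 2 c)"
proof -
  have Rp: "psd n R" using R by (simp add: density_def)
  show ?thesis
    by (simp add: rel_entropy_supp[OF Rp S sub] trace_mat_log2_eigen[OF R Rp RR] trace_mat_log2_eigen[OF R S RS])
qed

text \<open>Jensen's inequality for the logarithm, applied to the spectral weights of \<open>R\<close> in an
  eigenbasis of \<open>S\<close>.\<close>

lemma rel_entropy_flat_ge:
  assumes R: "density n R" and RR: "R * R = complex_of_real r \<cdot>\<^sub>m R" and S: "psd n S"
  shows "0 < Re (mat_trace (R * S)) \<and> ereal (log 2 r - log 2 (Re (mat_trace (R * S)))) \<le> rel_entropy R S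
    \<or> rel_entropy R S = \<infinity>"
proof (cases "mat_supp R \<subseteq> mat_supp S")
  case sub: True
  have Rc: "R \<in> carrier_mat n n" and Rp: "psd n R" using R by (simp_all add: density_def psd_def)
  note Rh = Rp[unfolded psd_iff, THEN conjunct2, THEN conjunct1, rule_format]
  from psd_diagonalizable[OF S] obtain U x where U: "unitary_mat n U"
    and A: "S = U * mat_diag n (\<lambda>i. complex_of_real (x i)) * mat_adjoint U"
    and x: "\<And>i. i < n \<Longrightarrow> 0 \<le> x i" by metis
  note Uc = unitary_matD[OF U]
  have Sc: "S \<in> carrier_mat n n" using S by (rule psd_carrier)
  define w where "w j = Re (quad n R (\<lambda>i. U $$ (i, j)))" for j
  have w0: "0 \<le> w j" for j unfolding w_def by (rule psd_quad_ge[OF Rp])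
  have sw: "(\<Sum>j<n. w j) = 1" unfolding w_def
    using arg_cong[OF psd_diag_weights[OF R U], of Re] by simp
  \<comment> \<open>For a kernel vector \<open>u\<close> of \<open>S\<close>, the vector
    \<open>R u\<close> lies in the support of \<open>R\<close>, hence in that of \<open>S\<close>,
    and is thus orthogonal to \<open>u\<close>: \<open>R\<close> puts no weight on \<open>u\<close>.
    This matters because \<open>log 2 0 = 0\<close> would otherwise spoil the estimate.\<close>
  have ker: "w j = 0" if j: "j < n" and xj: "x j = 0" for j
  proof -
    define u where "u = vec n (\<lambda>i. U $$ (i, j))"
    have u: "u \<in> carrier_vec n" by (simp add: u_def)
    have "S *\<^sub>v u = 0\<^sub>v n"
    proof (rule eq_vecI)
      fix i assume "i < dim_vec (0\<^sub>v n)" hence i: "i < n" by simp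
      have "(S *\<^sub>v u) $ i = (\<Sum>k<n. S $$ (i, k) * U $$ (k, j))"
        unfolding mult_mat_vec_index[OF Sc u i] by (simp add: u_def)
      thus "(S *\<^sub>v u) $ i = 0\<^sub>v n $ i" unfolding A using conj_diag_right[OF U i j] xj i by simp
    qed (use Sc in simp)
    hence uk: "u \<in> mat_kernel S" using Sc u by (intro mat_kernelI) auto
    have "R *\<^sub>v u \<in> mat_supp R" unfolding mat_supp_def
    proof (intro CollectI conjI ballI)
      show "R *\<^sub>v u \<in> carrier_vec (dim_col R)" using Rc u by auto
      fix v assume v: "v \<in> mat_kernel R"
      hence vc: "v \<in> carrier_vec n" and Rv: "R *\<^sub>v v = 0\<^sub>v n" using mat_kernelD[OF Rc v] by auto
      have "(R *\<^sub>v u) \<bullet>c v = (\<Sum>i<n. (R *\<^sub>v u) $ i * cnj (v $ i))"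
        using Rc u vc by (intro cscalar_prod_index) auto
      also have "\<dots> = (\<Sum>i<n. \<Sum>k<n. cnj (R $$ (k, i) * v $ i) * u $ k)"
        by (intro sum.cong refl) (simp add: mult_mat_vec_index[OF Rc u] sum_distrib_left sum_distrib_right Rh mult_ac del: index_mult_mat_vec)
      also have "\<dots> = (\<Sum>k<n. cnj ((R *\<^sub>v v) $ k) * u $ k)"
        by (subst sum.swap) (intro sum.cong refl, simp add: mult_mat_vec_index[OF Rc vc] sum_distrib_right del: index_mult_mat_vec)
      finally show "(R *\<^sub>v u) \<bullet>c v = 0" by (simp add: Rv)
    qed
    hence "R *\<^sub>v u \<in> mat_supp S" using sub by blast
    hence "(R *\<^sub>v u) \<bullet>c u = 0" using uk by (simp add: mat_supp_def)
    hence "quad n R (\<lambda>i. u $ i) = 0" unfolding quad_vec[OF Rc u] .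
    moreover have "quad n R (\<lambda>i. u $ i) = quad n R (\<lambda>i. U $$ (i, j))" by (rule quad_cong) (simp add: u_def)
    ultimately show ?thesis by (simp add: w_def)
  qed
  define c where "c = (\<Sum>j<n. x j * w j)"
  have c: "Re (mat_trace (R * S)) = c"
    unfolding A c_def using mat_trace_conj_diag[OF Rc Uc(1), of "\<lambda>i. complex_of_real (x i)"] by (simp add: w_def)
  have l: "Re (mat_trace (R * mat_log2 S)) = (\<Sum>j<n. log 2 (x j) * w j)"
    unfolding A mat_log2_def mat_fun_conj_diag[OF U]
    using mat_trace_conj_diag[OF Rc Uc(1), of "\<lambda>i. complex_of_real (log 2 (x i))"] by (simp add: w_def)
  have c0: "c > 0"
  proof -
    have "c \<ge> 0" unfolding c_def using x w0 by (intro sum_nonneg) auto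
    moreover have "c \<noteq> 0"
    proof
      assume "c = 0"
      hence "\<forall>j<n. x j * w j = 0"
        unfolding c_def using x w0 by (subst (asm) sum_nonneg_eq_0_iff) auto
      hence "\<forall>j<n. w j = 0" using ker by auto
      thus False using sw by simp
    qed
    ultimately show ?thesis by simp
  qed
  \<comment> \<open>Tangent line of the logarithm at the mean \<open>c\<close>; after summation the
    linear terms cancel.\<close>
  have "log 2 (x j) * w j \<le> (log 2 c - 1 / ln 2) * w j + (1 / (c * ln 2)) * (x j * w j)" if j: "j < n" for j
  proof (cases "x j = 0")
    case True thus ?thesis using ker[OF j] by simp
  next
    case False
    hence xj: "x j > 0" using x[OF j] by simp
    have "ln (x j / c) \<le> x j / c - 1" using xj c0 by (intro ln_le_minus_one) auto
    hence "log 2 (x j) \<le> log 2 c - 1 / ln 2 + x j / (c * ln 2)"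
      using xj c0 by (simp add: log_def ln_div field_simps)
    hence "log 2 (x j) * w j \<le> (log 2 c - 1 / ln 2 + x j / (c * ln 2)) * w j"
      using w0 by (rule mult_right_mono)
    thus ?thesis by (simp add: algebra_simps)
  qed
  hence "(\<Sum>j<n. log 2 (x j) * w j) \<le> (\<Sum>j<n. (log 2 c - 1 / ln 2) * w j + (1 / (c * ln 2)) * (x j * w j))"
    by (intro sum_mono) auto
  also have "\<dots> = (log 2 c - 1 / ln 2) * 1 + (1 / (c * ln 2)) * c"
    by (simp only: sum.distrib flip: sum_distrib_left sw c_def)
  also have "\<dots> = log 2 c" using c0 by simp
  finally show ?thesis
    using c0 by (simp add: rel_entropy_supp[OF Rp S sub] trace_mat_log2_eigen[OF R Rp RR] l c)
qed (simp add: rel_entropy_def)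

text \<open>Supports are orthogonal complements of kernels, so inclusions reverse.\<close>

lemma mat_supp_mono:
  assumes "R \<in> carrier_mat n n" "S \<in> carrier_mat n n"
    and "\<And>v. v \<in> carrier_vec n \<Longrightarrow> S *\<^sub>v v = 0\<^sub>v n \<Longrightarrow> R *\<^sub>v v = 0\<^sub>v n"
  shows "mat_supp R \<subseteq> mat_supp S"
  using assms unfolding mat_supp_def mat_kernel[OF assms(1)] mat_kernel[OF assms(2)] by auto

section \<open>Separable operators\<close>

lemma sum_pair_nat:
  fixes f :: "nat \<Rightarrow> 'a::comm_monoid_add"
  shows "(\<Sum>p<a. \<Sum>q<b. f (p * b + q)) = (\<Sum>x<a * b. f x)"
proof -
  have "(\<Sum>q<b. f (p * b + q)) = sum f {p * b..<p * b + b}" for p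
    using sum.shift_bounds_nat_ivl[of f 0 "p * b" b] by (simp add: atLeast0LessThan add.commute)
  thus ?thesis by (simp add: sum.nat_group)
qed

lemma sum_div_mod:
  fixes f :: "nat \<Rightarrow> nat \<Rightarrow> 'a::comm_monoid_add"
  shows "(\<Sum>x<a * b. f (x div b) (x mod b)) = (\<Sum>p<a. \<Sum>q<b. f p q)"
  unfolding sum_pair_nat[symmetric] by (intro sum.cong refl) auto

lemma div_mod_less:
  fixes x a b :: nat
  assumes "x < a * b" shows "x div b < a" "x mod b < b"
  using assms by (auto simp: less_mult_imp_div_less intro!: mod_less_divisor, cases b) auto

definition norm_sq :: "nat \<Rightarrow> (nat \<Rightarrow> complex) \<Rightarrow> real" where
  "norm_sq n \<alpha> = (\<Sum>i<n. (cmod (\<alpha> i))\<^sup>2)"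

definition prodvec :: "nat \<Rightarrow> (nat \<Rightarrow> complex) \<Rightarrow> (nat \<Rightarrow> complex) \<Rightarrow> nat \<Rightarrow> complex" where
  "prodvec b \<alpha> \<beta> x = \<alpha> (x div b) * \<beta> (x mod b)"

text \<open>Terms are unnormalized pure product vectors, so that weights are absorbed and adding
  operators is concatenating lists. This presents the cone over the separable states, as
  \<open>cone_sep_states\<close> shows.\<close>

definition sep_sum :: "nat \<Rightarrow> nat \<Rightarrow> ((nat \<Rightarrow> complex) \<times> (nat \<Rightarrow> complex)) list \<Rightarrow> complex mat" where
  "sep_sum a b ls = mat (a * b) (a * b)
     (\<lambda>(x, y). \<Sum>(\<alpha>, \<beta>)\<leftarrow>ls. prodvec b \<alpha> \<beta> x * cnj (prodvec b \<alpha> \<beta> y))"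

definition sep_op :: "nat \<Rightarrow> nat \<Rightarrow> complex mat \<Rightarrow> bool" where
  "sep_op a b X \<longleftrightarrow> (\<exists>ls. X = sep_sum a b ls)"

definition qf :: "nat \<Rightarrow> nat \<Rightarrow> complex mat \<Rightarrow> (nat \<Rightarrow> complex) \<Rightarrow> (nat \<Rightarrow> complex) \<Rightarrow> real" where
  "qf a b X \<alpha> \<beta> = Re (quad (a * b) X (prodvec b \<alpha> \<beta>))"

lemma norm_sq_nonneg [simp]: "0 \<le> norm_sq n \<alpha>" by (simp add: norm_sq_def sum_nonneg)

lemma norm_sq_eq_0_iff: "norm_sq n \<alpha> = 0 \<longleftrightarrow> (\<forall>i<n. \<alpha> i = 0)"
  by (auto simp: norm_sq_def sum_nonneg_eq_0_iff)

lemma norm_sq_prodvec: "norm_sq (a * b) (prodvec b \<alpha> \<beta>) = norm_sq a \<alpha> * norm_sq b \<beta>"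
  unfolding norm_sq_def prodvec_def sum_product
  using sum_div_mod[of "\<lambda>p q. (cmod (\<alpha> p * \<beta> q))\<^sup>2" b a] by (simp add: norm_mult power_mult_distrib)

lemma qf_one: "qf a b (1\<^sub>m (a * b)) \<alpha> \<beta> = norm_sq a \<alpha> * norm_sq b \<beta>"
  by (simp add: qf_def quad_mult_one norm_sq_def[symmetric] norm_sq_prodvec)

lemma sep_sum_carrier [simp]: "sep_sum a b ls \<in> carrier_mat (a * b) (a * b)"
  by (simp add: sep_sum_def)

lemma sep_sum_index:
  "x < a * b \<Longrightarrow> y < a * b \<Longrightarrow>
    sep_sum a b ls $$ (x, y) = (\<Sum>(\<alpha>, \<beta>)\<leftarrow>ls. prodvec b \<alpha> \<beta> x * cnj (prodvec b \<alpha> \<beta> y))"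
  by (simp add: sep_sum_def)

lemma sep_op_carrier: "sep_op a b X \<Longrightarrow> X \<in> carrier_mat (a * b) (a * b)"
  by (auto simp: sep_op_def)

lemma sep_op_psd: "sep_op a b X \<Longrightarrow> psd (a * b) X"
proof -
  assume "sep_op a b X"
  then obtain ls where X: "X = sep_sum a b ls" by (auto simp: sep_op_def)
  show ?thesis
  proof (rule psd_factorI)
    show "X \<in> carrier_mat (a * b) (a * b)" by (simp add: X)
    fix i j assume "i < a * b" "j < a * b"
    thus "X $$ (i, j) = (\<Sum>l\<in>{..<length ls}. prodvec b (fst (ls ! l)) (snd (ls ! l)) i * cnj (prodvec b (fst (ls ! l)) (snd (ls ! l)) j))"
      by (simp add: X sep_sum_index sum_list_sum_nth case_prod_unfold atLeast0LessThan)
  qed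
qed

lemma sep_op_sum_list:
  assumes "Y \<in> carrier_mat (a * b) (a * b)"
    and "\<And>l. l \<in> set js \<Longrightarrow> sep_op a b (X l)"
    and "\<And>x y. x < a * b \<Longrightarrow> y < a * b \<Longrightarrow> Y $$ (x, y) = (\<Sum>l\<leftarrow>js. X l $$ (x, y))"
  shows "sep_op a b Y"
proof -
  from assms(2) obtain ls where ls: "\<And>l. l \<in> set js \<Longrightarrow> X l = sep_sum a b (ls l)"
    unfolding sep_op_def by metis
  have "sep_sum a b (concat (map ls js)) $$ (x, y) = (\<Sum>l\<leftarrow>js. X l $$ (x, y))"
    if "x < a * b" "y < a * b" for x y
  proof -
    have "(\<Sum>l\<leftarrow>js. X l $$ (x, y)) = (\<Sum>l\<leftarrow>js. sep_sum a b (ls l) $$ (x, y))"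
      using ls by (intro arg_cong[of _ _ sum_list] map_cong) auto
    also have "\<dots> = sep_sum a b (concat (map ls js)) $$ (x, y)"
      using that by (induction js) (simp_all add: sep_sum_index)
    finally show ?thesis ..
  qed
  hence "Y = sep_sum a b (concat (map ls js))"
    using assms(1,3) by (intro eq_matI) (auto simp: sep_sum_def)
  thus ?thesis unfolding sep_op_def by blast
qed

lemma sep_op_sum:
  assumes "finite L" "Y \<in> carrier_mat (a * b) (a * b)"
    and "\<And>l. l \<in> L \<Longrightarrow> sep_op a b (X l)"
    and "\<And>x y. x < a * b \<Longrightarrow> y < a * b \<Longrightarrow> Y $$ (x, y) = (\<Sum>l\<in>L. X l $$ (x, y))"
  shows "sep_op a b Y"
proof -
  from finite_distinct_list[OF assms(1)] obtain js where js: "set js = L" "distinct js" by auto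
  show ?thesis
    by (rule sep_op_sum_list[OF assms(2), of js X])
      (use assms(3,4) js in \<open>auto simp: sum.distinct_set_conv_list\<close>)
qed

lemma sep_op_rank1:
  "sep_op a b (mat (a * b) (a * b) (\<lambda>(x, y). prodvec b \<alpha> \<beta> x * cnj (prodvec b \<alpha> \<beta> y)))"
  unfolding sep_op_def by (rule exI[of _ "[(\<alpha>, \<beta>)]"]) (simp add: sep_sum_def)

lemma sep_op_scale:
  assumes "sep_op a b X" "0 \<le> c" "Y \<in> carrier_mat (a * b) (a * b)"
    and "\<And>x y. x < a * b \<Longrightarrow> y < a * b \<Longrightarrow> Y $$ (x, y) = complex_of_real c * X $$ (x, y)"
  shows "sep_op a b Y"
proof -
  from assms(1) obtain ls where X: "X = sep_sum a b ls" by (auto simp: sep_op_def)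
  have c: "complex_of_real c = complex_of_real (sqrt c) * complex_of_real (sqrt c)"
    using assms(2) by (simp flip: of_real_mult)
  have "Y = sep_sum a b (map (\<lambda>(\<alpha>, \<beta>). (\<lambda>i. complex_of_real (sqrt c) * \<alpha> i, \<beta>)) ls)"
  proof (rule eq_matI)
    fix x y assume "x < dim_row (sep_sum a b (map (\<lambda>(\<alpha>, \<beta>). (\<lambda>i. complex_of_real (sqrt c) * \<alpha> i, \<beta>)) ls))"
      "y < dim_col (sep_sum a b (map (\<lambda>(\<alpha>, \<beta>). (\<lambda>i. complex_of_real (sqrt c) * \<alpha> i, \<beta>)) ls))"
    hence xy: "x < a * b" "y < a * b" by (simp_all add: sep_sum_def)
    show "Y $$ (x, y) = sep_sum a b (map (\<lambda>(\<alpha>, \<beta>). (\<lambda>i. complex_of_real (sqrt c) * \<alpha> i, \<beta>)) ls) $$ (x, y)"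
      unfolding assms(4)[OF xy] X sep_sum_index[OF xy] sum_list_const_mult[symmetric] map_map o_def
      by (intro arg_cong[of _ _ sum_list] map_cong refl) (auto simp: prodvec_def c mult_ac)
  qed (use assms(3) in \<open>auto simp: sep_sum_def\<close>)
  thus ?thesis unfolding sep_op_def by blast
qed

text \<open>The reason why bounds on product vectors suffice everywhere: pairing with a separable
  operator evaluates quadratic forms at product vectors only.\<close>

lemma mat_trace_sep_sum_mult:
  assumes "Y \<in> carrier_mat (a * b) (a * b)"
  shows "mat_trace (sep_sum a b ls * Y) = (\<Sum>(\<alpha>, \<beta>)\<leftarrow>ls. quad (a * b) Y (prodvec b \<alpha> \<beta>))"
proof -
  have "mat_trace (sep_sum a b ls * Y) = (\<Sum>i<a * b. \<Sum>j<a * b. \<Sum>(\<alpha>, \<beta>)\<leftarrow>ls. prodvec b \<alpha> \<beta> i * cnj (prodvec b \<alpha> \<beta> j) * Y $$ (j, i))"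
    unfolding mat_trace_mult[OF sep_sum_carrier assms]
    by (intro sum.cong refl) (simp add: sep_sum_index case_prod_unfold flip: sum_list_mult_const)
  also have "\<dots> = (\<Sum>(\<alpha>, \<beta>)\<leftarrow>ls. \<Sum>i<a * b. \<Sum>j<a * b. prodvec b \<alpha> \<beta> i * cnj (prodvec b \<alpha> \<beta> j) * Y $$ (j, i))"
    by (induction ls) (auto simp: sum.distrib)
  also have "\<dots> = (\<Sum>(\<alpha>, \<beta>)\<leftarrow>ls. quad (a * b) Y (prodvec b \<alpha> \<beta>))"
    unfolding quad_def
    by (intro arg_cong[of _ _ sum_list] map_cong refl, clarify, subst sum.swap) (simp add: mult_ac)
  finally show ?thesis .
qed

lemma mat_trace_sep_sum:
  "mat_trace (sep_sum a b ls) = of_real (\<Sum>(\<alpha>, \<beta>)\<leftarrow>ls. norm_sq a \<alpha> * norm_sq b \<beta>)"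
proof -
  have "mat_trace (sep_sum a b ls) = mat_trace (sep_sum a b ls * 1\<^sub>m (a * b))"
    by (simp add: right_mult_one_mat[OF sep_sum_carrier])
  also have "\<dots> = (\<Sum>(\<alpha>, \<beta>)\<leftarrow>ls. of_real (norm_sq a \<alpha> * norm_sq b \<beta>))"
    by (simp add: mat_trace_sep_sum_mult quad_mult_one norm_sq_def[symmetric] norm_sq_prodvec)
  also have "\<dots> = of_real (\<Sum>(\<alpha>, \<beta>)\<leftarrow>ls. norm_sq a \<alpha> * norm_sq b \<beta>)"
    by (induction ls) auto
  finally show ?thesis .
qed

lemma density_rank1:
  assumes "norm_sq n \<alpha> = 1"
  shows "density n (mat n n (\<lambda>(i, j). \<alpha> i * cnj (\<alpha> j)))"
proof -
  have "psd n (mat n n (\<lambda>(i, j). \<alpha> i * cnj (\<alpha> j)))"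
    by (rule psd_factorI[where L = "{0::nat}" and b = "\<lambda>_. \<alpha>"]) auto
  moreover have "mat_trace (mat n n (\<lambda>(i, j). \<alpha> i * cnj (\<alpha> j))) = of_real (norm_sq n \<alpha>)"
    by (simp add: mat_trace_def norm_sq_def complex_norm_square del: of_real_power)
  ultimately show ?thesis using assms by (simp add: density_def)
qed

text \<open>For a zero vector any unit vector serves, because its coefficient vanishes;
  \<open>n > 0\<close> provides one.\<close>

lemma normalize_vec:
  assumes "n > 0"
  obtains \<alpha>' where "norm_sq n \<alpha>' = 1" "\<And>i. i < n \<Longrightarrow> \<alpha> i = complex_of_real (sqrt (norm_sq n \<alpha>)) * \<alpha>' i"
proof (cases "norm_sq n \<alpha> = 0")
  case True
  have "norm_sq n (\<lambda>i. if i = 0 then 1 else 0) = (\<Sum>i<n. if i = 0 then 1 else 0)"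
    unfolding norm_sq_def by (intro sum.cong) auto
  hence "norm_sq n (\<lambda>i. if i = 0 then 1 else 0) = 1" using assms by simp
  thus ?thesis using that True by (auto simp: norm_sq_eq_0_iff)
next
  case False
  hence pos: "norm_sq n \<alpha> > 0" using norm_sq_nonneg[of n \<alpha>] by linarith
  have "norm_sq n (\<lambda>i. \<alpha> i / complex_of_real (sqrt (norm_sq n \<alpha>))) = norm_sq n \<alpha> / norm_sq n \<alpha>"
    unfolding norm_sq_def sum_divide_distrib
    by (intro sum.cong refl) (simp add: norm_divide power_divide sum_nonneg)
  thus ?thesis using that[of "\<lambda>i. \<alpha> i / complex_of_real (sqrt (norm_sq n \<alpha>))"] pos by simp
qed

lemma sep_op_kron:
  assumes "psd a R" "psd b T"
  shows "sep_op a b (kron R T)"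
proof -
  from psd_factor[OF assms(1)] obtain f where f: "\<And>i j. i < a \<Longrightarrow> j < a \<Longrightarrow> R $$ (i, j) = (\<Sum>l<a. f l i * cnj (f l j))"
    by metis
  from psd_factor[OF assms(2)] obtain g where g: "\<And>i j. i < b \<Longrightarrow> j < b \<Longrightarrow> T $$ (i, j) = (\<Sum>l<b. g l i * cnj (g l j))"
    by metis
  note c = psd_carrier[OF assms(1)] psd_carrier[OF assms(2)]
  show ?thesis
  proof (rule sep_op_sum[where L = "{..<a} \<times> {..<b}" and
        X = "\<lambda>(l, m). mat (a * b) (a * b) (\<lambda>(x, y). prodvec b (f l) (g m) x * cnj (prodvec b (f l) (g m) y))"])
    show "kron R T \<in> carrier_mat (a * b) (a * b)" by (rule kron_carrier[OF c])
    fix x y assume xy: "x < a * b" "y < a * b"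
    have "kron R T $$ (x, y) = (\<Sum>l<a. f l (x div b) * cnj (f l (y div b))) * (\<Sum>m<b. g m (x mod b) * cnj (g m (y mod b)))"
      using div_mod_less[OF xy(1)] div_mod_less[OF xy(2)] by (simp add: kron_index[OF c xy] f g)
    also have "\<dots> = (\<Sum>(l, m)\<in>{..<a} \<times> {..<b}. prodvec b (f l) (g m) x * cnj (prodvec b (f l) (g m) y))"
      unfolding sum_product sum.cartesian_product by (intro sum.cong refl) (auto simp: prodvec_def)
    also have "\<dots> = (\<Sum>lm\<in>{..<a} \<times> {..<b}. (case lm of (l, m) \<Rightarrow>
        mat (a * b) (a * b) (\<lambda>(x, y). prodvec b (f l) (g m) x * cnj (prodvec b (f l) (g m) y))) $$ (x, y))"
      using xy by (intro sum.cong refl) auto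
    finally show "kron R T $$ (x, y) = \<dots>" .
  qed (auto intro: sep_op_rank1)
qed

text \<open>From left to right each density factor is split into rank-one terms; from right to left
  the product vectors are normalized and their squared norms become the convex weights.\<close>

theorem sep_states_iff:
  "\<sigma> \<in> sep_states a b \<longleftrightarrow> sep_op a b \<sigma> \<and> mat_trace \<sigma> = 1"
proof
  assume "\<sigma> \<in> sep_states a b"
  then obtain k :: nat and p R T where
    h: "\<And>i. i < k \<Longrightarrow> 0 \<le> p i \<and> density a (R i) \<and> density b (T i)" "(\<Sum>i<k. p i) = (1::real)"
    and \<sigma>: "\<sigma> = sum_mats (a * b) (\<lambda>i. complex_of_real (p i) \<cdot>\<^sub>m kron (R i) (T i)) [0..<k]"
    unfolding sep_states_def by auto
  have kr: "kron (R i) (T i) \<in> carrier_mat (a * b) (a * b)" if "i < k" for i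
    using h(1)[OF that] by (auto simp: density_def psd_def intro: kron_carrier)
  have entry: "\<sigma> $$ (x, y) = (\<Sum>i<k. (complex_of_real (p i) \<cdot>\<^sub>m kron (R i) (T i)) $$ (x, y))"
    if "x < a * b" "y < a * b" for x y
    using that by (simp add: \<sigma> sum_mats_def interv_sum_list_conv_sum_set_nat atLeast0LessThan)
  have \<sigma>c: "\<sigma> \<in> carrier_mat (a * b) (a * b)" by (simp add: \<sigma> sum_mats_def)
  have "sep_op a b \<sigma>"
  proof (rule sep_op_sum[OF _ \<sigma>c _ entry])
    fix i assume "i \<in> {..<k}"
    hence i: "i < k" by simp
    show "sep_op a b (complex_of_real (p i) \<cdot>\<^sub>m kron (R i) (T i))"
    proof (rule sep_op_scale[where c = "p i"])
      show "sep_op a b (kron (R i) (T i))"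
        using h(1)[OF i] by (auto simp: density_def intro: sep_op_kron)
    qed (use h(1)[OF i] kr[OF i] in auto)
  qed auto
  moreover have "mat_trace \<sigma> = 1"
  proof -
    have trk: "mat_trace (kron (R i) (T i)) = 1" if i: "i < k" for i
    proof -
      have c: "R i \<in> carrier_mat a a" "T i \<in> carrier_mat b b" using h(1)[OF i] by (auto simp: density_def psd_def)
      have "mat_trace (kron (R i) (T i)) = (\<Sum>x<a * b. R i $$ (x div b, x div b) * T i $$ (x mod b, x mod b))"
        using kr[OF i] by (auto simp: mat_trace_def kron_index[OF c] intro!: sum.cong)
      also have "\<dots> = mat_trace (R i) * mat_trace (T i)"
        using sum_div_mod[of "\<lambda>p q. R i $$ (p, p) * T i $$ (q, q)" b a] c by (simp add: mat_trace_def sum_product)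
      finally show ?thesis using h(1)[OF i] by (simp add: density_def)
    qed
    have "mat_trace \<sigma> = (\<Sum>x<a * b. \<Sum>i<k. (complex_of_real (p i) \<cdot>\<^sub>m kron (R i) (T i)) $$ (x, x))"
      using \<sigma>c by (simp add: mat_trace_def entry)
    also have "\<dots> = (\<Sum>i<k. complex_of_real (p i) * mat_trace (kron (R i) (T i)))"
      by (subst sum.swap) (auto simp: mat_trace_def sum_distrib_left intro!: sum.cong dest: kr)
    also have "\<dots> = complex_of_real (\<Sum>i<k. p i)" by (simp add: trk)
    finally show ?thesis by (simp add: h(2))
  qed
  ultimately show "sep_op a b \<sigma> \<and> mat_trace \<sigma> = 1" by blast
next
  assume "sep_op a b \<sigma> \<and> mat_trace \<sigma> = 1"
  then obtain ls where \<sigma>: "\<sigma> = sep_sum a b ls" and tr: "mat_trace \<sigma> = 1" by (auto simp: sep_op_def)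
  \<comment> \<open>Trace one excludes an empty index range, so both local dimensions are positive
    and unit vectors exist.\<close>
  have "a * b \<noteq> 0"
  proof
    assume "a * b = 0"
    hence "{..<a * b} = {}" by auto
    hence "mat_trace (sep_sum a b ls) = 0" unfolding mat_trace_def sep_sum_def dim_row_mat by (simp only: sum.empty)
    thus False using tr by (simp add: \<sigma>)
  qed
  hence ab: "a > 0" "b > 0" by auto
  have "\<exists>f. \<forall>\<alpha>. norm_sq n (f \<alpha>) = 1 \<and> (\<forall>i<n. \<alpha> i = complex_of_real (sqrt (norm_sq n \<alpha>)) * f \<alpha> i)" if "n > 0" for n
  proof (rule choice, rule allI)
    fix \<alpha> :: "nat \<Rightarrow> complex"
    show "\<exists>\<alpha>'. norm_sq n \<alpha>' = 1 \<and> (\<forall>i<n. \<alpha> i = complex_of_real (sqrt (norm_sq n \<alpha>)) * \<alpha>' i)"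
      by (rule normalize_vec[OF that, of \<alpha>]) blast
  qed
  from this[OF ab(1)] this[OF ab(2)] obtain na nb where
    na: "\<And>\<alpha>. norm_sq a (na \<alpha>) = 1" "\<And>\<alpha> i. i < a \<Longrightarrow> \<alpha> i = complex_of_real (sqrt (norm_sq a \<alpha>)) * na \<alpha> i"
    and nb: "\<And>\<alpha>. norm_sq b (nb \<alpha>) = 1" "\<And>\<alpha> i. i < b \<Longrightarrow> \<alpha> i = complex_of_real (sqrt (norm_sq b \<alpha>)) * nb \<alpha> i"
    by blast
  define R where "R i = mat a a (\<lambda>(x, y). na (fst (ls ! i)) x * cnj (na (fst (ls ! i)) y))" for i
  define T where "T i = mat b b (\<lambda>(x, y). nb (snd (ls ! i)) x * cnj (nb (snd (ls ! i)) y))" for i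
  \<comment> \<open>These weights sum to the trace, which is one.\<close>
  define p where "p i = norm_sq a (fst (ls ! i)) * norm_sq b (snd (ls ! i))" for i
  have d: "density a (R i)" "density b (T i)" for i
    unfolding R_def T_def by (rule density_rank1, rule na nb)+
  have c: "R i \<in> carrier_mat a a" "T i \<in> carrier_mat b b" for i by (simp_all add: R_def T_def)
  have "(\<Sum>i<length ls. p i) = (\<Sum>(\<alpha>, \<beta>)\<leftarrow>ls. norm_sq a \<alpha> * norm_sq b \<beta>)"
    by (simp add: p_def sum_list_sum_nth atLeast0LessThan case_prod_unfold)
  also have "complex_of_real \<dots> = complex_of_real 1" using tr by (simp add: \<sigma> mat_trace_sep_sum)
  hence "(\<Sum>(\<alpha>, \<beta>)\<leftarrow>ls. norm_sq a \<alpha> * norm_sq b \<beta>) = 1" unfolding of_real_eq_iff .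
  finally have sp: "(\<Sum>i<length ls. p i) = 1" .
  have "\<sigma> = sum_mats (a * b) (\<lambda>i. complex_of_real (p i) \<cdot>\<^sub>m kron (R i) (T i)) [0..<length ls]"
  proof (rule eq_matI)
    fix x y assume "x < dim_row (sum_mats (a * b) (\<lambda>i. complex_of_real (p i) \<cdot>\<^sub>m kron (R i) (T i)) [0..<length ls])"
      "y < dim_col (sum_mats (a * b) (\<lambda>i. complex_of_real (p i) \<cdot>\<^sub>m kron (R i) (T i)) [0..<length ls])"
    hence xy: "x < a * b" "y < a * b" by (simp_all add: sum_mats_def)
    note dm = div_mod_less[OF xy(1)] div_mod_less[OF xy(2)]
    have "(complex_of_real (p i) \<cdot>\<^sub>m kron (R i) (T i)) $$ (x, y) =
        prodvec b (fst (ls ! i)) (snd (ls ! i)) x * cnj (prodvec b (fst (ls ! i)) (snd (ls ! i)) y)" for i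
    proof -
      let ?\<alpha> = "fst (ls ! i)" and ?\<beta> = "snd (ls ! i)"
      have s: "complex_of_real (p i) = complex_of_real (sqrt (norm_sq a ?\<alpha>)) * complex_of_real (sqrt (norm_sq a ?\<alpha>)) *
          (complex_of_real (sqrt (norm_sq b ?\<beta>)) * complex_of_real (sqrt (norm_sq b ?\<beta>)))"
        by (simp add: p_def flip: of_real_mult)
      have "(complex_of_real (p i) \<cdot>\<^sub>m kron (R i) (T i)) $$ (x, y) =
        complex_of_real (p i) * (na ?\<alpha> (x div b) * cnj (na ?\<alpha> (y div b)) * (nb ?\<beta> (x mod b) * cnj (nb ?\<beta> (y mod b))))"
      proof -
        have "(complex_of_real (p i) \<cdot>\<^sub>m kron (R i) (T i)) $$ (x, y) = complex_of_real (p i) * kron (R i) (T i) $$ (x, y)"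
          using kron_carrier[OF c[of i]] xy by auto
        also have "kron (R i) (T i) $$ (x, y) = R i $$ (x div b, y div b) * T i $$ (x mod b, y mod b)"
          by (rule kron_index[OF c xy])
        finally show ?thesis using dm by (simp add: R_def T_def)
      qed
      also have "\<dots> = (complex_of_real (sqrt (norm_sq a ?\<alpha>)) * na ?\<alpha> (x div b)) * (complex_of_real (sqrt (norm_sq b ?\<beta>)) * nb ?\<beta> (x mod b)) *
          cnj ((complex_of_real (sqrt (norm_sq a ?\<alpha>)) * na ?\<alpha> (y div b)) * (complex_of_real (sqrt (norm_sq b ?\<beta>)) * nb ?\<beta> (y mod b)))"
        unfolding s by (simp add: mult_ac)
      also have "\<dots> = prodvec b ?\<alpha> ?\<beta> x * cnj (prodvec b ?\<alpha> ?\<beta> y)"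
        by (simp only: prodvec_def na(2)[OF dm(1), symmetric] na(2)[OF dm(3), symmetric] nb(2)[OF dm(2), symmetric] nb(2)[OF dm(4), symmetric])
      finally show ?thesis .
    qed
    thus "\<sigma> $$ (x, y) = sum_mats (a * b) (\<lambda>i. complex_of_real (p i) \<cdot>\<^sub>m kron (R i) (T i)) [0..<length ls] $$ (x, y)"
      using xy by (simp add: \<sigma> sep_sum_index sum_mats_def sum_list_sum_nth atLeast0LessThan case_prod_unfold
            interv_sum_list_conv_sum_set_nat)
  qed (simp_all add: \<sigma> sum_mats_def sep_sum_def)
  thus "\<sigma> \<in> sep_states a b" unfolding sep_states_def
    using d sp by (intro CollectI exI[of _ "length ls"] exI[of _ p] exI[of _ R] exI[of _ T]) (auto simp: p_def)
qed

lemma sep_states_carrier: "\<sigma> \<in> sep_states a b \<Longrightarrow> \<sigma> \<in> carrier_mat (a * b) (a * b)"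
  by (simp add: sep_states_iff sep_op_carrier)

lemma sep_states_psd: "\<sigma> \<in> sep_states a b \<Longrightarrow> psd (a * b) \<sigma>"
  by (simp add: sep_states_iff sep_op_psd)

lemma sep_states_nonempty:
  assumes "a > 0" "b > 0" shows "sep_states a b \<noteq> {}"
proof -
  obtain \<alpha> where \<alpha>: "norm_sq a \<alpha> = 1" using normalize_vec[OF assms(1)] by metis
  obtain \<beta> where \<beta>: "norm_sq b \<beta> = 1" using normalize_vec[OF assms(2)] by metis
  have "sep_sum a b [(\<alpha>, \<beta>)] \<in> sep_states a b"
    unfolding sep_states_iff mat_trace_sep_sum by (auto simp: sep_op_def \<alpha> \<beta>)
  thus ?thesis by blast
qed

text \<open>An operator of positive trace is divided by it. Trace zero forces \<open>X = 0\<close>,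
  which has to be written as zero times some separable state; positive dimensions guarantee that one
  exists.\<close>

theorem cone_sep_states:
  assumes "a > 0" "b > 0"
  shows "X \<in> cone_of (sep_states a b) \<longleftrightarrow> sep_op a b X"
proof
  assume "X \<in> cone_of (sep_states a b)"
  then obtain c \<sigma> where c: "0 \<le> c" "\<sigma> \<in> sep_states a b" "X = complex_of_real c \<cdot>\<^sub>m \<sigma>"
    by (auto simp: cone_of_def)
  show "sep_op a b X"
    using c sep_states_carrier[OF c(2)]
    by (intro sep_op_scale[of a b \<sigma> c X]) (auto simp: sep_states_iff)
next
  assume X: "sep_op a b X"
  then obtain ls where ls: "X = sep_sum a b ls" by (auto simp: sep_op_def)
  note Xc = sep_op_carrier[OF X]
  define c where "c = (\<Sum>(\<alpha>, \<beta>)\<leftarrow>ls. norm_sq a \<alpha> * norm_sq b \<beta>)"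
  have tr: "mat_trace X = of_real c" by (simp add: ls mat_trace_sep_sum c_def)
  have c0: "c \<ge> 0" unfolding c_def by (intro sum_list_nonneg) auto
  show "X \<in> cone_of (sep_states a b)"
  proof (cases "c = 0")
    case True
    obtain \<sigma> where \<sigma>: "\<sigma> \<in> sep_states a b" using sep_states_nonempty[OF assms] by blast
    have "\<forall>t\<in>set (map (\<lambda>(\<alpha>, \<beta>). norm_sq a \<alpha> * norm_sq b \<beta>) ls). t = 0"
      using True unfolding c_def
      by (subst (asm) sum_list_nonneg_eq_0_iff) auto
    hence "\<forall>l\<in>set ls. norm_sq a (fst l) * norm_sq b (snd l) = 0" by (simp add: case_prod_unfold)
    hence z: "prodvec b (fst l) (snd l) x = 0" if "l \<in> set ls" "x < a * b" for l x
      using that div_mod_less[OF that(2)] by (auto simp: prodvec_def norm_sq_eq_0_iff)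
    have "X = complex_of_real 0 \<cdot>\<^sub>m \<sigma>"
    proof (rule eq_matI)
      fix x y assume "x < dim_row (complex_of_real 0 \<cdot>\<^sub>m \<sigma>)" "y < dim_col (complex_of_real 0 \<cdot>\<^sub>m \<sigma>)"
      hence xy: "x < a * b" "y < a * b" using sep_states_carrier[OF \<sigma>] by auto
      have "X $$ (x, y) = (\<Sum>l\<leftarrow>ls. 0)"
        unfolding ls sep_sum_index[OF xy] using z xy by (intro arg_cong[of _ _ sum_list] map_cong) (auto simp: case_prod_unfold)
      thus "X $$ (x, y) = (complex_of_real 0 \<cdot>\<^sub>m \<sigma>) $$ (x, y)"
        using xy sep_states_carrier[OF \<sigma>] by simp
    qed (use Xc sep_states_carrier[OF \<sigma>] in auto)
    note X0 = this
    show ?thesis unfolding cone_of_def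
    proof (intro CollectI exI conjI)
      show "X = complex_of_real 0 \<cdot>\<^sub>m \<sigma>" by (rule X0)
    qed (use \<sigma> in simp_all)
  next
    case False
    define \<sigma> where "\<sigma> = complex_of_real (1 / c) \<cdot>\<^sub>m X"
    have "sep_op a b \<sigma>" by (rule sep_op_scale[of a b X "1 / c"]) (use X Xc c0 in \<open>auto simp: \<sigma>_def\<close>)
    moreover have "mat_trace \<sigma> = complex_of_real (1 / c) * mat_trace X"
      using Xc by (simp add: \<sigma>_def mat_trace_def sum_distrib_left)
    hence "mat_trace \<sigma> = 1" using False by (simp add: tr)
    ultimately have s: "\<sigma> \<in> sep_states a b" by (simp add: sep_states_iff)
    have "X = complex_of_real c \<cdot>\<^sub>m \<sigma>" using False Xc by (intro eq_matI) (auto simp: \<sigma>_def)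
    note X1 = this
    show ?thesis unfolding cone_of_def
    proof (intro CollectI exI conjI)
      show "X = complex_of_real c \<cdot>\<^sub>m \<sigma>" by (rule X1)
    qed (use s c0 in simp_all)
  qed
qed

text \<open>The bound is linear in each product term, and the squared norms add up to the
  trace.\<close>

lemma trace_sep_le:
  assumes \<sigma>: "\<sigma> \<in> sep_states a b" and X: "X \<in> carrier_mat (a * b) (a * b)"
    and le: "\<And>\<alpha> \<beta>. qf a b X \<alpha> \<beta> \<le> c * (norm_sq a \<alpha> * norm_sq b \<beta>)"
  shows "Re (mat_trace (\<sigma> * X)) \<le> c"
proof -
  from \<sigma> obtain ls where ls: "\<sigma> = sep_sum a b ls" by (auto simp: sep_states_iff sep_op_def)
  have "Re (mat_trace (\<sigma> * X)) = (\<Sum>(\<alpha>, \<beta>)\<leftarrow>ls. qf a b X \<alpha> \<beta>)"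
    unfolding ls mat_trace_sep_sum_mult[OF X] by (induction ls) (auto simp: qf_def)
  also have "\<dots> \<le> (\<Sum>(\<alpha>, \<beta>)\<leftarrow>ls. c * (norm_sq a \<alpha> * norm_sq b \<beta>))"
    by (intro sum_list_mono) (auto simp: le)
  also have "\<dots> = c * Re (mat_trace \<sigma>)"
    by (simp add: ls mat_trace_sep_sum case_prod_unfold sum_list_const_mult)
  finally show ?thesis using \<sigma> by (simp add: sep_states_iff)
qed

text \<open>Conjugation by a local operator \<open>u \<otimes> v\<close> maps product vectors to
  product vectors. The hypothesis is entrywise, so \<open>u\<close> and \<open>v\<close> need no
  matrix format.\<close>

lemma sep_op_conj:
  assumes "sep_op a b X" and Y: "Y \<in> carrier_mat (a * b) (a * b)"
    and e: "\<And>x y. x < a * b \<Longrightarrow> y < a * b \<Longrightarrow> Y $$ (x, y) =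
      (\<Sum>x'<a * b. \<Sum>y'<a * b. (u (x div b) (x' div b) * v (x mod b) (x' mod b)) * X $$ (x', y') *
         cnj (u (y div b) (y' div b) * v (y mod b) (y' mod b)))"
  shows "sep_op a b Y"
proof -
  from assms(1) obtain ls where ls: "X = sep_sum a b ls" by (auto simp: sep_op_def)
  define \<Phi> where "\<Phi> = (\<lambda>(\<alpha>, \<beta>). (\<lambda>p. \<Sum>p'<a. u p p' * \<alpha> p', \<lambda>q. \<Sum>q'<b. v q q' * \<beta> q' :: complex))"
  have pv: "(\<Sum>x'<a * b. u (x div b) (x' div b) * v (x mod b) (x' mod b) * prodvec b \<alpha> \<beta> x') =
      prodvec b (fst (\<Phi> (\<alpha>, \<beta>))) (snd (\<Phi> (\<alpha>, \<beta>))) x" for \<alpha> \<beta> x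
    using sum_div_mod[of "\<lambda>p' q'. (u (x div b) p' * \<alpha> p') * (v (x mod b) q' * \<beta> q')" b a]
    by (simp add: prodvec_def \<Phi>_def sum_product mult_ac)
  have "Y = sep_sum a b (map \<Phi> ls)"
  proof (rule eq_matI)
    fix x y assume "x < dim_row (sep_sum a b (map \<Phi> ls))" "y < dim_col (sep_sum a b (map \<Phi> ls))"
    hence xy: "x < a * b" "y < a * b" by (simp_all add: sep_sum_def)
    have "Y $$ (x, y) = (\<Sum>x'<a * b. \<Sum>y'<a * b. \<Sum>(\<alpha>, \<beta>)\<leftarrow>ls.
        (u (x div b) (x' div b) * v (x mod b) (x' mod b) * prodvec b \<alpha> \<beta> x') *
        cnj (u (y div b) (y' div b) * v (y mod b) (y' mod b) * prodvec b \<alpha> \<beta> y'))"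
      unfolding e[OF xy] ls
      by (intro sum.cong refl) (simp add: sep_sum_index case_prod_unfold mult_ac flip: sum_list_const_mult)
    also have "\<dots> = (\<Sum>(\<alpha>, \<beta>)\<leftarrow>ls. \<Sum>x'<a * b. \<Sum>y'<a * b.
        (u (x div b) (x' div b) * v (x mod b) (x' mod b) * prodvec b \<alpha> \<beta> x') *
        cnj (u (y div b) (y' div b) * v (y mod b) (y' mod b) * prodvec b \<alpha> \<beta> y'))"
      by (induction ls) (auto simp: sum.distrib)
    also have "\<dots> = (\<Sum>(\<alpha>, \<beta>)\<leftarrow>ls. (\<Sum>x'<a * b. u (x div b) (x' div b) * v (x mod b) (x' mod b) * prodvec b \<alpha> \<beta> x') *
        cnj (\<Sum>y'<a * b. u (y div b) (y' div b) * v (y mod b) (y' mod b) * prodvec b \<alpha> \<beta> y'))"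
      by (simp add: sum_product)
    also have "\<dots> = sep_sum a b (map \<Phi> ls) $$ (x, y)"
      unfolding pv by (simp add: sep_sum_index[OF xy] o_def case_prod_unfold)
    finally show "Y $$ (x, y) = sep_sum a b (map \<Phi> ls) $$ (x, y)" .
  qed (use Y in \<open>auto simp: sep_sum_def\<close>)
  thus ?thesis unfolding sep_op_def by blast
qed

section \<open>Tensor powers across the bipartition\<close>

text \<open>Digits are counted from the least significant one, so digit \<open>0\<close> belongs to
  the last factor of \<open>kron_pow\<close>. In terms of digits, the regrouping of
  \<open>A B A B ...\<close> into \<open>A ... A B ... B\<close> disappears.\<close>

definition dig :: "nat \<Rightarrow> nat \<Rightarrow> nat \<Rightarrow> nat" where
  "dig d k a = a div d ^ k mod d"

lemma dig_less: "d > 0 \<Longrightarrow> dig d k a < d" by (simp add: dig_def)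

lemma dig_mod_power:
  assumes "k < n" shows "dig d k (a mod d ^ n) = dig d k a"
proof -
  define m where "m = d ^ (n - k)"
  have n: "d ^ n = d ^ k * m" using assms by (simp add: m_def flip: power_add)
  have dm: "d dvd m" using assms by (simp add: m_def dvd_power)
  show ?thesis
  proof (cases "d = 0")
    case False
    have "a mod d ^ n div d ^ k = a div d ^ k mod m"
      unfolding n mod_mult2_eq using False by simp
    thus ?thesis unfolding dig_def using mod_mod_cancel[OF dm] by simp
  qed (use assms in \<open>cases n; simp add: dig_def\<close>)
qed

lemma dig_div_power: "dig d k (a div d ^ m) = dig d (m + k) a"
  by (simp add: dig_def power_add div_mult2_eq)

lemma dig_top: "a < d * d ^ n \<Longrightarrow> dig d n a = a div d ^ n"
  by (simp add: dig_def less_mult_imp_div_less)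

text \<open>Distributivity over words: an index below \<open>d ^ n\<close> is the same as a choice
  of \<open>n\<close> digits, so sums of products over the copies factorize.\<close>

lemma sum_prod_dig:
  fixes g :: "nat \<Rightarrow> nat \<Rightarrow> 'a::comm_semiring_1"
  shows "(\<Sum>p<d ^ n. \<Prod>k<n. g k (dig d k p)) = (\<Prod>k<n. \<Sum>i<d. g k i)"
proof (induction n)
  case (Suc n)
  have "(\<Sum>p<d ^ Suc n. \<Prod>k<Suc n. g k (dig d k p))
      = (\<Sum>p<d * d ^ n. (\<Prod>k<n. g k (dig d k (p mod d ^ n))) * g n (p div d ^ n))"
    by (intro sum.cong) (auto simp: dig_mod_power dig_top)
  also have "\<dots> = (\<Sum>i<d. \<Sum>r<d ^ n. (\<Prod>k<n. g k (dig d k r)) * g n i)"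
    by (rule sum_div_mod)
  also have "\<dots> = (\<Sum>i<d. (\<Prod>k<n. \<Sum>i<d. g k i) * g n i)"
    by (simp add: Suc.IH flip: sum_distrib_right)
  finally show ?case by (simp add: sum_distrib_left)
qed simp

lemma dig_eqI:
  assumes "p < d ^ n" "q < d ^ n" "\<And>k. k < n \<Longrightarrow> dig d k p = dig d k q"
  shows "p = q"
  using assms
proof (induction n arbitrary: p q)
  case (Suc n)
  hence d0: "d ^ n > 0" by (cases "d = 0") auto
  have "p mod d ^ n = q mod d ^ n"
    by (rule Suc.IH) (use Suc.prems(3) d0 in \<open>auto simp: dig_mod_power\<close>)
  moreover have "p div d ^ n = q div d ^ n"
    using Suc.prems dig_top[of p d n] dig_top[of q d n] by (metis lessI power_Suc)
  ultimately show ?case by (metis div_mult_mod_eq)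
qed simp

lemma prod_lessThan_add:
  fixes f :: "nat \<Rightarrow> 'a::comm_monoid_mult"
  shows "(\<Prod>k<m + n. f k) = (\<Prod>k<m. f k) * (\<Prod>k<n. f (m + k))"
  by (induction n) (auto simp: mult_ac)

text \<open>The kernel \<open>M k\<close> of copy \<open>k\<close> takes the row digits on
  \<open>A\<close> and \<open>B\<close>, then the column digits. Different kernels per copy are
  allowed, as required for \<open>type_proj\<close>.\<close>

definition tens :: "nat \<Rightarrow> nat \<Rightarrow> (nat \<Rightarrow> nat \<Rightarrow> nat \<Rightarrow> nat \<Rightarrow> nat \<Rightarrow> complex) \<Rightarrow> complex mat" where
  "tens d n M = mat (d ^ n * d ^ n) (d ^ n * d ^ n) (\<lambda>(x, y). \<Prod>k<n.
     M k (dig d k (x div d ^ n)) (dig d k (x mod d ^ n)) (dig d k (y div d ^ n)) (dig d k (y mod d ^ n)))"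

definition kern :: "nat \<Rightarrow> complex mat \<Rightarrow> nat \<Rightarrow> nat \<Rightarrow> nat \<Rightarrow> nat \<Rightarrow> complex" where
  "kern d R i j k l = R $$ (i * d + j, k * d + l)"

lemma tens_carrier [simp]: "tens d n M \<in> carrier_mat (d ^ n * d ^ n) (d ^ n * d ^ n)"
  by (simp add: tens_def)

lemma tens_index:
  "x < d ^ n * d ^ n \<Longrightarrow> y < d ^ n * d ^ n \<Longrightarrow> tens d n M $$ (x, y) = (\<Prod>k<n.
     M k (dig d k (x div d ^ n)) (dig d k (x mod d ^ n)) (dig d k (y div d ^ n)) (dig d k (y mod d ^ n)))"
  by (simp add: tens_def)

lemma kron_pow_interleave_dig:
  assumes R: "R \<in> carrier_mat (d * d) (d * d)"
    and "a < d ^ n" "b < d ^ n" "a' < d ^ n" "b' < d ^ n"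
  shows "kron_pow R n $$ (interleave d d n a b, interleave d d n a' b') =
    (\<Prod>k<n. kern d R (dig d k a) (dig d k b) (dig d k a') (dig d k b'))"
  using assms(2-)
proof (induction n arbitrary: a b a' b')
  case (Suc n)
  note C = kron_pow_carrier[OF R, of n]
  define x where "x a b = a div d ^ n * d + b div d ^ n" for a b
  define u where "u a b = interleave d d n (a mod d ^ n) (b mod d ^ n)" for a b
  have eq: "interleave d d (Suc n) a b = x a b * (d * d) ^ n + u a b" for a b
    by (simp add: x_def u_def)
  have xl: "x a b < d * d" "u a b < (d * d) ^ n" if "a < d ^ Suc n" "b < d ^ Suc n" for a b
    using that div_mod_power_less[of a d n] div_mod_power_less[of b d n]
    by (auto simp: x_def u_def intro!: pair_index_less interleave_less)
  note X = xl[OF Suc.prems(1,2)] xl[OF Suc.prems(3,4)]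
  have pos: "(d * d) ^ n \<noteq> 0" using X(2) by (metis less_nat_zero_code)
  have "kron_pow R (Suc n) $$ (interleave d d (Suc n) a b, interleave d d (Suc n) a' b')
      = R $$ (x a b, x a' b') * kron_pow R n $$ (u a b, u a' b')"
    unfolding eq kron_pow.simps
    by (subst kron_index[OF R C])
      (use X pos pair_index_less[OF X(1,2)] pair_index_less[OF X(3,4)] in
        \<open>simp_all add: div_mult_self3[OF pos] div_less[OF X(2)] div_less[OF X(4)] del: power_mult_distrib mult_eq_0_iff power_eq_0_iff\<close>)
  also have "R $$ (x a b, x a' b') = kern d R (dig d n a) (dig d n b) (dig d n a') (dig d n b')"
    using Suc.prems by (simp add: kern_def x_def dig_top)
  also have "kron_pow R n $$ (u a b, u a' b') =
      (\<Prod>k<n. kern d R (dig d k (a mod d ^ n)) (dig d k (b mod d ^ n)) (dig d k (a' mod d ^ n)) (dig d k (b' mod d ^ n)))"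
    unfolding u_def by (rule Suc.IH) (use Suc.prems div_mod_power_less[of _ d n] in auto)
  also have "\<dots> = (\<Prod>k<n. kern d R (dig d k a) (dig d k b) (dig d k a') (dig d k b'))"
    by (intro prod.cong refl) (simp add: dig_mod_power)
  finally show ?case by (simp add: mult.commute)
qed simp

lemma bip_pow_tens:
  assumes R: "R \<in> carrier_mat (d * d) (d * d)"
  shows "bip_pow d d R n = tens d n (\<lambda>_. kern d R)"
proof (rule eq_matI)
  fix x y assume "x < dim_row (tens d n (\<lambda>_. kern d R))" "y < dim_col (tens d n (\<lambda>_. kern d R))"
  hence xy: "x < d ^ n * d ^ n" "y < d ^ n * d ^ n" by (simp_all add: tens_def)
  show "bip_pow d d R n $$ (x, y) = tens d n (\<lambda>_. kern d R) $$ (x, y)"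
    unfolding tens_index[OF xy] using xy div_mod_less[OF xy(1)] div_mod_less[OF xy(2)]
    by (simp add: bip_pow_def regroup_def kron_pow_interleave_dig[OF R])
qed (simp_all add: tens_def bip_pow_def regroup_def)

lemma sum_prod_dig2:
  fixes f :: "nat \<Rightarrow> nat \<Rightarrow> nat \<Rightarrow> 'a::comm_semiring_1"
  shows "(\<Sum>p<d ^ n. \<Sum>q<d ^ n. \<Prod>k<n. f k (dig d k p) (dig d k q)) = (\<Prod>k<n. \<Sum>i<d. \<Sum>j<d. f k i j)"
proof -
  have "(\<Sum>q<d ^ n. \<Prod>k<n. f k (dig d k p) (dig d k q)) = (\<Prod>k<n. \<Sum>j<d. f k (dig d k p) j)" for p
    by (rule sum_prod_dig)
  thus ?thesis by (simp add: sum_prod_dig[where g = "\<lambda>k i. \<Sum>j<d. f k i j"])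
qed

lemma sum_prod_dig_pair:
  fixes f :: "nat \<Rightarrow> nat \<Rightarrow> nat \<Rightarrow> 'a::comm_semiring_1"
  shows "(\<Sum>z<d ^ n * d ^ n. \<Prod>k<n. f k (dig d k (z div d ^ n)) (dig d k (z mod d ^ n))) = (\<Prod>k<n. \<Sum>i<d. \<Sum>j<d. f k i j)"
  using sum_div_mod[of "\<lambda>p q. \<Prod>k<n. f k (dig d k p) (dig d k q)" "d ^ n" "d ^ n"] by (simp add: sum_prod_dig2)

lemma tens_mult:
  "tens d n M * tens d n N = tens d n (\<lambda>k i j i' j'. \<Sum>u<d. \<Sum>v<d. M k i j u v * N k u v i' j')"
proof (rule eq_matI)
  fix x y assume "x < dim_row (tens d n (\<lambda>k i j i' j'. \<Sum>u<d. \<Sum>v<d. M k i j u v * N k u v i' j'))"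
    "y < dim_col (tens d n (\<lambda>k i j i' j'. \<Sum>u<d. \<Sum>v<d. M k i j u v * N k u v i' j'))"
  hence xy: "x < d ^ n * d ^ n" "y < d ^ n * d ^ n" by (simp_all add: tens_def)
  show "(tens d n M * tens d n N) $$ (x, y) = tens d n (\<lambda>k i j i' j'. \<Sum>u<d. \<Sum>v<d. M k i j u v * N k u v i' j') $$ (x, y)"
    unfolding mult_index[OF tens_carrier tens_carrier xy] tens_index[OF xy] sum_prod_dig_pair[symmetric]
    by (intro sum.cong refl) (simp add: tens_index xy prod.distrib)
qed (simp_all add: tens_def)

lemma mat_trace_tens: "mat_trace (tens d n M) = (\<Prod>k<n. \<Sum>i<d. \<Sum>j<d. M k i j i j)"
  unfolding sum_prod_dig_pair[symmetric] mat_trace_def by (auto simp: tens_def intro!: sum.cong)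

lemma tens_eqI:
  assumes "\<And>k i j i' j'. k < n \<Longrightarrow> i < d \<Longrightarrow> j < d \<Longrightarrow> i' < d \<Longrightarrow> j' < d \<Longrightarrow> M k i j i' j' = N k i j i' j'"
  shows "tens d n M = tens d n N"
proof (cases "d = 0 \<and> n > 0")
  case True thus ?thesis by (intro eq_matI) (auto simp: tens_def zero_power)
next
  case False
  thus ?thesis
    by (cases "n = 0") (auto simp: tens_def dig_less intro!: eq_matI prod.cong assms)
qed

text \<open>The product of an operator on \<open>A\<^sub>1 B\<^sub>1\<close> and one on \<open>A\<^sub>2 B\<^sub>2\<close>, as an operator on \<open>A\<^sub>1 A\<^sub>2 : B\<^sub>1 B\<^sub>2\<close>; \<open>hi\<close> and \<open>lo\<close>
  below extract the indices of the two factors.\<close>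

definition box :: "nat \<Rightarrow> nat \<Rightarrow> nat \<Rightarrow> nat \<Rightarrow> complex mat \<Rightarrow> complex mat \<Rightarrow> complex mat" where
  "box a1 b1 a2 b2 X Y = mat (a1 * a2 * (b1 * b2)) (a1 * a2 * (b1 * b2)) (\<lambda>(x, y).
     X $$ (x div (b1 * b2) div a2 * b1 + x mod (b1 * b2) div b2, y div (b1 * b2) div a2 * b1 + y mod (b1 * b2) div b2) *
     Y $$ (x div (b1 * b2) mod a2 * b2 + x mod (b1 * b2) mod b2, y div (b1 * b2) mod a2 * b2 + y mod (b1 * b2) mod b2))"

context
  fixes a1 b1 a2 b2 :: nat
begin

definition hi :: "nat \<Rightarrow> nat" where "hi x = x div (b1 * b2) div a2 * b1 + x mod (b1 * b2) div b2"
definition lo :: "nat \<Rightarrow> nat" where "lo x = x div (b1 * b2) mod a2 * b2 + x mod (b1 * b2) mod b2"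

lemma box_carrier [simp]: "box a1 b1 a2 b2 X Y \<in> carrier_mat (a1 * a2 * (b1 * b2)) (a1 * a2 * (b1 * b2))"
  by (simp add: box_def)

lemma box_index:
  "x < a1 * a2 * (b1 * b2) \<Longrightarrow> y < a1 * a2 * (b1 * b2) \<Longrightarrow>
    box a1 b1 a2 b2 X Y $$ (x, y) = X $$ (hi x, hi y) * Y $$ (lo x, lo y)"
  by (simp add: box_def hi_def lo_def)

lemma hi_lo:
  assumes "x < a1 * a2 * (b1 * b2)"
  shows "hi x < a1 * b1" "lo x < a2 * b2"
    "hi x div b1 = x div (b1 * b2) div a2" "hi x mod b1 = x mod (b1 * b2) div b2"
    "lo x div b2 = x div (b1 * b2) mod a2" "lo x mod b2 = x mod (b1 * b2) mod b2"
proof -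
  note p = div_mod_less[OF assms]
  note p1 = div_mod_less[OF p(1)] and p2 = div_mod_less[OF p(2)]
  show "hi x < a1 * b1" "lo x < a2 * b2"
    unfolding hi_def lo_def using p1 p2 by (auto intro!: pair_index_less)
  have b: "b1 > 0" "b2 > 0" using p2 by auto
  show "hi x div b1 = x div (b1 * b2) div a2" "hi x mod b1 = x mod (b1 * b2) div b2"
    "lo x div b2 = x div (b1 * b2) mod a2" "lo x mod b2 = x mod (b1 * b2) mod b2"
    unfolding hi_def lo_def using p2 b by simp_all
qed

text \<open>The map from \<open>x\<close> to \<open>(hi x, lo x)\<close> is a bijection: it
  exchanges the two middle indices of a quadruple, which here is one interchange of sums.\<close>

lemma sum_hi_lo:
  fixes f :: "nat \<Rightarrow> nat \<Rightarrow> 'a::comm_monoid_add"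
  shows "(\<Sum>x<a1 * a2 * (b1 * b2). f (hi x) (lo x)) = (\<Sum>h<a1 * b1. \<Sum>l<a2 * b2. f h l)"
proof -
  have "(\<Sum>x<a1 * a2 * (b1 * b2). f (hi x) (lo x)) =
      (\<Sum>p<a1 * a2. \<Sum>q<b1 * b2. f (p div a2 * b1 + q div b2) (p mod a2 * b2 + q mod b2))"
    unfolding hi_def lo_def by (rule sum_div_mod)
  also have "\<dots> = (\<Sum>p<a1 * a2. \<Sum>q1<b1. \<Sum>q2<b2. f (p div a2 * b1 + q1) (p mod a2 * b2 + q2))"
    by (rule sum.cong[OF refl], rule sum_div_mod)
  also have "\<dots> = (\<Sum>p1<a1. \<Sum>p2<a2. \<Sum>q1<b1. \<Sum>q2<b2. f (p1 * b1 + q1) (p2 * b2 + q2))"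
    by (rule sum_div_mod)
  also have "\<dots> = (\<Sum>p1<a1. \<Sum>q1<b1. \<Sum>p2<a2. \<Sum>q2<b2. f (p1 * b1 + q1) (p2 * b2 + q2))"
    by (rule sum.cong[OF refl], rule sum.swap)
  also have "\<dots> = (\<Sum>h<a1 * b1. \<Sum>l<a2 * b2. f h l)"
    unfolding sum_pair_nat[of "\<lambda>l. f (_ * b1 + _) l"] by (rule sum_pair_nat)
  finally show ?thesis .
qed

lemma mat_trace_box_mult:
  assumes "X \<in> carrier_mat (a1 * b1) (a1 * b1)" "X' \<in> carrier_mat (a1 * b1) (a1 * b1)"
    "Y \<in> carrier_mat (a2 * b2) (a2 * b2)" "Y' \<in> carrier_mat (a2 * b2) (a2 * b2)"
  shows "mat_trace (box a1 b1 a2 b2 X Y * box a1 b1 a2 b2 X' Y') = mat_trace (X * X') * mat_trace (Y * Y')"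
proof -
  have "mat_trace (box a1 b1 a2 b2 X Y * box a1 b1 a2 b2 X' Y') =
     (\<Sum>x<a1 * a2 * (b1 * b2). \<Sum>y<a1 * a2 * (b1 * b2).
       X $$ (hi x, hi y) * X' $$ (hi y, hi x) * (Y $$ (lo x, lo y) * Y' $$ (lo y, lo x)))"
    unfolding mat_trace_mult[OF box_carrier box_carrier]
    by (intro sum.cong refl) (simp add: box_index mult_ac)
  also have "\<dots> = (\<Sum>x<a1 * a2 * (b1 * b2). \<Sum>h<a1 * b1. \<Sum>l<a2 * b2.
       X $$ (hi x, h) * X' $$ (h, hi x) * (Y $$ (lo x, l) * Y' $$ (l, lo x)))"
    by (rule sum.cong[OF refl], rule sum_hi_lo)
  also have "\<dots> = (\<Sum>h'<a1 * b1. \<Sum>l'<a2 * b2. \<Sum>h<a1 * b1. \<Sum>l<a2 * b2.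
       X $$ (h', h) * X' $$ (h, h') * (Y $$ (l', l) * Y' $$ (l, l')))"
    by (rule sum_hi_lo)
  also have "\<dots> = (\<Sum>h'<a1 * b1. \<Sum>h<a1 * b1. X $$ (h', h) * X' $$ (h, h')) *
      (\<Sum>l'<a2 * b2. \<Sum>l<a2 * b2. Y $$ (l', l) * Y' $$ (l, l'))"
    by (simp add: sum_product)
  finally show ?thesis by (simp add: mat_trace_mult[OF assms(1,2)] mat_trace_mult[OF assms(3,4)])
qed

lemma box_one: "box a1 b1 a2 b2 (1\<^sub>m (a1 * b1)) (1\<^sub>m (a2 * b2)) = 1\<^sub>m (a1 * a2 * (b1 * b2))"
proof (rule eq_matI)
  fix x y assume "x < dim_row (1\<^sub>m (a1 * a2 * (b1 * b2)))" "y < dim_col (1\<^sub>m (a1 * a2 * (b1 * b2)))"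
  hence xy: "x < a1 * a2 * (b1 * b2)" "y < a1 * a2 * (b1 * b2)" by auto
  have "x = y" if "hi x = hi y" "lo x = lo y"
    using that hi_lo[OF xy(1)] hi_lo[OF xy(2)] by (metis div_mult_mod_eq)
  thus "box a1 b1 a2 b2 (1\<^sub>m (a1 * b1)) (1\<^sub>m (a2 * b2)) $$ (x, y) = 1\<^sub>m (a1 * a2 * (b1 * b2)) $$ (x, y)"
    using xy hi_lo(1,2)[OF xy(1)] hi_lo(1,2)[OF xy(2)] by (auto simp: box_index)
qed (simp_all add: box_def)

text \<open>A product vector of the first system times one of the second is again a product vector
  across the joint cut, with components grouped by party.\<close>

lemma sep_op_box:
  assumes "sep_op a1 b1 X" "sep_op a2 b2 Y"
  shows "sep_op (a1 * a2) (b1 * b2) (box a1 b1 a2 b2 X Y)"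
proof -
  from assms obtain ls ls' where X: "X = sep_sum a1 b1 ls" and Y: "Y = sep_sum a2 b2 ls'"
    by (auto simp: sep_op_def)
  define M where "M = (\<lambda>((\<alpha>, \<beta>), (\<gamma>, \<delta>)). mat (a1 * a2 * (b1 * b2)) (a1 * a2 * (b1 * b2)) (\<lambda>(x, y).
     prodvec (b1 * b2) (\<lambda>p. \<alpha> (p div a2) * \<gamma> (p mod a2)) (\<lambda>q. \<beta> (q div b2) * \<delta> (q mod b2)) x *
     cnj (prodvec (b1 * b2) (\<lambda>p. \<alpha> (p div a2) * \<gamma> (p mod a2)) (\<lambda>q. \<beta> (q div b2) * \<delta> (q mod b2)) y)))"
  show ?thesis
  proof (rule sep_op_sum_list[where X = M and js = "List.product ls ls'"])
    fix l :: "((nat \<Rightarrow> complex) \<times> (nat \<Rightarrow> complex)) \<times> ((nat \<Rightarrow> complex) \<times> (nat \<Rightarrow> complex))"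
    obtain \<alpha> \<beta> \<gamma> \<delta> where l: "l = ((\<alpha>, \<beta>), (\<gamma>, \<delta>))" by (metis surj_pair)
    show "sep_op (a1 * a2) (b1 * b2) (M l)" unfolding l M_def prod.case by (rule sep_op_rank1)
  next
    fix x y assume xy: "x < a1 * a2 * (b1 * b2)" "y < a1 * a2 * (b1 * b2)"
    have pr: "prodvec b1 \<alpha> \<beta> (hi z) * prodvec b2 \<gamma> \<delta> (lo z) =
        prodvec (b1 * b2) (\<lambda>p. \<alpha> (p div a2) * \<gamma> (p mod a2)) (\<lambda>q. \<beta> (q div b2) * \<delta> (q mod b2)) z"
      if "z < a1 * a2 * (b1 * b2)" for \<alpha> \<beta> \<gamma> \<delta> z
      using hi_lo[OF that] by (simp add: prodvec_def)
    have "box a1 b1 a2 b2 X Y $$ (x, y) =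
      (\<Sum>l\<leftarrow>ls. \<Sum>l'\<leftarrow>ls'. (prodvec b1 (fst l) (snd l) (hi x) * cnj (prodvec b1 (fst l) (snd l) (hi y))) *
         (prodvec b2 (fst l') (snd l') (lo x) * cnj (prodvec b2 (fst l') (snd l') (lo y))))"
      using xy hi_lo(1,2)[OF xy(1)] hi_lo(1,2)[OF xy(2)]
      by (simp add: box_index X Y sep_sum_index case_prod_unfold sum_list_const_mult sum_list_mult_const)
    also have "\<dots> = (\<Sum>l\<leftarrow>ls. \<Sum>l'\<leftarrow>ls'. M (l, l') $$ (x, y))"
      using xy by (simp add: M_def case_prod_unfold pr[symmetric] mult_ac)
    also have "\<dots> = (\<Sum>l\<leftarrow>List.product ls ls'. M l $$ (x, y))"
      by (induction ls) (simp_all add: o_def)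
    finally show "box a1 b1 a2 b2 X Y $$ (x, y) = (\<Sum>l\<leftarrow>List.product ls ls'. M l $$ (x, y))" .
  qed simp
qed

text \<open>The partial inner product of \<open>\<alpha>\<close> with \<open>\<gamma>\<close> on the
  first tensor factor; \<open>s\<close> is the index that remains.\<close>

definition ctr :: "nat \<Rightarrow> nat \<Rightarrow> (nat \<Rightarrow> complex) \<Rightarrow> (nat \<Rightarrow> complex) \<Rightarrow> nat \<Rightarrow> complex" where
  "ctr m n \<gamma> \<alpha> s = (\<Sum>p<m. cnj (\<gamma> p) * \<alpha> (p * n + s))"

lemma quad_box_sep:
  assumes Y: "Y \<in> carrier_mat (a2 * b2) (a2 * b2)"
  shows "quad (a1 * a2 * (b1 * b2)) (box a1 b1 a2 b2 (sep_sum a1 b1 ls) Y) (prodvec (b1 * b2) \<alpha> \<beta>) =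
    (\<Sum>(\<gamma>, \<delta>)\<leftarrow>ls. quad (a2 * b2) Y (prodvec b2 (ctr a1 a2 \<gamma> \<alpha>) (ctr b1 b2 \<delta> \<beta>)))"
proof -
  define Z where "Z h l = \<alpha> (h div b1 * a2 + l div b2) * \<beta> (h mod b1 * b2 + l mod b2)" for h l
  have Z: "prodvec (b1 * b2) \<alpha> \<beta> x = Z (hi x) (lo x)" if "x < a1 * a2 * (b1 * b2)" for x
    unfolding prodvec_def Z_def hi_lo(3-)[OF that] by simp
  have c: "(\<Sum>h<a1 * b1. cnj (prodvec b1 \<gamma> \<delta> h) * Z h l) = prodvec b2 (ctr a1 a2 \<gamma> \<alpha>) (ctr b1 b2 \<delta> \<beta>) l" for \<gamma> \<delta> l
    using sum_div_mod[of "\<lambda>p q. (cnj (\<gamma> p) * \<alpha> (p * a2 + l div b2)) * (cnj (\<delta> q) * \<beta> (q * b2 + l mod b2))" b1 a1]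
    by (simp add: prodvec_def Z_def ctr_def sum_product, simp add: mult_ac)
  define F where "F l h k h' k' = (cnj (Z h k) * prodvec b1 (fst l) (snd l) h) * Y $$ (k, k') *
      (cnj (prodvec b1 (fst l) (snd l) h') * Z h' k')" for l h k h' k'
  have "quad (a1 * a2 * (b1 * b2)) (box a1 b1 a2 b2 (sep_sum a1 b1 ls) Y) (prodvec (b1 * b2) \<alpha> \<beta>) =
     (\<Sum>x<a1 * a2 * (b1 * b2). \<Sum>y<a1 * a2 * (b1 * b2). \<Sum>l\<leftarrow>ls. F l (hi x) (lo x) (hi y) (lo y))"
    unfolding quad_def
    by (intro sum.cong refl)
      (simp add: box_index Z hi_lo(1,2) sep_sum_index F_def case_prod_unfold mult_ac flip: sum_list_const_mult)
  also have "\<dots> = (\<Sum>l\<leftarrow>ls. \<Sum>x<a1 * a2 * (b1 * b2). \<Sum>y<a1 * a2 * (b1 * b2). F l (hi x) (lo x) (hi y) (lo y))"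
    by (induction ls) (auto simp: sum.distrib)
  also have "\<dots> = (\<Sum>(\<gamma>, \<delta>)\<leftarrow>ls. quad (a2 * b2) Y (prodvec b2 (ctr a1 a2 \<gamma> \<alpha>) (ctr b1 b2 \<delta> \<beta>)))"
  proof (intro arg_cong[of _ _ sum_list] map_cong refl)
    fix l :: "(nat \<Rightarrow> complex) \<times> (nat \<Rightarrow> complex)"
    obtain \<gamma> \<delta> where l: "l = (\<gamma>, \<delta>)" by (cases l)
    have "(\<Sum>x<a1 * a2 * (b1 * b2). \<Sum>y<a1 * a2 * (b1 * b2). F l (hi x) (lo x) (hi y) (lo y)) =
        (\<Sum>x<a1 * a2 * (b1 * b2). \<Sum>h'<a1 * b1. \<Sum>k'<a2 * b2. F l (hi x) (lo x) h' k')"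
      by (rule sum.cong[OF refl], rule sum_hi_lo)
    also have "\<dots> = (\<Sum>h<a1 * b1. \<Sum>k<a2 * b2. \<Sum>h'<a1 * b1. \<Sum>k'<a2 * b2. F l h k h' k')"
      by (rule sum_hi_lo)
    also have "\<dots> = (\<Sum>k<a2 * b2. \<Sum>h<a1 * b1. \<Sum>h'<a1 * b1. \<Sum>k'<a2 * b2. F l h k h' k')"
      by (rule sum.swap)
    also have "\<dots> = (\<Sum>k<a2 * b2. \<Sum>h<a1 * b1. \<Sum>k'<a2 * b2. \<Sum>h'<a1 * b1. F l h k h' k')"
      by (rule sum.cong[OF refl], rule sum.cong[OF refl], rule sum.swap)
    also have "\<dots> = (\<Sum>k<a2 * b2. \<Sum>k'<a2 * b2. \<Sum>h<a1 * b1. \<Sum>h'<a1 * b1. F l h k h' k')"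
      by (rule sum.cong[OF refl], rule sum.swap)
    also have "\<dots> = (\<Sum>k<a2 * b2. \<Sum>k'<a2 * b2. cnj (\<Sum>h<a1 * b1. cnj (prodvec b1 \<gamma> \<delta> h) * Z h k) * Y $$ (k, k') *
        (\<Sum>h<a1 * b1. cnj (prodvec b1 \<gamma> \<delta> h) * Z h k'))"
      by (intro sum.cong refl) (simp add: F_def l sum_distrib_left sum_distrib_right mult_ac)
    finally show "(\<Sum>x<a1 * a2 * (b1 * b2). \<Sum>y<a1 * a2 * (b1 * b2). F l (hi x) (lo x) (hi y) (lo y)) =
        (case l of (\<gamma>, \<delta>) \<Rightarrow> quad (a2 * b2) Y (prodvec b2 (ctr a1 a2 \<gamma> \<alpha>) (ctr b1 b2 \<delta> \<beta>)))"
      by (simp add: c quad_def l)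
  qed
  finally show ?thesis .
qed

lemma quad_sep_sum:
  "quad (a1 * b1) (sep_sum a1 b1 ls) (prodvec b1 \<phi> \<psi>) =
    of_real (\<Sum>(\<gamma>, \<delta>)\<leftarrow>ls. (cmod (\<Sum>p<a1. cnj (\<gamma> p) * \<phi> p))\<^sup>2 * (cmod (\<Sum>q<b1. cnj (\<delta> q) * \<psi> q))\<^sup>2)"
proof -
  define s where "s l = (\<Sum>x<a1 * b1. cnj (prodvec b1 \<phi> \<psi> x) * prodvec b1 (fst l) (snd l) x)" for l
  have s: "s (\<gamma>, \<delta>) = cnj ((\<Sum>p<a1. cnj (\<gamma> p) * \<phi> p) * (\<Sum>q<b1. cnj (\<delta> q) * \<psi> q))" for \<gamma> \<delta>
    using sum_div_mod[of "\<lambda>p q. (cnj (\<phi> p) * \<gamma> p) * (cnj (\<psi> q) * \<delta> q)" b1 a1]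
    by (simp add: s_def prodvec_def sum_product mult_ac)
  have "quad (a1 * b1) (sep_sum a1 b1 ls) (prodvec b1 \<phi> \<psi>) = of_real (\<Sum>k<length ls. (cmod (s (ls ! k)))\<^sup>2)"
    unfolding s_def
    by (rule quad_factor)
      (simp add: sep_sum_index sum_list_sum_nth case_prod_unfold atLeast0LessThan)
  also have "(\<Sum>k<length ls. (cmod (s (ls ! k)))\<^sup>2) = (\<Sum>l\<leftarrow>ls. (cmod (s l))\<^sup>2)"
    by (simp add: sum_list_sum_nth atLeast0LessThan)
  also have "\<dots> = (\<Sum>(\<gamma>, \<delta>)\<leftarrow>ls. (cmod (\<Sum>p<a1. cnj (\<gamma> p) * \<phi> p))\<^sup>2 * (cmod (\<Sum>q<b1. cnj (\<delta> q) * \<psi> q))\<^sup>2)"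
    by (intro arg_cong[of _ _ sum_list] map_cong refl)
      (auto simp: s norm_mult power_mult_distrib simp del: complex_cnj_mult)
  finally show ?thesis .
qed

text \<open>Contracting the second factor against any vector leaves a product vector in the first one, so
  bounds on product vectors are multiplicative.\<close>

lemma qf_box_le:
  assumes G: "sep_op a1 b1 G" and Y: "Y \<in> carrier_mat (a2 * b2) (a2 * b2)" and "0 \<le> c'"
    and leG: "\<And>\<alpha> \<beta>. qf a1 b1 G \<alpha> \<beta> \<le> c * (norm_sq a1 \<alpha> * norm_sq b1 \<beta>)"
    and leY: "\<And>\<alpha> \<beta>. qf a2 b2 Y \<alpha> \<beta> \<le> c' * (norm_sq a2 \<alpha> * norm_sq b2 \<beta>)"
  shows "qf (a1 * a2) (b1 * b2) (box a1 b1 a2 b2 G Y) \<alpha> \<beta> \<le> c * c' * (norm_sq (a1 * a2) \<alpha> * norm_sq (b1 * b2) \<beta>)"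
proof -
  from G obtain ls where ls: "G = sep_sum a1 b1 ls" by (auto simp: sep_op_def)
  \<comment> \<open>Slicing a vector along its second index preserves the total squared
    norm.\<close>
  have pair: "(\<Sum>s<n. norm_sq m (\<lambda>p. \<phi> (p * n + s))) = norm_sq (m * n) \<phi>" for m n \<phi>
    unfolding norm_sq_def by (subst sum.swap, rule sum_pair_nat)
  have "qf (a1 * a2) (b1 * b2) (box a1 b1 a2 b2 G Y) \<alpha> \<beta> =
      (\<Sum>(\<gamma>, \<delta>)\<leftarrow>ls. qf a2 b2 Y (ctr a1 a2 \<gamma> \<alpha>) (ctr b1 b2 \<delta> \<beta>))"
    unfolding qf_def ls quad_box_sep[OF Y] by (induction ls) auto
  also have "\<dots> \<le> (\<Sum>(\<gamma>, \<delta>)\<leftarrow>ls. c' * (norm_sq a2 (ctr a1 a2 \<gamma> \<alpha>) * norm_sq b2 (ctr b1 b2 \<delta> \<beta>)))"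
    by (intro sum_list_mono) (auto simp: leY)
  also have "\<dots> = c' * (\<Sum>(\<gamma>, \<delta>)\<leftarrow>ls. norm_sq a2 (ctr a1 a2 \<gamma> \<alpha>) * norm_sq b2 (ctr b1 b2 \<delta> \<beta>))"
    by (simp add: case_prod_unfold sum_list_const_mult)
  finally have 1: "qf (a1 * a2) (b1 * b2) (box a1 b1 a2 b2 G Y) \<alpha> \<beta> \<le> \<dots>" .
  \<comment> \<open>The norms of the contractions are squared overlaps with slices of \<alpha> and
    \<beta>. Summed over the terms of \<open>G\<close> first, they are values of \<open>G\<close> on
    pairs of slices, where \<open>leG\<close> applies.\<close>
  have "(\<Sum>(\<gamma>, \<delta>)\<leftarrow>ls. norm_sq a2 (ctr a1 a2 \<gamma> \<alpha>) * norm_sq b2 (ctr b1 b2 \<delta> \<beta>)) =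
      (\<Sum>(\<gamma>, \<delta>)\<leftarrow>ls. \<Sum>s<a2. \<Sum>t<b2. (cmod (ctr a1 a2 \<gamma> \<alpha> s))\<^sup>2 * (cmod (ctr b1 b2 \<delta> \<beta> t))\<^sup>2)"
    by (simp add: norm_sq_def sum_product)
  also have "\<dots> = (\<Sum>s<a2. \<Sum>t<b2. \<Sum>(\<gamma>, \<delta>)\<leftarrow>ls. (cmod (ctr a1 a2 \<gamma> \<alpha> s))\<^sup>2 * (cmod (ctr b1 b2 \<delta> \<beta> t))\<^sup>2)"
    by (induction ls) (auto simp: sum.distrib)
  also have "\<dots> = (\<Sum>s<a2. \<Sum>t<b2. qf a1 b1 G (\<lambda>p. \<alpha> (p * a2 + s)) (\<lambda>q. \<beta> (q * b2 + t)))"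
    unfolding qf_def ls quad_sep_sum ctr_def by simp
  also have "\<dots> \<le> (\<Sum>s<a2. \<Sum>t<b2. c * (norm_sq a1 (\<lambda>p. \<alpha> (p * a2 + s)) * norm_sq b1 (\<lambda>q. \<beta> (q * b2 + t))))"
    by (intro sum_mono leG)
  also have "\<dots> = c * ((\<Sum>s<a2. norm_sq a1 (\<lambda>p. \<alpha> (p * a2 + s))) * (\<Sum>t<b2. norm_sq b1 (\<lambda>q. \<beta> (q * b2 + t))))"
    by (subst sum_product) (simp only: sum_distrib_left)
  also have "\<dots> = c * (norm_sq (a1 * a2) \<alpha> * norm_sq (b1 * b2) \<beta>)" by (simp only: pair)
  finally have "c' * (\<Sum>(\<gamma>, \<delta>)\<leftarrow>ls. norm_sq a2 (ctr a1 a2 \<gamma> \<alpha>) * norm_sq b2 (ctr b1 b2 \<delta> \<beta>)) \<le>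
      c' * (c * (norm_sq (a1 * a2) \<alpha> * norm_sq (b1 * b2) \<beta>))"
    by (rule mult_left_mono[OF _ assms(3)])
  with 1 show ?thesis by (simp add: mult_ac)
qed

end

text \<open>The low \<open>n\<close> digits index the second factor and the high \<open>m\<close>
  digits the first, which is why the proof works with \<open>n + m\<close>.\<close>

lemma bip_pow_add:
  assumes R: "R \<in> carrier_mat (d * d) (d * d)"
  shows "bip_pow d d R (m + n) = box (d ^ m) (d ^ m) (d ^ n) (d ^ n) (bip_pow d d R m) (bip_pow d d R n)"
proof (rule eq_matI)
  fix x y assume "x < dim_row (box (d ^ m) (d ^ m) (d ^ n) (d ^ n) (bip_pow d d R m) (bip_pow d d R n))"
    "y < dim_col (box (d ^ m) (d ^ m) (d ^ n) (d ^ n) (bip_pow d d R m) (bip_pow d d R n))"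
  hence xy: "x < d ^ m * d ^ n * (d ^ m * d ^ n)" "y < d ^ m * d ^ n * (d ^ m * d ^ n)" by (simp_all add: box_def)
  hence xy': "x < d ^ (n + m) * d ^ (n + m)" "y < d ^ (n + m) * d ^ (n + m)" by (simp_all add: power_add mult_ac)
  note h = hi_lo[OF xy(1)] hi_lo[OF xy(2)]
  have e: "d ^ (n + m) = d ^ m * d ^ n" by (simp add: power_add mult.commute)
  show "bip_pow d d R (m + n) $$ (x, y) = box (d ^ m) (d ^ m) (d ^ n) (d ^ n) (bip_pow d d R m) (bip_pow d d R n) $$ (x, y)"
    unfolding box_index[OF xy] bip_pow_tens[OF R] tens_index[OF h(1,7)] tens_index[OF h(2,8)]
      add.commute[of m n] tens_index[OF xy'] prod_lessThan_add h e
    by (simp add: dig_mod_power dig_div_power mult.commute)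
qed (simp_all add: box_def bip_pow_def regroup_def power_add)

section \<open>Twirling\<close>

text \<open>Order three is the smallest that works: averaging over phases must kill every net
  exponent between \<open>-2\<close> and \<open>2\<close> other than \<open>0\<close>, and signs
  would let \<open>2\<close> survive.\<close>

definition cube_root :: complex where "cube_root = cis (2 * pi / 3)"

lemma cube_root_facts: "cube_root ^ 3 = 1" "1 + cube_root + cube_root\<^sup>2 = 0" "cnj cube_root = cube_root\<^sup>2"
proof -
  have o3: "cube_root ^ 3 = 1" by (simp add: cube_root_def DeMoivre)
  have "cos (2 * pi / 3) = - (1 / 2)" using cos_120 by (simp add: mult.commute)
  hence "cube_root \<noteq> 1" by (auto simp: cube_root_def complex_eq_iff)
  moreover have "(cube_root - 1) * (1 + cube_root + cube_root\<^sup>2) = cube_root ^ 3 - 1" by (simp add: algebra_simps power2_eq_square power3_eq_cube)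
  ultimately show s: "1 + cube_root + cube_root\<^sup>2 = 0" using o3 by auto
  show "cube_root ^ 3 = 1" by (rule o3)
  have "cnj cube_root * cube_root = 1" by (simp add: cube_root_def cis_cnj cis_mult)
  moreover have "cube_root\<^sup>2 * cube_root = 1" using o3 by (simp add: power3_eq_cube power2_eq_square)
  moreover have "cube_root \<noteq> 0" by (simp add: cube_root_def)
  ultimately show "cnj cube_root = cube_root\<^sup>2" by (metis mult_right_cancel)
qed

text \<open>Matrix entries of the projections onto the span of the \<open>e\<^sub>i \<otimes> e\<^sub>i\<close> (\<open>c = 0\<close>) and onto the symmetric
  (\<open>c = 1\<close>) and antisymmetric (\<open>c = 2\<close>) parts of its orthogonal complement; these span the commutant of the
  operators \<open>U \<otimes> U\<close> with \<open>U\<close> in the monomial group below.\<close>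

definition copy_proj :: "nat \<Rightarrow> nat \<Rightarrow> nat \<Rightarrow> nat \<Rightarrow> nat \<Rightarrow> complex" where
  "copy_proj c i j k l =
    (if c = 0 then (if i = j \<and> k = i \<and> l = i then 1 else 0)
     else if i = j then 0
     else if c = 1 then ((if k = i \<and> l = j then 1 else 0) + (if k = j \<and> l = i then 1 else 0)) / 2
     else ((if k = i \<and> l = j then 1 else 0) - (if k = j \<and> l = i then 1 else 0)) / 2)"

definition copy_rank :: "nat \<Rightarrow> nat \<Rightarrow> real" where
  "copy_rank d c = (if c = 0 then real d else real d * (real d - 1) / 2)"

text \<open>Exponents of the phases together with a permutation of the basis: a finite group of
  monomial unitaries with \<open>3 ^ d * fact d\<close> elements, small enough to average over
  without integration.\<close>

definition dg :: "nat \<Rightarrow> ((nat \<Rightarrow> nat) \<times> (nat \<Rightarrow> nat)) set" where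
  "dg d = PiE {..<d} (\<lambda>_. {..<3}) \<times> {\<pi>. \<pi> permutes {..<d}}"

definition mono_u :: "((nat \<Rightarrow> nat) \<times> (nat \<Rightarrow> nat)) \<Rightarrow> nat \<Rightarrow> nat \<Rightarrow> complex" where
  "mono_u g i i' = (if i' = snd g i then cube_root ^ fst g i else 0)"

lemma finite_dg: "finite (dg d)" by (simp add: dg_def finite_PiE finite_permutations)

lemma card_dg: "card (dg d) = 3 ^ d * fact d"
  by (simp add: dg_def card_cartesian_product card_PiE card_permutations)

text \<open>The sum over exponents factorizes over the basis indices. A factor vanishes unless its
  index occurs equally often among \<open>i, j\<close> and among \<open>k, l\<close>.\<close>

lemma phase_sum:
  assumes "i < d" "j < d" "k < d" "l < d"
  shows "(\<Sum>\<theta>\<in>PiE {..<d} (\<lambda>_. {..<3::nat}). cube_root ^ \<theta> i * cube_root ^ \<theta> j * cnj (cube_root ^ \<theta> k) * cnj (cube_root ^ \<theta> l)) =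
    (if k = i \<and> l = j \<or> k = j \<and> l = i then 3 ^ d else 0)"
proof -
  define g where "g m t = (if m = i then cube_root ^ t else 1) * (if m = j then cube_root ^ t else 1) *
     (if m = k then cnj (cube_root ^ t) else 1) * (if m = l then cnj (cube_root ^ t) else 1)" for m t
  have "cube_root ^ \<theta> i * cube_root ^ \<theta> j * cnj (cube_root ^ \<theta> k) * cnj (cube_root ^ \<theta> l) = (\<Prod>m<d. g m (\<theta> m))" for \<theta>
    using assms by (simp add: g_def prod.distrib)
  hence "(\<Sum>\<theta>\<in>PiE {..<d} (\<lambda>_. {..<3::nat}). cube_root ^ \<theta> i * cube_root ^ \<theta> j * cnj (cube_root ^ \<theta> k) * cnj (cube_root ^ \<theta> l)) =
      (\<Prod>m<d. \<Sum>t<3. g m t)"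
    by (simp add: prod_sum_PiE)
  also have "\<dots> = (if k = i \<and> l = j \<or> k = j \<and> l = i then 3 ^ d else 0)"
  proof (cases "k = i \<and> l = j \<or> k = j \<and> l = i")
    case True
    have gz: "(if m = i then z else 1) * (if m = j then z else 1) * (if m = k then w else 1) * (if m = l then w else 1) = 1"
      if "z * w = 1" for m and z w :: complex
    proof -
      have "z * z * w * w = (z * w) * (z * w)" by (simp only: mult_ac)
      thus ?thesis using True that by auto
    qed
    have n: "cube_root ^ t * cnj (cube_root ^ t) = 1" for t
    proof -
      have "cube_root ^ t * cnj (cube_root ^ t) = (cube_root * cnj cube_root) ^ t" by (simp add: power_mult_distrib)
      also have "cube_root * cnj cube_root = 1" by (simp add: cube_root_def cis_cnj cis_mult)
      finally show ?thesis by simp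
    qed
    have "g m t = 1" for m t
      unfolding g_def by (rule gz[OF n])
    thus ?thesis using True by simp
  next
    case False
    \<comment> \<open>An index that occurs more often among \<open>i, j\<close> than among
      \<open>k, l\<close>. Its net exponent is one or two, so its factor is the sum of all three
      cube roots of unity.\<close>
    define m where "m = (if i = k \<or> i = l then j else i)"
    have s: "1 + cube_root + cube_root\<^sup>2 = 0" "1 + cube_root\<^sup>2 + cube_root = 0" "(cube_root\<^sup>2)\<^sup>2 = cube_root" "cnj (cube_root\<^sup>2) = cube_root" "cnj cube_root = cube_root\<^sup>2"
      "cube_root\<^sup>2 * cube_root = 1" "cube_root * cube_root\<^sup>2 = 1" "cube_root * cube_root = cube_root\<^sup>2" "cube_root\<^sup>2 * cube_root\<^sup>2 = cube_root"
    proof -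
      have o4: "cube_root\<^sup>2 * cube_root\<^sup>2 = cube_root * cube_root ^ 3" by (simp add: eval_nat_numeral)
      show "1 + cube_root + cube_root\<^sup>2 = 0" "cnj cube_root = cube_root\<^sup>2" by (rule cube_root_facts)+
      thus "1 + cube_root\<^sup>2 + cube_root = 0" by (simp add: add_ac)
      show o: "cube_root\<^sup>2 * cube_root\<^sup>2 = cube_root" using o4 cube_root_facts(1) by simp
      thus "(cube_root\<^sup>2)\<^sup>2 = cube_root" by (simp add: power2_eq_square)
      show "cube_root\<^sup>2 * cube_root = 1" "cube_root * cube_root\<^sup>2 = 1" using cube_root_facts(1) by (simp_all add: power2_eq_square power3_eq_cube mult.assoc)
      show "cube_root * cube_root = cube_root\<^sup>2" by (simp add: power2_eq_square)
      show "cnj (cube_root\<^sup>2) = cube_root" using cube_root_facts(3) \<open>(cube_root\<^sup>2)\<^sup>2 = cube_root\<close> by simp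
    qed
    have e3: "(\<Sum>t<3. f t) = f 0 + f 1 + f 2" for f :: "nat \<Rightarrow> complex" by (simp add: eval_nat_numeral)
    have o4: "cube_root ^ 4 = cube_root" using s(9) by (simp add: eval_nat_numeral)
    have p: "cube_root ^ 0 = 1" "cube_root ^ 1 = cube_root" "cnj 1 = 1" by simp_all
    have "(\<Sum>t<3. g m t) = 0"
      unfolding e3 m_def g_def p s(4,5) using False
      by (cases "i = j"; cases "j = k"; cases "j = l"; cases "i = k"; cases "i = l") (simp_all add: s o4)
    moreover have "m < d" using assms by (auto simp: m_def)
    ultimately have "(\<Prod>m<d. \<Sum>t<3. g m t) = 0" by (auto intro: prod_zero)
    thus ?thesis unfolding if_not_P[OF False] .
  qed
  finally show ?thesis .
qed

lemma permutes_pair_ex: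
  assumes "a < d" "b < d" "a' < d" "b' < d" "a \<noteq> b" "a' \<noteq> b'"
  obtains \<tau> where "\<tau> permutes {..<d::nat}" "\<tau> a = a'" "\<tau> b = b'"
proof
  define b1 where "b1 = Transposition.transpose a a' b"
  let ?\<tau> = "Transposition.transpose b1 b' \<circ> Transposition.transpose a a'"
  have b1: "b1 \<in> {..<d}" "b1 \<noteq> a'" using assms by (auto simp: b1_def Transposition.transpose_def)
  show "?\<tau> permutes {..<d}"
    using assms b1 by (intro permutes_compose permutes_swap_id) auto
  show "?\<tau> a = a'" using b1 assms by (simp add: Transposition.transpose_def)
  show "?\<tau> b = b'" by (simp flip: b1_def)
qed

text \<open>Double transitivity: composing with a suitable permutation shows that all
  \<open>d * (d - 1)\<close> pairs of distinct targets are hit equally often, and together they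
  exhaust the permutations.\<close>

lemma sum_perm_pair:
  fixes i j i' j' d :: nat
  assumes "i < d" "j < d" "i' < d" "j' < d" "i \<noteq> j" "i' \<noteq> j'"
  shows "real d * (real d - 1) * (\<Sum>\<pi> | \<pi> permutes {..<d}. if \<pi> i = i' \<and> \<pi> j = j' then 1 else 0) = fact d"
proof -
  define N where "N a b = (\<Sum>\<pi> | \<pi> permutes {..<d}. if \<pi> i = a \<and> \<pi> j = b then 1 else (0::real))" for a b
  have N: "N a b = N i' j'" if "a < d" "b < d" "a \<noteq> b" for a b
  proof -
    from permutes_pair_ex[OF assms(3,4) that(1,2) assms(6) that(3)] obtain \<tau>
      where \<tau>: "\<tau> permutes {..<d}" "\<tau> i' = a" "\<tau> j' = b" by metis
    have inj: "\<tau> x = \<tau> y \<longleftrightarrow> x = y" for x y using permutes_inj[OF \<tau>(1)] by (auto dest: injD)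
    have "N a b = (\<Sum>\<pi> | \<pi> permutes {..<d}. if (\<tau> \<circ> \<pi>) i = a \<and> (\<tau> \<circ> \<pi>) j = b then 1 else (0::real))"
      unfolding N_def by (rule setum_permutations_compose_left[OF \<tau>(1)])
    thus ?thesis unfolding N_def using inj by (simp flip: \<tau>(2,3))
  qed
  have fin: "finite {\<pi>. \<pi> permutes {..<d}}" by (simp add: finite_permutations)
  have "(\<Sum>a<d. \<Sum>b<d. if a \<noteq> b then N a b else 0) =
     (\<Sum>\<pi> | \<pi> permutes {..<d}. \<Sum>a<d. \<Sum>b<d. if a = \<pi> i \<and> b = \<pi> j then 1 else 0)"
  proof -
    have "(\<Sum>a<d. \<Sum>b<d. if a \<noteq> b then N a b else 0) =
       (\<Sum>a<d. \<Sum>b<d. \<Sum>\<pi> | \<pi> permutes {..<d}. if a = \<pi> i \<and> b = \<pi> j then 1 else 0)"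
    proof (intro sum.cong refl)
      fix a b
      have ne: "\<pi> i \<noteq> \<pi> j" if "\<pi> permutes {..<d}" for \<pi>
        using permutes_inj[OF that] assms(5) by (auto dest: injD)
      show "(if a \<noteq> b then N a b else 0) = (\<Sum>\<pi> | \<pi> permutes {..<d}. if a = \<pi> i \<and> b = \<pi> j then 1 else 0)"
      proof (cases "a = b")
        case True
        have "(\<Sum>\<pi> | \<pi> permutes {..<d}. if a = \<pi> i \<and> b = \<pi> j then 1 else (0::real)) = 0"
          using ne True by (intro sum.neutral) auto
        thus ?thesis using True by simp
      next
        case False
        thus ?thesis unfolding N_def by (auto intro!: sum.cong)
      qed
    qed
    also have "\<dots> = (\<Sum>a<d. \<Sum>\<pi> | \<pi> permutes {..<d}. \<Sum>b<d. if a = \<pi> i \<and> b = \<pi> j then 1 else 0)"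
      by (rule sum.cong[OF refl], rule sum.swap)
    also have "\<dots> = (\<Sum>\<pi> | \<pi> permutes {..<d}. \<Sum>a<d. \<Sum>b<d. if a = \<pi> i \<and> b = \<pi> j then 1 else 0)"
      by (rule sum.swap)
    finally show ?thesis .
  qed
  also have "\<dots> = (\<Sum>\<pi> | \<pi> permutes {..<d}. 1)"
  proof (intro sum.cong refl)
    fix \<pi> assume "\<pi> \<in> {\<pi>. \<pi> permutes {..<d}}"
    hence p: "\<pi> i < d" "\<pi> j < d" using permutes_in_image[of \<pi> "{..<d}"] assms by auto
    have "(\<Sum>a<d. \<Sum>b<d. if a = \<pi> i \<and> b = \<pi> j then 1 else (0::real)) = (\<Sum>a<d. if a = \<pi> i then 1 else 0)"
      using p by (intro sum.cong refl) auto
    thus "(\<Sum>a<d. \<Sum>b<d. if a = \<pi> i \<and> b = \<pi> j then 1 else (0::real)) = 1" using p by simp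
  qed
  also have "\<dots> = fact d" by (simp add: card_permutations)
  finally have "fact d = (\<Sum>a<d. \<Sum>b<d. if a \<noteq> b then N a b else 0)" ..
  also have "\<dots> = (\<Sum>a<d. \<Sum>b<d. if a \<noteq> b then N i' j' else 0)"
    by (intro sum.cong refl) (use N in auto)
  also have "\<dots> = (\<Sum>a<d. (real d - 1) * N i' j')"
  proof (intro sum.cong refl)
    fix a assume "a \<in> {..<d}"
    have "(\<Sum>b<d. if a \<noteq> b then N i' j' else 0) = (\<Sum>b<d. N i' j' - (if b = a then N i' j' else 0))"
      by (intro sum.cong) auto
    also have "\<dots> = real d * N i' j' - N i' j'" using \<open>a \<in> {..<d}\<close> by (simp add: sum_subtractf)
    finally show "(\<Sum>b<d. if a \<noteq> b then N i' j' else 0) = (real d - 1) * N i' j'" by (simp add: algebra_simps)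
  qed
  finally show ?thesis by (simp add: N_def)
qed

lemma sum_perm_single:
  fixes i i' d :: nat
  assumes "i < d" "i' < d"
  shows "real d * (\<Sum>\<pi> | \<pi> permutes {..<d}. if \<pi> i = i' then 1 else 0) = fact d"
proof -
  define N where "N a = (\<Sum>\<pi> | \<pi> permutes {..<d}. if \<pi> i = a then 1 else (0::real))" for a
  have N: "N a = N i'" if "a < d" for a
  proof -
    define \<tau> where "\<tau> = Transposition.transpose i' a"
    have \<tau>: "\<tau> permutes {..<d}" "\<tau> i' = a" using assms that by (auto simp: \<tau>_def intro: permutes_swap_id)
    have inj: "\<tau> x = \<tau> y \<longleftrightarrow> x = y" for x y using permutes_inj[OF \<tau>(1)] by (auto dest: injD)
    have "N a = (\<Sum>\<pi> | \<pi> permutes {..<d}. if (\<tau> \<circ> \<pi>) i = a then 1 else (0::real))"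
      unfolding N_def by (rule setum_permutations_compose_left[OF \<tau>(1)])
    thus ?thesis unfolding N_def using inj by (simp flip: \<tau>(2))
  qed
  have "(\<Sum>a<d. N a) = (\<Sum>\<pi> | \<pi> permutes {..<d}. \<Sum>a<d. if \<pi> i = a then 1 else 0)"
    unfolding N_def by (rule sum.swap)
  also have "\<dots> = (\<Sum>\<pi> | \<pi> permutes {..<d}. 1)"
    by (intro sum.cong refl) (use permutes_in_image[of _ "{..<d}"] assms in auto)
  also have "\<dots> = fact d" by (simp add: card_permutations)
  finally have "fact d = (\<Sum>a<d. N a)" ..
  also have "\<dots> = (\<Sum>a<d. N i')" using N by (intro sum.cong) auto
  finally show ?thesis by (simp add: N_def)
qed

text \<open>The average of the conjugations by \<open>U \<otimes> U\<close> is the orthogonal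
  projection onto the span of the three \<open>copy_proj c\<close>. The phases leave only the
  pairings \<open>k, l = i, j\<close> and \<open>k, l = j, i\<close>; for these the permutations are
  counted.\<close>

lemma twirl_one:
  assumes "d \<ge> 2" and b: "i < d" "j < d" "k < d" "l < d" and b': "i' < d" "j' < d" "k' < d" "l' < d"
  shows "(\<Sum>g\<in>dg d. mono_u g i i' * mono_u g j j' * cnj (mono_u g k k') * cnj (mono_u g l l')) =
    of_nat (card (dg d)) * (\<Sum>c<3. copy_proj c i j k l * copy_proj c k' l' i' j' / of_real (copy_rank d c))"
proof -
  define P where "P = (\<Sum>\<pi> | \<pi> permutes {..<d}. if i' = \<pi> i \<and> j' = \<pi> j \<and> k' = \<pi> k \<and> l' = \<pi> l then 1 else (0::real))"
  have L: "(\<Sum>g\<in>dg d. mono_u g i i' * mono_u g j j' * cnj (mono_u g k k') * cnj (mono_u g l l')) =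
     (if k = i \<and> l = j \<or> k = j \<and> l = i then 3 ^ d else 0) * of_real P"
  proof -
    have "(\<Sum>g\<in>dg d. mono_u g i i' * mono_u g j j' * cnj (mono_u g k k') * cnj (mono_u g l l')) =
      (\<Sum>(\<theta>, \<pi>)\<in>dg d. (cube_root ^ \<theta> i * cube_root ^ \<theta> j * cnj (cube_root ^ \<theta> k) * cnj (cube_root ^ \<theta> l)) *
         (if i' = \<pi> i \<and> j' = \<pi> j \<and> k' = \<pi> k \<and> l' = \<pi> l then 1 else 0))"
      by (intro sum.cong refl) (auto simp: mono_u_def)
    also have "\<dots> = (\<Sum>\<theta>\<in>PiE {..<d} (\<lambda>_. {..<3::nat}). cube_root ^ \<theta> i * cube_root ^ \<theta> j * cnj (cube_root ^ \<theta> k) * cnj (cube_root ^ \<theta> l)) *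
         (\<Sum>\<pi> | \<pi> permutes {..<d}. if i' = \<pi> i \<and> j' = \<pi> j \<and> k' = \<pi> k \<and> l' = \<pi> l then 1 else 0)"
      unfolding dg_def sum_product sum.cartesian_product ..
    also have "(\<Sum>\<pi> | \<pi> permutes {..<d}. if i' = \<pi> i \<and> j' = \<pi> j \<and> k' = \<pi> k \<and> l' = \<pi> l then 1 else 0) = complex_of_real P"
      unfolding P_def of_real_sum by (intro sum.cong) auto
    finally show ?thesis by (simp only: phase_sum[OF b])
  qed
  have d0: "real d \<noteq> 0" "real d - 1 \<noteq> 0" using assms(1) by auto
  have gen: "(if E then 0 else ((if A then 1 else 0) + (if B then 1 else 0)) / 2) +
      (if E then 0 else ((if A then 1 else 0) - (if B then 1 else 0)) / 2) = (if \<not> E \<and> A then 1 else (0::complex))"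
    "(if E then 0 else ((if A then 1 else 0) + (if B then 1 else 0)) / 2) -
      (if E then 0 else ((if A then 1 else 0) - (if B then 1 else 0)) / 2) = (if \<not> E \<and> B then 1 else (0::complex))"
    for A B E by simp_all
  have XX: "0 * x / u + 1 / 2 * y / of_real (v / 2) + 1 / 2 * z / of_real (v / 2) = (y + z) / of_real v"
    "0 * x / u + 1 / 2 * y / of_real (v / 2) + - 1 / 2 * z / of_real (v / 2) = (y - z) / of_real v"
    for x y z u :: complex and v by (simp_all add: add_divide_distrib diff_divide_distrib)
  have nn: "((1::nat) = 0) = False" "((2::nat) = 0) = False" "((2::nat) = 1) = False" "((1::nat) = 1) = True" by simp_all
  define K where "K = real d * (real d - 1)"
  have tqdK: "copy_rank d 1 = K / 2" "copy_rank d 2 = K / 2" by (simp_all add: copy_rank_def K_def)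
  have s3: "(\<Sum>c<3. f c) = f 0 + f 1 + f 2" for f :: "nat \<Rightarrow> complex" by (simp add: eval_nat_numeral)
  consider (no) "\<not> (k = i \<and> l = j \<or> k = j \<and> l = i)" | (eq) "i = j" "k = i" "l = i"
    | (id) "i \<noteq> j" "k = i" "l = j" | (sw) "i \<noteq> j" "k = j" "l = i" by blast
  thus ?thesis
  proof cases
    case no
    hence n: "(k = i \<and> l = j) = False" "(k = j \<and> l = i) = False" "(i = j \<and> k = i \<and> l = i) = False" by blast+
    have "copy_proj c i j k l = 0" for c unfolding copy_proj_def n by simp
    thus ?thesis unfolding L if_not_P[OF no] by simp
  next
    case eq
    have "P = (if i' = j' \<and> k' = i' \<and> l' = i' then fact d / real d else 0)"
    proof (cases "i' = j' \<and> k' = i' \<and> l' = i'")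
      case True
      have "P = (\<Sum>\<pi> | \<pi> permutes {..<d}. if \<pi> i = i' then 1 else 0)"
        unfolding P_def using True eq by (intro sum.cong) auto
      thus ?thesis using True sum_perm_single[OF b(1) b'(1)] d0 by (simp add: field_simps)
    next
      case False
      thus ?thesis unfolding P_def using eq by (auto intro!: sum.neutral)
    qed
    thus ?thesis unfolding L s3 using eq d0 by (auto simp: copy_proj_def copy_rank_def card_dg)
  next
    case id
    have "P = (if i' \<noteq> j' \<and> k' = i' \<and> l' = j' then fact d / (real d * (real d - 1)) else 0)"
    proof (cases "i' \<noteq> j' \<and> k' = i' \<and> l' = j'")
      case True
      have "P = (\<Sum>\<pi> | \<pi> permutes {..<d}. if \<pi> i = i' \<and> \<pi> j = j' then 1 else 0)"
        unfolding P_def using True id by (intro sum.cong) auto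
      thus ?thesis using True sum_perm_pair[OF b(1,2) b'(1,2) id(1)] d0 by (simp add: field_simps)
    next
      case False
      have "\<pi> i \<noteq> \<pi> j" if "\<pi> permutes {..<d}" for \<pi>
        using permutes_inj[OF that] id(1) by (auto dest: injD)
      note ne = this
      have "P = 0" unfolding P_def
      proof (rule sum.neutral, rule ballI)
        fix \<pi> assume "\<pi> \<in> {\<pi>. \<pi> permutes {..<d}}"
        hence "\<pi> i \<noteq> \<pi> j" using ne by simp
        thus "(if i' = \<pi> i \<and> j' = \<pi> j \<and> k' = \<pi> k \<and> l' = \<pi> l then 1 else 0) = (0::real)"
          using False id by auto
      qed
      thus ?thesis using False by (simp only: if_False)
    qed
    moreover have "(i' \<noteq> j' \<and> k' = i' \<and> l' = j') = (k' \<noteq> l' \<and> i' = k' \<and> j' = l')" by blast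
    ultimately have P: "P = (if k' \<noteq> l' \<and> i' = k' \<and> j' = l' then fact d / K else 0)" by (simp only: K_def)
    \<comment> \<open>Equal weights combine the symmetric and antisymmetric projections into the
      identity off the diagonal. In the case \<open>sw\<close> the weights have opposite signs and
      the combination is the flip.\<close>
    have "copy_proj 0 i j k l = 0" "copy_proj 1 i j k l = 1 / 2" "copy_proj 2 i j k l = 1 / 2"
      unfolding copy_proj_def id(2,3) using id(1) by simp_all
    moreover have "copy_proj 1 k' l' i' j' + copy_proj 2 k' l' i' j' = (if k' \<noteq> l' \<and> i' = k' \<and> j' = l' then 1 else 0)"
      unfolding copy_proj_def by (simp only: nn if_False if_True gen)
    ultimately have "(\<Sum>c<3. copy_proj c i j k l * copy_proj c k' l' i' j' / of_real (copy_rank d c)) =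
        (if k' \<noteq> l' \<and> i' = k' \<and> j' = l' then 1 else 0) / of_real K"
      unfolding s3 tqdK by (simp only: XX)
    moreover define J where "J \<longleftrightarrow> k' \<noteq> l' \<and> i' = k' \<and> j' = l'"
    ultimately show ?thesis unfolding L unfolding P id(2,3) J_def[symmetric] by (simp add: card_dg)
  next
    case sw
    have "P = (if i' \<noteq> j' \<and> k' = j' \<and> l' = i' then fact d / (real d * (real d - 1)) else 0)"
    proof (cases "i' \<noteq> j' \<and> k' = j' \<and> l' = i'")
      case True
      have "P = (\<Sum>\<pi> | \<pi> permutes {..<d}. if \<pi> i = i' \<and> \<pi> j = j' then 1 else 0)"
        unfolding P_def using True sw by (intro sum.cong) auto
      thus ?thesis using True sum_perm_pair[OF b(1,2) b'(1,2) sw(1)] d0 by (simp add: field_simps)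
    next
      case False
      have "\<pi> i \<noteq> \<pi> j" if "\<pi> permutes {..<d}" for \<pi>
        using permutes_inj[OF that] sw(1) by (auto dest: injD)
      note ne = this
      have "P = 0" unfolding P_def
      proof (rule sum.neutral, rule ballI)
        fix \<pi> assume "\<pi> \<in> {\<pi>. \<pi> permutes {..<d}}"
        hence "\<pi> i \<noteq> \<pi> j" using ne by simp
        thus "(if i' = \<pi> i \<and> j' = \<pi> j \<and> k' = \<pi> k \<and> l' = \<pi> l then 1 else 0) = (0::real)"
          using False sw by auto
      qed
      thus ?thesis using False by (simp only: if_False)
    qed
    moreover have "(i' \<noteq> j' \<and> k' = j' \<and> l' = i') = (k' \<noteq> l' \<and> i' = l' \<and> j' = k')" by blast
    ultimately have P: "P = (if k' \<noteq> l' \<and> i' = l' \<and> j' = k' then fact d / K else 0)" by (simp only: K_def)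
    have "copy_proj 0 i j k l = 0" "copy_proj 1 i j k l = 1 / 2" "copy_proj 2 i j k l = - 1 / 2"
      unfolding copy_proj_def sw(2,3) using sw(1) by simp_all
    moreover have "copy_proj 1 k' l' i' j' - copy_proj 2 k' l' i' j' = (if k' \<noteq> l' \<and> i' = l' \<and> j' = k' then 1 else 0)"
      unfolding copy_proj_def by (simp only: nn if_False if_True gen)
    ultimately have "(\<Sum>c<3. copy_proj c i j k l * copy_proj c k' l' i' j' / of_real (copy_rank d c)) =
        (if k' \<noteq> l' \<and> i' = l' \<and> j' = k' then 1 else 0) / of_real K"
      unfolding s3 tqdK by (simp only: XX)
    moreover define J where "J \<longleftrightarrow> k' \<noteq> l' \<and> i' = l' \<and> j' = k'"
    ultimately show ?thesis unfolding L unfolding P sw(2,3) J_def[symmetric] by (simp add: card_dg)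
  qed
qed

section \<open>Symmetrization of n copies\<close>

definition type_proj :: "nat \<Rightarrow> nat \<Rightarrow> (nat \<Rightarrow> nat) \<Rightarrow> complex mat" where
  "type_proj d n c = tens d n (\<lambda>k. copy_proj (c k))"

definition type_rank :: "nat \<Rightarrow> nat \<Rightarrow> (nat \<Rightarrow> nat) \<Rightarrow> real" where
  "type_rank d n c = (\<Prod>k<n. copy_rank d (c k))"

definition copy_types :: "nat \<Rightarrow> (nat \<Rightarrow> nat) set" where
  "copy_types n = PiE {..<n} (\<lambda>_. {..<3})"

definition twirl_weight :: "nat \<Rightarrow> nat \<Rightarrow> (nat \<Rightarrow> nat) \<Rightarrow> complex mat \<Rightarrow> complex" where
  "twirl_weight d n c X = (\<Sum>\<tau> | \<tau> permutes {..<n}. mat_trace (type_proj d n (c \<circ> \<tau>) * X)) / fact n"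

text \<open>Defined by its expansion in the mutually orthogonal \<open>type_proj d n c\<close>,
  which makes trace identities finite sums over types; \<open>twirl_n_eq_average\<close> identifies
  it with a group average. The permutations of the copies enter through
  \<open>twirl_weight\<close>.\<close>

definition twirl_n :: "nat \<Rightarrow> nat \<Rightarrow> complex mat \<Rightarrow> complex mat" where
  "twirl_n d n X = mat (d ^ n * d ^ n) (d ^ n * d ^ n)
     (\<lambda>(x, y). \<Sum>c\<in>copy_types n. twirl_weight d n c X * (type_proj d n c $$ (x, y) / of_real (type_rank d n c)))"

lemma mat_trace_herm_real:
  assumes "psd n A" "psd n B"
  shows "mat_trace (A * B) = complex_of_real (Re (mat_trace (A * B)))"
proof -
  note A = assms(1)[unfolded psd_iff] and B = assms(2)[unfolded psd_iff]
  have "cnj (mat_trace (A * B)) = (\<Sum>i<n. \<Sum>j<n. A $$ (j, i) * B $$ (i, j))"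
    unfolding mat_trace_mult[OF conjunct1[OF A] conjunct1[OF B]] using A B by simp
  also have "\<dots> = mat_trace (A * B)"
    unfolding mat_trace_mult[OF conjunct1[OF A] conjunct1[OF B]] by (rule sum.swap)
  finally show ?thesis by (simp add: complex_eq_iff)
qed

lemma psd_nonneg_sum:
  assumes "finite L" "Y \<in> carrier_mat n n"
    and "\<And>l. l \<in> L \<Longrightarrow> psd n (X l)" "\<And>l. l \<in> L \<Longrightarrow> 0 \<le> w l"
    and e: "\<And>i j. i < n \<Longrightarrow> j < n \<Longrightarrow> Y $$ (i, j) = (\<Sum>l\<in>L. complex_of_real (w l) * X l $$ (i, j))"
  shows "psd n Y"
  unfolding psd_iff
proof (intro conjI allI impI)
  fix i j assume ij: "i < n" "j < n"
  have "cnj (X l $$ (i, j)) = X l $$ (j, i)" if "l \<in> L" for l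
    using assms(3)[OF that] ij by (simp add: psd_iff)
  thus "cnj (Y $$ (i, j)) = Y $$ (j, i)" using ij by (simp add: e)
next
  fix z
  have "quad n Y z = (\<Sum>i<n. \<Sum>j<n. \<Sum>l\<in>L. complex_of_real (w l) * (cnj (z i) * X l $$ (i, j) * z j))"
    unfolding quad_def by (intro sum.cong refl) (simp add: e sum_distrib_left sum_distrib_right mult_ac)
  also have "\<dots> = (\<Sum>i<n. \<Sum>l\<in>L. \<Sum>j<n. complex_of_real (w l) * (cnj (z i) * X l $$ (i, j) * z j))"
    by (rule sum.cong[OF refl], rule sum.swap)
  also have "\<dots> = (\<Sum>l\<in>L. \<Sum>i<n. \<Sum>j<n. complex_of_real (w l) * (cnj (z i) * X l $$ (i, j) * z j))"
    by (rule sum.swap)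
  also have "\<dots> = (\<Sum>l\<in>L. complex_of_real (w l) * quad n (X l) z)"
    by (simp add: quad_def sum_distrib_left)
  finally show "0 \<le> Re (quad n Y z)"
    using assms(3,4) psd_quad_ge[of n] by (auto intro!: sum_nonneg)
qed (use assms(2) in auto)

lemma copy_proj_sym: "copy_proj c k l i j = copy_proj c i j k l"
  by (auto simp: copy_proj_def)

lemma cnj_copy_proj [simp]: "cnj (copy_proj c i j k l) = copy_proj c i j k l"
  by (simp add: copy_proj_def)

lemma copy_proj_mult:
  assumes "i < d" "j < d" "c < 3" "c' < 3"
  shows "(\<Sum>u<d. \<Sum>v<d. copy_proj c i j u v * copy_proj c' u v k l) = (if c = c' then copy_proj c i j k l else 0)"
proof -
  define a where "a = (if c = 0 then if i = j then 1 else 0 else if i = j then 0 else 1 / 2 :: complex)"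
  define b where "b = (if c = 0 then 0 else if i = j then 0 else if c = 1 then 1 / 2 else - 1 / 2 :: complex)"
  \<comment> \<open>Row by row, each projection is a combination of identity and flip whose
    coefficients depend only on whether \<open>i = j\<close>.\<close>
  have t: "copy_proj c i j u v = a * (if u = i \<and> v = j then 1 else 0) + b * (if u = j \<and> v = i then 1 else 0)" for u v
    by (auto simp: copy_proj_def a_def b_def)
  have s: "(\<Sum>u<d. \<Sum>v<d. (if u = i' \<and> v = j' then 1 else 0) * f u v) = f i' j'"
    if "i' < d" "j' < d" for i' j' and f :: "nat \<Rightarrow> nat \<Rightarrow> complex"
  proof -
    have "(\<Sum>u<d. \<Sum>v<d. (if u = i' \<and> v = j' then 1 else 0) * f u v) = (\<Sum>u<d. if u = i' then f i' j' else 0)"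
      using that by (intro sum.cong refl) (auto simp: if_distrib[of "\<lambda>x. x * _"] cong: if_cong)
    thus ?thesis using that by simp
  qed
  have "(\<Sum>u<d. \<Sum>v<d. copy_proj c i j u v * copy_proj c' u v k l) =
     a * (\<Sum>u<d. \<Sum>v<d. (if u = i \<and> v = j then 1 else 0) * copy_proj c' u v k l) +
     b * (\<Sum>u<d. \<Sum>v<d. (if u = j \<and> v = i then 1 else 0) * copy_proj c' u v k l)"
    unfolding t by (simp add: sum.distrib sum_distrib_left algebra_simps)
  also have "\<dots> = a * copy_proj c' i j k l + b * copy_proj c' j i k l" by (simp only: s assms)
  also have "\<dots> = (if c = c' then copy_proj c i j k l else 0)"
  proof -
    have sw: "copy_proj c' j i k l = (if c' = 2 then - 1 else 1) * copy_proj c' i j k l"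
      using assms(4) by (auto simp: copy_proj_def)
    have d: "c' \<noteq> 0 \<Longrightarrow> i = j \<Longrightarrow> copy_proj c' i j k l = 0" "c' = 0 \<Longrightarrow> i \<noteq> j \<Longrightarrow> copy_proj c' i j k l = 0"
      by (auto simp: copy_proj_def)
    have cc: "c = 0 \<or> c = 1 \<or> c = 2" "c' = 0 \<or> c' = 1 \<or> c' = 2" using assms by auto
    show ?thesis unfolding sw using cc d
      by (elim disjE; cases "i = j") (simp_all add: a_def b_def)
  qed
  finally show ?thesis .
qed

lemma copy_proj_trace:
  assumes "c < 3"
  shows "(\<Sum>i<d. \<Sum>j<d. copy_proj c i j i j) = of_real (copy_rank d c)"
proof (cases "c = 0")
  case True
  have "(\<Sum>i<d. \<Sum>j<d. copy_proj c i j i j) = (\<Sum>i<d. \<Sum>j<d. if j = i then 1 else 0)"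
    using True by (intro sum.cong refl) (auto simp: copy_proj_def)
  thus ?thesis using True by (simp add: copy_rank_def)
next
  case False
  have "(\<Sum>i<d. \<Sum>j<d. copy_proj c i j i j) = (\<Sum>i<d. \<Sum>j<d. 1 / 2 - (if j = i then 1 / 2 else 0))"
    using False by (intro sum.cong refl) (auto simp: copy_proj_def)
  also have "\<dots> = (\<Sum>i<d. (of_nat d - 1) / 2)"
    by (intro sum.cong refl) (simp add: sum_subtractf diff_divide_distrib)
  finally show ?thesis using False by (simp add: copy_rank_def)
qed

lemma copy_proj_sum: "(\<Sum>c<3. copy_proj c i j k l) = (if i = k \<and> j = l then 1 else 0)"
proof -
  have e3: "(\<Sum>c<3. f c) = f 0 + f 1 + f 2" for f :: "nat \<Rightarrow> complex" by (simp add: eval_nat_numeral)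
  show ?thesis unfolding e3 by (cases "i = j"; cases "k = i"; cases "l = j"; cases "k = j"; cases "l = i") (simp_all add: copy_proj_def)
qed

lemma type_proj_carrier [simp]: "type_proj d n c \<in> carrier_mat (d ^ n * d ^ n) (d ^ n * d ^ n)"
  by (simp add: type_proj_def)

lemma twirl_n_carrier [simp]: "twirl_n d n X \<in> carrier_mat (d ^ n * d ^ n) (d ^ n * d ^ n)"
  by (simp add: twirl_n_def)

lemma type_proj_cong: "(\<And>k. k < n \<Longrightarrow> c k = c' k) \<Longrightarrow> type_proj d n c = type_proj d n c'"
  unfolding type_proj_def by (intro tens_eqI) simp

lemma CnD: "c \<in> copy_types n \<Longrightarrow> k < n \<Longrightarrow> c k < 3"
  by (auto simp: copy_types_def PiE_def)

lemma copy_types_eqI: "c \<in> copy_types n \<Longrightarrow> c' \<in> copy_types n \<Longrightarrow> (\<And>k. k < n \<Longrightarrow> c k = c' k) \<Longrightarrow> c = c'"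
  unfolding copy_types_def by (rule PiE_ext) auto

lemma finite_copy_types [simp]: "finite (copy_types n)" by (simp add: copy_types_def finite_PiE)

lemma type_proj_mult:
  assumes c: "c \<in> copy_types n" and c': "c' \<in> copy_types n"
  shows "type_proj d n c * type_proj d n c' = (if c = c' then type_proj d n c else 0\<^sub>m (d ^ n * d ^ n) (d ^ n * d ^ n))"
proof -
  have e: "type_proj d n c * type_proj d n c' = tens d n (\<lambda>k i j i' j'. if c k = c' k then copy_proj (c k) i j i' j' else 0)"
    unfolding type_proj_def tens_mult
    by (intro tens_eqI) (use c c' in \<open>auto simp: copy_proj_mult CnD\<close>)
  show ?thesis
  proof (cases "c = c'")
    case True thus ?thesis unfolding e by (simp add: type_proj_def)
  next
    case False
    then obtain k where k: "k < n" "c k \<noteq> c' k" using copy_types_eqI[OF c c'] by blast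
    have "tens d n (\<lambda>k i j i' j'. if c k = c' k then copy_proj (c k) i j i' j' else 0) = 0\<^sub>m (d ^ n * d ^ n) (d ^ n * d ^ n)"
      by (rule eq_matI) (use k in \<open>auto simp: tens_def intro!: prod_zero\<close>)
    thus ?thesis using False e by simp
  qed
qed

lemma mat_trace_type_proj:
  assumes "c \<in> copy_types n"
  shows "mat_trace (type_proj d n c) = of_real (type_rank d n c)"
  unfolding type_proj_def mat_trace_tens type_rank_def of_real_prod
  by (intro prod.cong refl) (use assms in \<open>simp add: copy_proj_trace CnD\<close>)

lemma type_proj_herm:
  assumes "x < d ^ n * d ^ n" "y < d ^ n * d ^ n"
  shows "cnj (type_proj d n c $$ (x, y)) = type_proj d n c $$ (y, x)"
  using assms by (auto simp: type_proj_def tens_index intro!: prod.cong copy_proj_sym)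

lemma psd_type_proj:
  assumes "c \<in> copy_types n"
  shows "psd (d ^ n * d ^ n) (type_proj d n c)"
proof (rule psd_factorI[where L = "{..<d ^ n * d ^ n}" and b = "\<lambda>l i. type_proj d n c $$ (i, l)"])
  fix i j assume ij: "i < d ^ n * d ^ n" "j < d ^ n * d ^ n"
  have "type_proj d n c $$ (i, j) = (type_proj d n c * type_proj d n c) $$ (i, j)"
    by (simp add: type_proj_mult[OF assms assms])
  also have "\<dots> = (\<Sum>l<d ^ n * d ^ n. type_proj d n c $$ (i, l) * type_proj d n c $$ (l, j))"
    by (rule mult_index[OF type_proj_carrier type_proj_carrier ij])
  finally show "type_proj d n c $$ (i, j) = (\<Sum>l<d ^ n * d ^ n. type_proj d n c $$ (i, l) * cnj (type_proj d n c $$ (j, l)))"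
    using ij by (simp add: type_proj_herm)
qed simp

lemma sum_type_proj:
  assumes "x < d ^ n * d ^ n" "y < d ^ n * d ^ n"
  shows "(\<Sum>c\<in>copy_types n. type_proj d n c $$ (x, y)) = (if x = y then 1 else 0)"
proof -
  let ?A = "\<lambda>k x. dig d k (x div d ^ n)" and ?B = "\<lambda>k x. dig d k (x mod d ^ n)"
  have "(\<Sum>c\<in>copy_types n. type_proj d n c $$ (x, y)) = (\<Sum>c\<in>copy_types n. \<Prod>k<n. copy_proj (c k) (?A k x) (?B k x) (?A k y) (?B k y))"
    using assms by (simp add: type_proj_def tens_index)
  also have "\<dots> = (\<Prod>k<n. \<Sum>t<3. copy_proj t (?A k x) (?B k x) (?A k y) (?B k y))"
    unfolding copy_types_def by (rule prod_sum_PiE[symmetric]) auto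
  also have "\<dots> = (\<Prod>k<n. if ?A k x = ?A k y \<and> ?B k x = ?B k y then 1 else 0)"
    by (simp only: copy_proj_sum)
  also have "\<dots> = (if x = y then 1 else 0)"
  proof (cases "x = y")
    case False
    have "\<exists>k<n. \<not> (?A k x = ?A k y \<and> ?B k x = ?B k y)"
    proof (rule ccontr)
      assume "\<not> (\<exists>k<n. \<not> (?A k x = ?A k y \<and> ?B k x = ?B k y))"
      hence e: "?A k x = ?A k y" "?B k x = ?B k y" if "k < n" for k using that by blast+
      have "x div d ^ n = y div d ^ n"
        by (rule dig_eqI[OF div_mod_less(1)[OF assms(1)] div_mod_less(1)[OF assms(2)] e(1)])
      moreover have "x mod d ^ n = y mod d ^ n"
        by (rule dig_eqI[OF div_mod_less(2)[OF assms(1)] div_mod_less(2)[OF assms(2)] e(2)])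
      moreover have "x = x div d ^ n * d ^ n + x mod d ^ n" "y = y div d ^ n * d ^ n + y mod d ^ n"
        by (simp_all only: div_mult_mod_eq)
      ultimately have "x = y" by argo
      thus False using False by blast
    qed
    then obtain k where k: "k < n" "\<not> (?A k x = ?A k y \<and> ?B k x = ?B k y)" by blast
    hence "\<exists>k\<in>{..<n}. (if ?A k x = ?A k y \<and> ?B k x = ?B k y then 1 else 0) = (0::complex)"
      by (intro bexI[of _ k]) auto
    hence "(\<Prod>k<n. if ?A k x = ?A k y \<and> ?B k x = ?B k y then 1 else 0) = (0::complex)"
      by (intro prod_zero) auto
    thus ?thesis using False by (simp only: if_False)
  qed simp
  finally show ?thesis .
qed

lemma permutes_lessThan: "\<tau> permutes {..<n::nat} \<Longrightarrow> k < n \<longleftrightarrow> \<tau> k < n"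
  using permutes_in_image[of \<tau> "{..<n}" k] by simp

lemma copy_types_compose:
  assumes "\<tau> permutes {..<n}" "c \<in> copy_types n" shows "c \<circ> \<tau> \<in> copy_types n"
proof -
  have "\<tau> k = k" if "\<not> k < n" for k using permutes_not_in[OF assms(1), of k] that by simp
  thus ?thesis using assms(2) permutes_lessThan[OF assms(1)] by (auto simp: copy_types_def PiE_def extensional_def)
qed

lemma sum_copy_types_compose:
  assumes "\<tau> permutes {..<n}"
  shows "(\<Sum>c\<in>copy_types n. f (c \<circ> \<tau>)) = (\<Sum>c\<in>copy_types n. f c)"
  by (rule sum.reindex_bij_witness[where i = "\<lambda>c. c \<circ> inv_into UNIV \<tau>" and j = "\<lambda>c. c \<circ> \<tau>"])
    (use assms permutes_inv[OF assms] permutes_inv_o[OF assms] in \<open>auto simp: copy_types_compose o_assoc[symmetric]\<close>)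

lemma type_rank_compose:
  assumes "\<tau> permutes {..<n}" shows "type_rank d n (c \<circ> \<tau>) = type_rank d n c"
  unfolding type_rank_def using prod.permute[OF assms, of "\<lambda>k. copy_rank d (c k)"] by (simp add: o_def)

lemma type_rank_pos: "d \<ge> 2 \<Longrightarrow> type_rank d n c > 0"
  unfolding type_rank_def by (intro prod_pos) (auto simp: copy_rank_def)

lemma twirl_weight_inv: "twirl_weight d n c X = (\<Sum>\<tau> | \<tau> permutes {..<n}. mat_trace (type_proj d n (c \<circ> inv_into UNIV \<tau>) * X)) / fact n"
  unfolding twirl_weight_def by (subst sum_permutations_inverse) simp

lemma twirl_weight_sym:
  assumes "\<sigma> permutes {..<n}" shows "twirl_weight d n (c \<circ> \<sigma>) X = twirl_weight d n c X"
  unfolding twirl_weight_def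
  by (subst (2) setum_permutations_compose_left[OF assms]) (simp add: o_assoc)

lemma mat_trace_sum_mult:
  assumes "Y \<in> carrier_mat D D" "Z \<in> carrier_mat D D" "\<And>l. l \<in> L \<Longrightarrow> X l \<in> carrier_mat D D"
    and "\<And>x y. x < D \<Longrightarrow> y < D \<Longrightarrow> Y $$ (x, y) = (\<Sum>l\<in>L. w l * X l $$ (x, y))"
  shows "mat_trace (Y * Z) = (\<Sum>l\<in>L. w l * mat_trace (X l * Z))"
proof -
  have "mat_trace (Y * Z) = (\<Sum>i<D. \<Sum>j<D. \<Sum>l\<in>L. w l * (X l $$ (i, j) * Z $$ (j, i)))"
    unfolding mat_trace_mult[OF assms(1,2)]
    by (intro sum.cong refl) (simp add: assms(4) sum_distrib_left sum_distrib_right mult_ac)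
  also have "\<dots> = (\<Sum>i<D. \<Sum>l\<in>L. \<Sum>j<D. w l * (X l $$ (i, j) * Z $$ (j, i)))"
    by (rule sum.cong[OF refl], rule sum.swap)
  also have "\<dots> = (\<Sum>l\<in>L. \<Sum>i<D. \<Sum>j<D. w l * (X l $$ (i, j) * Z $$ (j, i)))" by (rule sum.swap)
  also have "\<dots> = (\<Sum>l\<in>L. w l * mat_trace (X l * Z))"
    by (intro sum.cong refl) (simp add: mat_trace_mult[OF assms(3) assms(2)] sum_distrib_left)
  finally show ?thesis .
qed

lemma mat_trace_twirl_n_mult:
  assumes "E \<in> carrier_mat (d ^ n * d ^ n) (d ^ n * d ^ n)"
  shows "mat_trace (twirl_n d n X * E) = (\<Sum>c\<in>copy_types n. twirl_weight d n c X * (mat_trace (type_proj d n c * E) / of_real (type_rank d n c)))"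
proof -
  have "mat_trace (twirl_n d n X * E) = (\<Sum>c\<in>copy_types n. (twirl_weight d n c X / of_real (type_rank d n c)) * mat_trace (type_proj d n c * E))"
    by (rule mat_trace_sum_mult[OF twirl_n_carrier assms]) (simp_all add: twirl_n_def)
  thus ?thesis by simp
qed

text \<open>Both sides are sums over types and permutations. Reindexing the types by a permutation
  exchanges the roles of \<open>X\<close> and \<open>Y\<close> and inverts the permutation, over
  which the sum is invariant; the ranks do not change.\<close>

lemma twirl_n_adjoint:
  assumes X: "X \<in> carrier_mat (d ^ n * d ^ n) (d ^ n * d ^ n)" and Y: "Y \<in> carrier_mat (d ^ n * d ^ n) (d ^ n * d ^ n)"
  shows "mat_trace (X * twirl_n d n Y) = mat_trace (twirl_n d n X * Y)"
proof -
  define a where "a Z c = mat_trace (type_proj d n c * Z)" for Z c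
  define q where "q c = complex_of_real (type_rank d n c)" for c
  have L: "(\<Sum>c\<in>copy_types n. twirl_weight d n c Z * (a W c / q c)) = (\<Sum>\<tau> | \<tau> permutes {..<n}. \<Sum>c\<in>copy_types n. a Z (c \<circ> \<tau>) * (a W c / q c)) / fact n" for Z W
    unfolding twirl_weight_def a_def[symmetric]
    by (simp only: times_divide_eq_left sum_distrib_right sum_divide_distrib) (rule sum.swap)
  have M: "(\<Sum>c\<in>copy_types n. a Z (c \<circ> \<tau>) * (a W c / q c)) = (\<Sum>c\<in>copy_types n. a W (c \<circ> inv_into UNIV \<tau>) * (a Z c / q c))"
    if \<tau>: "\<tau> permutes {..<n}" for \<tau> Z W
  proof -
    have "(\<Sum>c\<in>copy_types n. a W (c \<circ> inv_into UNIV \<tau>) * (a Z c / q c)) = (\<Sum>c\<in>copy_types n. a W (c \<circ> \<tau> \<circ> inv_into UNIV \<tau>) * (a Z (c \<circ> \<tau>) / q (c \<circ> \<tau>)))"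
      by (rule sum_copy_types_compose[OF \<tau>, symmetric])
    also have "\<dots> = (\<Sum>c\<in>copy_types n. a Z (c \<circ> \<tau>) * (a W c / q c))"
      using permutes_inv_o[OF \<tau>] by (simp add: o_assoc[symmetric] q_def type_rank_compose[OF \<tau>] mult.commute)
    finally show ?thesis ..
  qed
  have "mat_trace (X * twirl_n d n Y) = mat_trace (twirl_n d n Y * X)" by (rule mat_trace_comm[OF X twirl_n_carrier])
  also have "\<dots> = (\<Sum>c\<in>copy_types n. twirl_weight d n c Y * (a X c / q c))"
    unfolding mat_trace_twirl_n_mult[OF X] by (simp add: a_def q_def)
  also have "\<dots> = (\<Sum>\<tau> | \<tau> permutes {..<n}. \<Sum>c\<in>copy_types n. a X (c \<circ> inv_into UNIV \<tau>) * (a Y c / q c)) / fact n"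
    unfolding L using M by simp
  also have "\<dots> = (\<Sum>\<tau> | \<tau> permutes {..<n}. \<Sum>c\<in>copy_types n. a X (c \<circ> \<tau>) * (a Y c / q c)) / fact n"
    by (subst (2) sum_permutations_inverse) simp
  also have "\<dots> = mat_trace (twirl_n d n X * Y)"
    unfolding L[symmetric] mat_trace_twirl_n_mult[OF Y] by (simp add: a_def q_def)
  finally show ?thesis .
qed

lemma twirl_n_one: 
  assumes "d \<ge> 2" shows "twirl_n d n (1\<^sub>m (d ^ n * d ^ n)) = 1\<^sub>m (d ^ n * d ^ n)"
proof (rule eq_matI)
  have tb1: "twirl_weight d n c (1\<^sub>m (d ^ n * d ^ n)) = of_real (type_rank d n c)" if "c \<in> copy_types n" for c
  proof -
    have "mat_trace (type_proj d n (c \<circ> \<tau>) * 1\<^sub>m (d ^ n * d ^ n)) = of_real (type_rank d n c)" if "\<tau> permutes {..<n}" for \<tau>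
      using mat_trace_type_proj[OF copy_types_compose[OF that \<open>c \<in> copy_types n\<close>]] by (simp add: right_mult_one_mat[OF type_proj_carrier] type_rank_compose[OF that])
    hence "twirl_weight d n c (1\<^sub>m (d ^ n * d ^ n)) = (\<Sum>\<tau> | \<tau> permutes {..<n}. of_real (type_rank d n c)) / fact n"
      unfolding twirl_weight_def by simp
    thus ?thesis by (simp add: card_permutations)
  qed
  fix x y assume "x < dim_row (1\<^sub>m (d ^ n * d ^ n))" "y < dim_col (1\<^sub>m (d ^ n * d ^ n))"
  hence xy: "x < d ^ n * d ^ n" "y < d ^ n * d ^ n" by auto
  have "twirl_n d n (1\<^sub>m (d ^ n * d ^ n)) $$ (x, y) = (\<Sum>c\<in>copy_types n. type_proj d n c $$ (x, y))"
    using xy type_rank_pos[OF assms, of n] by (auto simp: twirl_n_def tb1 less_imp_neq[THEN not_sym] intro!: sum.cong)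
  thus "twirl_n d n (1\<^sub>m (d ^ n * d ^ n)) $$ (x, y) = 1\<^sub>m (d ^ n * d ^ n) $$ (x, y)"
    using xy by (simp add: sum_type_proj)
qed (simp_all add: twirl_n_def)

text \<open>Dual to \<open>twirl_n_one\<close> under \<open>twirl_n_adjoint\<close>.\<close>

lemma mat_trace_twirl_n:
  assumes "d \<ge> 2" and X: "X \<in> carrier_mat (d ^ n * d ^ n) (d ^ n * d ^ n)"
  shows "mat_trace (twirl_n d n X) = mat_trace X"
  using twirl_n_adjoint[OF X, of "1\<^sub>m (d ^ n * d ^ n)"] X
  by (simp add: twirl_n_one[OF assms(1)] right_mult_one_mat[OF twirl_n_carrier])

text \<open>Together with \<open>twirl_n_one\<close>, this shows that symmetrized effects again sum
  to the identity.\<close>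

lemma twirl_n_sum_list:
  assumes "\<And>E. E \<in> set Es \<Longrightarrow> f E \<in> carrier_mat (d ^ n * d ^ n) (d ^ n * d ^ n)"
  shows "twirl_n d n (sum_mats (d ^ n * d ^ n) f Es) = sum_mats (d ^ n * d ^ n) (\<lambda>E. twirl_n d n (f E)) Es"
proof -
  let ?D = "d ^ n * d ^ n"
  have tr: "mat_trace (Z * sum_mats ?D f Es) = (\<Sum>E\<leftarrow>Es. mat_trace (Z * f E))" if Z: "Z \<in> carrier_mat ?D ?D" for Z
  proof -
    have "mat_trace (Z * sum_mats ?D f Es) = (\<Sum>i<?D. \<Sum>j<?D. \<Sum>E\<leftarrow>Es. Z $$ (i, j) * f E $$ (j, i))"
      by (subst mat_trace_mult[OF Z]) (auto simp: sum_mats_def sum_list_const_mult intro!: sum.cong)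
    also have "\<dots> = (\<Sum>E\<leftarrow>Es. \<Sum>i<?D. \<Sum>j<?D. Z $$ (i, j) * f E $$ (j, i))"
      by (induction Es) (auto simp: sum.distrib)
    also have "\<dots> = (\<Sum>E\<leftarrow>Es. mat_trace (Z * f E))"
      using assms by (intro arg_cong[of _ _ sum_list] map_cong refl) (simp add: mat_trace_mult[OF Z])
    finally show ?thesis .
  qed
  have tbs: "twirl_weight d n c (sum_mats ?D f Es) = (\<Sum>E\<leftarrow>Es. twirl_weight d n c (f E))" for c
    unfolding twirl_weight_def tr[OF type_proj_carrier] by (induction Es) (auto simp: sum.distrib add_divide_distrib)
  show ?thesis
  proof (rule eq_matI)
    fix x y assume "x < dim_row (sum_mats ?D (\<lambda>E. twirl_n d n (f E)) Es)" "y < dim_col (sum_mats ?D (\<lambda>E. twirl_n d n (f E)) Es)"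
    hence xy: "x < ?D" "y < ?D" by (simp_all add: sum_mats_def)
    have "twirl_n d n (sum_mats ?D f Es) $$ (x, y) = (\<Sum>c\<in>copy_types n. \<Sum>E\<leftarrow>Es. twirl_weight d n c (f E) * (type_proj d n c $$ (x, y) / of_real (type_rank d n c)))"
      using xy by (simp add: twirl_n_def tbs del: times_divide_eq_right flip: sum_list_mult_const)
    also have "\<dots> = (\<Sum>E\<leftarrow>Es. twirl_n d n (f E) $$ (x, y))"
      using xy by (induction Es) (auto simp: sum.distrib twirl_n_def)
    finally show "twirl_n d n (sum_mats ?D f Es) $$ (x, y) = sum_mats ?D (\<lambda>E. twirl_n d n (f E)) Es $$ (x, y)"
      using xy by (simp add: sum_mats_def)
  qed (simp_all add: twirl_n_def sum_mats_def)
qed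

text \<open>The twirl is a mixture of conjugations by local monomial unitaries composed with
  permutations of the copies, so it preserves separability.\<close>

lemma twirl_n_eq_average:
  assumes d: "d \<ge> 2" and X: "X \<in> carrier_mat (d ^ n * d ^ n) (d ^ n * d ^ n)"
    and xy: "x < d ^ n * d ^ n" "y < d ^ n * d ^ n"
  defines "U \<equiv> \<lambda>g \<tau> p p'. \<Prod>k<n. mono_u (g k) (dig d k p) (dig d (\<tau> k) p')"
  shows "of_nat (card (dg d) ^ n * fact n) * twirl_n d n X $$ (x, y) =
    (\<Sum>(\<tau>, g)\<in>{\<tau>. \<tau> permutes {..<n}} \<times> PiE {..<n} (\<lambda>_. dg d). \<Sum>x'<d ^ n * d ^ n. \<Sum>y'<d ^ n * d ^ n.
      (U g \<tau> (x div d ^ n) (x' div d ^ n) * U g \<tau> (x mod d ^ n) (x' mod d ^ n)) * X $$ (x', y') *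
      cnj (U g \<tau> (y div d ^ n) (y' div d ^ n) * U g \<tau> (y mod d ^ n) (y' mod d ^ n)))"
proof -
  let ?D = "d ^ n * d ^ n" and ?G = "PiE {..<n} (\<lambda>_. dg d)" and ?S = "{\<tau>. \<tau> permutes {..<n}}"
  let ?A = "\<lambda>k x. dig d k (x div d ^ n)" and ?B = "\<lambda>k x. dig d k (x mod d ^ n)"
  \<comment> \<open>For a fixed permutation \<tau>, the sum over independent group elements
    factorizes over the copies and \<open>twirl_one\<close> applies to each. Relabelling the copies
    on the primed side turns \<tau> into its inverse acting on the type.\<close>
  have inner: "(\<Sum>g\<in>?G. (U g \<tau> (x div d ^ n) (x' div d ^ n) * U g \<tau> (x mod d ^ n) (x' mod d ^ n)) *
      cnj (U g \<tau> (y div d ^ n) (y' div d ^ n) * U g \<tau> (y mod d ^ n) (y' mod d ^ n))) =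
      of_nat (card (dg d)) ^ n * (\<Sum>c\<in>copy_types n. type_proj d n c $$ (x, y) / of_real (type_rank d n c) * type_proj d n (c \<circ> inv_into UNIV \<tau>) $$ (y', x'))"
    if \<tau>: "\<tau> permutes {..<n}" and xy': "x' < ?D" "y' < ?D" for \<tau> x' y'
  proof -
    have "(\<Sum>g\<in>?G. (U g \<tau> (x div d ^ n) (x' div d ^ n) * U g \<tau> (x mod d ^ n) (x' mod d ^ n)) *
      cnj (U g \<tau> (y div d ^ n) (y' div d ^ n) * U g \<tau> (y mod d ^ n) (y' mod d ^ n))) =
      (\<Sum>g\<in>?G. \<Prod>k<n. mono_u (g k) (?A k x) (?A (\<tau> k) x') * mono_u (g k) (?B k x) (?B (\<tau> k) x') *
         cnj (mono_u (g k) (?A k y) (?A (\<tau> k) y')) * cnj (mono_u (g k) (?B k y) (?B (\<tau> k) y')))"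
      unfolding U_def by (simp add: prod.distrib mult_ac)
    also have "\<dots> = (\<Prod>k<n. \<Sum>g\<in>dg d. mono_u g (?A k x) (?A (\<tau> k) x') * mono_u g (?B k x) (?B (\<tau> k) x') *
         cnj (mono_u g (?A k y) (?A (\<tau> k) y')) * cnj (mono_u g (?B k y) (?B (\<tau> k) y')))"
      by (rule prod_sum_PiE[symmetric]) (auto simp: finite_dg)
    also have "\<dots> = (\<Prod>k<n. of_nat (card (dg d)) * (\<Sum>c<3. copy_proj c (?A k x) (?B k x) (?A k y) (?B k y) *
         copy_proj c (?A (\<tau> k) y') (?B (\<tau> k) y') (?A (\<tau> k) x') (?B (\<tau> k) x') / of_real (copy_rank d c)))"
      using d by (intro prod.cong refl twirl_one dig_less) auto
    also have "\<dots> = of_nat (card (dg d)) ^ n * (\<Prod>k<n. \<Sum>c<3. copy_proj c (?A k x) (?B k x) (?A k y) (?B k y) *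
         copy_proj c (?A (\<tau> k) y') (?B (\<tau> k) y') (?A (\<tau> k) x') (?B (\<tau> k) x') / of_real (copy_rank d c))"
      by (simp add: prod.distrib)
    also have "(\<Prod>k<n. \<Sum>c<3. copy_proj c (?A k x) (?B k x) (?A k y) (?B k y) *
         copy_proj c (?A (\<tau> k) y') (?B (\<tau> k) y') (?A (\<tau> k) x') (?B (\<tau> k) x') / of_real (copy_rank d c)) =
       (\<Sum>c\<in>copy_types n. \<Prod>k<n. copy_proj (c k) (?A k x) (?B k x) (?A k y) (?B k y) *
         copy_proj (c k) (?A (\<tau> k) y') (?B (\<tau> k) y') (?A (\<tau> k) x') (?B (\<tau> k) x') / of_real (copy_rank d (c k)))"
      unfolding copy_types_def by (rule prod_sum_PiE) auto
    also have "\<dots> = (\<Sum>c\<in>copy_types n. type_proj d n c $$ (x, y) / of_real (type_rank d n c) * type_proj d n (c \<circ> inv_into UNIV \<tau>) $$ (y', x'))"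
    proof (intro sum.cong refl)
      fix c
      have "(\<Prod>k<n. copy_proj (c k) (?A (\<tau> k) y') (?B (\<tau> k) y') (?A (\<tau> k) x') (?B (\<tau> k) x')) =
        (\<Prod>k<n. copy_proj (c (inv_into UNIV \<tau> k)) (?A k y') (?B k y') (?A k x') (?B k x'))"
        using prod.permute[OF \<tau>, of "\<lambda>k. copy_proj (c (inv_into UNIV \<tau> k)) (?A k y') (?B k y') (?A k x') (?B k x')"]
        by (simp add: o_def permutes_inverses[OF \<tau>])
      thus "(\<Prod>k<n. copy_proj (c k) (?A k x) (?B k x) (?A k y) (?B k y) *
         copy_proj (c k) (?A (\<tau> k) y') (?B (\<tau> k) y') (?A (\<tau> k) x') (?B (\<tau> k) x') / of_real (copy_rank d (c k))) =
        type_proj d n c $$ (x, y) / of_real (type_rank d n c) * type_proj d n (c \<circ> inv_into UNIV \<tau>) $$ (y', x')"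
        using xy xy' by (simp add: type_proj_def tens_index type_rank_def prod.distrib prod_dividef)
    qed
    finally show ?thesis .
  qed
  have "(\<Sum>(\<tau>, g)\<in>?S \<times> ?G. \<Sum>x'<?D. \<Sum>y'<?D.
      (U g \<tau> (x div d ^ n) (x' div d ^ n) * U g \<tau> (x mod d ^ n) (x' mod d ^ n)) * X $$ (x', y') *
      cnj (U g \<tau> (y div d ^ n) (y' div d ^ n) * U g \<tau> (y mod d ^ n) (y' mod d ^ n))) =
    (\<Sum>\<tau>\<in>?S. \<Sum>x'<?D. \<Sum>y'<?D. X $$ (x', y') * (\<Sum>g\<in>?G.
      (U g \<tau> (x div d ^ n) (x' div d ^ n) * U g \<tau> (x mod d ^ n) (x' mod d ^ n)) *
      cnj (U g \<tau> (y div d ^ n) (y' div d ^ n) * U g \<tau> (y mod d ^ n) (y' mod d ^ n))))"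
    unfolding sum.cartesian_product[symmetric] sum_distrib_left
    by (intro sum.cong refl, subst sum.swap, intro sum.cong refl, subst sum.swap) (simp add: mult_ac)
  also have "\<dots> = (\<Sum>\<tau>\<in>?S. \<Sum>x'<?D. \<Sum>y'<?D. X $$ (x', y') * (of_nat (card (dg d)) ^ n *
      (\<Sum>c\<in>copy_types n. type_proj d n c $$ (x, y) / of_real (type_rank d n c) * type_proj d n (c \<circ> inv_into UNIV \<tau>) $$ (y', x'))))"
    by (intro sum.cong refl) (simp only: inner mem_Collect_eq lessThan_iff)
  also have "\<dots> = (\<Sum>\<tau>\<in>?S. of_nat (card (dg d)) ^ n * (\<Sum>c\<in>copy_types n. type_proj d n c $$ (x, y) / of_real (type_rank d n c) *
      mat_trace (type_proj d n (c \<circ> inv_into UNIV \<tau>) * X)))"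
  proof (intro sum.cong refl)
    fix \<tau>
    have "(\<Sum>x'<?D. \<Sum>y'<?D. X $$ (x', y') * (of_nat (card (dg d)) ^ n *
        (\<Sum>c\<in>copy_types n. type_proj d n c $$ (x, y) / of_real (type_rank d n c) * type_proj d n (c \<circ> inv_into UNIV \<tau>) $$ (y', x')))) =
      (\<Sum>x'<?D. \<Sum>y'<?D. \<Sum>c\<in>copy_types n. of_nat (card (dg d)) ^ n * (type_proj d n c $$ (x, y) / of_real (type_rank d n c) *
        (X $$ (x', y') * type_proj d n (c \<circ> inv_into UNIV \<tau>) $$ (y', x'))))"
      by (simp add: sum_distrib_left mult_ac)
    also have "\<dots> = (\<Sum>x'<?D. \<Sum>c\<in>copy_types n. \<Sum>y'<?D. of_nat (card (dg d)) ^ n * (type_proj d n c $$ (x, y) / of_real (type_rank d n c) *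
        (X $$ (x', y') * type_proj d n (c \<circ> inv_into UNIV \<tau>) $$ (y', x'))))"
      by (rule sum.cong[OF refl], rule sum.swap)
    also have "\<dots> = (\<Sum>c\<in>copy_types n. \<Sum>x'<?D. \<Sum>y'<?D. of_nat (card (dg d)) ^ n * (type_proj d n c $$ (x, y) / of_real (type_rank d n c) *
        (X $$ (x', y') * type_proj d n (c \<circ> inv_into UNIV \<tau>) $$ (y', x'))))"
      by (rule sum.swap)
    also have "\<dots> = of_nat (card (dg d)) ^ n * (\<Sum>c\<in>copy_types n. type_proj d n c $$ (x, y) / of_real (type_rank d n c) *
      mat_trace (type_proj d n (c \<circ> inv_into UNIV \<tau>) * X))"
      unfolding mat_trace_comm[OF type_proj_carrier X] mat_trace_mult[OF X type_proj_carrier]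
      by (simp add: sum_distrib_left)
    finally show "(\<Sum>x'<?D. \<Sum>y'<?D. X $$ (x', y') * (of_nat (card (dg d)) ^ n *
        (\<Sum>c\<in>copy_types n. type_proj d n c $$ (x, y) / of_real (type_rank d n c) * type_proj d n (c \<circ> inv_into UNIV \<tau>) $$ (y', x')))) = \<dots>" .
  qed
  also have "\<dots> = of_nat (card (dg d)) ^ n * (\<Sum>c\<in>copy_types n. type_proj d n c $$ (x, y) / of_real (type_rank d n c) *
      (\<Sum>\<tau>\<in>?S. mat_trace (type_proj d n (c \<circ> inv_into UNIV \<tau>) * X)))"
    by (simp only: sum_distrib_left[symmetric], subst sum.swap, simp only: sum_distrib_left)
  also have "\<dots> = of_nat (card (dg d) ^ n * fact n) * twirl_n d n X $$ (x, y)"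
  proof -
    define s where "s c = (\<Sum>\<tau>\<in>?S. mat_trace (type_proj d n (c \<circ> inv_into UNIV \<tau>) * X))" for c
    have "of_nat (card (dg d) ^ n * fact n) * twirl_n d n X $$ (x, y) =
        (\<Sum>c\<in>copy_types n. of_nat (card (dg d) ^ n * fact n) * (s c / fact n * (type_proj d n c $$ (x, y) / of_real (type_rank d n c))))"
      using xy by (simp add: twirl_n_def twirl_weight_inv s_def[symmetric] sum_distrib_left)
    also have "\<dots> = (\<Sum>c\<in>copy_types n. of_nat (card (dg d)) ^ n * (type_proj d n c $$ (x, y) / of_real (type_rank d n c) * s c))"
      by (intro sum.cong refl) simp
    finally show ?thesis by (simp add: s_def sum_distrib_left)
  qed
  finally show ?thesis ..
qed

theorem sep_op_twirl_n:
  assumes d: "d \<ge> 2" and X: "sep_op (d ^ n) (d ^ n) X"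
  shows "sep_op (d ^ n) (d ^ n) (twirl_n d n X)"
proof -
  let ?D = "d ^ n * d ^ n" and ?G = "PiE {..<n} (\<lambda>_. dg d)" and ?S = "{\<tau>. \<tau> permutes {..<n}}"
  define U where "U = (\<lambda>g \<tau> p p'. \<Prod>k<n. mono_u (g k) (dig d k p) (dig d (\<tau> k) p'))"
  define V where "V = (\<lambda>(\<tau>, g). mat ?D ?D (\<lambda>(x, y). \<Sum>x'<?D. \<Sum>y'<?D.
      (U g \<tau> (x div d ^ n) (x' div d ^ n) * U g \<tau> (x mod d ^ n) (x' mod d ^ n)) * X $$ (x', y') *
      cnj (U g \<tau> (y div d ^ n) (y' div d ^ n) * U g \<tau> (y mod d ^ n) (y' mod d ^ n))))"
  define N where "N = real (card (dg d) ^ n * fact n)"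
  have N: "N > 0" by (simp add: N_def card_dg)
  note Xc = sep_op_carrier[OF X]
  define Y where "Y = mat ?D ?D (\<lambda>(x, y). \<Sum>t\<in>?S \<times> ?G. V t $$ (x, y))"
  have "sep_op (d ^ n) (d ^ n) Y"
  proof (rule sep_op_sum)
    show "finite (?S \<times> ?G)" by (auto simp: finite_permutations finite_dg intro!: finite_PiE)
    show "Y \<in> carrier_mat ?D ?D" by (simp add: Y_def)
    fix t assume "t \<in> ?S \<times> ?G"
    then obtain \<tau> g where t: "t = (\<tau>, g)" by auto
    show "sep_op (d ^ n) (d ^ n) (V t)" unfolding t
      by (rule sep_op_conj[OF X, of _ "U g \<tau>" "U g \<tau>"]) (simp_all add: V_def)
  next
    fix x y assume "x < ?D" "y < ?D"
    thus "Y $$ (x, y) = (\<Sum>t\<in>?S \<times> ?G. V t $$ (x, y))" by (simp add: Y_def)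
  qed
  thus ?thesis
  proof (rule sep_op_scale[where c = "1 / N"])
    fix x y assume xy: "x < ?D" "y < ?D"
    have "complex_of_real N * twirl_n d n X $$ (x, y) = Y $$ (x, y)"
      using twirl_n_eq_average[OF d Xc xy] xy
      by (simp add: N_def Y_def V_def U_def case_prod_unfold)
    thus "twirl_n d n X $$ (x, y) = complex_of_real (1 / N) * Y $$ (x, y)"
      using N by (simp add: field_simps)
  qed (use N in simp_all)
qed

section \<open>A separable state dominating all symmetrized ones\<close>

lemma sep_op_one: "sep_op a b (1\<^sub>m (a * b))"
proof -
  have "kron (1\<^sub>m a) (1\<^sub>m b) = (1\<^sub>m (a * b) :: complex mat)"
  proof (rule eq_matI)
    fix i j assume "i < dim_row (1\<^sub>m (a * b) :: complex mat)" "j < dim_col (1\<^sub>m (a * b) :: complex mat)"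
    hence ij: "i < a * b" "j < a * b" by auto
    have "i = j" if "i div b = j div b" "i mod b = j mod b" using that by (metis div_mult_mod_eq)
    thus "kron (1\<^sub>m a) (1\<^sub>m b) $$ (i, j) = (1\<^sub>m (a * b) :: complex mat) $$ (i, j)"
      using ij div_mod_less[OF ij(1)] div_mod_less[OF ij(2)]
      by (auto simp: kron_index[OF one_carrier_mat one_carrier_mat])
  qed (simp_all add: kron_def)
  thus ?thesis using sep_op_kron[OF psd_one psd_one] by metis
qed

text \<open>Replaces attainment of the supremum, which would need compactness; the factor two
  disappears in the limit.\<close>

lemma exists_near_sup:
  fixes f :: "'a \<Rightarrow> real"
  assumes "S \<noteq> {}" "\<And>s. s \<in> S \<Longrightarrow> 0 \<le> f s" "\<And>s. s \<in> S \<Longrightarrow> f s \<le> b"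
  shows "\<exists>s\<in>S. \<forall>t\<in>S. f t \<le> 2 * f s"
proof (cases "\<forall>t\<in>S. f t = 0")
  case True thus ?thesis using assms(1) by auto
next
  case False
  then obtain t0 where t0: "t0 \<in> S" "f t0 > 0" using assms(2) by force
  define M where "M = (SUP s\<in>S. f s)"
  have bdd: "bdd_above (f ` S)" using assms(3) by (rule bdd_aboveI2)
  have le: "f t \<le> M" if "t \<in> S" for t unfolding M_def using bdd that by (rule cSUP_upper2) simp
  have "M / 2 < (SUP s\<in>S. f s)" using le[OF t0(1)] t0(2) by (simp flip: M_def)
  then obtain s where "s \<in> S" "M / 2 < f s" using less_cSUP_iff[OF assms(1) bdd] by auto
  thus ?thesis using le by (intro bexI[of _ s]) force+
qed

text \<open>For a member of \<open>copy_types n\<close> the number of copies with label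
  \<open>2\<close> is determined by these two counts.\<close>

definition ctype :: "nat \<Rightarrow> (nat \<Rightarrow> nat) \<Rightarrow> nat \<times> nat" where
  "ctype n c = (card {k \<in> {..<n}. c k = 0}, card {k \<in> {..<n}. c k = 1})"

text \<open>Equal counts mean equal multisets of labels, so the two assignments differ by a
  permutation of the copies, to which the weight is insensitive.\<close>

lemma twirl_weight_typ:
  assumes c: "c \<in> copy_types n" and c': "c' \<in> copy_types n" and t: "ctype n c = ctype n c'"
  shows "twirl_weight d n c X = twirl_weight d n c' X"
proof -
  have part: "card {k \<in> {..<n}. c k = 2} = n - card {k \<in> {..<n}. c k = 0} - card {k \<in> {..<n}. c k = 1}" if "c \<in> copy_types n" for c
  proof -
    have "{..<n} = {k \<in> {..<n}. c k = 0} \<union> {k \<in> {..<n}. c k = 1} \<union> {k \<in> {..<n}. c k = 2}"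
      using CnD[OF that] by (force simp: less_Suc_eq eval_nat_numeral)
    hence "n = card ({k \<in> {..<n}. c k = 0} \<union> {k \<in> {..<n}. c k = 1} \<union> {k \<in> {..<n}. c k = 2})"
      by (metis card_lessThan)
    also have "\<dots> = card ({k \<in> {..<n}. c k = 0} \<union> {k \<in> {..<n}. c k = 1}) + card {k \<in> {..<n}. c k = 2}"
      by (rule card_Un_disjoint) auto
    also have "card ({k \<in> {..<n}. c k = 0} \<union> {k \<in> {..<n}. c k = 1}) = card {k \<in> {..<n}. c k = 0} + card {k \<in> {..<n}. c k = 1}"
      by (rule card_Un_disjoint) auto
    finally show ?thesis by linarith
  qed
  have cnt: "card {k \<in> {..<n}. c k = b} = card {k \<in> {..<n}. c' k = b}" for b
  proof -
    consider "b = 0" | "b = 1" | "b = 2" | "b \<ge> 3" by linarith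
    thus ?thesis
    proof cases
      case 4
      have "{k \<in> {..<n}. c k = b} = {}" "{k \<in> {..<n}. c' k = b}  = {}"
        using CnD[OF c] CnD[OF c'] 4 by fastforce+
      thus ?thesis by (simp only:)
    qed (use t part[OF c] part[OF c'] in \<open>simp_all add: ctype_def\<close>)
  qed
  have "image_mset c' (mset_set {..<n}) = image_mset c (mset_set {..<n})"
    by (rule multiset_eqI) (use cnt in \<open>simp add: count_image_mset_eq_card_vimage\<close>)
  from image_mset_eq_implies_permutes[OF finite_lessThan this]
  obtain p where p: "p permutes {..<n}" "\<forall>k\<in>{..<n}. c' k = c (p k)" by blast
  have "c' = c \<circ> p" using p c' copy_types_compose[OF p(1) c] by (intro copy_types_eqI) auto
  thus ?thesis using twirl_weight_sym[OF p(1)] by simp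
qed

lemma twirl_weight_real:
  assumes "c \<in> copy_types n" "psd (d ^ n * d ^ n) X"
  shows "twirl_weight d n c X = of_real (Re (twirl_weight d n c X))" "0 \<le> Re (twirl_weight d n c X)"
proof -
  define f where "f \<tau> = Re (mat_trace (type_proj d n (c \<circ> \<tau>) * X))" for \<tau>
  have f: "mat_trace (type_proj d n (c \<circ> \<tau>) * X) = of_real (f \<tau>)" "0 \<le> f \<tau>" if "\<tau> permutes {..<n}" for \<tau>
    unfolding f_def using psd_type_proj[OF copy_types_compose[OF that assms(1)]] assms(2)
    by (rule mat_trace_herm_real, intro mat_trace_psd_mult) auto
  have e: "twirl_weight d n c X = of_real ((\<Sum>\<tau> | \<tau> permutes {..<n}. f \<tau>) / fact n)"
    unfolding twirl_weight_def using f(1) by simp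
  show "twirl_weight d n c X = of_real (Re (twirl_weight d n c X))" by (simp only: e Re_complex_of_real)
  show "0 \<le> Re (twirl_weight d n c X)" unfolding e Re_complex_of_real using f(2) by (auto intro!: divide_nonneg_pos sum_nonneg)
qed

text \<open>With \<open>twirl_weight_real\<close>, the weights of a state form a probability
  distribution on \<open>copy_types n\<close>.\<close>

lemma sum_twirl_weight:
  assumes X: "X \<in> carrier_mat (d ^ n * d ^ n) (d ^ n * d ^ n)" and "d \<ge> 2"
  shows "(\<Sum>c\<in>copy_types n. twirl_weight d n c X) = mat_trace X"
proof -
  have "mat_trace (twirl_n d n X * 1\<^sub>m (d ^ n * d ^ n)) = (\<Sum>c\<in>copy_types n. twirl_weight d n c X)"
    unfolding mat_trace_twirl_n_mult[OF one_carrier_mat]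
    using type_rank_pos[OF assms(2), of n] by (auto simp: right_mult_one_mat[OF type_proj_carrier] mat_trace_type_proj less_imp_neq[THEN not_sym] intro!: sum.cong)
  thus ?thesis by (simp add: right_mult_one_mat[OF twirl_n_carrier] mat_trace_twirl_n[OF assms(2) X])
qed

text \<open>After symmetrization a separable state is a mixture of \<open>3\<^sup>n\<close> fixed states whose weights only
  depend on the type. There are at most \<open>(n + 1)\<^sup>2\<close> types, so averaging, over all types, separable
  states that nearly maximize the weight of the type gives a state that dominates
  all symmetrized separable states up to a polynomial factor.\<close>

theorem universal_state:
  assumes d: "d \<ge> 2"
  obtains u where "u \<in> sep_states (d ^ n) (d ^ n)"
    "\<And>\<sigma> E. \<sigma> \<in> sep_states (d ^ n) (d ^ n) \<Longrightarrow> psd (d ^ n * d ^ n) E \<Longrightarrow>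
       Re (mat_trace (\<sigma> * twirl_n d n E)) \<le> 2 * (real n + 1)\<^sup>2 * Re (mat_trace (u * E))"
proof -
  let ?D = "d ^ n * d ^ n" and ?S = "sep_states (d ^ n) (d ^ n)"
  let ?K = "{..n} \<times> {..n}"
  have S: "?S \<noteq> {}" using d by (intro sep_states_nonempty) auto
  \<comment> \<open>A representative of each type. Pairs that are not the type of any assignment get
    the constant zero assignment, so that \<open>rp\<close> is total on the grid.\<close>
  define rp where "rp \<kappa> = (if \<exists>c\<in>copy_types n. ctype n c = \<kappa> then SOME c. c \<in> copy_types n \<and> ctype n c = \<kappa> else restrict (\<lambda>_. 0) {..<n})" for \<kappa>
  have rp: "rp \<kappa> \<in> copy_types n" for \<kappa>
  proof (cases "\<exists>c\<in>copy_types n. ctype n c = \<kappa>")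
    case True
    hence "\<exists>c. c \<in> copy_types n \<and> ctype n c = \<kappa>" by blast
    from someI_ex[OF this] show ?thesis using True by (simp add: rp_def)
  qed (auto simp: rp_def copy_types_def)
  have rp_typ: "ctype n (rp (ctype n c)) = ctype n c" if "c \<in> copy_types n" for c
  proof -
    have ex: "\<exists>c'. c' \<in> copy_types n \<and> ctype n c' = ctype n c" using that by blast
    from someI_ex[OF this] show ?thesis using that by (auto simp: rp_def)
  qed
  have tb1: "Re (twirl_weight d n c \<sigma>) \<le> 1" if "c \<in> copy_types n" "\<sigma> \<in> ?S" for c \<sigma>
  proof -
    have "Re (twirl_weight d n c \<sigma>) \<le> (\<Sum>c\<in>copy_types n. Re (twirl_weight d n c \<sigma>))"
      by (rule member_le_sum[OF that(1)]) (use twirl_weight_real(2) sep_states_psd[OF that(2)] in auto)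
    also have "\<dots> = Re (mat_trace \<sigma>)" by (simp flip: sum_twirl_weight[OF sep_states_carrier[OF that(2)] d])
    finally show ?thesis using that(2) by (simp add: sep_states_iff)
  qed
  have "\<exists>s\<in>?S. \<forall>t\<in>?S. Re (twirl_weight d n (rp \<kappa>) t) \<le> 2 * Re (twirl_weight d n (rp \<kappa>) s)" for \<kappa>
    by (rule exists_near_sup[OF S, of _ 1]) (use tb1[OF rp] twirl_weight_real(2)[OF rp] sep_states_psd in auto)
  then obtain s where s: "\<And>\<kappa>. s \<kappa> \<in> ?S"
    and s_max: "\<And>\<kappa> t. t \<in> ?S \<Longrightarrow> Re (twirl_weight d n (rp \<kappa>) t) \<le> 2 * Re (twirl_weight d n (rp \<kappa>) (s \<kappa>))"
    by metis
  define N where "N = (real n + 1)\<^sup>2"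
  have N: "N > 0" "real (card ?K) = N"
    by (simp add: N_def) (simp add: N_def card_cartesian_product power2_eq_square algebra_simps)
  define u0 where "u0 = mat ?D ?D (\<lambda>(x, y). \<Sum>\<kappa>\<in>?K. complex_of_real (1 / N) * s \<kappa> $$ (x, y))"
  have u0c: "u0 \<in> carrier_mat ?D ?D" by (simp add: u0_def)
  have sc: "s \<kappa> \<in> carrier_mat ?D ?D" for \<kappa> by (rule sep_states_carrier[OF s])
  have u0_tr: "mat_trace (u0 * Z) = (\<Sum>\<kappa>\<in>?K. complex_of_real (1 / N) * mat_trace (s \<kappa> * Z))" if "Z \<in> carrier_mat ?D ?D" for Z
    by (rule mat_trace_sum_mult[OF u0c that sc]) (simp add: u0_def)
  have u0: "u0 \<in> ?S"
  proof -
    have "sep_op (d ^ n) (d ^ n) (complex_of_real (1 / N) \<cdot>\<^sub>m s \<kappa>)" for \<kappa>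
      by (rule sep_op_scale[of _ _ "s \<kappa>" "1 / N"]) (use s sc[of \<kappa>] N in \<open>auto simp: sep_states_iff\<close>)
    hence "sep_op (d ^ n) (d ^ n) u0"
    proof (intro sep_op_sum[where L = ?K and X = "\<lambda>\<kappa>. complex_of_real (1 / N) \<cdot>\<^sub>m s \<kappa>" and Y = u0])
      fix x y assume "x < ?D" "y < ?D"
      thus "u0 $$ (x, y) = (\<Sum>\<kappa>\<in>?K. (complex_of_real (1 / N) \<cdot>\<^sub>m s \<kappa>) $$ (x, y))"
        unfolding u0_def using carrier_matD[OF sc] by (auto intro!: sum.cong)
    qed (use u0c in auto)
    moreover have "mat_trace u0 = 1"
    proof -
      have "mat_trace u0 = (\<Sum>\<kappa>\<in>?K. complex_of_real (1 / N) * mat_trace (s \<kappa>))"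
        using u0_tr[OF one_carrier_mat] u0c sc by (simp add: right_mult_one_mat[OF sc] right_mult_one_mat[OF u0c])
      also have "\<dots> = of_real (real (card ?K) / N)"
        using s by (simp add: sep_states_iff)
      finally show ?thesis unfolding N(2) using N(1) by simp
    qed
    ultimately show ?thesis by (simp add: sep_states_iff)
  qed
  have twirl_weight_u0: "twirl_weight d n c u0 = (\<Sum>\<kappa>\<in>?K. complex_of_real (1 / N) * twirl_weight d n c (s \<kappa>))" for c
  proof -
    have "twirl_weight d n c u0 = (\<Sum>\<tau> | \<tau> permutes {..<n}. \<Sum>\<kappa>\<in>?K. complex_of_real (1 / N) * mat_trace (type_proj d n (c \<circ> \<tau>) * s \<kappa>)) / fact n"
      unfolding twirl_weight_def mat_trace_comm[OF type_proj_carrier u0c] mat_trace_comm[OF type_proj_carrier sc]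
      by (simp only: u0_tr[OF type_proj_carrier])
    thus ?thesis unfolding twirl_weight_def
      by (subst (asm) sum.swap) (simp add: sum_distrib_left sum_divide_distrib)
  qed
  \<comment> \<open>The mixture \<open>u0\<close> contains the near-maximizer for the type of
    \<open>c\<close> with weight \<open>1 / N\<close>; near-maximality costs the factor two.\<close>
  have dom: "Re (twirl_weight d n c \<sigma>) \<le> 2 * N * Re (twirl_weight d n c u0)" if c: "c \<in> copy_types n" and \<sigma>: "\<sigma> \<in> ?S" for c \<sigma>
  proof -
    define \<kappa> where "\<kappa> = ctype n c"
    have "card {k \<in> {..<n}. Q k} \<le> n" for Q
      using card_mono[OF finite_lessThan, of "{k \<in> {..<n}. Q k}" n] by auto
    hence \<kappa>: "\<kappa> \<in> ?K" unfolding \<kappa>_def ctype_def by (intro SigmaI) auto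
    have same: "twirl_weight d n (rp \<kappa>) X = twirl_weight d n c X" for X
      by (rule twirl_weight_typ[OF rp c]) (simp add: \<kappa>_def rp_typ c)
    have nn: "0 \<le> Re (twirl_weight d n c (s \<kappa>)) / N" for \<kappa>
      by (intro divide_nonneg_pos twirl_weight_real(2)[OF c] sep_states_psd[OF s] N)
    have "Re (twirl_weight d n c (s \<kappa>)) / N \<le> (\<Sum>\<kappa>\<in>?K. Re (twirl_weight d n c (s \<kappa>)) / N)"
      by (rule member_le_sum[OF \<kappa> nn]) simp
    also have "\<dots> = Re (twirl_weight d n c u0)" by (simp add: twirl_weight_u0)
    finally have "Re (twirl_weight d n c (s \<kappa>)) \<le> N * Re (twirl_weight d n c u0)" using N by (simp add: field_simps)
    moreover have "Re (twirl_weight d n c \<sigma>) \<le> 2 * Re (twirl_weight d n c (s \<kappa>))" using s_max[OF \<sigma>, of \<kappa>] by (simp add: same)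
    ultimately show ?thesis by linarith
  qed
  have expand: "Re (mat_trace (X * twirl_n d n E)) = (\<Sum>c\<in>copy_types n. Re (twirl_weight d n c X) * (Re (mat_trace (type_proj d n c * E)) / type_rank d n c))"
    if X: "psd ?D X" and E: "psd ?D E" for X E
  proof -
    have "mat_trace (X * twirl_n d n E) = (\<Sum>c\<in>copy_types n. twirl_weight d n c X * (mat_trace (type_proj d n c * E) / of_real (type_rank d n c)))"
      unfolding twirl_n_adjoint[OF psd_carrier[OF X] psd_carrier[OF E]] by (rule mat_trace_twirl_n_mult[OF psd_carrier[OF E]])
    also have "\<dots> = (\<Sum>c\<in>copy_types n. of_real (Re (twirl_weight d n c X) * (Re (mat_trace (type_proj d n c * E)) / type_rank d n c)))"
      by (intro sum.cong refl)
        (simp only: of_real_mult of_real_divide twirl_weight_real(1)[OF _ X, symmetric] mat_trace_herm_real[OF psd_type_proj E, symmetric])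
    finally show ?thesis by (simp flip: of_real_sum)
  qed
  show ?thesis
  \<comment> \<open>Self-adjointness moves the twirl from the effect to the state, so that the
    right-hand side involves \<open>E\<close> itself.\<close>
  proof (rule that[of "twirl_n d n u0"])
    show "twirl_n d n u0 \<in> ?S"
      using u0 sep_op_twirl_n[OF d] mat_trace_twirl_n[OF d u0c] by (simp add: sep_states_iff)
    fix \<sigma> E assume \<sigma>: "\<sigma> \<in> ?S" and E: "psd ?D E"
    have "Re (mat_trace (\<sigma> * twirl_n d n E)) \<le> (\<Sum>c\<in>copy_types n. 2 * N * Re (twirl_weight d n c u0) * (Re (mat_trace (type_proj d n c * E)) / type_rank d n c))"
      unfolding expand[OF sep_states_psd[OF \<sigma>] E]
      using dom[OF _ \<sigma>] type_rank_pos[OF d, of n] mat_trace_psd_mult[OF psd_type_proj E]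
      by (intro sum_mono mult_right_mono) (auto intro!: divide_nonneg_pos)
    also have "\<dots> = 2 * N * Re (mat_trace (u0 * twirl_n d n E))"
      by (simp add: expand[OF sep_states_psd[OF u0] E] sum_distrib_left mult_ac)
    also have "mat_trace (u0 * twirl_n d n E) = mat_trace (twirl_n d n u0 * E)"
      by (rule twirl_n_adjoint[OF u0c psd_carrier[OF E]])
    finally show "Re (mat_trace (\<sigma> * twirl_n d n E)) \<le> 2 * (real n + 1)\<^sup>2 * Re (mat_trace (twirl_n d n u0 * E))"
      by (simp add: N_def)
  qed
qed

section \<open>Powers of the antisymmetric state\<close>

definition rho :: "nat \<Rightarrow> nat \<Rightarrow> complex mat" where
  "rho d n = bip_pow d d (antisym_state d) n"

definition antisym_type :: "nat \<Rightarrow> nat \<Rightarrow> nat" where "antisym_type n = restrict (\<lambda>_. 2) {..<n}"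

definition antisym_proj :: "nat \<Rightarrow> nat \<Rightarrow> complex mat" where "antisym_proj d n = type_proj d n (antisym_type n)"

definition antisym_rank :: "nat \<Rightarrow> nat \<Rightarrow> real" where "antisym_rank d n = type_rank d n (antisym_type n)"

lemma antisym_type_copy_types: "antisym_type n \<in> copy_types n" by (auto simp: antisym_type_def copy_types_def)

lemma antisym_rank_pos: "d \<ge> 2 \<Longrightarrow> antisym_rank d n > 0" unfolding antisym_rank_def by (rule type_rank_pos)

lemma antisym_proj_carrier [simp]: "antisym_proj d n \<in> carrier_mat (d ^ n * d ^ n) (d ^ n * d ^ n)"
  by (simp add: antisym_proj_def)

lemma antisym_carrier: "antisym_state d \<in> carrier_mat (d * d) (d * d)"
  unfolding antisym_state_def by (intro smult_carrier_mat minus_carrier_mat) (simp add: swap_op_def)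

lemma rho_carrier [simp]: "rho d n \<in> carrier_mat (d ^ n * d ^ n) (d ^ n * d ^ n)"
  by (simp add: rho_def bip_pow_def regroup_def)

lemma antisym_proj_dim [simp]: "dim_row (antisym_proj d n) = d ^ n * d ^ n" "dim_col (antisym_proj d n) = d ^ n * d ^ n"
  using antisym_proj_carrier[of d n] by blast+

lemma rho_dim [simp]: "dim_row (rho d n) = d ^ n * d ^ n" "dim_col (rho d n) = d ^ n * d ^ n"
  using rho_carrier[of d n] by blast+

text \<open>The vectors \<open>e\<^sub>i \<otimes> e\<^sub>i\<close> are symmetric, so removing them
  leaves the antisymmetric projection intact and \<open>copy_proj 2\<close> is all of it.\<close>

lemma kern_antisym:
  assumes "d \<ge> 2" "i < d" "j < d" "k < d" "l < d"
  shows "kern d (antisym_state d) i j k l = copy_proj 2 i j k l / of_real (copy_rank d 2)"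
proof -
  have lt: "i * d + j < d * d" "k * d + l < d * d" using assms by (auto intro: pair_index_less)
  have eq: "i * d + j = k * d + l \<longleftrightarrow> i = k \<and> j = l"
  proof
    assume e: "i * d + j = k * d + l"
    have "(i * d + j) div d = i" "(k * d + l) div d = k" "(i * d + j) mod d = j" "(k * d + l) mod d = l"
      using assms by auto
    thus "i = k \<and> j = l" using e by metis
  qed auto
  define a b :: complex where "a = (if k = i \<and> l = j then 1 else 0)" and "b = (if k = j \<and> l = i then 1 else 0)"
  have "kern d (antisym_state d) i j k l =
      ((if i = k \<and> j = l then 1 else 0) - (if i = l \<and> j = k then 1 else 0)) / of_real (real d * (real d - 1))"
    using lt assms by (simp add: kern_def antisym_state_def swap_op_def eq)
  also have "\<dots> = (a - b) / of_real (real d * (real d - 1))"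
    unfolding a_def b_def by (simp only: eq_commute[of k] eq_commute[of l] conj_commute[of "j = k"])
  finally have k: "kern d (antisym_state d) i j k l = (a - b) / of_real (real d * (real d - 1))" .
  have "copy_proj 2 i j k l = (if i = j then 0 else (a - b) / 2)"
    unfolding copy_proj_def a_def b_def by (simp only: zero_neq_numeral[symmetric] if_False) simp
  moreover have "a = b" if "i = j" unfolding a_def b_def that ..
  ultimately have t: "copy_proj 2 i j k l = (a - b) / 2" by auto
  have tqd2: "copy_rank d 2 = real d * (real d - 1) / 2" by (simp add: copy_rank_def)
  have "u / x = u / 2 / (x / 2)" for u x :: complex by simp
  thus ?thesis unfolding k t tqd2 of_real_divide of_real_numeral .
qed

lemma rho_index:
  assumes "d \<ge> 2" "x < d ^ n * d ^ n" "y < d ^ n * d ^ n"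
  shows "rho d n $$ (x, y) = antisym_proj d n $$ (x, y) / of_real (antisym_rank d n)"
  using assms unfolding rho_def bip_pow_tens[OF antisym_carrier] antisym_proj_def antisym_rank_def type_proj_def type_rank_def
  by (simp add: tens_index kern_antisym dig_less antisym_type_def prod_dividef power_divide)

lemma rho_antisym_proj: "d \<ge> 2 \<Longrightarrow> rho d n = complex_of_real (1 / antisym_rank d n) \<cdot>\<^sub>m antisym_proj d n"
  by (rule eq_matI) (auto simp: rho_index)

lemma psd_antisym_proj: "psd (d ^ n * d ^ n) (antisym_proj d n)"
  unfolding antisym_proj_def by (rule psd_type_proj[OF antisym_type_copy_types])

lemma mat_trace_smult_mult:
  assumes "A \<in> carrier_mat D D" "B \<in> carrier_mat D D"
  shows "mat_trace ((k \<cdot>\<^sub>m A) * B) = k * mat_trace (A * B)"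
  using assms by (simp add: mat_trace_mult[of _ D] sum_distrib_left mult_ac)

lemma mat_trace_rho_mult:
  assumes "d \<ge> 2" "X \<in> carrier_mat (d ^ n * d ^ n) (d ^ n * d ^ n)"
  shows "mat_trace (rho d n * X) = mat_trace (antisym_proj d n * X) / of_real (antisym_rank d n)"
  unfolding rho_antisym_proj[OF assms(1)] mat_trace_smult_mult[OF antisym_proj_carrier assms(2)] by simp

lemma density_rho:
  assumes d: "d \<ge> 2" shows "density (d ^ n * d ^ n) (rho d n)"
proof -
  let ?D = "d ^ n * d ^ n"
  have "psd ?D (rho d n)"
    by (rule psd_nonneg_sum[of "{0::nat}" _ _ "\<lambda>_. antisym_proj d n" "\<lambda>_. 1 / antisym_rank d n"])
      (use psd_antisym_proj antisym_rank_pos[OF d, of n] rho_index[OF d] in auto)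
  moreover have "mat_trace (rho d n) = 1"
    using mat_trace_rho_mult[OF d, of "1\<^sub>m ?D" n] mat_trace_type_proj[OF antisym_type_copy_types, of d n] antisym_rank_pos[OF d, of n]
    by (simp add: right_mult_one_mat[OF rho_carrier] right_mult_one_mat[OF antisym_proj_carrier])
      (simp add: antisym_proj_def antisym_rank_def)
  ultimately show ?thesis by (simp add: density_def)
qed

lemma type_proj_mult_twirl_n:
  assumes c: "c \<in> copy_types n" and xy: "x < d ^ n * d ^ n" "y < d ^ n * d ^ n"
  shows "(type_proj d n c * twirl_n d n X) $$ (x, y) = twirl_weight d n c X / of_real (type_rank d n c) * type_proj d n c $$ (x, y)"
proof -
  let ?D = "d ^ n * d ^ n"
  have "(type_proj d n c * twirl_n d n X) $$ (x, y) = (\<Sum>z<?D. \<Sum>c'\<in>copy_types n. twirl_weight d n c' X / of_real (type_rank d n c') * (type_proj d n c $$ (x, z) * type_proj d n c' $$ (z, y)))"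
    unfolding mult_index[OF type_proj_carrier twirl_n_carrier xy]
    using xy by (intro sum.cong refl) (simp add: twirl_n_def sum_distrib_left mult_ac)
  also have "\<dots> = (\<Sum>c'\<in>copy_types n. twirl_weight d n c' X / of_real (type_rank d n c') * (\<Sum>z<?D. type_proj d n c $$ (x, z) * type_proj d n c' $$ (z, y)))"
    by (subst sum.swap) (simp only: sum_distrib_left)
  also have "\<dots> = (\<Sum>c'\<in>copy_types n. twirl_weight d n c' X / of_real (type_rank d n c') * (type_proj d n c * type_proj d n c') $$ (x, y))"
    unfolding mult_index[OF type_proj_carrier type_proj_carrier xy] ..
  also have "\<dots> = (\<Sum>c'\<in>copy_types n. if c' = c then twirl_weight d n c X / of_real (type_rank d n c) * type_proj d n c $$ (x, y) else 0)"
    using xy by (intro sum.cong refl) (auto simp: type_proj_mult[OF c])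
  finally show ?thesis using c by simp
qed

lemma twirl_weight_antisym_type: "twirl_weight d n (antisym_type n) X = mat_trace (antisym_proj d n * X)"
proof -
  have "type_proj d n (antisym_type n \<circ> \<tau>) = antisym_proj d n" if "\<tau> permutes {..<n}" for \<tau>
    unfolding antisym_proj_def by (rule type_proj_cong) (use permutes_lessThan[OF that] in \<open>auto simp: antisym_type_def\<close>)
  hence "twirl_weight d n (antisym_type n) X = (\<Sum>\<tau> | \<tau> permutes {..<n}. mat_trace (antisym_proj d n * X)) / fact n"
    unfolding twirl_weight_def by simp
  thus ?thesis by (simp add: card_permutations)
qed

text \<open>In the expansion of the twirl, the block of \<open>antisym_type n\<close> is exactly
  \<open>h\<close> times \<open>rho d n\<close>, and the other blocks are positive and orthogonal to
  it. The eigenvalue equation serves the relative entropy, the operator inequality the converse for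
  tests.\<close>

lemma rho_twirl_n:
  assumes d: "d \<ge> 2" and X: "psd (d ^ n * d ^ n) X"
  defines "h \<equiv> Re (mat_trace (antisym_proj d n * X))"
  shows "rho d n * twirl_n d n X = complex_of_real (h / antisym_rank d n) \<cdot>\<^sub>m rho d n"
    and "psd (d ^ n * d ^ n) (twirl_n d n X - complex_of_real h \<cdot>\<^sub>m rho d n)"
proof -
  let ?D = "d ^ n * d ^ n"
  have tbh: "twirl_weight d n (antisym_type n) X = of_real h"
    using twirl_weight_real(1)[OF antisym_type_copy_types X] by (simp add: h_def twirl_weight_antisym_type)
  show "rho d n * twirl_n d n X = complex_of_real (h / antisym_rank d n) \<cdot>\<^sub>m rho d n"
  proof (rule eq_matI)
    fix x y assume "x < dim_row (complex_of_real (h / antisym_rank d n) \<cdot>\<^sub>m rho d n)" "y < dim_col (complex_of_real (h / antisym_rank d n) \<cdot>\<^sub>m rho d n)"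
    hence xy: "x < ?D" "y < ?D" using rho_carrier[of d n] by auto
    have "(rho d n * twirl_n d n X) $$ (x, y) = (\<Sum>z<?D. antisym_proj d n $$ (x, z) * twirl_n d n X $$ (z, y)) / of_real (antisym_rank d n)"
      unfolding mult_index[OF rho_carrier twirl_n_carrier xy] sum_divide_distrib
      using xy by (intro sum.cong refl) (simp add: rho_index[OF d])
    also have "\<dots> = (antisym_proj d n * twirl_n d n X) $$ (x, y) / of_real (antisym_rank d n)"
      unfolding mult_index[OF antisym_proj_carrier twirl_n_carrier xy] ..
    also have "(antisym_proj d n * twirl_n d n X) $$ (x, y) = of_real h / of_real (antisym_rank d n) * antisym_proj d n $$ (x, y)"
      unfolding antisym_proj_def type_proj_mult_twirl_n[OF antisym_type_copy_types xy] tbh antisym_rank_def ..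
    finally show "(rho d n * twirl_n d n X) $$ (x, y) = (complex_of_real (h / antisym_rank d n) \<cdot>\<^sub>m rho d n) $$ (x, y)"
      using xy by (simp add: rho_index[OF d])
  qed (simp_all add: twirl_n_def)
  show "psd ?D (twirl_n d n X - complex_of_real h \<cdot>\<^sub>m rho d n)"
  proof (rule psd_nonneg_sum[where L = "copy_types n - {antisym_type n}" and X = "type_proj d n" and w = "\<lambda>c. Re (twirl_weight d n c X) / type_rank d n c"])
    show "twirl_n d n X - complex_of_real h \<cdot>\<^sub>m rho d n \<in> carrier_mat ?D ?D" by (intro minus_carrier_mat) simp
    fix c assume "c \<in> copy_types n - {antisym_type n}"
    thus "psd ?D (type_proj d n c)" "0 \<le> Re (twirl_weight d n c X) / type_rank d n c"
      using psd_type_proj twirl_weight_real(2)[OF _ X] type_rank_pos[OF d, of n c] by (auto intro!: divide_nonneg_pos)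
  next
    fix x y assume xy: "x < ?D" "y < ?D"
    have "twirl_n d n X $$ (x, y) = (\<Sum>c\<in>copy_types n. complex_of_real (Re (twirl_weight d n c X) / type_rank d n c) * type_proj d n c $$ (x, y))"
      using xy twirl_weight_real(1)[OF _ X] by (auto simp: twirl_n_def intro!: sum.cong)
    also have "\<dots> = complex_of_real h * rho d n $$ (x, y) + (\<Sum>c\<in>copy_types n - {antisym_type n}. complex_of_real (Re (twirl_weight d n c X) / type_rank d n c) * type_proj d n c $$ (x, y))"
      by (subst sum.remove[OF finite_copy_types antisym_type_copy_types]) (simp add: tbh rho_index[OF d xy] antisym_proj_def antisym_rank_def)
    finally show "(twirl_n d n X - complex_of_real h \<cdot>\<^sub>m rho d n) $$ (x, y) =
        (\<Sum>c\<in>copy_types n - {antisym_type n}. complex_of_real (Re (twirl_weight d n c X) / type_rank d n c) * type_proj d n c $$ (x, y))"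
      using xy by simp
  qed simp
qed

lemma psd_one_minus_antisym_proj: "psd (d ^ n * d ^ n) (1\<^sub>m (d ^ n * d ^ n) - antisym_proj d n)"
proof (rule psd_nonneg_sum[where L = "copy_types n - {antisym_type n}" and X = "type_proj d n" and w = "\<lambda>_. 1"])
  fix x y assume xy: "x < d ^ n * d ^ n" "y < d ^ n * d ^ n"
  have "1\<^sub>m (d ^ n * d ^ n) $$ (x, y) = (\<Sum>c\<in>copy_types n. type_proj d n c $$ (x, y))" using xy by (simp add: sum_type_proj)
  also have "\<dots> = antisym_proj d n $$ (x, y) + (\<Sum>c\<in>copy_types n - {antisym_type n}. type_proj d n c $$ (x, y))"
    by (subst sum.remove[OF finite_copy_types antisym_type_copy_types]) (simp add: antisym_proj_def)
  finally show "(1\<^sub>m (d ^ n * d ^ n) - antisym_proj d n) $$ (x, y) = (\<Sum>c\<in>copy_types n - {antisym_type n}. complex_of_real 1 * type_proj d n c $$ (x, y))"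
    using xy by simp
qed (auto intro: psd_type_proj)

text \<open>The state is invariant under the twirl, so symmetrizing an effect does not change its
  probability.\<close>

lemma twirl_n_rho:
  assumes d: "d \<ge> 2" and X: "X \<in> carrier_mat (d ^ n * d ^ n) (d ^ n * d ^ n)"
  shows "mat_trace (rho d n * twirl_n d n X) = mat_trace (rho d n * X)"
proof -
  have P: "antisym_proj d n \<in> carrier_mat (d ^ n * d ^ n) (d ^ n * d ^ n)" by simp
  have "mat_trace (antisym_proj d n * twirl_n d n X) = (\<Sum>c\<in>copy_types n. twirl_weight d n c X * (mat_trace (type_proj d n c * antisym_proj d n) / of_real (type_rank d n c)))"
    unfolding mat_trace_comm[OF P twirl_n_carrier] by (rule mat_trace_twirl_n_mult[OF P])
  also have "\<dots> = (\<Sum>c\<in>copy_types n. if c = antisym_type n then twirl_weight d n (antisym_type n) X else 0)"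
  proof (intro sum.cong refl)
    fix c assume c: "c \<in> copy_types n"
    have "mat_trace (type_proj d n c * antisym_proj d n) = (if c = antisym_type n then of_real (type_rank d n c) else 0)"
      unfolding antisym_proj_def type_proj_mult[OF c antisym_type_copy_types] by (auto simp: mat_trace_type_proj antisym_type_copy_types) (simp add: mat_trace_def)
    thus "twirl_weight d n c X * (mat_trace (type_proj d n c * antisym_proj d n) / of_real (type_rank d n c)) = (if c = antisym_type n then twirl_weight d n (antisym_type n) X else 0)"
      using type_rank_pos[OF d, of n c] by auto
  qed
  also have "\<dots> = mat_trace (antisym_proj d n * X)" using antisym_type_copy_types by (simp add: twirl_weight_antisym_type)
  finally show ?thesis by (simp add: mat_trace_rho_mult[OF d twirl_n_carrier] mat_trace_rho_mult[OF d X])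
qed

section \<open>Partial transposition and the Werner state\<close>

text \<open>A tensor product of positive kernels is positive: expanding the product over the copies
  gives one squared modulus for each choice \<open>f\<close> of a factor per copy.\<close>

lemma prod_kernel_nonneg:
  fixes m :: "nat \<Rightarrow> 'l \<Rightarrow> nat \<Rightarrow> nat \<Rightarrow> complex" and \<eta> :: "nat \<Rightarrow> nat \<Rightarrow> complex"
  assumes "finite L"
  shows "0 \<le> Re (\<Sum>p<N. \<Sum>s<N. \<Sum>p'<N. \<Sum>s'<N. cnj (\<eta> p s) * \<eta> p' s' *
     (\<Prod>k<n. \<Sum>l\<in>L. m k l (dig d k p) (dig d k s) * cnj (m k l (dig d k p') (dig d k s'))))"
proof -
  define F where "F = PiE {..<n} (\<lambda>_. L)"
  define w where "w f p s = (\<Prod>k<n. m k (f k) (dig d k p) (dig d k s))" for f p s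
  define v where "v f = (\<Sum>p<N. \<Sum>s<N. cnj (\<eta> p s) * w f p s)" for f
  have "(\<Prod>k<n. \<Sum>l\<in>L. m k l (dig d k p) (dig d k s) * cnj (m k l (dig d k p') (dig d k s'))) =
      (\<Sum>f\<in>F. w f p s * cnj (w f p' s'))" for p s p' s'
    unfolding F_def w_def by (subst prod_sum_PiE) (auto simp: assms prod.distrib)
  hence "(\<Sum>p<N. \<Sum>s<N. \<Sum>p'<N. \<Sum>s'<N. cnj (\<eta> p s) * \<eta> p' s' *
     (\<Prod>k<n. \<Sum>l\<in>L. m k l (dig d k p) (dig d k s) * cnj (m k l (dig d k p') (dig d k s')))) =
     (\<Sum>p<N. \<Sum>s<N. \<Sum>p'<N. \<Sum>s'<N. \<Sum>f\<in>F. (cnj (\<eta> p s) * w f p s) * cnj (cnj (\<eta> p' s') * w f p' s'))"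
    by (simp add: sum_distrib_left mult_ac)
  also have "\<dots> = (\<Sum>p<N. \<Sum>s<N. \<Sum>p'<N. \<Sum>f\<in>F. \<Sum>s'<N. (cnj (\<eta> p s) * w f p s) * cnj (cnj (\<eta> p' s') * w f p' s'))"
    by (rule sum.cong[OF refl], rule sum.cong[OF refl], rule sum.cong[OF refl], rule sum.swap)
  also have "\<dots> = (\<Sum>p<N. \<Sum>s<N. \<Sum>f\<in>F. \<Sum>p'<N. \<Sum>s'<N. (cnj (\<eta> p s) * w f p s) * cnj (cnj (\<eta> p' s') * w f p' s'))"
    by (rule sum.cong[OF refl], rule sum.cong[OF refl], rule sum.swap)
  also have "\<dots> = (\<Sum>p<N. \<Sum>s<N. \<Sum>f\<in>F. (cnj (\<eta> p s) * w f p s) * cnj (v f))"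
    by (simp add: v_def sum_distrib_left)
  also have "\<dots> = (\<Sum>p<N. \<Sum>f\<in>F. \<Sum>s<N. (cnj (\<eta> p s) * w f p s) * cnj (v f))"
    by (rule sum.cong[OF refl], rule sum.swap)
  also have "\<dots> = (\<Sum>f\<in>F. \<Sum>p<N. \<Sum>s<N. (cnj (\<eta> p s) * w f p s) * cnj (v f))"
    by (rule sum.swap)
  also have "\<dots> = (\<Sum>f\<in>F. v f * cnj (v f))" by (simp add: v_def sum_distrib_right)
  also have "\<dots> = of_real (\<Sum>f\<in>F. (cmod (v f))\<^sup>2)"
    by (simp add: complex_norm_square del: of_real_power)
  finally show ?thesis by (simp add: sum_nonneg)
qed

lemma quad_tens_prodvec:
  "quad (d ^ n * d ^ n) (tens d n M) (prodvec (d ^ n) \<alpha> \<beta>) =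
    (\<Sum>p<d ^ n. \<Sum>q<d ^ n. \<Sum>p'<d ^ n. \<Sum>q'<d ^ n. cnj (\<alpha> p) * cnj (\<beta> q) * \<alpha> p' * \<beta> q' *
       (\<Prod>k<n. M k (dig d k p) (dig d k q) (dig d k p') (dig d k q')))"
proof -
  let ?N = "d ^ n"
  define G where "G p q p' q' = cnj (\<alpha> p) * cnj (\<beta> q) * \<alpha> p' * \<beta> q' *
     (\<Prod>k<n. M k (dig d k p) (dig d k q) (dig d k p') (dig d k q'))" for p q p' q'
  have "quad (?N * ?N) (tens d n M) (prodvec ?N \<alpha> \<beta>) = (\<Sum>x<?N * ?N. \<Sum>y<?N * ?N. G (x div ?N) (x mod ?N) (y div ?N) (y mod ?N))"
    unfolding quad_def by (intro sum.cong refl) (simp add: tens_index prodvec_def G_def mult_ac)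
  also have "\<dots> = (\<Sum>x<?N * ?N. \<Sum>p'<?N. \<Sum>q'<?N. G (x div ?N) (x mod ?N) p' q')"
    by (rule sum.cong[OF refl], rule sum_div_mod)
  also have "\<dots> = (\<Sum>p<?N. \<Sum>q<?N. \<Sum>p'<?N. \<Sum>q'<?N. G p q p' q')" by (rule sum_div_mod)
  finally show ?thesis by (simp add: G_def)
qed

text \<open>A product vector is not affected by partial transposition, up to conjugating one factor.\<close>

lemma quad_tens_partial_transpose:
  "quad (d ^ n * d ^ n) (tens d n M) (prodvec (d ^ n) \<alpha> \<beta>) =
    (\<Sum>p<d ^ n. \<Sum>q<d ^ n. \<Sum>p'<d ^ n. \<Sum>q'<d ^ n. cnj (\<alpha> p * cnj (\<beta> q)) * (\<alpha> p' * cnj (\<beta> q')) *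
       (\<Prod>k<n. M k (dig d k p) (dig d k q') (dig d k p') (dig d k q)))"
proof -
  let ?N = "d ^ n"
  define G where "G p q p' q' = cnj (\<alpha> p) * cnj (\<beta> q) * \<alpha> p' * \<beta> q' *
     (\<Prod>k<n. M k (dig d k p) (dig d k q) (dig d k p') (dig d k q'))" for p q p' q'
  have "(\<Sum>q<?N. \<Sum>p'<?N. \<Sum>q'<?N. G p q p' q') = (\<Sum>q<?N. \<Sum>p'<?N. \<Sum>q'<?N. G p q' p' q)" for p
  proof -
    have "(\<Sum>q<?N. \<Sum>p'<?N. \<Sum>q'<?N. G p q p' q') = (\<Sum>q<?N. \<Sum>q'<?N. \<Sum>p'<?N. G p q p' q')"
      by (rule sum.cong[OF refl], rule sum.swap)
    also have "\<dots> = (\<Sum>q'<?N. \<Sum>q<?N. \<Sum>p'<?N. G p q p' q')" by (rule sum.swap)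
    also have "\<dots> = (\<Sum>q'<?N. \<Sum>p'<?N. \<Sum>q<?N. G p q p' q')"
      by (rule sum.cong[OF refl], rule sum.swap)
    finally show ?thesis .
  qed
  thus ?thesis unfolding quad_tens_prodvec by (simp add: G_def mult_ac)
qed

text \<open>Proportional to the identity plus \<open>(d - 2) / d\<close> times the flip. This
  coefficient makes its partial transpose proportional to the absolute value of that of the
  antisymmetric state; the denominator is the resulting trace.\<close>

definition werner :: "nat \<Rightarrow> complex mat" where
  "werner d = mat (d * d) (d * d) (\<lambda>(x, y).
     ((if x = y then 1 else 0) + of_real ((real d - 2) / real d) * (if x div d = y mod d \<and> x mod d = y div d then 1 else 0)) /
     of_real ((real d + 2) * (real d - 1)))"

lemma werner_carrier [simp]: "werner d \<in> carrier_mat (d * d) (d * d)"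
  by (simp add: werner_def)

lemma div_mod_eq_iff: "x = y \<longleftrightarrow> x div d = y div d \<and> x mod d = y mod (d::nat)"
  by (metis div_mult_mod_eq)

text \<open>Identity plus flip equals the average of the projections onto phase vectors
  \<open>\<psi> \<otimes> \<psi>\<close>, whose entries are one where either matches, plus the
  projections onto \<open>e\<^sub>i \<otimes> e\<^sub>i\<close>, whose entries are one where both
  match. Since \<open>0 \<le> b \<le> 1\<close>, the remaining identity part has a nonnegative
  coefficient.\<close>

lemma sep_op_werner:
  assumes d: "d \<ge> 2" shows "sep_op d d (werner d)"
proof -
  define c where "c = 1 / ((real d + 2) * (real d - 1))"
  define b where "b = (real d - 2) / real d"
  have c0: "c \<ge> 0" and b0: "0 \<le> b" "b \<le> 1" using d by (auto simp: c_def b_def)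
  define V where "V \<theta> = mat (d * d) (d * d) (\<lambda>(x, y). prodvec d (\<lambda>i. cube_root ^ \<theta> i) (\<lambda>i. cube_root ^ \<theta> i) x * cnj (prodvec d (\<lambda>i. cube_root ^ \<theta> i) (\<lambda>i. cube_root ^ \<theta> i) y))" for \<theta> :: "nat \<Rightarrow> nat"
  define V' where "V' = mat (d * d) (d * d) (\<lambda>(x, y). \<Sum>\<theta>\<in>PiE {..<d} (\<lambda>_. {..<3::nat}). V \<theta> $$ (x, y))"
  define Q where "Q = mat (d * d) (d * d) (\<lambda>(x, y). \<Sum>i<d. mat (d * d) (d * d) (\<lambda>(x, y).
     prodvec d (\<lambda>j. if j = i then 1 else 0) (\<lambda>j. if j = i then 1 else 0) x * cnj (prodvec d (\<lambda>j. if j = i then 1 else 0) (\<lambda>j. if j = i then 1 else 0) y)) $$ (x, y))"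
  have V': "sep_op d d V'"
    by (rule sep_op_sum[where L = "PiE {..<d} (\<lambda>_. {..<3::nat})" and X = V])
      (auto simp: V'_def V_def intro: sep_op_rank1 finite_PiE)
  have Q: "sep_op d d Q" unfolding Q_def
    by (rule sep_op_sum[where L = "{..<d}", OF _ _ sep_op_rank1]) auto
  define W1 where "W1 = complex_of_real (c * (1 - b)) \<cdot>\<^sub>m 1\<^sub>m (d * d)"
  define W2 where "W2 = complex_of_real (c * b / 3 ^ d) \<cdot>\<^sub>m V'"
  define W3 where "W3 = complex_of_real (c * b) \<cdot>\<^sub>m Q"
  have W: "sep_op d d W1" "sep_op d d W2" "sep_op d d W3"
  proof -
    show "sep_op d d W1"
      by (rule sep_op_scale[OF sep_op_one, of "c * (1 - b)"]) (use c0 b0 in \<open>auto simp: W1_def\<close>)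
    show "sep_op d d W2"
      by (rule sep_op_scale[OF V', of "c * b / 3 ^ d"]) (use c0 b0 in \<open>auto simp: W2_def V'_def\<close>)
    show "sep_op d d W3"
      by (rule sep_op_scale[OF Q, of "c * b"]) (use c0 b0 in \<open>auto simp: W3_def Q_def\<close>)
  qed
  show ?thesis
  proof (rule sep_op_sum_list[where js = "[W1, W2, W3]" and X = "\<lambda>X. X"])
    fix x y assume xy: "x < d * d" "y < d * d"
    note l = div_mod_less[OF xy(1)] div_mod_less[OF xy(2)]
    have v: "V' $$ (x, y) = (if y div d = x div d \<and> y mod d = x mod d \<or> y div d = x mod d \<and> y mod d = x div d then 3 ^ d else 0)"
      using xy phase_sum[OF l] by (simp add: V'_def V_def prodvec_def mult_ac)
    have q: "Q $$ (x, y) = (if x div d = x mod d \<and> y div d = x div d \<and> y mod d = x div d then 1 else 0)"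
    proof -
      have "Q $$ (x, y) = (\<Sum>i<d. if i = x div d then (if x div d = x mod d \<and> y div d = x div d \<and> y mod d = x div d then 1 else 0) else 0)"
      proof -
        have "Q $$ (x, y) = (\<Sum>i<d. prodvec d (\<lambda>j. if j = i then 1 else 0) (\<lambda>j. if j = i then 1 else 0) x *
            cnj (prodvec d (\<lambda>j. if j = i then 1 else 0) (\<lambda>j. if j = i then 1 else 0) y))"
          using xy by (simp add: Q_def)
        also have "\<dots> = (\<Sum>i<d. if i = x div d then (if x div d = x mod d \<and> y div d = x div d \<and> y mod d = x div d then 1 else 0) else 0)"
          by (intro sum.cong refl) (auto simp: prodvec_def)
        finally show ?thesis .
      qed
      also have "\<dots> = (if x div d = x mod d \<and> y div d = x div d \<and> y mod d = x div d then 1 else 0)"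
        unfolding sum.delta[OF finite_lessThan] using l(1) by (simp only: lessThan_iff if_True)
      finally show ?thesis .
    qed
    define A B where "A \<longleftrightarrow> x div d = y div d \<and> x mod d = y mod d" and "B \<longleftrightarrow> x div d = y mod d \<and> x mod d = y div d"
    have vq: "V' $$ (x, y) = (if A \<or> B then 3 ^ d else 0)" "Q $$ (x, y) = (if A \<and> B then 1 else 0)"
      unfolding v q A_def B_def by (auto intro!: if_cong)
    have e: "(x = y) = A" unfolding A_def by (rule div_mod_eq_iff)
    have w: "werner d $$ (x, y) = complex_of_real c * ((if A then 1 else 0) + complex_of_real b * (if B then 1 else 0))"
      using xy by (simp add: werner_def c_def b_def e B_def)
    have o: "(1\<^sub>m (d * d)) $$ (x, y) = (if A then 1 else (0::complex))"
      using xy by (simp add: e)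
    have "(\<Sum>X\<leftarrow>[W1, W2, W3]. X $$ (x, y)) = complex_of_real (c * (1 - b)) * (if A then 1 else 0) +
       (complex_of_real (c * b / 3 ^ d) * (if A \<or> B then 3 ^ d else 0) + complex_of_real (c * b) * (if A \<and> B then 1 else 0))"
      using xy sep_op_carrier[OF V'] sep_op_carrier[OF Q] by (simp add: W1_def W2_def W3_def o flip: vq)
    also have "\<dots> = werner d $$ (x, y)" unfolding w by (cases A; cases B) (simp_all add: algebra_simps)
    finally show "werner d $$ (x, y) = (\<Sum>X\<leftarrow>[W1, W2, W3]. X $$ (x, y))" ..
  qed (use W in auto)
qed

lemma werner_sep_state:
  assumes d: "d \<ge> 2" shows "werner d \<in> sep_states d d"
proof -
  define K where "K = (real d + 2) * (real d - 1)"
  define b where "b = (real d - 2) / real d"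
  have K0: "K > 0" using d by (simp add: K_def)
  have bd: "b * real d = real d - 2" using d by (simp add: b_def)
  have "mat_trace (werner d) = (\<Sum>x<d * d. (1 + of_real b * (if x div d = x mod d then 1 else 0)) / of_real K)"
    by (auto simp: mat_trace_def werner_def b_def K_def intro!: sum.cong)
  also have "\<dots> = (\<Sum>i<d. \<Sum>j<d. (1 + of_real b * (if i = j then 1 else 0)) / of_real K)"
    by (rule sum_div_mod)
  also have "\<dots> = (\<Sum>i<d. \<Sum>j<d. 1 / of_real K + (if i = j then of_real b / of_real K else 0))"
    by (intro sum.cong refl) (simp add: add_divide_distrib)
  also have "\<dots> = (of_real (real d * real d + b * real d)) / of_real K"
    by (simp add: sum.distrib add_divide_distrib algebra_simps)
  also have "real d * real d + b * real d = K" by (simp add: bd K_def algebra_simps)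
  also have "complex_of_real K / complex_of_real K = 1" using K0 by simp
  finally have "mat_trace (werner d) = 1" .
  thus ?thesis using sep_op_werner[OF d] by (simp add: sep_states_iff)
qed

lemma bip_pow_0: "R \<in> carrier_mat (d * d) (d * d) \<Longrightarrow> bip_pow d d R 0 = 1\<^sub>m 1"
  by (rule eq_matI) (auto simp: bip_pow_tens tens_def)

lemma bip_pow_1: 
  assumes "R \<in> carrier_mat (d * d) (d * d)" shows "bip_pow d d R 1 = R"
proof (rule eq_matI)
  fix x y assume "x < dim_row R" "y < dim_col R"
  hence xy: "x < d * d" "y < d * d" using assms by auto
  thus "bip_pow d d R 1 $$ (x, y) = R $$ (x, y)"
    using div_mod_less[OF xy(1)] div_mod_less[OF xy(2)] by (simp add: bip_pow_tens[OF assms] tens_def kern_def dig_def)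
qed (use assms in \<open>auto simp: bip_pow_def regroup_def\<close>)

lemma box_sep_states:
  assumes "\<sigma> \<in> sep_states a1 b1" "\<tau> \<in> sep_states a2 b2"
  shows "box a1 b1 a2 b2 \<sigma> \<tau> \<in> sep_states (a1 * a2) (b1 * b2)"
proof -
  have c: "\<sigma> \<in> carrier_mat (a1 * b1) (a1 * b1)" "\<tau> \<in> carrier_mat (a2 * b2) (a2 * b2)"
    using assms sep_states_carrier by auto
  have "mat_trace (box a1 b1 a2 b2 \<sigma> \<tau>) = mat_trace \<sigma> * mat_trace \<tau>"
    using mat_trace_box_mult[OF c(1) one_carrier_mat c(2) one_carrier_mat] c
    by (simp add: box_one right_mult_one_mat[OF box_carrier])
  thus ?thesis using assms sep_op_box by (simp add: sep_states_iff)
qed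

lemma bip_pow_sep_states:
  assumes R: "R \<in> sep_states d d"
  shows "bip_pow d d R n \<in> sep_states (d ^ n) (d ^ n)"
proof (induction n)
  case 0
  have "sep_op 1 1 (1\<^sub>m (1 * 1))" by (rule sep_op_one)
  thus ?case by (simp add: bip_pow_0[OF sep_states_carrier[OF R]] sep_states_iff mat_trace_def)
next
  case (Suc n)
  have "bip_pow d d R (1 + n) = box (d ^ 1) (d ^ 1) (d ^ n) (d ^ n) R (bip_pow d d R n)"
    unfolding bip_pow_add[OF sep_states_carrier[OF R]] bip_pow_1[OF sep_states_carrier[OF R]] ..
  thus ?case using box_sep_states[of R "d ^ 1" "d ^ 1" _ "d ^ n" "d ^ n"] R Suc.IH by simp
qed

text \<open>The partial transposes of the antisymmetric state and of the scaled Werner state are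
  \<open>c (J - t \<Phi>)\<close> and \<open>c (J + t \<Phi>)\<close> with orthogonal positive operators \<open>J\<close>, \<open>\<Phi>\<close>: the latter is the
  absolute value of the former. Hence the difference of their \<open>n\<close>-th tensor powers has positive partial transpose.\<close>

lemma qf_rho_le_werner:
  assumes d: "d \<ge> 2"
  shows "qf (d ^ n) (d ^ n) (rho d n) \<alpha> \<beta> \<le> (1 + 2 / real d) ^ n * qf (d ^ n) (d ^ n) (bip_pow d d (werner d) n) \<alpha> \<beta>"
proof -
  let ?N = "d ^ n"
  \<comment> \<open>The partial transpose of the flip, which is \<open>d\<close> times the
    projection onto the maximally entangled vector; \<open>J\<close> is the complementary
    projection.\<close>
  define \<Phi> where "\<Phi> i j i' j' = (if i = j \<and> i' = j' then 1 else 0 :: complex)" for i j i' j' :: nat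
  define J where "J i j i' j' = (if i = i' \<and> j = j' then 1 else 0) - \<Phi> i j i' j' / of_nat d" for i j i' j'
  \<comment> \<open>From \<open>1 - \<Phi> = J - (1 - 1 / d) \<Phi>\<close>.\<close>
  define t where "t = 1 - 1 / real d"
  define c where "c = 1 / (real d * (real d - 1))"
  have d0: "real d > 0" "real d - 1 > 0" using d by auto
  have t0: "t \<ge> 0" using d0 by (simp add: t_def)
  have c0: "c \<ge> 0" using d0 by (simp add: c_def)
  have neg: "kern d (antisym_state d) i j' i' j = of_real c * (J i j i' j' + of_real (- t) * \<Phi> i j i' j')"
    if "i < d" "j < d" "i' < d" "j' < d" for i j i' j'
  proof -
    have e: "kern d (antisym_state d) i j' i' j = of_real c * ((if i = i' \<and> j = j' then 1 else 0) - \<Phi> i j i' j')"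
    proof -
      define A B where "A \<longleftrightarrow> i = i' \<and> j = j'" and "B \<longleftrightarrow> i = j \<and> i' = j'"
      have lt: "i * d + j' < d * d" "i' * d + j < d * d" using that by (auto intro: pair_index_less)
      have dm: "(i * d + j') div d = i" "(i' * d + j) div d = i'" "(i * d + j') mod d = j'" "(i' * d + j) mod d = j"
        using that by auto
      have AB: "(i * d + j' = i' * d + j) = A" "(i = j \<and> j' = i') = B"
        unfolding A_def B_def div_mod_eq_iff[of "i * d + j'" _ d] dm by auto
      have "kern d (antisym_state d) i j' i' j = of_real c * ((if A then 1 else 0) - (if B then 1 else 0))"
        using lt that by (simp add: kern_def antisym_state_def swap_op_def dm AB c_def)
      thus ?thesis by (simp only: A_def B_def \<Phi>_def)
    qed
    show ?thesis unfolding e J_def using d0 by (simp add: t_def field_simps)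
  qed
  \<comment> \<open>The flip coefficient \<open>(d - 2) / d\<close> plus the \<open>1 / d\<close>
    contained in the identity is \<open>t\<close>. The prefactor
    \<open>1 + 2 / d = (d + 2) / d\<close> turns the normalization of the Werner state into
    \<open>c\<close>.\<close>
  have pos: "of_real (1 + 2 / real d) * kern d (werner d) i j' i' j = of_real c * (J i j i' j' + of_real t * \<Phi> i j i' j')"
    if "i < d" "j < d" "i' < d" "j' < d" for i j i' j'
  proof -
    define A B where "A \<longleftrightarrow> i = i' \<and> j = j'" and "B \<longleftrightarrow> i = j \<and> i' = j'"
    have lt: "i * d + j' < d * d" "i' * d + j < d * d" using that by (auto intro: pair_index_less)
    have dm: "(i * d + j') div d = i" "(i' * d + j) div d = i'" "(i * d + j') mod d = j'" "(i' * d + j) mod d = j"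
      using that by auto
    have AB: "(i * d + j' = i' * d + j) = A" "(i = j \<and> j' = i') = B"
      unfolding A_def B_def div_mod_eq_iff[of "i * d + j'" _ d] dm by auto
    define a b :: complex where "a = (if A then 1 else 0)" and "b = (if B then 1 else 0)"
    have k: "kern d (werner d) i j' i' j = (a + of_real ((real d - 2) / real d) * b) / of_real ((real d + 2) * (real d - 1))"
      using lt that by (simp add: kern_def werner_def dm AB a_def b_def)
    have jp: "J i j i' j' = a - b / of_nat d" "\<Phi> i j i' j' = b"
      by (simp_all only: J_def \<Phi>_def a_def b_def A_def B_def)
    have g: "r * ((a + s * b) / k) = r / k * a + r * s / k * b" for r s k :: complex
      by (simp add: add_divide_distrib distrib_left mult_ac)
    have "of_real (1 + 2 / real d) * ((a + of_real ((real d - 2) / real d) * b) / of_real ((real d + 2) * (real d - 1))) =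
      of_real ((1 + 2 / real d) / ((real d + 2) * (real d - 1))) * a + of_real ((1 + 2 / real d) * ((real d - 2) / real d) / ((real d + 2) * (real d - 1))) * b"
      by (simp only: g of_real_divide of_real_mult)
    also have "(1 + 2 / real d) / ((real d + 2) * (real d - 1)) = c"
      using d0 by (simp add: c_def divide_simps) (simp add: algebra_simps)?
    also have "(1 + 2 / real d) * ((real d - 2) / real d) / ((real d + 2) * (real d - 1)) = c * (t - 1 / real d)"
    proof -
      have c1: "c = (1 + 2 / real d) / ((real d + 2) * (real d - 1))"
        using d0 by (simp add: c_def divide_simps) (simp add: algebra_simps)?
      have t1: "(real d - 2) / real d = t - 1 / real d" using d0 by (simp add: t_def field_simps)
      show ?thesis unfolding t1 c1 by simp
    qed
    finally show ?thesis unfolding k jp by (simp add: algebra_simps)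
  qed
  define \<eta> where "\<eta> p q = \<alpha> p * cnj (\<beta> q)" for p q
  define Fm where "Fm M = (\<Sum>p<?N. \<Sum>q<?N. \<Sum>p'<?N. \<Sum>q'<?N. cnj (\<eta> p q) * \<eta> p' q' *
       (\<Prod>k<n. M k (dig d k p) (dig d k q) (dig d k p') (dig d k q')))" for M :: "nat \<Rightarrow> nat \<Rightarrow> nat \<Rightarrow> nat \<Rightarrow> nat \<Rightarrow> complex"
  \<comment> \<open>Binomial expansion over the copies: those in \<open>X\<close> carry
    \<open>J\<close>, the others \<Phi>.\<close>
  define JS where "JS X k = (if k \<in> X then J else \<Phi>)" for X :: "nat set" and k :: nat
  \<comment> \<open>Idempotence of the self-adjoint \<open>J\<close>, in the factorized form
    required by \<open>prod_kernel_nonneg\<close>.\<close>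
  have Jsym: "(\<Sum>l\<in>{..<d} \<times> {..<d}. J i j (fst l) (snd l) * cnj (J i' j' (fst l) (snd l))) = J i j i' j'"
    if ij: "i < d" "j < d" "i' < d" "j' < d" for i j i' j'
  proof -
    have r: "cnj (J a b a' b') = J a b a' b'" for a b a' b' by (simp add: J_def \<Phi>_def)
    have s1: "(\<Sum>u<d. \<Sum>v<d. J i j u v * (if i' = u \<and> j' = v then 1 else 0)) = J i j i' j'"
    proof -
      have "(\<Sum>u<d. \<Sum>v<d. J i j u v * (if i' = u \<and> j' = v then 1 else 0)) = (\<Sum>u<d. if u = i' then J i j i' j' else 0)"
        using ij by (intro sum.cong refl) (auto simp: if_distrib[of "\<lambda>x. _ * x"] cong: if_cong)
      thus ?thesis using ij by simp
    qed
    have s2: "(\<Sum>u<d. \<Sum>v<d. J i j u v * \<Phi> i' j' u v) = 0"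
    proof -
      have "(\<Sum>v<d. J i j u v * \<Phi> i' j' u v) = (if i' = j' then J i j u u else 0)" if "u < d" for u
        using that by (simp add: \<Phi>_def if_distrib[of "\<lambda>x. _ * x"] cong: if_cong)
      hence "(\<Sum>u<d. \<Sum>v<d. J i j u v * \<Phi> i' j' u v) = (\<Sum>u<d. if i' = j' then J i j u u else 0)"
        by (intro sum.cong refl) auto
      also have "\<dots> = 0"
      proof (cases "i' = j'")
        case True
        have "(\<Sum>u<d. J i j u u) = (\<Sum>u<d. (if u = i then (if i = j then 1 else 0) else 0)) - (\<Sum>u<d. (if i = j then 1 else 0) / of_nat d)"
          unfolding sum_subtractf[symmetric] by (intro sum.cong refl) (auto simp: J_def \<Phi>_def)
        thus ?thesis using True ij d0 by simp
      qed simp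
      finally show ?thesis .
    qed
    have "(\<Sum>l\<in>{..<d} \<times> {..<d}. J i j (fst l) (snd l) * cnj (J i' j' (fst l) (snd l))) =
        (\<Sum>u<d. \<Sum>v<d. J i j u v * J i' j' u v)"
      by (simp add: sum.cartesian_product r case_prod_unfold)
    also have "\<dots> = (\<Sum>u<d. \<Sum>v<d. J i j u v * (if i' = u \<and> j' = v then 1 else 0)) - (\<Sum>u<d. \<Sum>v<d. J i j u v * \<Phi> i' j' u v) / of_nat d"
      unfolding sum_divide_distrib sum_subtractf[symmetric]
      by (intro sum.cong refl) (simp add: J_def[of i' j'] right_diff_distrib)
    finally show ?thesis using s1 s2 by simp
  qed
  have Fpos: "0 \<le> Re (Fm (JS X))" for X
  proof -
    \<comment> \<open>\<Phi> has rank one, so a single summand \<open>l = (0, 0)\<close> carries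
      it.\<close>
    define m where "m k l i j = (if k \<in> X then J i j (fst l) (snd l) else if l = (0, 0) \<and> i = j then 1 else 0)"
      for k :: nat and l :: "nat \<times> nat" and i j
    have JSm: "JS X k i j i' j' = (\<Sum>l\<in>{..<d} \<times> {..<d}. m k l i j * cnj (m k l i' j'))"
      if "i < d" "j < d" "i' < d" "j' < d" for k i j i' j'
    proof (cases "k \<in> X")
      case True thus ?thesis using Jsym[OF that] by (simp add: JS_def m_def)
    next
      case False
      have "(\<Sum>l\<in>{..<d} \<times> {..<d}. m k l i j * cnj (m k l i' j')) = (\<Sum>l\<in>{..<d} \<times> {..<d}. if l = (0, 0) then \<Phi> i j i' j' else 0)"
        using False by (intro sum.cong refl) (auto simp: m_def \<Phi>_def)
      also have "\<dots> = \<Phi> i j i' j'" using d0 by (subst sum.delta) auto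
      finally show ?thesis using False by (simp add: JS_def)
    qed
    have "Fm (JS X) = (\<Sum>p<?N. \<Sum>q<?N. \<Sum>p'<?N. \<Sum>q'<?N. cnj (\<eta> p q) * \<eta> p' q' *
       (\<Prod>k<n. \<Sum>l\<in>{..<d} \<times> {..<d}. m k l (dig d k p) (dig d k q) * cnj (m k l (dig d k p') (dig d k q'))))"
      unfolding Fm_def using d by (intro sum.cong refl arg_cong2[of _ _ _ _ "(*)"] prod.cong JSm dig_less) auto
    thus ?thesis using prod_kernel_nonneg[where L = "{..<d} \<times> {..<d}" and \<eta> = \<eta> and N = ?N and m = m and n = n and d = d] by simp
  qed
  have Fexp: "Fm (\<lambda>_ i j i' j'. of_real c * (J i j i' j' + of_real s * \<Phi> i j i' j')) =
     of_real (c ^ n) * (\<Sum>X\<in>Pow {..<n}. of_real (s ^ card ({..<n} - X)) * Fm (JS X))" for s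
  proof -
    have pr: "(\<Prod>k<n. of_real c * (J (a k) (b k) (a' k) (b' k) + of_real s * \<Phi> (a k) (b k) (a' k) (b' k))) =
       of_real (c ^ n) * (\<Sum>X\<in>Pow {..<n}. of_real (s ^ card ({..<n} - X)) * (\<Prod>k<n. JS X k (a k) (b k) (a' k) (b' k)))" for a b a' b'
    proof -
      have "(\<Prod>k<n. J (a k) (b k) (a' k) (b' k) + of_real s * \<Phi> (a k) (b k) (a' k) (b' k)) =
         (\<Sum>X\<in>Pow {..<n}. (\<Prod>k\<in>X. J (a k) (b k) (a' k) (b' k)) * (\<Prod>k\<in>{..<n} - X. of_real s * \<Phi> (a k) (b k) (a' k) (b' k)))"
        by (rule prod_add) simp
      also have "\<dots> = (\<Sum>X\<in>Pow {..<n}. of_real (s ^ card ({..<n} - X)) * (\<Prod>k<n. JS X k (a k) (b k) (a' k) (b' k)))"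
      proof (intro sum.cong refl)
        fix X assume "X \<in> Pow {..<n}"
        hence X: "X \<subseteq> {..<n}" by simp
        have "(\<Prod>k<n. JS X k (a k) (b k) (a' k) (b' k)) = (\<Prod>k\<in>{..<n} - X. JS X k (a k) (b k) (a' k) (b' k)) * (\<Prod>k\<in>X. JS X k (a k) (b k) (a' k) (b' k))"
          by (rule prod.subset_diff[OF X]) simp
        thus "(\<Prod>k\<in>X. J (a k) (b k) (a' k) (b' k)) * (\<Prod>k\<in>{..<n} - X. of_real s * \<Phi> (a k) (b k) (a' k) (b' k)) =
            of_real (s ^ card ({..<n} - X)) * (\<Prod>k<n. JS X k (a k) (b k) (a' k) (b' k))"
          by (simp add: JS_def prod.distrib)
      qed
      finally show ?thesis by (simp add: prod.distrib)
    qed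
    define T where "T X p q p' q' = of_real (c ^ n) * (of_real (s ^ card ({..<n} - X)) *
       (cnj (\<eta> p q) * \<eta> p' q' * (\<Prod>k<n. JS X k (dig d k p) (dig d k q) (dig d k p') (dig d k q'))))" for X p q p' q'
    have "Fm (\<lambda>_ i j i' j'. of_real c * (J i j i' j' + of_real s * \<Phi> i j i' j')) =
      (\<Sum>p<?N. \<Sum>q<?N. \<Sum>p'<?N. \<Sum>q'<?N. \<Sum>X\<in>Pow {..<n}. T X p q p' q')"
      unfolding Fm_def pr T_def by (simp add: sum_distrib_left mult_ac)
    also have "\<dots> = (\<Sum>p<?N. \<Sum>q<?N. \<Sum>p'<?N. \<Sum>X\<in>Pow {..<n}. \<Sum>q'<?N. T X p q p' q')"
      by (rule sum.cong[OF refl], rule sum.cong[OF refl], rule sum.cong[OF refl], rule sum.swap)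
    also have "\<dots> = (\<Sum>p<?N. \<Sum>q<?N. \<Sum>X\<in>Pow {..<n}. \<Sum>p'<?N. \<Sum>q'<?N. T X p q p' q')"
      by (rule sum.cong[OF refl], rule sum.cong[OF refl], rule sum.swap)
    also have "\<dots> = (\<Sum>p<?N. \<Sum>X\<in>Pow {..<n}. \<Sum>q<?N. \<Sum>p'<?N. \<Sum>q'<?N. T X p q p' q')"
      by (rule sum.cong[OF refl], rule sum.swap)
    also have "\<dots> = (\<Sum>X\<in>Pow {..<n}. \<Sum>p<?N. \<Sum>q<?N. \<Sum>p'<?N. \<Sum>q'<?N. T X p q p' q')"
      by (rule sum.swap)
    also have "\<dots> = of_real (c ^ n) * (\<Sum>X\<in>Pow {..<n}. of_real (s ^ card ({..<n} - X)) * Fm (JS X))"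
      unfolding T_def Fm_def by (simp only: sum_distrib_left)
    finally show ?thesis .
  qed
  have qr: "qf ?N ?N (rho d n) \<alpha> \<beta> = Re (Fm (\<lambda>_ i j i' j'. of_real c * (J i j i' j' + of_real (- t) * \<Phi> i j i' j')))"
    unfolding qf_def rho_def bip_pow_tens[OF antisym_carrier] quad_tens_partial_transpose Fm_def \<eta>_def
    using d by (intro arg_cong[of _ _ Re] sum.cong refl arg_cong2[of _ _ _ _ "(*)"] prod.cong neg dig_less) auto
  have qw: "(1 + 2 / real d) ^ n * qf ?N ?N (bip_pow d d (werner d) n) \<alpha> \<beta> =
      Re (Fm (\<lambda>_ i j i' j'. of_real c * (J i j i' j' + of_real t * \<Phi> i j i' j')))"
  proof -
    have "(\<Prod>k<n. of_real c * (J (dig d k p) (dig d k q) (dig d k p') (dig d k q') + of_real t * \<Phi> (dig d k p) (dig d k q) (dig d k p') (dig d k q'))) =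
      of_real ((1 + 2 / real d) ^ n) * (\<Prod>k<n. kern d (werner d) (dig d k p) (dig d k q') (dig d k p') (dig d k q))" for p q p' q'
    proof -
      have "(\<Prod>k<n. of_real c * (J (dig d k p) (dig d k q) (dig d k p') (dig d k q') + of_real t * \<Phi> (dig d k p) (dig d k q) (dig d k p') (dig d k q'))) =
        (\<Prod>k<n. of_real (1 + 2 / real d) * kern d (werner d) (dig d k p) (dig d k q') (dig d k p') (dig d k q))"
        using d by (intro prod.cong refl pos[symmetric] dig_less) auto
      thus ?thesis by (simp add: prod.distrib)
    qed
    hence "Fm (\<lambda>_ i j i' j'. of_real c * (J i j i' j' + of_real t * \<Phi> i j i' j')) =
       of_real ((1 + 2 / real d) ^ n) * quad (?N * ?N) (bip_pow d d (werner d) n) (prodvec ?N \<alpha> \<beta>)"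
      unfolding Fm_def bip_pow_tens[OF werner_carrier] quad_tens_partial_transpose \<eta>_def
      by (simp add: sum_distrib_left mult_ac)
    thus ?thesis by (simp add: qf_def del: of_real_power)
  qed
  \<comment> \<open>Both expansions have the same nonnegative terms; only the sign of
    \<open>t\<close> differs, so they compare term by term.\<close>
  have "(- t) ^ m * Re (Fm (JS X)) \<le> t ^ m * Re (Fm (JS X))" for m X
  proof (rule mult_right_mono[OF _ Fpos])
    show "(- t) ^ m \<le> t ^ m" using t0 by (metis abs_ge_self abs_minus_cancel abs_of_nonneg power_abs)
  qed
  hence "(\<Sum>X\<in>Pow {..<n}. (- t) ^ card ({..<n} - X) * Re (Fm (JS X))) \<le> (\<Sum>X\<in>Pow {..<n}. t ^ card ({..<n} - X) * Re (Fm (JS X)))"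
    by (intro sum_mono)
  hence "c ^ n * (\<Sum>X\<in>Pow {..<n}. (- t) ^ card ({..<n} - X) * Re (Fm (JS X))) \<le> c ^ n * (\<Sum>X\<in>Pow {..<n}. t ^ card ({..<n} - X) * Re (Fm (JS X)))"
    using c0 by (intro mult_left_mono) auto
  thus ?thesis unfolding qr qw Fexp by (simp del: of_real_power of_real_minus)
qed

text \<open>The inequality holds on product vectors only, hence for separable effects; as an
  operator inequality it is not asserted.\<close>

lemma trace_rho_le_werner:
  assumes d: "d \<ge> 2" and E: "sep_op (d ^ n) (d ^ n) E"
  shows "Re (mat_trace (rho d n * E)) \<le> (1 + 2 / real d) ^ n * Re (mat_trace (bip_pow d d (werner d) n * E))"
proof -
  from E obtain ls where ls: "E = sep_sum (d ^ n) (d ^ n) ls" by (auto simp: sep_op_def)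
  have c: "bip_pow d d (werner d) n \<in> carrier_mat (d ^ n * d ^ n) (d ^ n * d ^ n)"
    by (rule sep_states_carrier[OF bip_pow_sep_states[OF werner_sep_state[OF d]]])
  have t: "Re (mat_trace (X * E)) = (\<Sum>(\<alpha>, \<beta>)\<leftarrow>ls. qf (d ^ n) (d ^ n) X \<alpha> \<beta>)" if X: "X \<in> carrier_mat (d ^ n * d ^ n) (d ^ n * d ^ n)" for X
    unfolding mat_trace_comm[OF X sep_op_carrier[OF E]] unfolding ls mat_trace_sep_sum_mult[OF X]
    by (induction ls) (auto simp: qf_def)
  have "(\<Sum>(\<alpha>, \<beta>)\<leftarrow>ls. qf (d ^ n) (d ^ n) (rho d n) \<alpha> \<beta>) \<le>
      (\<Sum>(\<alpha>, \<beta>)\<leftarrow>ls. (1 + 2 / real d) ^ n * qf (d ^ n) (d ^ n) (bip_pow d d (werner d) n) \<alpha> \<beta>)"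
    by (intro sum_list_mono) (auto simp: qf_rho_le_werner[OF d])
  also have "\<dots> = (1 + 2 / real d) ^ n * (\<Sum>(\<alpha>, \<beta>)\<leftarrow>ls. qf (d ^ n) (d ^ n) (bip_pow d d (werner d) n) \<alpha> \<beta>)"
    by (simp add: case_prod_unfold sum_list_const_mult)
  finally show ?thesis unfolding t[OF rho_carrier] t[OF c] .
qed

section \<open>Overlap of separable states with the antisymmetric subspace\<close>

lemma Cauchy_Schwarz_sum:
  fixes f g :: "'a \<Rightarrow> real"
  shows "(\<Sum>i\<in>A. f i * g i)\<^sup>2 \<le> (\<Sum>i\<in>A. (f i)\<^sup>2) * (\<Sum>i\<in>A. (g i)\<^sup>2)"
proof -
  have "\<bar>\<Sum>i\<in>A. f i * g i\<bar> \<le> (\<Sum>i\<in>A. \<bar>f i\<bar> * \<bar>g i\<bar>)"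
    using sum_abs[of "\<lambda>i. f i * g i" A] by (simp add: abs_mult)
  also have "\<dots> \<le> L2_set f A * L2_set g A" by (rule L2_set_mult_ineq)
  finally have "\<bar>\<Sum>i\<in>A. f i * g i\<bar>\<^sup>2 \<le> (L2_set f A * L2_set g A)\<^sup>2" by (intro power_mono) auto
  thus ?thesis by (simp add: L2_set_def power_mult_distrib sum_nonneg)
qed

section \<open>Kernels on three tensor factors\<close>

type_synonym trip = "nat \<times> nat \<times> nat"

definition X3 :: "nat \<Rightarrow> trip set" where "X3 N = {..<N} \<times> {..<N} \<times> {..<N}"

definition dg3 :: "nat \<Rightarrow> nat \<Rightarrow> trip \<Rightarrow> trip" where
  "dg3 d k x = (dig d k (fst x), dig d k (fst (snd x)), dig d k (snd (snd x)))"

definition pw :: "nat \<Rightarrow> nat \<Rightarrow> (trip \<Rightarrow> trip \<Rightarrow> complex) \<Rightarrow> trip \<Rightarrow> trip \<Rightarrow> complex" where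
  "pw d n K x y = (\<Prod>k<n. K (dg3 d k x) (dg3 d k y))"

definition comp3 :: "nat \<Rightarrow> (trip \<Rightarrow> trip \<Rightarrow> complex) \<Rightarrow> (trip \<Rightarrow> trip \<Rightarrow> complex) \<Rightarrow> trip \<Rightarrow> trip \<Rightarrow> complex" where
  "comp3 d K L a c = (\<Sum>b\<in>X3 d. K a b * L b c)"

definition sw12 :: "trip \<Rightarrow> trip" where "sw12 a = (fst (snd a), fst a, snd (snd a))"
definition sw13 :: "trip \<Rightarrow> trip" where "sw13 a = (snd (snd a), fst (snd a), fst a)"

definition P3 :: "trip \<Rightarrow> trip \<Rightarrow> complex" where
  "P3 a c = ((if c = a then 1 else 0) - (if c = sw12 a then 1 else 0)) / 2"

text \<open>On the range of \<open>P3\<close> the transposition \<open>(13)\<close>, compressed, is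
  \<open>-1\<close> on the totally antisymmetric part and \<open>1 / 2\<close> on the part of mixed
  symmetry. The added \<open>1 / 4\<close> makes the two values opposite, and adding a positive
  operator costs nothing in an upper bound.\<close>

definition T3 :: "trip \<Rightarrow> trip \<Rightarrow> complex" where
  "T3 a c = (if c = sw13 a then 1 else 0) + (if c = a then 1 / 4 else 0)"

lemma finite_X3 [simp]: "finite (X3 N)" by (simp add: X3_def)

lemma sum_X3: "(\<Sum>x\<in>X3 N. f x) = (\<Sum>p<N. \<Sum>q<N. \<Sum>r<N. f (p, q, r))"
  by (simp add: X3_def sum.cartesian_product)

lemma sum_prod_dg3:
  fixes f :: "nat \<Rightarrow> trip \<Rightarrow> complex"
  shows "(\<Sum>x\<in>X3 (d ^ n). \<Prod>k<n. f k (dg3 d k x)) = (\<Prod>k<n. \<Sum>b\<in>X3 d. f k b)"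
proof -
  have "(\<Sum>r<d ^ n. \<Prod>k<n. f k (dig d k p, dig d k q, dig d k r)) = (\<Prod>k<n. \<Sum>l<d. f k (dig d k p, dig d k q, l))" for p q
    by (rule sum_prod_dig)
  thus ?thesis
    by (simp add: sum_X3 dg3_def sum_prod_dig2[where f = "\<lambda>k i j. \<Sum>l<d. f k (i, j, l)"])
qed

lemma pw_comp3: "(\<Sum>y\<in>X3 (d ^ n). pw d n K x y * pw d n L y z) = pw d n (comp3 d K L) x z"
  unfolding pw_def comp3_def prod.distrib[symmetric] by (rule sum_prod_dg3)

lemma dg3_X3: "d > 0 \<Longrightarrow> dg3 d k x \<in> X3 d"
  by (simp add: dg3_def X3_def dig_less)

lemma pw_cong:
  assumes "d > 0" "\<And>a c. a \<in> X3 d \<Longrightarrow> c \<in> X3 d \<Longrightarrow> K a c = L a c"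
  shows "pw d n K x y = pw d n L x y"
  unfolding pw_def by (intro prod.cong refl assms(2) dg3_X3 assms(1))

lemma sw_X3: "a \<in> X3 d \<Longrightarrow> sw12 a \<in> X3 d" "a \<in> X3 d \<Longrightarrow> sw13 a \<in> X3 d"
  by (auto simp: X3_def sw12_def sw13_def)

lemma P3_sum: "a \<in> X3 d \<Longrightarrow> (\<Sum>b\<in>X3 d. P3 a b * f b) = (f a - f (sw12 a)) / 2"
proof -
  assume a: "a \<in> X3 d"
  have "(\<Sum>b\<in>X3 d. P3 a b * f b) = (\<Sum>b\<in>X3 d. (if b = a then f a / 2 else 0) - (if b = sw12 a then f (sw12 a) / 2 else 0))"
    by (intro sum.cong refl) (auto simp: P3_def)
  thus ?thesis using a sw_X3[OF a] by (simp add: sum_subtractf diff_divide_distrib)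
qed

lemma T3_sum: "a \<in> X3 d \<Longrightarrow> (\<Sum>b\<in>X3 d. T3 a b * f b) = f (sw13 a) + f a / 4"
proof -
  assume a: "a \<in> X3 d"
  have "(\<Sum>b\<in>X3 d. T3 a b * f b) = (\<Sum>b\<in>X3 d. (if b = sw13 a then f (sw13 a) else 0) + (if b = a then f a / 4 else 0))"
    by (intro sum.cong refl) (auto simp: T3_def)
  thus ?thesis using a sw_X3[OF a] by (simp add: sum.distrib)
qed

definition K3 :: "nat \<Rightarrow> trip \<Rightarrow> trip \<Rightarrow> complex" where "K3 d = comp3 d P3 (comp3 d T3 P3)"

lemma sw_inv: "c = sw12 a \<longleftrightarrow> a = sw12 c" "c = sw13 a \<longleftrightarrow> a = sw13 c"
  by (auto simp: sw12_def sw13_def prod_eq_iff)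

lemma P3_sym: "P3 c a = P3 a c" and T3_sym: "T3 c a = T3 a c"
  unfolding P3_def T3_def by (simp_all only: sw_inv[of c a] eq_commute[of a c])

lemma P3_cnj: "cnj (P3 a c) = P3 a c" and T3_cnj: "cnj (T3 a c) = T3 a c"
  by (auto simp: P3_def T3_def)

lemma K3_sym_cnj: "cnj (K3 d c a) = K3 d a c"
proof -
  have "cnj (K3 d c a) = (\<Sum>b\<in>X3 d. \<Sum>e\<in>X3 d. P3 c b * (T3 b e * P3 e a))"
    by (simp add: K3_def comp3_def P3_cnj T3_cnj sum_distrib_left)
  also have "\<dots> = (\<Sum>e\<in>X3 d. \<Sum>b\<in>X3 d. P3 a e * (T3 e b * P3 b c))"
    by (subst sum.swap, intro sum.cong refl) (metis P3_sym T3_sym mult.commute mult.left_commute)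
  finally show ?thesis by (simp add: K3_def comp3_def sum_distrib_left)
qed

text \<open>In the group algebra of the permutations of three tensor factors, with \<open>P = (1 - (12)) / 2\<close>, the operator
  \<open>P ((13) + 1 / 4) P\<close> squares to \<open>9 / 16 P\<close>.\<close>

lemma K3_square:
  assumes a: "a \<in> X3 d"
  shows "comp3 d (K3 d) (K3 d) a c = 9 / 16 * P3 a c"
proof -
  have K: "(\<Sum>b\<in>X3 d. K3 d a b * f b) =
      ((let g = (\<lambda>a. (f a - f (sw12 a)) / 2); h = (\<lambda>a. g (sw13 a) + g a / 4) in (h a - h (sw12 a)) / 2))"
    if a: "a \<in> X3 d" for a f
  proof -
    have "(\<Sum>b\<in>X3 d. K3 d a b * f b) = (\<Sum>b\<in>X3 d. \<Sum>u\<in>X3 d. \<Sum>v\<in>X3 d. P3 a u * (T3 u v * (P3 v b * f b)))"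
      by (intro sum.cong refl) (simp add: K3_def comp3_def sum_distrib_left sum_distrib_right mult_ac)
    also have "\<dots> = (\<Sum>u\<in>X3 d. \<Sum>b\<in>X3 d. \<Sum>v\<in>X3 d. P3 a u * (T3 u v * (P3 v b * f b)))" by (rule sum.swap)
    also have "\<dots> = (\<Sum>u\<in>X3 d. \<Sum>v\<in>X3 d. \<Sum>b\<in>X3 d. P3 a u * (T3 u v * (P3 v b * f b)))"
      by (rule sum.cong[OF refl], rule sum.swap)
    also have "\<dots> = (\<Sum>u\<in>X3 d. P3 a u * (\<Sum>v\<in>X3 d. T3 u v * (\<Sum>b\<in>X3 d. P3 v b * f b)))"
      by (simp add: sum_distrib_left)
    also have "\<dots> = (\<Sum>u\<in>X3 d. P3 a u * (\<Sum>v\<in>X3 d. T3 u v * ((f v - f (sw12 v)) / 2)))"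
      by (intro sum.cong refl arg_cong2[of _ _ _ _ "(*)"] P3_sum)
    also have "\<dots> = (\<Sum>u\<in>X3 d. P3 a u * ((f (sw13 u) - f (sw12 (sw13 u))) / 2 + (f u - f (sw12 u)) / 2 / 4))"
      by (intro sum.cong refl arg_cong2[of _ _ _ _ "(*)"]) (simp only: T3_sum)
    finally show ?thesis unfolding P3_sum[OF a] Let_def .
  qed
  \<comment> \<open>Two involutions with the braid relation. Together with the sign rule
    \<open>anti\<close> for \<open>sw12\<close> they reduce every word that occurs in the
    square.\<close>
  have inv: "sw12 (sw12 x) = x" "sw13 (sw13 x) = x" "sw12 (sw13 (sw12 x)) = sw13 (sw12 (sw13 x))" for x
    by (simp_all add: sw12_def sw13_def)
  obtain i j l where ijl: "a = (i, j, l)" by (cases a)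
  have Kc: "K3 d a c = (let g = (\<lambda>a. P3 a c); h = (\<lambda>a. g (sw13 a) + g a / 4) in (h a - h (sw12 a)) / 2)"
    if a: "a \<in> X3 d" for a
  proof -
    have "K3 d a c = (\<Sum>u\<in>X3 d. P3 a u * (\<Sum>v\<in>X3 d. T3 u v * P3 v c))" by (simp add: K3_def comp3_def)
    also have "\<dots> = (\<Sum>u\<in>X3 d. P3 a u * (P3 (sw13 u) c + P3 u c / 4))"
      by (intro sum.cong refl arg_cong2[of _ _ _ _ "(*)"]) (simp only: T3_sum)
    finally show ?thesis unfolding P3_sum[OF a] Let_def .
  qed
  have anti: "P3 (sw12 x) c = - P3 x c" for x by (simp add: P3_def inv minus_divide_left)
  have anti': "P3 (sw13 (sw12 (sw13 x))) c = - P3 (sw13 (sw12 x)) c" for x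
    unfolding inv(3)[symmetric] by (rule anti)
  note X = a sw_X3[OF a] sw_X3[OF sw_X3(1)[OF a]] sw_X3[OF sw_X3(2)[OF a]] sw_X3[OF sw_X3(1)[OF sw_X3(2)[OF a]]]
    sw_X3[OF sw_X3(2)[OF sw_X3(1)[OF a]]] sw_X3[OF sw_X3(1)[OF sw_X3(2)[OF sw_X3(1)[OF a]]]]
  define F where "F x = K3 d x c" for x
  have F: "F x = (P3 (sw13 x) c + P3 x c / 4 - (P3 (sw13 (sw12 x)) c + P3 (sw12 x) c / 4)) / 2" if "x \<in> X3 d" for x
    unfolding F_def Kc[OF that] Let_def ..
  have "comp3 d (K3 d) (K3 d) a c = (\<Sum>b\<in>X3 d. K3 d a b * F b)" by (simp add: comp3_def F_def)
  also have "\<dots> = 9 / 16 * P3 a c"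
    unfolding K[OF a] Let_def
    using X by (simp add: F anti inv anti') (simp add: field_simps)?
  finally show ?thesis .
qed

text \<open>Let \<open>h\<close> be the overlap and \<chi> the projected product vector.
  Cauchy-Schwarz against \<beta> bounds \<open>h\<^sup>2\<close> by the squared norm
  \<open>G\<close> of the contraction of \<chi> with \<alpha>. This is the expectation of
  \<open>(13)\<close> on all copies in \<open>\<chi> \<otimes> \<alpha>\<close>, the image under
  \<open>P\<close> of \<open>\<alpha> \<otimes> \<beta> \<otimes> \<alpha>\<close>. Replacing
  \<open>(13)\<close> by \<open>(13) + 1 / 4\<close> only increases it, and \<open>K3_square\<close>
  bounds the result.\<close>

theorem qf_antisym_proj_le:
  assumes d: "d \<ge> 2" and na: "norm_sq (d ^ n) \<alpha> = 1" and nb: "norm_sq (d ^ n) \<beta> = 1"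
  shows "0 \<le> qf (d ^ n) (d ^ n) (antisym_proj d n) \<alpha> \<beta>" "(qf (d ^ n) (d ^ n) (antisym_proj d n) \<alpha> \<beta>)\<^sup>2 \<le> (3 / 4) ^ n"
proof -
  let ?N = "d ^ n"
  have d0: "d > 0" using d by simp
  define pp where "pp p q p' q' = (\<Prod>k<n. copy_proj 2 (dig d k p) (dig d k q) (dig d k p') (dig d k q'))" for p q p' q'
  define \<chi> where "\<chi> p q = (\<Sum>p'<?N. \<Sum>q'<?N. pp p q p' q' * (\<alpha> p' * \<beta> q'))" for p q
  define h where "h = qf ?N ?N (antisym_proj d n) \<alpha> \<beta>"
  have antisym_proj: "antisym_proj d n = tens d n (\<lambda>_. copy_proj 2)"
    unfolding antisym_proj_def type_proj_def by (intro tens_eqI) (simp add: antisym_type_def)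
  have qh: "quad (?N * ?N) (antisym_proj d n) (prodvec ?N \<alpha> \<beta>) = of_real h"
  proof -
    have "Im (quad (?N * ?N) (antisym_proj d n) z) = 0" for z
    proof -
      obtain b where b: "\<And>i j. i < ?N * ?N \<Longrightarrow> j < ?N * ?N \<Longrightarrow> antisym_proj d n $$ (i, j) = (\<Sum>l<?N * ?N. b l i * cnj (b l j))"
        using psd_factor[OF psd_antisym_proj] by metis
      have "quad (?N * ?N) (antisym_proj d n) z = of_real (\<Sum>l<?N * ?N. (cmod (\<Sum>i<?N * ?N. cnj (z i) * b l i))\<^sup>2)"
        by (rule quad_factor[OF b])
      thus ?thesis by (simp only: Im_complex_of_real)
    qed
    thus ?thesis by (simp add: h_def qf_def complex_eq_iff)
  qed
  show h0: "0 \<le> qf ?N ?N (antisym_proj d n) \<alpha> \<beta>" unfolding qf_def by (rule psd_quad_ge[OF psd_antisym_proj])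
  have h\<chi>: "of_real h = (\<Sum>p<?N. \<Sum>q<?N. cnj (\<alpha> p) * cnj (\<beta> q) * \<chi> p q)"
    unfolding qh[symmetric] antisym_proj quad_tens_prodvec \<chi>_def pp_def by (simp add: sum_distrib_left mult_ac)
  define G where "G = (\<Sum>q<?N. (cmod (\<Sum>p<?N. cnj (\<chi> p q) * \<alpha> p))\<^sup>2)"
  have hG: "h\<^sup>2 \<le> G"
  proof -
    define v where "v q = cmod (\<Sum>p<?N. cnj (\<chi> p q) * \<alpha> p)" for q
    have "of_real h = cnj (of_real h :: complex)" by simp
    also have "\<dots> = (\<Sum>q<?N. (\<Sum>p<?N. cnj (\<chi> p q) * \<alpha> p) * \<beta> q)"
      unfolding h\<chi> by (subst sum.swap) (simp add: sum_distrib_left sum_distrib_right mult_ac)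
    finally have e: "of_real h = (\<Sum>q<?N. (\<Sum>p<?N. cnj (\<chi> p q) * \<alpha> p) * \<beta> q)" .
    have "\<bar>h\<bar> = cmod (of_real h)" by simp
    also have "\<dots> \<le> (\<Sum>q<?N. v q * cmod (\<beta> q))"
      unfolding e v_def norm_mult[symmetric] by (rule norm_sum)
    finally have "h\<^sup>2 \<le> (\<Sum>q<?N. v q * cmod (\<beta> q))\<^sup>2" by (metis abs_ge_zero power2_abs power_mono)
    also have "\<dots> \<le> (\<Sum>q<?N. (v q)\<^sup>2) * (\<Sum>q<?N. (cmod (\<beta> q))\<^sup>2)"
      by (rule Cauchy_Schwarz_sum)
    finally show ?thesis using nb by (simp add: G_def v_def norm_sq_def)
  qed
  \<comment> \<open>A second copy of \<alpha> occupies the third factor; contracting \<chi> with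
    \<alpha> becomes an exchange of the first and third factors.\<close>
  define Y where "Y x = \<alpha> (fst x) * \<beta> (fst (snd x)) * \<alpha> (snd (snd x))" for x :: trip
  define Z where "Z x = (\<Sum>y\<in>X3 ?N. pw d n P3 x y * Y y)" for x
  have pw_P3: "pw d n P3 (p, q, r) (p', q', r') = pp p q p' q' * (if r = r' then 1 else 0)" if rr: "r < ?N" "r' < ?N" for p q r p' q' r'
  proof -
    have t: "P3 (i, j, l) (i', j', l') = copy_proj 2 i j i' j' * (if l = l' then 1 else 0)" for i j l i' j' l'
    proof (cases "l = l'")
      case True thus ?thesis by (auto simp: P3_def sw12_def copy_proj_def)
    qed (auto simp: P3_def sw12_def)
    have "(\<Prod>k<n. if dig d k r = dig d k r' then 1 else (0::complex)) = (if r = r' then 1 else 0)"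
    proof (cases "r = r'")
      case False
      then obtain k where "k < n" "dig d k r \<noteq> dig d k r'" using dig_eqI[OF rr] by blast
      hence "\<exists>k\<in>{..<n}. (if dig d k r = dig d k r' then 1 else (0::complex)) = 0" by (intro bexI[of _ k]) auto
      thus ?thesis unfolding if_not_P[OF False] by (intro prod_zero) auto
    qed simp
    thus ?thesis by (simp add: pw_def dg3_def t prod.distrib pp_def)
  qed
  have Z: "Z (p, q, r) = \<chi> p q * \<alpha> r" if "r < ?N" for p q r
  proof -
    have "Z (p, q, r) = (\<Sum>p'<?N. \<Sum>q'<?N. \<Sum>r'<?N. if r' = r then pp p q p' q' * (\<alpha> p' * \<beta> q') * \<alpha> r else 0)"
      unfolding Z_def sum_X3 using that by (intro sum.cong refl) (auto simp: pw_P3 Y_def)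
    also have "\<dots> = (\<Sum>p'<?N. \<Sum>q'<?N. pp p q p' q' * (\<alpha> p' * \<beta> q') * \<alpha> r)"
      using that by simp
    finally show ?thesis by (simp add: \<chi>_def sum_distrib_right)
  qed
  define Gf where "Gf = (\<Sum>x\<in>X3 ?N. \<Sum>y\<in>X3 ?N. cnj (Z x) * pw d n T3 x y * Z y)"
  have G_le: "G \<le> Re Gf"
  proof -
    \<comment> \<open>Partial transposition of the third factor: \<open>(13)\<close> turns into the
      rank-one kernel \<open>M1\<close> and \<open>1 / 4\<close> into the positive
      \<open>M2\<close>. The vector is a product across this cut, so conjugating \<alpha> in \<eta>
      compensates for the transposition.\<close>
    define M1 where "M1 i s i' s' = (if i = s \<and> i' = s' then 1 else 0 :: complex)" for i s i' s' :: nat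
    define M2 where "M2 i s i' s' = (if i = i' \<and> s = s' then 1 / 4 else 0 :: complex)" for i s i' s' :: nat
    define MS where "MS X k = (if k \<in> X then M1 else M2)" for X :: "nat set" and k :: nat
    define \<eta> where "\<eta> q p s = \<chi> p q * cnj (\<alpha> s)" for q p s
    define Fm where "Fm q M = (\<Sum>p<?N. \<Sum>s<?N. \<Sum>p'<?N. \<Sum>s'<?N. cnj (\<eta> q p s) * \<eta> q p' s' *
       (\<Prod>k<n. M k (dig d k p) (dig d k s) (dig d k p') (dig d k s')))" for q and M :: "nat \<Rightarrow> nat \<Rightarrow> nat \<Rightarrow> nat \<Rightarrow> nat \<Rightarrow> complex"
    have Fpos: "0 \<le> Re (Fm q (MS X))" for q X
    proof -
      define m where "m k l i s = (if k \<in> X then (if l = (0, 0) \<and> i = s then 1 else 0) else if l = (i, s) then 1 / 2 else 0 :: complex)"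
        for k :: nat and l :: "nat \<times> nat" and i s
      have MSm: "MS X k i s i' s' = (\<Sum>l\<in>{..<d} \<times> {..<d}. m k l i s * cnj (m k l i' s'))"
        if "i < d" "s < d" "i' < d" "s' < d" for k i s i' s'
      proof (cases "k \<in> X")
        case True
        have "(\<Sum>l\<in>{..<d} \<times> {..<d}. m k l i s * cnj (m k l i' s')) = (\<Sum>l\<in>{..<d} \<times> {..<d}. if l = (0, 0) then M1 i s i' s' else 0)"
          using True by (intro sum.cong refl) (auto simp: m_def M1_def)
        also have "\<dots> = M1 i s i' s'" using d0 by (subst sum.delta) auto
        finally show ?thesis using True by (simp add: MS_def)
      next
        case False
        have "(\<Sum>l\<in>{..<d} \<times> {..<d}. m k l i s * cnj (m k l i' s')) = (\<Sum>l\<in>{..<d} \<times> {..<d}. if l = (i, s) then M2 i s i' s' else 0)"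
          using False by (intro sum.cong refl) (auto simp: m_def M2_def)
        also have "\<dots> = M2 i s i' s'" using that by (subst sum.delta) auto
        finally show ?thesis using False by (simp add: MS_def)
      qed
      have "Fm q (MS X) = (\<Sum>p<?N. \<Sum>s<?N. \<Sum>p'<?N. \<Sum>s'<?N. cnj (\<eta> q p s) * \<eta> q p' s' *
         (\<Prod>k<n. \<Sum>l\<in>{..<d} \<times> {..<d}. m k l (dig d k p) (dig d k s) * cnj (m k l (dig d k p') (dig d k s'))))"
        unfolding Fm_def using d0 by (intro sum.cong refl arg_cong2[of _ _ _ _ "(*)"] prod.cong MSm dig_less) auto
      thus ?thesis using prod_kernel_nonneg[where L = "{..<d} \<times> {..<d}" and \<eta> = "\<eta> q" and N = ?N and m = m and n = n and d = d] by simp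
    qed
    have Fexp: "Fm q (\<lambda>_ i s i' s'. M1 i s i' s' + M2 i s i' s') = (\<Sum>X\<in>Pow {..<n}. Fm q (MS X))" for q
    proof -
      have pr: "(\<Prod>k<n. M1 (a k) (b k) (a' k) (b' k) + M2 (a k) (b k) (a' k) (b' k)) =
         (\<Sum>X\<in>Pow {..<n}. \<Prod>k<n. MS X k (a k) (b k) (a' k) (b' k))" for a b a' b'
      proof -
        have "(\<Prod>k<n. M1 (a k) (b k) (a' k) (b' k) + M2 (a k) (b k) (a' k) (b' k)) =
           (\<Sum>X\<in>Pow {..<n}. (\<Prod>k\<in>X. M1 (a k) (b k) (a' k) (b' k)) * (\<Prod>k\<in>{..<n} - X. M2 (a k) (b k) (a' k) (b' k)))"
          by (rule prod_add) simp
        also have "\<dots> = (\<Sum>X\<in>Pow {..<n}. \<Prod>k<n. MS X k (a k) (b k) (a' k) (b' k))"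
        proof (intro sum.cong refl)
          fix X assume "X \<in> Pow {..<n}"
          hence X: "X \<subseteq> {..<n}" by simp
          have "(\<Prod>k<n. MS X k (a k) (b k) (a' k) (b' k)) = (\<Prod>k\<in>{..<n} - X. MS X k (a k) (b k) (a' k) (b' k)) * (\<Prod>k\<in>X. MS X k (a k) (b k) (a' k) (b' k))"
            by (rule prod.subset_diff[OF X]) simp
          thus "(\<Prod>k\<in>X. M1 (a k) (b k) (a' k) (b' k)) * (\<Prod>k\<in>{..<n} - X. M2 (a k) (b k) (a' k) (b' k)) =
              (\<Prod>k<n. MS X k (a k) (b k) (a' k) (b' k))"
            by (simp add: MS_def mult.commute)
        qed
        finally show ?thesis .
      qed
      define T where "T X p s p' s' = cnj (\<eta> q p s) * \<eta> q p' s' * (\<Prod>k<n. MS X k (dig d k p) (dig d k s) (dig d k p') (dig d k s'))" for X p s p' s'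
      have "Fm q (\<lambda>_ i s i' s'. M1 i s i' s' + M2 i s i' s') = (\<Sum>p<?N. \<Sum>s<?N. \<Sum>p'<?N. \<Sum>s'<?N. \<Sum>X\<in>Pow {..<n}. T X p s p' s')"
        unfolding Fm_def pr T_def by (simp add: sum_distrib_left)
      also have "\<dots> = (\<Sum>p<?N. \<Sum>s<?N. \<Sum>p'<?N. \<Sum>X\<in>Pow {..<n}. \<Sum>s'<?N. T X p s p' s')"
        by (rule sum.cong[OF refl], rule sum.cong[OF refl], rule sum.cong[OF refl], rule sum.swap)
      also have "\<dots> = (\<Sum>p<?N. \<Sum>s<?N. \<Sum>X\<in>Pow {..<n}. \<Sum>p'<?N. \<Sum>s'<?N. T X p s p' s')"
        by (rule sum.cong[OF refl], rule sum.cong[OF refl], rule sum.swap)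
      also have "\<dots> = (\<Sum>p<?N. \<Sum>X\<in>Pow {..<n}. \<Sum>s<?N. \<Sum>p'<?N. \<Sum>s'<?N. T X p s p' s')"
        by (rule sum.cong[OF refl], rule sum.swap)
      also have "\<dots> = (\<Sum>X\<in>Pow {..<n}. \<Sum>p<?N. \<Sum>s<?N. \<Sum>p'<?N. \<Sum>s'<?N. T X p s p' s')"
        by (rule sum.swap)
      finally show ?thesis unfolding T_def Fm_def .
    qed
    \<comment> \<open>The term with \<open>(13)\<close> on every copy is the one wanted; all other
      terms of the expansion are nonnegative and may be added.\<close>
    have top: "Fm q (MS {..<n}) = of_real ((cmod (\<Sum>p<?N. cnj (\<chi> p q) * \<alpha> p))\<^sup>2)" for q
    proof -
      have pr: "(\<Prod>k<n. MS {..<n} k (dig d k p) (dig d k s) (dig d k p') (dig d k s')) = (if s = p then 1 else 0) * (if s' = p' then 1 else 0)"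
        if lt: "p < ?N" "s < ?N" "p' < ?N" "s' < ?N" for p s p' s'
      proof (cases "s = p \<and> s' = p'")
        case True thus ?thesis by (simp add: MS_def M1_def)
      next
        case False
        then obtain k where k: "k < n" "\<not> (dig d k p = dig d k s \<and> dig d k p' = dig d k s')"
          using dig_eqI[OF lt(2,1)] dig_eqI[OF lt(4,3)] by metis
        hence "\<exists>k\<in>{..<n}. MS {..<n} k (dig d k p) (dig d k s) (dig d k p') (dig d k s') = 0"
          by (intro bexI[of _ k]) (auto simp: MS_def M1_def)
        hence "(\<Prod>k<n. MS {..<n} k (dig d k p) (dig d k s) (dig d k p') (dig d k s')) = 0" by (intro prod_zero) auto
        thus ?thesis using False by auto
      qed
      have "Fm q (MS {..<n}) = (\<Sum>p<?N. \<Sum>s<?N. \<Sum>p'<?N. \<Sum>s'<?N. (if s = p then cnj (\<eta> q p p) else 0) * (if s' = p' then \<eta> q p' p' else 0))"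
        unfolding Fm_def by (intro sum.cong refl) (auto simp: pr)
      also have "\<dots> = (\<Sum>p<?N. cnj (\<eta> q p p)) * (\<Sum>p'<?N. \<eta> q p' p')"
      proof -
        have i1: "(\<Sum>s'<?N. x * (if s' = p' then y else 0)) = x * y" if "p' < ?N" for p' and x y :: complex
          using that by (simp add: if_distrib[of "\<lambda>z. x * z"] cong: if_cong)
        have "(\<Sum>p<?N. \<Sum>s<?N. \<Sum>p'<?N. \<Sum>s'<?N. (if s = p then cnj (\<eta> q p p) else 0) * (if s' = p' then \<eta> q p' p' else 0)) =
            (\<Sum>p<?N. \<Sum>s<?N. \<Sum>p'<?N. (if s = p then cnj (\<eta> q p p) else 0) * \<eta> q p' p')"
          by (intro sum.cong refl i1) simp
        also have "\<dots> = (\<Sum>p<?N. \<Sum>s<?N. (\<Sum>p'<?N. \<eta> q p' p') * (if s = p then cnj (\<eta> q p p) else 0))"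
          unfolding sum_distrib_right by (simp only: mult.commute)
        also have "\<dots> = (\<Sum>p<?N. (\<Sum>p'<?N. \<eta> q p' p') * cnj (\<eta> q p p))"
          by (intro sum.cong refl i1) simp
        also have "\<dots> = (\<Sum>p'<?N. \<eta> q p' p') * (\<Sum>p<?N. cnj (\<eta> q p p))" by (rule sum_distrib_left[symmetric])
        also have "\<dots> = (\<Sum>p<?N. cnj (\<eta> q p p)) * (\<Sum>p'<?N. \<eta> q p' p')" by (rule mult.commute)
        finally show ?thesis .
      qed
      also have "\<dots> = of_real ((cmod (\<Sum>p<?N. cnj (\<chi> p q) * \<alpha> p))\<^sup>2)"
        by (simp add: \<eta>_def complex_norm_square del: of_real_power)
      finally show ?thesis .
    qed
    have "G = (\<Sum>q<?N. Re (Fm q (MS {..<n})))" by (simp add: G_def top)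
    also have "\<dots> \<le> (\<Sum>q<?N. Re (Fm q (\<lambda>_ i s i' s'. M1 i s i' s' + M2 i s i' s')))"
    proof (rule sum_mono)
      fix q
      have "Re (Fm q (MS {..<n})) \<le> (\<Sum>X\<in>Pow {..<n}. Re (Fm q (MS X)))"
        by (rule member_le_sum) (auto simp: Fpos)
      thus "Re (Fm q (MS {..<n})) \<le> Re (Fm q (\<lambda>_ i s i' s'. M1 i s i' s' + M2 i s i' s'))"
        by (simp add: Fexp)
    qed
    also have "\<dots> = Re Gf"
    proof -
      have pwT: "pw d n T3 (p, q, r) (p', q', r') = (if q' = q then 1 else 0) *
          (\<Prod>k<n. M1 (dig d k p) (dig d k r') (dig d k p') (dig d k r) + M2 (dig d k p) (dig d k r') (dig d k p') (dig d k r))"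
        if q: "q < ?N" "q' < ?N" for p q r p' q' r'
      proof (cases "q' = q")
        case True
        have "T3 (i, j, l) (i', j, l') = M1 i l' i' l + M2 i l' i' l" for i j l i' l'
        proof -
          have "((i', j, l') = sw13 (i, j, l)) = (i = l' \<and> i' = l)" "((i', j, l') = (i, j, l)) = (i = i' \<and> l' = l)"
            by (auto simp: sw13_def)
          thus ?thesis unfolding T3_def M1_def M2_def by simp
        qed
        thus ?thesis using True by (simp add: pw_def dg3_def)
      next
        case False
        then obtain k where k: "k < n" "dig d k q' \<noteq> dig d k q" using dig_eqI[OF q(2,1)] by blast
        hence "\<exists>k\<in>{..<n}. T3 (dg3 d k (p, q, r)) (dg3 d k (p', q', r')) = 0"
          by (intro bexI[of _ k]) (auto simp: T3_def dg3_def sw13_def)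
        hence "pw d n T3 (p, q, r) (p', q', r') = 0" unfolding pw_def by (intro prod_zero) auto
        thus ?thesis using False by simp
      qed
      define W where "W p q r p' r' = cnj (\<chi> p q * \<alpha> r) * (\<chi> p' q * \<alpha> r') *
          (\<Prod>k<n. M1 (dig d k p) (dig d k r') (dig d k p') (dig d k r) + M2 (dig d k p) (dig d k r') (dig d k p') (dig d k r))" for p q r p' r'
      have "Gf = (\<Sum>p<?N. \<Sum>q<?N. \<Sum>r<?N. \<Sum>p'<?N. \<Sum>q'<?N. \<Sum>r'<?N. if q' = q then W p q r p' r' else 0)"
        unfolding Gf_def sum_X3 by (intro sum.cong refl) (auto simp: Z pwT W_def)
      also have "\<dots> = (\<Sum>p<?N. \<Sum>q<?N. \<Sum>r<?N. \<Sum>p'<?N. \<Sum>r'<?N. W p q r p' r')"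
      proof (rule sum.cong[OF refl], rule sum.cong[OF refl], rule sum.cong[OF refl], rule sum.cong[OF refl])
        fix p q r p' assume "q \<in> {..<?N}"
        have "(\<Sum>q'<?N. \<Sum>r'<?N. if q' = q then W p q r p' r' else 0) = (\<Sum>q'<?N. if q' = q then (\<Sum>r'<?N. W p q r p' r') else 0)"
          by (intro sum.cong refl) auto
        thus "(\<Sum>q'<?N. \<Sum>r'<?N. if q' = q then W p q r p' r' else 0) = (\<Sum>r'<?N. W p q r p' r')"
          using \<open>q \<in> {..<?N}\<close> by simp
      qed
      also have "\<dots> = (\<Sum>q<?N. \<Sum>p<?N. \<Sum>r<?N. \<Sum>p'<?N. \<Sum>r'<?N. W p q r p' r')" by (rule sum.swap)
      also have "\<dots> = (\<Sum>q<?N. \<Sum>p<?N. \<Sum>r'<?N. \<Sum>p'<?N. \<Sum>r<?N. W p q r p' r')"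
      proof (rule sum.cong[OF refl], rule sum.cong[OF refl])
        fix q p
        have "(\<Sum>r<?N. \<Sum>p'<?N. \<Sum>r'<?N. W p q r p' r') = (\<Sum>r<?N. \<Sum>r'<?N. \<Sum>p'<?N. W p q r p' r')"
          by (rule sum.cong[OF refl], rule sum.swap)
        also have "\<dots> = (\<Sum>r'<?N. \<Sum>r<?N. \<Sum>p'<?N. W p q r p' r')" by (rule sum.swap)
        also have "\<dots> = (\<Sum>r'<?N. \<Sum>p'<?N. \<Sum>r<?N. W p q r p' r')" by (rule sum.cong[OF refl], rule sum.swap)
        finally show "(\<Sum>r<?N. \<Sum>p'<?N. \<Sum>r'<?N. W p q r p' r') = (\<Sum>r'<?N. \<Sum>p'<?N. \<Sum>r<?N. W p q r p' r')" .
      qed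
      also have "\<dots> = (\<Sum>q<?N. Fm q (\<lambda>_ i s i' s'. M1 i s i' s' + M2 i s i' s'))"
        unfolding Fm_def W_def \<eta>_def by (simp add: mult_ac)
      finally show ?thesis by simp
    qed
    finally show ?thesis .
  qed
  define V where "V x = (\<Sum>y\<in>X3 ?N. pw d n (K3 d) x y * Y y)" for x
  have VZ: "V x = (\<Sum>u\<in>X3 ?N. pw d n P3 x u * (\<Sum>v\<in>X3 ?N. pw d n T3 u v * Z v))" for x
  proof -
    have "V x = (\<Sum>y\<in>X3 ?N. \<Sum>u\<in>X3 ?N. \<Sum>v\<in>X3 ?N. pw d n P3 x u * (pw d n T3 u v * (pw d n P3 v y * Y y)))"
      unfolding V_def K3_def pw_comp3[symmetric] by (simp add: sum_distrib_left sum_distrib_right mult_ac)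
    also have "\<dots> = (\<Sum>u\<in>X3 ?N. \<Sum>y\<in>X3 ?N. \<Sum>v\<in>X3 ?N. pw d n P3 x u * (pw d n T3 u v * (pw d n P3 v y * Y y)))"
      by (rule sum.swap)
    also have "\<dots> = (\<Sum>u\<in>X3 ?N. \<Sum>v\<in>X3 ?N. \<Sum>y\<in>X3 ?N. pw d n P3 x u * (pw d n T3 u v * (pw d n P3 v y * Y y)))"
      by (rule sum.cong[OF refl], rule sum.swap)
    finally show ?thesis by (simp add: Z_def sum_distrib_left)
  qed
  have GV: "Gf = (\<Sum>x\<in>X3 ?N. cnj (Y x) * V x)"
  proof -
    define TZ where "TZ x = (\<Sum>v\<in>X3 ?N. pw d n T3 x v * Z v)" for x
    have sym: "cnj (pw d n P3 x y) = pw d n P3 y x" for x y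
      by (simp add: pw_def P3_cnj P3_sym)
    have "Gf = (\<Sum>x\<in>X3 ?N. cnj (Z x) * TZ x)" by (simp add: Gf_def TZ_def sum_distrib_left mult_ac)
    also have "\<dots> = (\<Sum>x\<in>X3 ?N. \<Sum>y\<in>X3 ?N. cnj (Y y) * (pw d n P3 y x * TZ x))"
      by (simp add: Z_def sym sum_distrib_left sum_distrib_right mult_ac)
    also have "\<dots> = (\<Sum>y\<in>X3 ?N. \<Sum>x\<in>X3 ?N. cnj (Y y) * (pw d n P3 y x * TZ x))" by (rule sum.swap)
    finally show ?thesis by (simp add: VZ TZ_def sum_distrib_left)
  qed
  have normY: "(\<Sum>x\<in>X3 ?N. (cmod (Y x))\<^sup>2) = 1"
  proof -
    have "(\<Sum>x\<in>X3 ?N. (cmod (Y x))\<^sup>2) = (\<Sum>p<?N. \<Sum>q<?N. \<Sum>r<?N. (cmod (\<alpha> p))\<^sup>2 * ((cmod (\<beta> q))\<^sup>2 * (cmod (\<alpha> r))\<^sup>2))"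
      by (simp add: sum_X3 Y_def norm_mult power_mult_distrib mult_ac)
    also have "\<dots> = norm_sq ?N \<alpha> * (norm_sq ?N \<beta> * norm_sq ?N \<alpha>)"
      unfolding norm_sq_def by (simp only: sum_distrib_left[symmetric] sum_distrib_right[symmetric])
    finally show ?thesis by (simp add: na nb)
  qed
  \<comment> \<open>Here \<open>K3_square\<close> enters, once per copy. What remains is the
    expectation of \<open>P\<close> in \<open>Y\<close>, which is \<open>h\<close> because \<alpha>
    is a unit vector.\<close>
  have normV: "(\<Sum>x\<in>X3 ?N. (cmod (V x))\<^sup>2) = (9 / 16) ^ n * h"
  proof -
    have sym: "cnj (pw d n (K3 d) x y) = pw d n (K3 d) y x" for x y
      by (simp add: pw_def K3_sym_cnj)
    have "complex_of_real (\<Sum>x\<in>X3 ?N. (cmod (V x))\<^sup>2) = (\<Sum>x\<in>X3 ?N. cnj (V x) * V x)"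
      by (simp add: complex_norm_square mult.commute del: of_real_power)
    also have "\<dots> = (\<Sum>x\<in>X3 ?N. \<Sum>y\<in>X3 ?N. \<Sum>z\<in>X3 ?N. cnj (Y y) * (pw d n (K3 d) y x * pw d n (K3 d) x z) * Y z)"
      unfolding V_def cnj_sum sum_product by (simp add: sym mult_ac)
    also have "\<dots> = (\<Sum>y\<in>X3 ?N. \<Sum>x\<in>X3 ?N. \<Sum>z\<in>X3 ?N. cnj (Y y) * (pw d n (K3 d) y x * pw d n (K3 d) x z) * Y z)"
      by (rule sum.swap)
    also have "\<dots> = (\<Sum>y\<in>X3 ?N. \<Sum>z\<in>X3 ?N. \<Sum>x\<in>X3 ?N. cnj (Y y) * (pw d n (K3 d) y x * pw d n (K3 d) x z) * Y z)"
      by (rule sum.cong[OF refl], rule sum.swap)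
    also have "\<dots> = (\<Sum>y\<in>X3 ?N. \<Sum>z\<in>X3 ?N. cnj (Y y) * pw d n (comp3 d (K3 d) (K3 d)) y z * Y z)"
      by (simp add: sum_distrib_left sum_distrib_right flip: pw_comp3)
    also have "\<dots> = (\<Sum>y\<in>X3 ?N. \<Sum>z\<in>X3 ?N. cnj (Y y) * ((9 / 16) ^ n * pw d n P3 y z) * Y z)"
    proof (intro sum.cong refl)
      fix y z
      have "pw d n (comp3 d (K3 d) (K3 d)) y z = pw d n (\<lambda>a c. 9 / 16 * P3 a c) y z"
        by (rule pw_cong[OF d0]) (rule K3_square)
      also have "\<dots> = (9 / 16) ^ n * pw d n P3 y z" unfolding pw_def prod.distrib by simp
      finally show "cnj (Y y) * pw d n (comp3 d (K3 d) (K3 d)) y z * Y z = cnj (Y y) * ((9 / 16) ^ n * pw d n P3 y z) * Y z" by simp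
    qed
    also have "\<dots> = (9 / 16) ^ n * (\<Sum>y\<in>X3 ?N. cnj (Y y) * Z y)"
      by (simp add: Z_def sum_distrib_left mult_ac)
    also have "(\<Sum>y\<in>X3 ?N. cnj (Y y) * Z y) = of_real h"
    proof -
      have "(\<Sum>y\<in>X3 ?N. cnj (Y y) * Z y) = (\<Sum>p<?N. \<Sum>q<?N. \<Sum>r<?N. cnj (\<alpha> p) * cnj (\<beta> q) * \<chi> p q * of_real ((cmod (\<alpha> r))\<^sup>2))"
        unfolding sum_X3 by (intro sum.cong refl) (simp add: Y_def Z complex_norm_square mult_ac del: of_real_power)
      also have "\<dots> = (\<Sum>p<?N. \<Sum>q<?N. cnj (\<alpha> p) * cnj (\<beta> q) * \<chi> p q * of_real (norm_sq ?N \<alpha>))"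
        by (simp add: norm_sq_def sum_distrib_left)
      finally show ?thesis by (simp add: na h\<chi>)
    qed
    also have "(9 / 16) ^ n * complex_of_real h = complex_of_real ((9 / 16) ^ n * h)" by simp
    finally show ?thesis unfolding of_real_eq_iff .
  qed
  have h1: "h \<le> 1"
  proof -
    have "qf ?N ?N (1\<^sub>m (?N * ?N)) \<alpha> \<beta> - qf ?N ?N (antisym_proj d n) \<alpha> \<beta> = qf ?N ?N (1\<^sub>m (?N * ?N) - antisym_proj d n) \<alpha> \<beta>"
      by (simp add: qf_def quad_def left_diff_distrib right_diff_distrib sum_subtractf)
    also have "\<dots> \<ge> 0" unfolding qf_def by (rule psd_quad_ge[OF psd_one_minus_antisym_proj])
    finally show ?thesis by (simp add: qf_one na nb h_def)
  qed
  have "(Re Gf)\<^sup>2 \<le> (cmod Gf)\<^sup>2" by (simp add: cmod_power2)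
  also have "\<dots> \<le> (\<Sum>x\<in>X3 ?N. cmod (Y x) * cmod (V x))\<^sup>2"
    unfolding GV by (intro power_mono order.trans[OF norm_sum]) (auto simp: norm_mult)
  also have "\<dots> \<le> (\<Sum>x\<in>X3 ?N. (cmod (Y x))\<^sup>2) * (\<Sum>x\<in>X3 ?N. (cmod (V x))\<^sup>2)"
    by (rule Cauchy_Schwarz_sum)
  \<comment> \<open>The remaining factor \<open>h\<close> is bounded by one only.\<close>
  also have "\<dots> \<le> (9 / 16) ^ n" unfolding normY normV using h1 by (simp add: mult_left_le)
  also have "(9 / 16 :: real) ^ n = ((3 / 4) ^ n)\<^sup>2"
    by (simp add: power2_eq_square flip: power_mult_distrib)
  finally have "Re Gf \<le> (3 / 4) ^ n" by (rule power2_le_imp_le) simp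
  thus "(qf ?N ?N (antisym_proj d n) \<alpha> \<beta>)\<^sup>2 \<le> (3 / 4) ^ n" using hG G_le by (simp add: h_def)
qed

text \<open>Homogeneity extends the bound for unit vectors to all product vectors, and
  \<open>trace_sep_le\<close> carries it to mixtures.\<close>

lemma trace_antisym_proj_sep_le:
  assumes d: "d \<ge> 2" and \<sigma>: "\<sigma> \<in> sep_states (d ^ n) (d ^ n)"
  shows "Re (mat_trace (antisym_proj d n * \<sigma>)) \<le> sqrt ((3 / 4) ^ n)"
proof -
  let ?N = "d ^ n"
  have N0: "?N > 0" using d by simp
  have "qf ?N ?N (antisym_proj d n) \<alpha> \<beta> \<le> sqrt ((3 / 4) ^ n) * (norm_sq ?N \<alpha> * norm_sq ?N \<beta>)" for \<alpha> \<beta>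
  proof -
    obtain \<alpha>' where \<alpha>': "norm_sq ?N \<alpha>' = 1" "\<And>i. i < ?N \<Longrightarrow> \<alpha> i = complex_of_real (sqrt (norm_sq ?N \<alpha>)) * \<alpha>' i"
      using normalize_vec[OF N0, of \<alpha>] by blast
    obtain \<beta>' where \<beta>': "norm_sq ?N \<beta>' = 1" "\<And>i. i < ?N \<Longrightarrow> \<beta> i = complex_of_real (sqrt (norm_sq ?N \<beta>)) * \<beta>' i"
      using normalize_vec[OF N0, of \<beta>] by blast
    define s where "s = sqrt (norm_sq ?N \<alpha>) * sqrt (norm_sq ?N \<beta>)"
    have pv: "prodvec ?N \<alpha> \<beta> x = complex_of_real s * prodvec ?N \<alpha>' \<beta>' x" if "x < ?N * ?N" for x
    proof -
      have "prodvec ?N \<alpha> \<beta> x = (complex_of_real (sqrt (norm_sq ?N \<alpha>)) * \<alpha>' (x div ?N)) * (complex_of_real (sqrt (norm_sq ?N \<beta>)) * \<beta>' (x mod ?N))"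
        unfolding prodvec_def by (simp only: \<alpha>'(2)[OF div_mod_less(1)[OF that], symmetric] \<beta>'(2)[OF div_mod_less(2)[OF that], symmetric])
      thus ?thesis by (simp add: s_def prodvec_def mult_ac)
    qed
    have "quad (?N * ?N) (antisym_proj d n) (prodvec ?N \<alpha> \<beta>) = complex_of_real (s * s) * quad (?N * ?N) (antisym_proj d n) (prodvec ?N \<alpha>' \<beta>')"
      unfolding quad_def sum_distrib_left by (intro sum.cong refl) (simp add: pv mult_ac)
    hence "qf ?N ?N (antisym_proj d n) \<alpha> \<beta> = (s * s) * qf ?N ?N (antisym_proj d n) \<alpha>' \<beta>'" by (simp add: qf_def)
    also have "s * s = norm_sq ?N \<alpha> * norm_sq ?N \<beta>" by (simp add: s_def mult_ac flip: mult.assoc) 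
    finally have "qf ?N ?N (antisym_proj d n) \<alpha> \<beta> = (norm_sq ?N \<alpha> * norm_sq ?N \<beta>) * qf ?N ?N (antisym_proj d n) \<alpha>' \<beta>'" .
    moreover have "qf ?N ?N (antisym_proj d n) \<alpha>' \<beta>' \<le> sqrt ((3 / 4) ^ n)"
      by (rule real_le_rsqrt) (rule qf_antisym_proj_le(2)[OF d \<alpha>'(1) \<beta>'(1)])
    ultimately show ?thesis by (metis mult.commute mult_left_mono mult_nonneg_nonneg norm_sq_nonneg)
  qed
  from trace_sep_le[OF \<sigma> antisym_proj_carrier this] show ?thesis
    by (simp add: mat_trace_comm[OF antisym_proj_carrier sep_states_carrier[OF \<sigma>]])
qed

section \<open>Separable hypothesis tests\<close>

text \<open>One test suffices. If the infimum is zero, \<open>D_H\<close> is infinite and the bound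
  is trivial.\<close>

lemma D_H_ge:
  assumes R: "\<rho> \<in> carrier_mat D D" and S: "psd D \<sigma>"
    and E: "psd D E" "psd D (1\<^sub>m D - E)" "[E, 1\<^sub>m D - E] \<in> M" "1 - \<epsilon> \<le> Re (mat_trace (E * \<rho>))"
    and b: "0 < b" "Re (mat_trace (E * \<sigma>)) \<le> b"
  shows "ereal (- log 2 b) \<le> D_H M \<epsilon> \<rho> \<sigma>"
proof -
  let ?V = "{Re (mat_trace (E * \<sigma>)) | E. psd D E \<and> psd D (1\<^sub>m D - E) \<and>
      [E, 1\<^sub>m D - E] \<in> M \<and> Re (mat_trace (E * \<rho>)) \<ge> 1 - \<epsilon>}"
  have d: "dim_row \<rho> = D" using R by auto
  have v: "Re (mat_trace (E * \<sigma>)) \<in> ?V" using E by blast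
  have nn: "0 \<le> x" if "x \<in> ?V" for x using that mat_trace_psd_mult[OF _ S] by blast
  have "bdd_below ?V" using nn by (rule bdd_belowI)
  hence "Inf ?V \<le> b" using cInf_lower[OF v] b(2) by linarith
  moreover have "0 \<le> Inf ?V" using v nn by (intro cInf_greatest) auto
  ultimately show ?thesis unfolding D_H_def Let_def d using b(1) by auto
qed

text \<open>The feasible test \<open>E\<close> only ensures that the infimum is over a nonempty set;
  the bound itself must hold for every feasible test.\<close>

lemma D_H_le:
  assumes R: "\<rho> \<in> carrier_mat D D"
    and E: "psd D E" "psd D (1\<^sub>m D - E)" "[E, 1\<^sub>m D - E] \<in> M" "1 - \<epsilon> \<le> Re (mat_trace (E * \<rho>))"
    and b: "0 < b" "\<And>E. psd D E \<Longrightarrow> psd D (1\<^sub>m D - E) \<Longrightarrow> [E, 1\<^sub>m D - E] \<in> M \<Longrightarrow>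
      1 - \<epsilon> \<le> Re (mat_trace (E * \<rho>)) \<Longrightarrow> b \<le> Re (mat_trace (E * \<sigma>))"
  shows "D_H M \<epsilon> \<rho> \<sigma> \<le> ereal (- log 2 b)"
proof -
  let ?V = "{Re (mat_trace (E * \<sigma>)) | E. psd D E \<and> psd D (1\<^sub>m D - E) \<and>
      [E, 1\<^sub>m D - E] \<in> M \<and> Re (mat_trace (E * \<rho>)) \<ge> 1 - \<epsilon>}"
  have d: "dim_row \<rho> = D" using R by auto
  have v: "Re (mat_trace (E * \<sigma>)) \<in> ?V" using E by blast
  have "b \<le> Inf ?V" using v b(2) by (intro cInf_greatest) blast+
  thus ?thesis unfolding D_H_def Let_def d using b(1) by auto
qed

lemma mat_trace_sum_mats:
  assumes Z: "Z \<in> carrier_mat D D" and "\<And>E. E \<in> set Es \<Longrightarrow> f E \<in> carrier_mat D D"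
  shows "mat_trace (Z * sum_mats D f Es) = (\<Sum>E\<leftarrow>Es. mat_trace (Z * f E))"
proof -
  have "mat_trace (Z * sum_mats D f Es) = (\<Sum>i<D. \<Sum>j<D. \<Sum>E\<leftarrow>Es. Z $$ (i, j) * f E $$ (j, i))"
    by (subst mat_trace_mult[OF Z]) (auto simp: sum_mats_def sum_list_const_mult intro!: sum.cong)
  also have "\<dots> = (\<Sum>E\<leftarrow>Es. \<Sum>i<D. \<Sum>j<D. Z $$ (i, j) * f E $$ (j, i))"
    by (induction Es) (auto simp: sum.distrib)
  also have "\<dots> = (\<Sum>E\<leftarrow>Es. mat_trace (Z * f E))"
    using assms by (intro arg_cong[of _ _ sum_list] map_cong refl) (simp add: mat_trace_mult[OF Z])
  finally show ?thesis .
qed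

lemma Re_sum_list: "Re (\<Sum>x\<leftarrow>xs. f x) = (\<Sum>x\<leftarrow>xs. Re (f x))"
  by (induction xs) auto

lemma SEP_meas_iff:
  assumes "a > 0" "b > 0"
  shows "Es \<in> SEP_meas a b \<longleftrightarrow> (\<forall>E\<in>set Es. sep_op a b E) \<and> sum_mats (a * b) (\<lambda>E. E) Es = 1\<^sub>m (a * b)"
  unfolding SEP_meas_def ALL_meas_def using cone_sep_states[OF assms] by (auto intro: sep_op_psd)

lemma sum_trace_povm:
  assumes "X \<in> carrier_mat D D" "\<And>E. E \<in> set Es \<Longrightarrow> E \<in> carrier_mat D D" "sum_mats D (\<lambda>E. E) Es = 1\<^sub>m D"
  shows "(\<Sum>E\<leftarrow>Es. Re (mat_trace (X * E))) = Re (mat_trace X)"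
  using mat_trace_sum_mats[of X D Es "\<lambda>E. E"] assms by (simp flip: Re_sum_list)

text \<open>Converse of \<open>trace_sep_le\<close>: the hypothesis is applied to the projection
  onto the normalized product vector.\<close>

lemma qf_le_of_trace_le:
  assumes X: "X \<in> carrier_mat (a * b) (a * b)" and pos: "a > 0" "b > 0"
    and le: "\<And>\<sigma>. \<sigma> \<in> sep_states a b \<Longrightarrow> Re (mat_trace (\<sigma> * X)) \<le> c"
  shows "qf a b X \<alpha> \<beta> \<le> c * (norm_sq a \<alpha> * norm_sq b \<beta>)"
proof -
  obtain \<alpha>' where \<alpha>': "norm_sq a \<alpha>' = 1" "\<And>i. i < a \<Longrightarrow> \<alpha> i = complex_of_real (sqrt (norm_sq a \<alpha>)) * \<alpha>' i"
    using normalize_vec[OF pos(1), of \<alpha>] by blast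
  obtain \<beta>' where \<beta>': "norm_sq b \<beta>' = 1" "\<And>i. i < b \<Longrightarrow> \<beta> i = complex_of_real (sqrt (norm_sq b \<beta>)) * \<beta>' i"
    using normalize_vec[OF pos(2), of \<beta>] by blast
  define s where "s = sqrt (norm_sq a \<alpha>) * sqrt (norm_sq b \<beta>)"
  have pv: "prodvec b \<alpha> \<beta> x = complex_of_real s * prodvec b \<alpha>' \<beta>' x" if "x < a * b" for x
  proof -
    have "prodvec b \<alpha> \<beta> x = (complex_of_real (sqrt (norm_sq a \<alpha>)) * \<alpha>' (x div b)) * (complex_of_real (sqrt (norm_sq b \<beta>)) * \<beta>' (x mod b))"
      unfolding prodvec_def by (simp only: \<alpha>'(2)[OF div_mod_less(1)[OF that], symmetric] \<beta>'(2)[OF div_mod_less(2)[OF that], symmetric])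
    thus ?thesis by (simp add: s_def prodvec_def mult_ac)
  qed
  have "quad (a * b) X (prodvec b \<alpha> \<beta>) = complex_of_real (s * s) * quad (a * b) X (prodvec b \<alpha>' \<beta>')"
    unfolding quad_def sum_distrib_left by (intro sum.cong refl) (simp add: pv mult_ac)
  hence e: "qf a b X \<alpha> \<beta> = (s * s) * qf a b X \<alpha>' \<beta>'" by (simp add: qf_def)
  have s: "s * s = norm_sq a \<alpha> * norm_sq b \<beta>" by (simp add: s_def mult_ac flip: mult.assoc)
  have "sep_sum a b [(\<alpha>', \<beta>')] \<in> sep_states a b"
    unfolding sep_states_iff mat_trace_sep_sum by (auto simp: sep_op_def \<alpha>' \<beta>')
  from le[OF this] have "qf a b X \<alpha>' \<beta>' \<le> c" by (simp add: mat_trace_sep_sum_mult[OF X] qf_def)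
  hence "(norm_sq a \<alpha> * norm_sq b \<beta>) * qf a b X \<alpha>' \<beta>' \<le> (norm_sq a \<alpha> * norm_sq b \<beta>) * c" by (intro mult_left_mono) auto
  thus ?thesis unfolding e s by (simp add: mult.commute)
qed

lemma qf_sum_list:
  assumes "\<And>x y. x < a * b \<Longrightarrow> y < a * b \<Longrightarrow> Y $$ (x, y) = (\<Sum>l\<leftarrow>ls. complex_of_real (w l) * X l $$ (x, y))"
  shows "qf a b Y \<alpha> \<beta> = (\<Sum>l\<leftarrow>ls. w l * qf a b (X l) \<alpha> \<beta>)"
proof -
  let ?z = "prodvec b \<alpha> \<beta>"
  have "quad (a * b) Y ?z = (\<Sum>i<a * b. \<Sum>j<a * b. \<Sum>l\<leftarrow>ls. complex_of_real (w l) * (cnj (?z i) * X l $$ (i, j) * ?z j))"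
    unfolding quad_def
    by (intro sum.cong refl) (simp add: assms mult_ac flip: sum_list_const_mult)
  also have "\<dots> = (\<Sum>l\<leftarrow>ls. \<Sum>i<a * b. \<Sum>j<a * b. complex_of_real (w l) * (cnj (?z i) * X l $$ (i, j) * ?z j))"
    by (induction ls) (auto simp: sum.distrib)
  also have "\<dots> = (\<Sum>l\<leftarrow>ls. complex_of_real (w l) * quad (a * b) (X l) ?z)"
    by (simp add: quad_def sum_distrib_left)
  finally show ?thesis by (simp add: qf_def Re_sum_list)
qed

lemma qf_nonneg: "sep_op a b E \<Longrightarrow> 0 \<le> qf a b E \<alpha> \<beta>"
  unfolding qf_def by (rule psd_quad_ge[OF sep_op_psd])

text \<open>A separable measurement together with a likelihood ratio \<open>L\<close> on its outcomes whose expectation is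
  at most one under every separable state.\<close>

definition lr_test :: "nat \<Rightarrow> nat \<Rightarrow> (complex mat \<times> real) list \<Rightarrow> bool" where
  "lr_test d n Z \<longleftrightarrow> (\<forall>l\<in>set Z. sep_op (d ^ n) (d ^ n) (fst l) \<and> 0 < snd l) \<and>
     sum_mats (d ^ n * d ^ n) fst Z = 1\<^sub>m (d ^ n * d ^ n) \<and>
     (\<forall>\<alpha> \<beta>. (\<Sum>l\<leftarrow>Z. snd l * qf (d ^ n) (d ^ n) (fst l) \<alpha> \<beta>) \<le> norm_sq (d ^ n) \<alpha> * norm_sq (d ^ n) \<beta>)"

definition rho_prob :: "nat \<Rightarrow> nat \<Rightarrow> complex mat \<Rightarrow> real" where
  "rho_prob d n E = Re (mat_trace (rho d n * E))"

text \<open>The expectation of \<open>L powr (- s)\<close> under the outcome distribution of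
  \<open>rho d n\<close>, an exponential moment of the log-likelihood ratio.\<close>

definition chernoff_sum :: "nat \<Rightarrow> nat \<Rightarrow> real \<Rightarrow> (complex mat \<times> real) list \<Rightarrow> real" where
  "chernoff_sum d n s Z = (\<Sum>l\<leftarrow>Z. rho_prob d n (fst l) * snd l powr (- s))"

text \<open>Pads numbers of copies that are not multiples of the block length.\<close>

lemma lr_test_trivial:
  assumes d: "d \<ge> 2"
  shows "lr_test d n [(1\<^sub>m (d ^ n * d ^ n), 1)]" "chernoff_sum d n s [(1\<^sub>m (d ^ n * d ^ n), 1)] = 1"
proof -
  have "sum_mats (d ^ n * d ^ n) fst [(1\<^sub>m (d ^ n * d ^ n), 1::real)] = 1\<^sub>m (d ^ n * d ^ n)"
    by (rule eq_matI) (auto simp: sum_mats_def)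
  thus "lr_test d n [(1\<^sub>m (d ^ n * d ^ n), 1)]" by (simp add: lr_test_def sep_op_one qf_one)
  show "chernoff_sum d n s [(1\<^sub>m (d ^ n * d ^ n), 1)] = 1"
    using density_rho[OF d] by (simp add: chernoff_sum_def rho_prob_def right_mult_one_mat[OF rho_carrier] density_def)
qed

lemma rho_prob_nonneg: "d \<ge> 2 \<Longrightarrow> sep_op (d ^ n) (d ^ n) E \<Longrightarrow> 0 \<le> rho_prob d n E"
  unfolding rho_prob_def using density_rho[of d n] by (auto simp: density_def intro!: mat_trace_psd_mult sep_op_psd)

lemma sum_rho_prob:
  assumes d: "d \<ge> 2" and Z: "lr_test d n Z"
  shows "(\<Sum>l\<leftarrow>Z. rho_prob d n (fst l)) = 1"
proof -
  have "mat_trace (rho d n * sum_mats (d ^ n * d ^ n) fst Z) = (\<Sum>l\<leftarrow>Z. mat_trace (rho d n * fst l))"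
    by (rule mat_trace_sum_mats[OF rho_carrier]) (use Z sep_op_carrier in \<open>auto simp: lr_test_def\<close>)
  moreover have "mat_trace (rho d n * sum_mats (d ^ n * d ^ n) fst Z) = 1"
    using Z density_rho[OF d] by (simp add: lr_test_def right_mult_one_mat[OF rho_carrier] density_def)
  ultimately show ?thesis by (simp add: rho_prob_def flip: Re_sum_list)
qed

lemma sum_list_product:
  fixes f g :: "_ \<Rightarrow> 'b::comm_semiring_0"
  shows "(\<Sum>t\<leftarrow>List.product xs ys. f (fst t) * g (snd t)) = (\<Sum>x\<leftarrow>xs. f x) * (\<Sum>y\<leftarrow>ys. g y)"
  by (induction xs) (simp_all add: o_def sum_list_const_mult distrib_right)

lemma rho_add: "rho d (m + n) = box (d ^ m) (d ^ m) (d ^ n) (d ^ n) (rho d m) (rho d n)"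
  unfolding rho_def by (rule bip_pow_add[OF antisym_carrier])

text \<open>Measuring both blocks and multiplying the ratios. The bound for arbitrary product
  vectors of the joint system, possibly entangled between the blocks within a party, is
  \<open>qf_box_le\<close> for the two ratio-weighted sums of effects.\<close>

lemma lr_test_box:
  assumes d: "d \<ge> 2" and Z: "lr_test d m Z" and Z': "lr_test d n Z'"
  defines "W \<equiv> map (\<lambda>t. (box (d ^ m) (d ^ m) (d ^ n) (d ^ n) (fst (fst t)) (fst (snd t)), snd (fst t) * snd (snd t))) (List.product Z Z')"
  shows "lr_test d (m + n) W" "chernoff_sum d (m + n) s W = chernoff_sum d m s Z * chernoff_sum d n s Z'"
proof -
  let ?a = "d ^ m" and ?b = "d ^ n"
  let ?box = "box ?a ?a ?b ?b"
  have N: "d ^ (m + n) = ?a * ?b" by (simp add: power_add)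
  have sZ: "sep_op ?a ?a (fst l)" "0 < snd l" if "l \<in> set Z" for l using Z that by (auto simp: lr_test_def)
  have sZ': "sep_op ?b ?b (fst l)" "0 < snd l" if "l \<in> set Z'" for l using Z' that by (auto simp: lr_test_def)
  have oneZ: "(\<Sum>l\<leftarrow>Z. fst l $$ (x, y)) = 1\<^sub>m (?a * ?a) $$ (x, y)" if "x < ?a * ?a" "y < ?a * ?a" for x y
  proof -
    have "sum_mats (?a * ?a) fst Z $$ (x, y) = 1\<^sub>m (?a * ?a) $$ (x, y)" using Z by (simp add: lr_test_def)
    thus ?thesis using that by (simp add: sum_mats_def)
  qed
  have oneZ': "(\<Sum>l\<leftarrow>Z'. fst l $$ (x, y)) = 1\<^sub>m (?b * ?b) $$ (x, y)" if "x < ?b * ?b" "y < ?b * ?b" for x y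
  proof -
    have "sum_mats (?b * ?b) fst Z' $$ (x, y) = 1\<^sub>m (?b * ?b) $$ (x, y)" using Z' by (simp add: lr_test_def)
    thus ?thesis using that by (simp add: sum_mats_def)
  qed
  have 1: "\<forall>l\<in>set W. sep_op (?a * ?b) (?a * ?b) (fst l) \<and> 0 < snd l"
    unfolding W_def using sZ sZ' by (auto intro: sep_op_box)
  have 2: "sum_mats (?a * ?b * (?a * ?b)) fst W = 1\<^sub>m (?a * ?b * (?a * ?b))"
  proof (rule eq_matI)
    fix x y assume "x < dim_row (1\<^sub>m (?a * ?b * (?a * ?b)))" "y < dim_col (1\<^sub>m (?a * ?b * (?a * ?b)))"
    hence xy: "x < ?a * ?b * (?a * ?b)" "y < ?a * ?b * (?a * ?b)" by auto
    note h = hi_lo(1,2)[OF xy(1)] hi_lo(1,2)[OF xy(2)]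
    let ?h = "hi ?a ?b ?b" and ?l = "lo ?a ?b ?b"
    have "sum_mats (?a * ?b * (?a * ?b)) fst W $$ (x, y) = (\<Sum>t\<leftarrow>List.product Z Z'. ?box (fst (fst t)) (fst (snd t)) $$ (x, y))"
      using xy by (simp add: sum_mats_def W_def o_def)
    also have "\<dots> = (\<Sum>t\<leftarrow>List.product Z Z'. fst (fst t) $$ (hi ?a ?b ?b x, hi ?a ?b ?b y) * fst (snd t) $$ (lo ?a ?b ?b x, lo ?a ?b ?b y))"
      by (simp only: box_index[OF xy])
    also have "\<dots> = (\<Sum>t\<leftarrow>Z. fst t $$ (hi ?a ?b ?b x, hi ?a ?b ?b y)) * (\<Sum>t\<leftarrow>Z'. fst t $$ (lo ?a ?b ?b x, lo ?a ?b ?b y))"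
      by (rule sum_list_product)
    also have "\<dots> = ?box (1\<^sub>m (?a * ?a)) (1\<^sub>m (?b * ?b)) $$ (x, y)"
      unfolding oneZ[OF h(1,3)] oneZ'[OF h(2,4)] box_index[OF xy] ..
    finally show "sum_mats (?a * ?b * (?a * ?b)) fst W $$ (x, y) = 1\<^sub>m (?a * ?b * (?a * ?b)) $$ (x, y)"
      by (simp only: box_one)
  qed (simp_all add: sum_mats_def)
  have 3: "(\<Sum>l\<leftarrow>W. snd l * qf (?a * ?b) (?a * ?b) (fst l) \<alpha> \<beta>) \<le> norm_sq (?a * ?b) \<alpha> * norm_sq (?a * ?b) \<beta>" for \<alpha> \<beta>
  proof -
    \<comment> \<open>Positivity of the ratios makes this weighted sum of effects separable, as
      \<open>qf_box_le\<close> demands of its first factor.\<close>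
    define G where "G = mat (?a * ?a) (?a * ?a) (\<lambda>(x, y). \<Sum>l\<leftarrow>Z. complex_of_real (snd l) * fst l $$ (x, y))"
    define G' where "G' = mat (?b * ?b) (?b * ?b) (\<lambda>(x, y). \<Sum>l\<leftarrow>Z'. complex_of_real (snd l) * fst l $$ (x, y))"
    have Gs: "sep_op ?a ?a G"
    proof (rule sep_op_sum_list[where js = Z and X = "\<lambda>l. complex_of_real (snd l) \<cdot>\<^sub>m fst l"])
      fix l assume l: "l \<in> set Z"
      show "sep_op ?a ?a (complex_of_real (snd l) \<cdot>\<^sub>m fst l)"
        by (rule sep_op_scale[OF sZ(1)[OF l], of "snd l"]) (use sZ(2)[OF l] sep_op_carrier[OF sZ(1)[OF l]] in auto)
    next
      fix x y assume xy: "x < ?a * ?a" "y < ?a * ?a"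
      show "G $$ (x, y) = (\<Sum>l\<leftarrow>Z. (complex_of_real (snd l) \<cdot>\<^sub>m fst l) $$ (x, y))"
        using xy carrier_matD[OF sep_op_carrier[OF sZ(1)]]
        by (auto simp: G_def intro!: arg_cong[of _ _ sum_list])
    qed (simp add: G_def)
    have Gle: "qf ?a ?a G \<alpha> \<beta> \<le> 1 * (norm_sq ?a \<alpha> * norm_sq ?a \<beta>)" for \<alpha> \<beta>
      using Z by (subst qf_sum_list[where ls = Z and X = fst and w = snd]) (auto simp: G_def lr_test_def)
    have G'le: "qf ?b ?b G' \<alpha> \<beta> \<le> 1 * (norm_sq ?b \<alpha> * norm_sq ?b \<beta>)" for \<alpha> \<beta>
      using Z' by (subst qf_sum_list[where ls = Z' and X = fst and w = snd]) (auto simp: G'_def lr_test_def)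
    have "qf (?a * ?b) (?a * ?b) (?box G G') \<alpha> \<beta> = (\<Sum>l\<leftarrow>W. snd l * qf (?a * ?b) (?a * ?b) (fst l) \<alpha> \<beta>)"
    proof (rule qf_sum_list)
      fix x y assume xy: "x < ?a * ?b * (?a * ?b)" "y < ?a * ?b * (?a * ?b)"
      note h = hi_lo(1,2)[OF xy(1)] hi_lo(1,2)[OF xy(2)]
      have "?box G G' $$ (x, y) = (\<Sum>t\<leftarrow>Z. complex_of_real (snd t) * fst t $$ (hi ?a ?b ?b x, hi ?a ?b ?b y)) *
          (\<Sum>t\<leftarrow>Z'. complex_of_real (snd t) * fst t $$ (lo ?a ?b ?b x, lo ?a ?b ?b y))"
        unfolding box_index[OF xy] using h by (simp add: G_def G'_def)
      also have "\<dots> = (\<Sum>t\<leftarrow>List.product Z Z'. (complex_of_real (snd (fst t)) * fst (fst t) $$ (hi ?a ?b ?b x, hi ?a ?b ?b y)) *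
          (complex_of_real (snd (snd t)) * fst (snd t) $$ (lo ?a ?b ?b x, lo ?a ?b ?b y)))"
        by (rule sum_list_product[symmetric])
      also have "\<dots> = (\<Sum>l\<leftarrow>W. complex_of_real (snd l) * fst l $$ (x, y))"
        unfolding W_def map_map o_def by (simp add: box_index[OF xy] mult_ac)
      finally show "?box G G' $$ (x, y) = (\<Sum>l\<leftarrow>W. complex_of_real (snd l) * fst l $$ (x, y))" .
    qed
    moreover have "qf (?a * ?b) (?a * ?b) (?box G G') \<alpha> \<beta> \<le> 1 * 1 * (norm_sq (?a * ?b) \<alpha> * norm_sq (?a * ?b) \<beta>)"
      by (rule qf_box_le[OF Gs _ _ Gle G'le]) (simp_all add: G'_def)
    ultimately show ?thesis by simp
  qed
  show "lr_test d (m + n) W" unfolding lr_test_def N using 1 2 3 by blast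
  have "rho_prob d (m + n) (?box E E') = rho_prob d m E * rho_prob d n E'" if "sep_op ?a ?a E" "sep_op ?b ?b E'" for E E'
  proof -
    have c: "E \<in> carrier_mat (?a * ?a) (?a * ?a)" "E' \<in> carrier_mat (?b * ?b) (?b * ?b)" using that sep_op_carrier by auto
    have p: "psd (?a * ?a) (rho d m)" using density_rho[OF d] by (simp add: density_def)
    have "mat_trace (rho d (m + n) * ?box E E') = mat_trace (rho d m * E) * mat_trace (rho d n * E')"
      unfolding rho_add by (rule mat_trace_box_mult[OF rho_carrier c(1) rho_carrier c(2)])
    \<comment> \<open>Needed because the real part of a product of traces must split into the
      product of real parts.\<close>
    moreover have "Im (mat_trace (rho d m * E)) = 0"
      using mat_trace_herm_real[OF p sep_op_psd[OF that(1)]] by (metis Im_complex_of_real)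
    ultimately show ?thesis by (simp add: rho_prob_def)
  qed
  hence "chernoff_sum d (m + n) s W = (\<Sum>t\<leftarrow>List.product Z Z'. (rho_prob d m (fst (fst t)) * snd (fst t) powr (- s)) * (rho_prob d n (fst (snd t)) * snd (snd t) powr (- s)))"
    unfolding chernoff_sum_def W_def map_map o_def
    by (intro arg_cong[of _ _ sum_list] map_cong refl) (use sZ sZ' in \<open>auto simp: powr_mult less_imp_le mult_ac\<close>)
  also have "\<dots> = chernoff_sum d m s Z * chernoff_sum d n s Z'" unfolding chernoff_sum_def by (rule sum_list_product)
  finally show "chernoff_sum d (m + n) s W = chernoff_sum d m s Z * chernoff_sum d n s Z'" .
qed

text \<open>The remainder \<open>r\<close> is measured trivially and does not change the moment, so
  every total number of copies is reached.\<close>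

lemma lr_test_power:
  assumes d: "d \<ge> 2" and Z: "lr_test d n Z"
  shows "\<exists>Z'. lr_test d (n * m + r) Z' \<and> chernoff_sum d (n * m + r) s Z' = chernoff_sum d n s Z ^ m"
proof (induction m)
  case 0
  show ?case using lr_test_trivial[OF d, of r] by (intro exI[of _ "[(1\<^sub>m (d ^ r * d ^ r), 1)]"]) simp
next
  case (Suc m)
  then obtain Z' where Z': "lr_test d (n * m + r) Z'" "chernoff_sum d (n * m + r) s Z' = chernoff_sum d n s Z ^ m" by blast
  from lr_test_box[OF d Z Z'(1)] Z'(2) show ?case by (force simp: add.assoc)
qed

text \<open>Each outcome is accepted with probability \<open>min 1 (L / T)\<close>. Under separable
  states the acceptance probability is at most the expectation of \<open>L / T\<close>, hence
  \<open>1 / T\<close>; under \<open>rho d n\<close> rejection is bounded by Markov's inequality for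
  \<open>L powr (- s)\<close>.\<close>

lemma lr_test_test:
  assumes d: "d \<ge> 2" and Z: "lr_test d n Z" and s: "0 \<le> s" and T: "0 < T"
    and le: "T powr s * chernoff_sum d n s Z \<le> \<epsilon>" and \<sigma>: "\<sigma> \<in> sep_states (d ^ n) (d ^ n)"
  shows "ereal (log 2 T) \<le> D_H (SEP_meas (d ^ n) (d ^ n)) \<epsilon> (rho d n) \<sigma>"
proof -
  let ?N = "d ^ n" and ?D = "d ^ n * d ^ n"
  have N0: "?N > 0" using d by simp
  define f where "f l = min 1 (snd l / T)" for l :: "complex mat \<times> real"
  have sZ: "sep_op ?N ?N (fst l)" "0 < snd l" if "l \<in> set Z" for l using Z that by (auto simp: lr_test_def)
  have f: "0 \<le> f l" "f l \<le> 1" "f l \<le> snd l / T" "1 - f l \<le> T powr s * snd l powr (- s)" if "l \<in> set Z" for l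
  proof -
    show "0 \<le> f l" "f l \<le> 1" "f l \<le> snd l / T" using sZ(2)[OF that] T by (auto simp: f_def)
    \<comment> \<open>Rejection has positive probability only below the threshold, and there the
      right-hand side is at least one.\<close>
    show "1 - f l \<le> T powr s * snd l powr (- s)"
    proof (cases "snd l \<ge> T")
      case True thus ?thesis using T by (simp add: f_def)
    next
      case False
      have "snd l powr s \<le> T powr s" using False sZ(2)[OF that] s by (intro powr_mono2) auto
      hence "1 \<le> T powr s * snd l powr (- s)" using sZ(2)[OF that] by (simp add: powr_minus field_simps)
      moreover have "1 - f l \<le> 1" using \<open>0 \<le> f l\<close> by simp
      ultimately show ?thesis by linarith
    qed
  qed
  define E where "E = mat ?D ?D (\<lambda>(x, y). \<Sum>l\<leftarrow>Z. complex_of_real (f l) * fst l $$ (x, y))"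
  have one: "(\<Sum>l\<leftarrow>Z. fst l $$ (x, y)) = 1\<^sub>m ?D $$ (x, y)" if "x < ?D" "y < ?D" for x y
  proof -
    have "sum_mats ?D fst Z $$ (x, y) = 1\<^sub>m ?D $$ (x, y)" using Z by (simp add: lr_test_def)
    thus ?thesis using that by (simp add: sum_mats_def)
  qed
  have sub: "sep_op ?N ?N Y" if w: "\<And>l. l \<in> set Z \<Longrightarrow> 0 \<le> w l" and Y: "Y \<in> carrier_mat ?D ?D"
    and e: "\<And>x y. x < ?D \<Longrightarrow> y < ?D \<Longrightarrow> Y $$ (x, y) = (\<Sum>l\<leftarrow>Z. complex_of_real (w l) * fst l $$ (x, y))" for w Y
  proof (rule sep_op_sum_list[where js = Z and X = "\<lambda>l. complex_of_real (w l) \<cdot>\<^sub>m fst l", OF Y])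
    fix l assume l: "l \<in> set Z"
    show "sep_op ?N ?N (complex_of_real (w l) \<cdot>\<^sub>m fst l)"
      by (rule sep_op_scale[OF sZ(1)[OF l] w[OF l]]) (use sep_op_carrier[OF sZ(1)[OF l]] in auto)
  next
    fix x y assume xy: "x < ?D" "y < ?D"
    show "Y $$ (x, y) = (\<Sum>l\<leftarrow>Z. (complex_of_real (w l) \<cdot>\<^sub>m fst l) $$ (x, y))"
      unfolding e[OF xy] using xy carrier_matD[OF sep_op_carrier[OF sZ(1)]]
      by (auto intro!: arg_cong[of _ _ sum_list])
  qed
  have Ec: "E \<in> carrier_mat ?D ?D" by (simp add: E_def)
  have Es: "sep_op ?N ?N E" by (rule sub[of f]) (use f in \<open>auto simp: E_def\<close>)
  have Es': "sep_op ?N ?N (1\<^sub>m ?D - E)"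
  proof (rule sub[of "\<lambda>l. 1 - f l"])
    fix x y assume xy: "x < ?D" "y < ?D"
    have "(1\<^sub>m ?D - E) $$ (x, y) = (\<Sum>l\<leftarrow>Z. fst l $$ (x, y)) - (\<Sum>l\<leftarrow>Z. complex_of_real (f l) * fst l $$ (x, y))"
      using xy Ec by (simp add: one E_def)
    also have "\<dots> = (\<Sum>l\<leftarrow>Z. complex_of_real (1 - f l) * fst l $$ (x, y))"
      by (simp add: left_diff_distrib sum_list_subtractf)
    finally show "(1\<^sub>m ?D - E) $$ (x, y) = \<dots>" .
  qed (use f(2) in \<open>auto simp: E_def\<close>)
  have meas: "[E, 1\<^sub>m ?D - E] \<in> SEP_meas ?N ?N"
    unfolding SEP_meas_iff[OF N0 N0] using Es Es' Ec by (auto simp: sum_mats_def intro!: eq_matI)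
  have trE: "Re (mat_trace (E * X)) = (\<Sum>l\<leftarrow>Z. f l * Re (mat_trace (X * fst l)))" if X: "X \<in> carrier_mat ?D ?D" for X
  proof -
    have "E = sum_mats ?D (\<lambda>l. complex_of_real (f l) \<cdot>\<^sub>m fst l) Z"
    proof (rule eq_matI)
      fix x y assume "x < dim_row (sum_mats ?D (\<lambda>l. complex_of_real (f l) \<cdot>\<^sub>m fst l) Z)" "y < dim_col (sum_mats ?D (\<lambda>l. complex_of_real (f l) \<cdot>\<^sub>m fst l) Z)"
      hence xy: "x < ?D" "y < ?D" by (simp_all add: sum_mats_def)
      show "E $$ (x, y) = sum_mats ?D (\<lambda>l. complex_of_real (f l) \<cdot>\<^sub>m fst l) Z $$ (x, y)"
        using xy carrier_matD[OF sep_op_carrier[OF sZ(1)]] by (auto simp: E_def sum_mats_def intro!: arg_cong[of _ _ sum_list])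
    qed (simp_all add: E_def sum_mats_def)
    hence "mat_trace (X * E) = (\<Sum>l\<leftarrow>Z. mat_trace (X * (complex_of_real (f l) \<cdot>\<^sub>m fst l)))"
      using sep_op_carrier[OF sZ(1)] by (simp only:) (intro mat_trace_sum_mats[OF X], auto)
    also have "\<dots> = (\<Sum>l\<leftarrow>Z. complex_of_real (f l) * mat_trace (X * fst l))"
    proof (intro arg_cong[of _ _ sum_list] map_cong refl)
      fix l assume "l \<in> set Z"
      note c = sep_op_carrier[OF sZ(1)[OF this]]
      show "mat_trace (X * (complex_of_real (f l) \<cdot>\<^sub>m fst l)) = complex_of_real (f l) * mat_trace (X * fst l)"
        using mat_trace_comm[OF X c] mat_trace_comm[OF X smult_carrier_mat[OF c]] mat_trace_smult_mult[OF c X] by simp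
    qed
    finally show ?thesis by (simp add: mat_trace_comm[OF Ec X] Re_sum_list)
  qed
  have "1 - Re (mat_trace (E * rho d n)) = (\<Sum>l\<leftarrow>Z. (1 - f l) * rho_prob d n (fst l))"
    unfolding trE[OF rho_carrier] rho_prob_def[symmetric] using sum_rho_prob[OF d Z]
    by (simp add: left_diff_distrib sum_list_subtractf)
  also have "\<dots> \<le> (\<Sum>l\<leftarrow>Z. T powr s * snd l powr (- s) * rho_prob d n (fst l))"
    by (intro sum_list_mono mult_right_mono f rho_prob_nonneg[OF d] sZ)
  also have "\<dots> = T powr s * chernoff_sum d n s Z" by (simp add: chernoff_sum_def mult_ac flip: sum_list_const_mult)
  finally have acc: "1 - \<epsilon> \<le> Re (mat_trace (E * rho d n))" using le by linarith
  have "Re (mat_trace (\<sigma> * E)) \<le> 1 / T"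
  proof (rule trace_sep_le[OF \<sigma> Ec])
    fix \<alpha> \<beta>
    have "qf ?N ?N E \<alpha> \<beta> = (\<Sum>l\<leftarrow>Z. f l * qf ?N ?N (fst l) \<alpha> \<beta>)"
      by (rule qf_sum_list) (simp add: E_def)
    also have "\<dots> \<le> (\<Sum>l\<leftarrow>Z. snd l / T * qf ?N ?N (fst l) \<alpha> \<beta>)"
      by (intro sum_list_mono mult_right_mono f qf_nonneg sZ)
    also have "\<dots> = 1 / T * (\<Sum>l\<leftarrow>Z. snd l * qf ?N ?N (fst l) \<alpha> \<beta>)"
      by (simp flip: sum_list_const_mult)
    also have "\<dots> \<le> 1 / T * (norm_sq ?N \<alpha> * norm_sq ?N \<beta>)"
      using Z T by (intro mult_left_mono) (auto simp: lr_test_def)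
    finally show "qf ?N ?N E \<alpha> \<beta> \<le> 1 / T * (norm_sq ?N \<alpha> * norm_sq ?N \<beta>)" .
  qed
  hence "Re (mat_trace (E * \<sigma>)) \<le> 1 / T" by (simp add: mat_trace_comm[OF Ec sep_states_carrier[OF \<sigma>]])
  from D_H_ge[OF rho_carrier sep_states_psd[OF \<sigma>] sep_op_psd[OF Es] sep_op_psd[OF Es'] meas acc _ this] T
  show ?thesis by (simp add: log_divide)
qed

text \<open>Chernoff's bound: the exponential moment of the log-likelihood ratio has negative derivative at zero.\<close>

lemma lr_test_chernoff:
  assumes d: "d \<ge> 2" and Z: "lr_test d n Z" and c: "c < (\<Sum>l\<leftarrow>Z. rho_prob d n (fst l) * ln (snd l))"
  obtains s where "0 < s" "exp (c * s) * chernoff_sum d n s Z < 1"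
proof -
  define p where "p i = rho_prob d n (fst (Z ! i))" for i
  define l where "l i = ln (snd (Z ! i))" for i
  define g where "g s = (\<Sum>i<length Z. p i * exp (s * (c - l i)))" for s
  have g: "exp (c * s) * chernoff_sum d n s Z = g s" for s
  proof -
    have "chernoff_sum d n s Z = (\<Sum>i<length Z. p i * exp (- s * l i))"
      unfolding chernoff_sum_def sum_list_sum_nth atLeast0LessThan length_map
    proof (intro sum.cong refl)
      fix i assume "i \<in> {..<length Z}"
      hence "Z ! i \<in> set Z" by simp
      hence "0 < snd (Z ! i)" using Z unfolding lr_test_def by blast
      thus "map (\<lambda>l. rho_prob d n (fst l) * snd l powr - s) Z ! i = p i * exp (- s * l i)"
        using \<open>i \<in> {..<length Z}\<close> by (simp add: p_def l_def powr_def)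
    qed
    thus ?thesis by (simp add: g_def sum_distrib_left algebra_simps flip: exp_add)
  qed
  have der: "(g has_real_derivative (\<Sum>i<length Z. p i * (c - l i))) (at 0)"
    unfolding g_def by (auto intro!: derivative_eq_intros sum.cong)
  have neg: "(\<Sum>i<length Z. p i * (c - l i)) < 0"
  proof -
    have "(\<Sum>i<length Z. p i) = 1"
      using sum_rho_prob[OF d Z] by (simp add: p_def sum_list_sum_nth atLeast0LessThan)
    moreover have "c < (\<Sum>i<length Z. p i * l i)"
      using c by (simp add: p_def l_def sum_list_sum_nth atLeast0LessThan)
    ultimately show ?thesis by (simp add: right_diff_distrib sum_subtractf flip: sum_distrib_right)
  qed
  obtain e where e: "e > 0" "\<And>h. 0 < h \<Longrightarrow> h < e \<Longrightarrow> g (0 + h) < g 0"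
    using DERIV_neg_dec_right[OF der neg] by blast
  have "g 0 = 1" using sum_rho_prob[OF d Z] by (simp add: g_def p_def sum_list_sum_nth atLeast0LessThan)
  hence "g (e / 2) < 1" using e(2)[of "e / 2"] e(1) by simp
  with that[of "e / 2"] e(1) show ?thesis unfolding g by simp
qed

section \<open>Measured relative entropy and likelihood ratios\<close>

definition mrel :: "nat \<Rightarrow> nat \<Rightarrow> complex mat \<Rightarrow> ereal" where
  "mrel d n \<sigma> = measured_rel_entropy (SEP_meas (d ^ n) (d ^ n)) (rho d n) \<sigma>"

definition min_mrel :: "nat \<Rightarrow> nat \<Rightarrow> ereal" where
  "min_mrel d n = (INF \<sigma>\<in>sep_states (d ^ n) (d ^ n). mrel d n \<sigma>)"

text \<open>The finite part of \<open>kl_term\<close>, used once absolute continuity is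
  known.\<close>

definition kl_real :: "real \<Rightarrow> real \<Rightarrow> real" where
  "kl_real p q = (if p = 0 then 0 else p * log 2 (p / q))"

lemma sum_kl_term:
  assumes "\<And>x. x \<in> set xs \<Longrightarrow> q x = 0 \<Longrightarrow> p x = 0"
  shows "(\<Sum>x\<leftarrow>xs. kl_term (p x) (q x)) = ereal (\<Sum>x\<leftarrow>xs. kl_real (p x) (q x))"
proof -
  have "kl_term (p x) (q x) = ereal (kl_real (p x) (q x))" if "x \<in> set xs" for x
    using assms[OF that] by (auto simp: kl_term_def kl_real_def)
  thus ?thesis by (induction xs) auto
qed

text \<open>Against the Werner power, the probability ratio of every separable effect is at most
  \<open>(1 + 2 / d) ^ n\<close>, so its logarithm bounds the average.\<close>

lemma min_mrel_upper:
  assumes d: "d \<ge> 2" shows "min_mrel d n \<le> ereal (real n * log 2 (1 + 2 / real d))"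
proof -
  let ?N = "d ^ n" and ?w = "bip_pow d d (werner d) n"
  have N0: "?N > 0" using d by simp
  have w: "?w \<in> sep_states ?N ?N" by (rule bip_pow_sep_states[OF werner_sep_state[OF d]])
  define r where "r = (1 + 2 / real d) ^ n"
  have r: "r > 0" using d by (simp add: r_def add_pos_nonneg)
  have "mrel d n ?w \<le> ereal (log 2 r)"
    unfolding mrel_def measured_rel_entropy_def
  proof (rule SUP_least)
    fix Es assume Es: "Es \<in> SEP_meas ?N ?N"
    hence se: "\<And>E. E \<in> set Es \<Longrightarrow> sep_op ?N ?N E" and one: "sum_mats (?N * ?N) (\<lambda>E. E) Es = 1\<^sub>m (?N * ?N)"
      unfolding SEP_meas_iff[OF N0 N0] by auto
    define p q where "p E = Re (mat_trace (rho d n * E))" and "q E = Re (mat_trace (?w * E))" for E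
    have p: "0 \<le> p E" "p E \<le> r * q E" if "E \<in> set Es" for E
      using trace_rho_le_werner[OF d se[OF that]] rho_prob_nonneg[OF d se[OF that]] by (auto simp: p_def q_def r_def rho_prob_def)
    have "(\<Sum>E\<leftarrow>Es. kl_term (p E) (q E)) = ereal (\<Sum>E\<leftarrow>Es. kl_real (p E) (q E))"
      using p by (intro sum_kl_term) force
    also have "(\<Sum>E\<leftarrow>Es. kl_real (p E) (q E)) \<le> (\<Sum>E\<leftarrow>Es. log 2 r * p E)"
    proof (rule sum_list_mono)
      fix E assume E: "E \<in> set Es"
      show "kl_real (p E) (q E) \<le> log 2 r * p E"
      proof (cases "p E = 0")
        case False
        hence pE: "p E > 0" using p(1)[OF E] by simp
        hence "0 < r * q E" using p(2)[OF E] by linarith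
        hence qE: "q E > 0" using r by (simp add: zero_less_mult_iff)
        have "log 2 (p E / q E) \<le> log 2 r"
          using pE qE p(2)[OF E] r by (intro log_mono) (auto simp: field_simps)
        thus ?thesis using pE by (simp add: kl_real_def mult.commute mult_left_mono)
      qed (simp add: kl_real_def)
    qed
    also have "\<dots> = log 2 r * Re (mat_trace (rho d n))"
      using sum_trace_povm[OF rho_carrier _ one] sep_op_carrier[OF se] by (simp add: p_def sum_list_const_mult)
    also have "\<dots> = log 2 r" using density_rho[OF d] by (simp add: density_def)
    finally show "(\<Sum>E\<leftarrow>Es. kl_term (Re (mat_trace (rho d n * E))) (Re (mat_trace (?w * E)))) \<le> ereal (log 2 r)"
      by (simp add: p_def q_def)
  qed
  moreover have "log 2 r = real n * log 2 (1 + 2 / real d)" unfolding r_def using d by (intro log_nat_power) (simp add: add_pos_nonneg)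
  ultimately show ?thesis unfolding min_mrel_def by (intro INF_lower2[OF w]) simp
qed

lemma min_mrel_nonneg:
  assumes d: "d \<ge> 2" shows "0 \<le> min_mrel d n"
  unfolding min_mrel_def
proof (rule INF_greatest)
  let ?N = "d ^ n"
  fix \<sigma> assume \<sigma>: "\<sigma> \<in> sep_states ?N ?N"
  have N0: "?N > 0" using d by simp
  have meas: "[1\<^sub>m (?N * ?N)] \<in> SEP_meas ?N ?N"
    unfolding SEP_meas_iff[OF N0 N0] using sep_op_one by (auto simp: sum_mats_def intro!: eq_matI)
  have "(\<Sum>E\<leftarrow>[1\<^sub>m (?N * ?N)]. kl_term (Re (mat_trace (rho d n * E))) (Re (mat_trace (\<sigma> * E)))) = 0"
    using density_rho[OF d, of n] \<sigma>
    by (simp add: right_mult_one_mat[OF rho_carrier] right_mult_one_mat[OF sep_states_carrier[OF \<sigma>]] density_def sep_states_iff kl_term_def zero_ereal_def)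
  moreover have "(\<Sum>E\<leftarrow>[1\<^sub>m (?N * ?N)]. kl_term (Re (mat_trace (rho d n * E))) (Re (mat_trace (\<sigma> * E)))) \<le> mrel d n \<sigma>"
    unfolding mrel_def measured_rel_entropy_def by (rule SUP_upper[OF meas])
  ultimately show "0 \<le> mrel d n \<sigma>" by (simp only:)
qed

text \<open>A measurement nearly optimal against the universal state \<open>u\<close> is
  symmetrized. This keeps its probabilities \<open>p\<close> under \<open>rho d n\<close>, while
  under any separable state they are at most \<open>K * q\<close>. So \<open>p / (K * q)\<close> has
  expectation at most one, at a cost of \<open>ln K\<close>.\<close>

lemma lr_test_exists:
  assumes d: "d \<ge> 2" and a: "ereal a < min_mrel d n"
  obtains Z where "lr_test d n Z"
    "a * ln 2 - ln (4 * (real n + 1)\<^sup>2) < (\<Sum>l\<leftarrow>Z. rho_prob d n (fst l) * ln (snd l))"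
proof -
  let ?N = "d ^ n" and ?D = "d ^ n * d ^ n" and ?w = "bip_pow d d (werner d) n"
  let ?S = "sep_states ?N ?N"
  have N0: "?N > 0" using d by simp
  define K where "K = 2 * (real n + 1)\<^sup>2"
  have K: "K > 0" by (simp add: K_def)
  obtain u where u: "u \<in> ?S"
    and dom: "\<And>\<sigma> E. \<sigma> \<in> ?S \<Longrightarrow> psd ?D E \<Longrightarrow> Re (mat_trace (\<sigma> * twirl_n d n E)) \<le> K * Re (mat_trace (u * E))"
    using universal_state[OF d, of n] unfolding K_def by metis
  have "ereal a < mrel d n u" using a u unfolding min_mrel_def by (meson INF_lower less_le_trans)
  then obtain Es where Es: "Es \<in> SEP_meas ?N ?N"
    and gt: "ereal a < (\<Sum>E\<leftarrow>Es. kl_term (Re (mat_trace (rho d n * E))) (Re (mat_trace (u * E))))"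
    unfolding mrel_def measured_rel_entropy_def less_SUP_iff by blast
  from Es have se: "\<And>E. E \<in> set Es \<Longrightarrow> sep_op ?N ?N E" and one: "sum_mats ?D (\<lambda>E. E) Es = 1\<^sub>m ?D"
    unfolding SEP_meas_iff[OF N0 N0] by auto
  have sec: "E \<in> carrier_mat ?D ?D" if "E \<in> set Es" for E using sep_op_carrier[OF se[OF that]] .
  define p q where "p E = Re (mat_trace (rho d n * E))" and "q E = Re (mat_trace (u * E))" for E
  \<comment> \<open>Averaging with the constant ratio one keeps \<open>L\<close> positive and its
    expectation at most one. It costs a factor two, which together with \<open>K\<close> gives
    \<open>4 * (n + 1)\<^sup>2\<close>.\<close>
  define L where "L E = (if q E = 0 then 0 else p E / (K * q E)) / 2 + 1 / 2" for E
  have p0: "0 \<le> p E" and q0: "0 \<le> q E" if "E \<in> set Es" for E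
    using rho_prob_nonneg[OF d se[OF that]] mat_trace_psd_mult[OF sep_states_psd[OF u] sep_op_psd[OF se[OF that]]]
    by (auto simp: p_def q_def rho_prob_def)
  \<comment> \<open>Absolute continuity with respect to \<open>u\<close>: \<open>rho d n\<close> is
    dominated on separable effects by the Werner power, which after symmetrization is dominated by
    \<open>u\<close>.\<close>
  have pq: "p E = 0" if E: "E \<in> set Es" and "q E = 0" for E
  proof -
    have w: "?w \<in> ?S" by (rule bip_pow_sep_states[OF werner_sep_state[OF d]])
    have "p E = Re (mat_trace (rho d n * twirl_n d n E))" by (simp add: p_def twirl_n_rho[OF d sec[OF E]])
    also have "\<dots> \<le> (1 + 2 / real d) ^ n * Re (mat_trace (?w * twirl_n d n E))"
      by (rule trace_rho_le_werner[OF d sep_op_twirl_n[OF d se[OF E]]])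
    also have "\<dots> \<le> (1 + 2 / real d) ^ n * (K * q E)"
      unfolding q_def by (intro mult_left_mono dom w sep_op_psd se E) simp
    finally show ?thesis using p0[OF E] \<open>q E = 0\<close> by simp
  qed
  have L0: "L E > 0" if "E \<in> set Es" for E
    using p0[OF that] q0[OF that] K by (auto simp: L_def intro!: add_nonneg_pos)
  have sp: "(\<Sum>E\<leftarrow>Es. p E) = 1"
    unfolding p_def using sum_trace_povm[OF rho_carrier sec one] density_rho[OF d] by (simp add: density_def)
  define Z where "Z = map (\<lambda>E. (twirl_n d n E, L E)) Es"
  have povm: "sum_mats ?D fst Z = 1\<^sub>m ?D"
  proof -
    have "sum_mats ?D fst Z = sum_mats ?D (\<lambda>E. twirl_n d n E) Es" by (simp add: sum_mats_def Z_def o_def)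
    also have "\<dots> = twirl_n d n (sum_mats ?D (\<lambda>E. E) Es)" by (rule twirl_n_sum_list[symmetric]) (rule sec)
    finally show ?thesis by (simp add: one twirl_n_one[OF d])
  qed
  have trs: "(\<Sum>E\<leftarrow>Es. Re (mat_trace (\<sigma> * twirl_n d n E))) = 1" if "\<sigma> \<in> ?S" for \<sigma>
  proof -
    have "mat_trace (\<sigma> * sum_mats ?D (\<lambda>E. twirl_n d n E) Es) = (\<Sum>E\<leftarrow>Es. mat_trace (\<sigma> * twirl_n d n E))"
      by (rule mat_trace_sum_mats[OF sep_states_carrier[OF that]]) simp
    moreover have "sum_mats ?D (\<lambda>E. twirl_n d n E) Es = 1\<^sub>m ?D" using povm by (simp add: sum_mats_def Z_def o_def)
    ultimately show ?thesis using that by (simp add: right_mult_one_mat[OF sep_states_carrier[OF that]] sep_states_iff flip: Re_sum_list)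
  qed
  have "lr_test d n Z" unfolding lr_test_def
  proof (intro conjI ballI allI)
    fix l assume "l \<in> set Z"
    thus "sep_op ?N ?N (fst l)" "0 < snd l" by (auto simp: Z_def sep_op_twirl_n[OF d se] L0)
  next
    fix \<alpha> \<beta>
    define G where "G = mat ?D ?D (\<lambda>(x, y). \<Sum>E\<leftarrow>Es. complex_of_real (L E) * twirl_n d n E $$ (x, y))"
    have G: "G = sum_mats ?D (\<lambda>E. complex_of_real (L E) \<cdot>\<^sub>m twirl_n d n E) Es"
      by (rule eq_matI) (auto simp: G_def sum_mats_def twirl_n_def)
    have "qf ?N ?N G \<alpha> \<beta> \<le> 1 * (norm_sq ?N \<alpha> * norm_sq ?N \<beta>)"
    proof (rule qf_le_of_trace_le[OF _ N0 N0])
      show "G \<in> carrier_mat ?D ?D" by (simp add: G_def)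
      fix \<sigma> assume \<sigma>: "\<sigma> \<in> ?S"
      note \<sigma>c = sep_states_carrier[OF \<sigma>]
      have "mat_trace (\<sigma> * G) = (\<Sum>E\<leftarrow>Es. mat_trace (\<sigma> * (complex_of_real (L E) \<cdot>\<^sub>m twirl_n d n E)))"
        unfolding G by (rule mat_trace_sum_mats[OF \<sigma>c]) (simp add: smult_carrier_mat)
      also have "\<dots> = (\<Sum>E\<leftarrow>Es. complex_of_real (L E) * mat_trace (\<sigma> * twirl_n d n E))"
        using mat_trace_comm[OF \<sigma>c twirl_n_carrier] mat_trace_comm[OF \<sigma>c smult_carrier_mat[OF twirl_n_carrier]] mat_trace_smult_mult[OF twirl_n_carrier \<sigma>c] by simp
      finally have "Re (mat_trace (\<sigma> * G)) = (\<Sum>E\<leftarrow>Es. L E * Re (mat_trace (\<sigma> * twirl_n d n E)))" by (simp add: Re_sum_list)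
      also have "\<dots> \<le> (\<Sum>E\<leftarrow>Es. p E / 2 + Re (mat_trace (\<sigma> * twirl_n d n E)) / 2)"
      proof (rule sum_list_mono)
        fix E assume E: "E \<in> set Es"
        define t where "t = Re (mat_trace (\<sigma> * twirl_n d n E))"
        have t: "t \<le> K * q E" unfolding t_def q_def by (rule dom[OF \<sigma> sep_op_psd[OF se[OF E]]])
        have "(if q E = 0 then 0 else p E / (K * q E)) * t \<le> p E"
        proof (cases "q E = 0")
          case False
          hence Kq: "K * q E > 0" using q0[OF E] K by simp
          have "p E / (K * q E) * t \<le> p E / (K * q E) * (K * q E)"
            using t p0[OF E] Kq by (intro mult_left_mono) auto
          also have "\<dots> = p E" by (metis Kq less_irrefl nonzero_eq_divide_eq)
          finally show ?thesis unfolding if_not_P[OF False] .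
        qed (use p0[OF E] in simp)
        hence "L E * t \<le> p E / 2 + t / 2" by (simp add: L_def distrib_right)
        thus "L E * Re (mat_trace (\<sigma> * twirl_n d n E)) \<le> p E / 2 + Re (mat_trace (\<sigma> * twirl_n d n E)) / 2" by (simp add: t_def)
      qed
      also have "\<dots> = ((\<Sum>E\<leftarrow>Es. p E) + (\<Sum>E\<leftarrow>Es. Re (mat_trace (\<sigma> * twirl_n d n E)))) / 2"
        by (induction Es) (simp_all add: add_divide_distrib)
      finally show "Re (mat_trace (\<sigma> * G)) \<le> 1" by (simp add: sp trs[OF \<sigma>])
    qed
    moreover have "qf ?N ?N G \<alpha> \<beta> = (\<Sum>E\<leftarrow>Es. L E * qf ?N ?N (twirl_n d n E) \<alpha> \<beta>)"
      by (rule qf_sum_list) (simp add: G_def)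
    ultimately show "(\<Sum>l\<leftarrow>Z. snd l * qf ?N ?N (fst l) \<alpha> \<beta>) \<le> norm_sq ?N \<alpha> * norm_sq ?N \<beta>"
      by (simp add: Z_def o_def)
  qed (rule povm)
  moreover have "a * ln 2 - ln (2 * K) < (\<Sum>l\<leftarrow>Z. rho_prob d n (fst l) * ln (snd l))"
  proof -
    have "a < (\<Sum>E\<leftarrow>Es. kl_real (p E) (q E))"
      using gt sum_kl_term[of Es q p] pq by (simp add: p_def q_def)
    hence "a * ln 2 - ln (2 * K) < (\<Sum>E\<leftarrow>Es. kl_real (p E) (q E)) * ln 2 - ln (2 * K) * (\<Sum>E\<leftarrow>Es. p E)"
      by (simp add: sp)
    also have "\<dots> = (\<Sum>E\<leftarrow>Es. kl_real (p E) (q E) * ln 2 - ln (2 * K) * p E)"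
      by (simp add: sum_list_subtractf sum_list_mult_const sum_list_const_mult)
    also have "\<dots> \<le> (\<Sum>E\<leftarrow>Es. p E * ln (L E))"
    proof (rule sum_list_mono)
      fix E assume E: "E \<in> set Es"
      show "kl_real (p E) (q E) * ln 2 - ln (2 * K) * p E \<le> p E * ln (L E)"
      proof (cases "p E = 0")
        case False
        hence pE: "p E > 0" using p0[OF E] by simp
        hence qE: "q E > 0" using pq[OF E] q0[OF E] by fastforce
        have "kl_real (p E) (q E) * ln 2 - ln (2 * K) * p E = p E * (ln (p E / q E) - ln (2 * K))"
          using False by (simp add: kl_real_def log_def algebra_simps)
        also have "ln (p E / q E) - ln (2 * K) = ln ((p E / q E) / (2 * K))"
          using pE qE K by (intro ln_divide_pos[symmetric]) auto
        \<comment> \<open>Only this part of the average counts for the logarithm; the constant part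
          is dropped.\<close>
        also have "(p E / q E) / (2 * K) \<le> L E" using qE K by (simp add: L_def field_simps)
        hence "ln ((p E / q E) / (2 * K)) \<le> ln (L E)" using pE qE K by (intro ln_mono) auto
        finally show ?thesis using pE by (simp add: mult_left_mono)
      qed (simp add: kl_real_def)
    qed
    also have "\<dots> = (\<Sum>l\<leftarrow>Z. rho_prob d n (fst l) * ln (snd l))"
      unfolding Z_def map_map o_def
      by (intro arg_cong[of _ _ sum_list] map_cong refl) (simp add: rho_prob_def p_def twirl_n_rho[OF d sec])
    finally show ?thesis .
  qed
  ultimately show ?thesis using that[of Z] by (simp add: K_def)
qed

section \<open>Asymptotics\<close>

lemma floor_ratio_tendsto:
  assumes "n \<ge> 1"
  shows "(\<lambda>N. real (N div n) / real N) \<longlonglongrightarrow> 1 / real n"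
proof (rule tendsto_sandwich)
  show "\<forall>\<^sub>F N in sequentially. 1 / real n - 1 / real N \<le> real (N div n) / real N"
    using eventually_gt_at_top[of 0]
  proof eventually_elim
    case (elim N)
    have "N \<le> n * (N div n) + n"
      using mult_div_mod_eq[of n N] mod_less_divisor[of n N] assms by linarith
    hence "real N \<le> real n * real (N div n) + real n" by (simp flip: of_nat_mult of_nat_add)
    hence "real N / real n - 1 \<le> real (N div n)" using assms by (simp add: field_simps)
    hence "(real N / real n - 1) / real N \<le> real (N div n) / real N" by (rule divide_right_mono) simp
    thus ?case using elim by (simp add: diff_divide_distrib)
  qed
  show "\<forall>\<^sub>F N in sequentially. real (N div n) / real N \<le> 1 / real n"
    using eventually_gt_at_top[of 0]
  proof eventually_elim
    case (elim N)
    have "real n * real (N div n) \<le> real N" by (simp flip: of_nat_mult)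
    hence "real (N div n) \<le> real N / real n" using assms by (simp add: field_simps)
    hence "real (N div n) / real N \<le> (real N / real n) / real N" by (rule divide_right_mono) simp
    thus ?case using elim by simp
  qed
  have "(\<lambda>N. 1 / real n - 1 / real N) \<longlonglongrightarrow> 1 / real n - 0"
    by (intro tendsto_intros lim_1_over_n)
  thus "(\<lambda>N. 1 / real n - 1 / real N) \<longlonglongrightarrow> 1 / real n" by simp
qed simp

text \<open>Fekete's lemma: the limit is the infimum. A block length nearly attaining it is
  repeated, and the finitely many remainders contribute a bounded amount \<open>M\<close>.\<close>

lemma fekete_limit:
  fixes B :: "nat \<Rightarrow> real"
  assumes nonneg: "\<And>n. 0 \<le> B n" and sub: "\<And>m n. B (m + n) \<le> B m + B n"
  shows "\<exists>D. (\<lambda>n. B n / real n) \<longlonglongrightarrow> D"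
proof -
  define D where "D = (INF n\<in>{1..}. B n / real n)"
  have bdd: "bdd_below ((\<lambda>n. B n / real n) ` {1..})"
    by (rule bdd_belowI[of _ 0]) (auto simp: nonneg)
  have lin: "B (n * m + r) \<le> real m * B n + B r" for n m r
  proof (induction m)
    case (Suc m)
    have "B (n * Suc m + r) \<le> B n + B (n * m + r)" using sub[of n "n * m + r"] by (simp add: add_ac)
    with Suc show ?case by (simp add: distrib_right)
  qed simp
  have "(\<lambda>n. B n / real n) \<longlonglongrightarrow> D"
  proof (rule order_tendstoI)
    fix a assume "a < D"
    show "\<forall>\<^sub>F N in sequentially. a < B N / real N"
      using eventually_ge_at_top[of 1]
    proof eventually_elim
      case (elim N)
      have "D \<le> B N / real N" unfolding D_def using elim by (intro cINF_lower[OF bdd]) simp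
      with \<open>a < D\<close> show ?case by linarith
    qed
  next
    fix a assume "D < a"
    then obtain n where n: "n \<ge> 1" "B n / real n < a"
      unfolding D_def by (subst (asm) cINF_less_iff[OF _ bdd]) auto
    define M where "M = Max (B ` {..<n})"
    have M: "B r \<le> M" if "r < n" for r unfolding M_def using that by (intro Max_ge) auto
    have "(\<lambda>N. real (N div n) / real N * B n + M * (1 / real N)) \<longlonglongrightarrow> 1 / real n * B n + M * 0"
      by (intro tendsto_intros floor_ratio_tendsto n lim_1_over_n)
    hence "\<forall>\<^sub>F N in sequentially. real (N div n) / real N * B n + M * (1 / real N) < a"
      using n(2) by (intro order_tendstoD(2)) auto
    thus "\<forall>\<^sub>F N in sequentially. B N / real N < a"
      using eventually_gt_at_top[of 0]
    proof eventually_elim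
      case (elim N)
      have "B N \<le> real (N div n) * B n + M"
        using lin[of n "N div n" "N mod n"] M[of "N mod n"] n by simp
      hence "B N / real N \<le> (real (N div n) * B n + M) / real N" by (intro divide_right_mono) auto
      also have "\<dots> = real (N div n) / real N * B n + M * (1 / real N)" by (simp add: add_divide_distrib)
      also note elim(1)
      finally show ?case .
    qed
  qed
  thus ?thesis by blast
qed

text \<open>The lower bound on the testing exponent turns the lower limit of \<open>A n / n\<close> into an upper bound for
  every \<open>A n / n\<close> up to the correction \<open>\<kappa> n / n\<close>, which forces convergence.\<close>

lemma stein_limit:
  fixes A \<kappa> :: "nat \<Rightarrow> real" and H :: "real \<Rightarrow> nat \<Rightarrow> ereal"
  assumes A: "\<And>n. 0 \<le> A n" "\<And>n. 1 \<le> n \<Longrightarrow> A n \<le> real n * C" and \<kappa>: "(\<lambda>n. \<kappa> n / real n) \<longlonglongrightarrow> 0"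
    and lower: "\<And>\<epsilon> n. 0 < \<epsilon> \<Longrightarrow> \<epsilon> < 1 \<Longrightarrow> 1 \<le> n \<Longrightarrow>
      ereal ((A n - \<kappa> n) / real n) \<le> liminf (\<lambda>N. ereal (1 / real N) * H \<epsilon> N)"
    and upper: "\<And>\<epsilon> N. 0 < \<epsilon> \<Longrightarrow> \<epsilon> < 1 \<Longrightarrow> H \<epsilon> N \<le> ereal ((A N + k) / (1 - \<epsilon>))"
  shows "\<exists>D. 0 \<le> D \<and> D \<le> C \<and> (\<lambda>n. A n / real n) \<longlonglongrightarrow> D \<and>
    Lim (at_right 0) (\<lambda>\<epsilon>. liminf (\<lambda>N. ereal (1 / real N) * H \<epsilon> N)) = ereal D"
proof -
  define t where "t n = A n / real n" for n
  define e where "e n = \<kappa> n / real n" for n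
  define LI where "LI \<epsilon> = liminf (\<lambda>N. ereal (1 / real N) * H \<epsilon> N)" for \<epsilon>
  have t0: "0 \<le> t n" for n using A(1) by (simp add: t_def)
  have tC: "t n \<le> C" if "n \<ge> 1" for n using A(2)[of n] that by (simp add: t_def field_simps)
  have up: "ereal (1 / real N) * H \<epsilon> N \<le> ereal ((t N + k * (1 / real N)) / (1 - \<epsilon>))" if "0 < \<epsilon>" "\<epsilon> < 1" for \<epsilon> N
  proof -
    have "ereal (1 / real N) * H \<epsilon> N \<le> ereal (1 / real N) * ereal ((A N + k) / (1 - \<epsilon>))"
      by (intro ereal_mult_left_mono upper that) simp
    also have "\<dots> = ereal ((t N + k * (1 / real N)) / (1 - \<epsilon>))"
      by (simp add: t_def add_divide_distrib mult.commute)
    finally show ?thesis .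
  qed
  have "0 \<le> liminf (\<lambda>n. ereal (t n))" by (intro Liminf_bounded always_eventually allI) (simp add: t0)
  moreover have "liminf (\<lambda>n. ereal (t n)) \<le> liminf (\<lambda>n. ereal C)"
    using tC by (intro Liminf_mono) (auto simp: eventually_sequentially)
  ultimately obtain D where D: "liminf (\<lambda>n. ereal (t n)) = ereal D"
    by (cases "liminf (\<lambda>n. ereal (t n))") (auto simp: Liminf_const)
  \<comment> \<open>With \<open>z = 1 - \<epsilon>\<close> the converse loses the factor
    \<open>1 / z\<close>. The left-hand side does not depend on \<open>z\<close>, so letting
    \<open>z\<close> tend to one removes the loss.\<close>
  have le: "t n - e n \<le> D" if n: "n \<ge> 1" for n
  proof (rule field_le_mult_one_interval)
    fix z :: real assume z: "0 < z" "z < 1"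
    show "z * (t n - e n) \<le> D"
    proof (rule dense_le)
      fix y assume "y < z * (t n - e n)"
      hence "ereal (y / z) < ereal (t n - e n)" using z by (simp add: field_simps)
      also have "\<dots> \<le> LI (1 - z)" using lower[of "1 - z" n] z n by (simp add: LI_def t_def e_def diff_divide_distrib)
      finally have "\<forall>\<^sub>F N in sequentially. ereal (y / z) < ereal (1 / real N) * H (1 - z) N"
        unfolding LI_def by (rule less_LiminfD)
      hence "\<forall>\<^sub>F N in sequentially. ereal (y - k * (1 / real N)) \<le> ereal (t N)"
      proof eventually_elim
        case (elim N)
        have "ereal (y / z) < ereal ((t N + k * (1 / real N)) / (1 - (1 - z)))"
          by (rule less_le_trans[OF elim up]) (use z in auto)
        hence "y / z < (t N + k * (1 / real N)) / z" by simp
        hence "y < t N + k * (1 / real N)" using z by (simp only: divide_less_cancel)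
        thus ?case by simp
      qed
      hence "liminf (\<lambda>N. ereal (y - k * (1 / real N))) \<le> liminf (\<lambda>N. ereal (t N))" by (rule Liminf_mono)
      moreover have "(\<lambda>N. y - k * (1 / real N)) \<longlonglongrightarrow> y - k * 0" by (intro tendsto_intros lim_1_over_n)
      hence "liminf (\<lambda>N. ereal (y - k * (1 / real N))) = ereal y"
        by (intro lim_imp_Liminf) (auto intro: tendsto_ereal)
      ultimately show "y \<le> D" by (simp add: D)
    qed
  qed
  have e0: "e \<longlonglongrightarrow> 0" using \<kappa> by (simp add: e_def[abs_def])
  have lim: "t \<longlonglongrightarrow> D"
  proof (rule order_tendstoI)
    fix a assume "a < D"
    hence "ereal a < liminf (\<lambda>n. ereal (t n))" by (simp add: D)
    thus "\<forall>\<^sub>F N in sequentially. a < t N" by (drule_tac less_LiminfD) simp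
  next
    fix a assume "D < a"
    hence "\<forall>\<^sub>F N in sequentially. e N < a - D" using e0 by (intro order_tendstoD(2)) auto
    thus "\<forall>\<^sub>F N in sequentially. t N < a"
      using eventually_ge_at_top[of 1]
    proof eventually_elim
      case (elim N) with le[of N] show ?case by linarith
    qed
  qed
  have D0: "0 \<le> D" using lim t0 by (intro LIMSEQ_le_const[OF lim]) auto
  have DC: "D \<le> C" using tC by (intro LIMSEQ_le_const2[OF lim]) auto
  have ge: "ereal D \<le> LI \<epsilon>" if "0 < \<epsilon>" "\<epsilon> < 1" for \<epsilon>
  proof (rule LIMSEQ_le_const2)
    show "(\<lambda>n. ereal (t n - e n)) \<longlonglongrightarrow> ereal D"
      using tendsto_diff[OF lim e0] by (intro tendsto_ereal) simp
    show "\<exists>N. \<forall>n\<ge>N. ereal (t n - e n) \<le> LI \<epsilon>"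
      using lower[OF that] by (intro exI[of _ 1]) (simp add: LI_def t_def e_def diff_divide_distrib)
  qed
  have le': "LI \<epsilon> \<le> ereal (D / (1 - \<epsilon>))" if \<epsilon>: "0 < \<epsilon>" "\<epsilon> < 1" for \<epsilon>
  proof -
    have "(\<lambda>N. (t N + k * (1 / real N)) / (1 - \<epsilon>)) \<longlonglongrightarrow> (D + k * 0) / (1 - \<epsilon>)"
      using \<epsilon> by (intro tendsto_intros lim lim_1_over_n) simp
    hence "liminf (\<lambda>N. ereal ((t N + k * (1 / real N)) / (1 - \<epsilon>))) = ereal (D / (1 - \<epsilon>))"
      by (intro lim_imp_Liminf) (auto intro: tendsto_ereal)
    moreover have "LI \<epsilon> \<le> liminf (\<lambda>N. ereal ((t N + k * (1 / real N)) / (1 - \<epsilon>)))"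
      unfolding LI_def by (intro Liminf_mono always_eventually allI up \<epsilon>)
    ultimately show ?thesis by simp
  qed
  have ev: "\<forall>\<^sub>F \<epsilon> in at_right 0. 0 < \<epsilon> \<and> \<epsilon> < (1::real)"
    unfolding eventually_at_right_field by (intro exI[of _ 1]) simp
  have "(LI \<longlongrightarrow> ereal D) (at_right 0)"
  proof (rule tendsto_sandwich)
    show "\<forall>\<^sub>F \<epsilon> in at_right 0. ereal D \<le> LI \<epsilon>" using ev by eventually_elim (simp add: ge)
    show "\<forall>\<^sub>F \<epsilon> in at_right 0. LI \<epsilon> \<le> ereal (D / (1 - \<epsilon>))" using ev by eventually_elim (simp add: le')
    have "((\<lambda>\<epsilon>. D / (1 - \<epsilon>)) \<longlongrightarrow> D / (1 - 0)) (at_right 0)" by (intro tendsto_intros) simp_all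
    thus "((\<lambda>\<epsilon>. ereal (D / (1 - \<epsilon>))) \<longlongrightarrow> ereal D) (at_right 0)" by (intro tendsto_ereal) simp
  qed simp
  hence "Lim (at_right 0) LI = ereal D" by (intro tendsto_Lim) (auto simp: trivial_limit_at_right_real)
  thus ?thesis using D0 DC lim by (auto simp: LI_def[abs_def] t_def[abs_def])
qed

section \<open>Stein exponent for separable measurements\<close>

definition min_D_H :: "(nat \<Rightarrow> nat \<Rightarrow> complex mat list set) \<Rightarrow> nat \<Rightarrow> real \<Rightarrow> nat \<Rightarrow> ereal" where
  "min_D_H M d \<epsilon> N = (INF \<sigma>\<in>sep_states (d ^ N) (d ^ N). D_H (M (d ^ N) (d ^ N)) \<epsilon> (rho d N) \<sigma>)"

text \<open>The block of \<open>n\<close> copies is repeated \<open>N div n\<close> times with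
  threshold \<open>exp c\<close> per block. The error is then a power of some \<open>x < 1\<close>
  and falls below any fixed \<open>\<epsilon>\<close>.\<close>

lemma lr_test_exponent:
  assumes d: "d \<ge> 2" and Z: "lr_test d n Z" and n: "n \<ge> 1" and \<epsilon>: "0 < \<epsilon>"
    and c: "c < (\<Sum>l\<leftarrow>Z. rho_prob d n (fst l) * ln (snd l))"
  shows "ereal (c / (real n * ln 2)) \<le> liminf (\<lambda>N. ereal (1 / real N) * min_D_H SEP_meas d \<epsilon> N)"
proof -
  obtain s where s: "0 < s" "exp (c * s) * chernoff_sum d n s Z < 1" by (rule lr_test_chernoff[OF d Z c])
  define x where "x = exp (c * s) * chernoff_sum d n s Z"
  have "0 \<le> chernoff_sum d n s Z" unfolding chernoff_sum_def
    by (rule sum_list_nonneg) (use Z rho_prob_nonneg[OF d] in \<open>auto simp: lr_test_def\<close>)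
  hence x: "0 \<le> x" "x < 1" using s by (auto simp: x_def)
  have "(\<lambda>m. x ^ m) \<longlonglongrightarrow> 0" using x by (intro LIMSEQ_realpow_zero)
  hence "\<forall>\<^sub>F m in sequentially. x ^ m < \<epsilon>" using \<epsilon> by (rule order_tendstoD(2))
  then obtain M where M: "\<And>m. m \<ge> M \<Longrightarrow> x ^ m < \<epsilon>" unfolding eventually_sequentially by blast
  have key: "ereal (real (N div n) / real N * (c / ln 2)) \<le> ereal (1 / real N) * min_D_H SEP_meas d \<epsilon> N" if N: "N \<ge> n * M" for N
  proof -
    define m where "m = N div n"
    have m: "m \<ge> M" using N n div_le_mono[of "n * M" N n] by (simp add: m_def)
    obtain Z' where Z': "lr_test d N Z'" "chernoff_sum d N s Z' = chernoff_sum d n s Z ^ m"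
      using lr_test_power[OF d Z, of m "N mod n" s] by (auto simp: m_def)
    define T where "T = exp (c * real m)"
    have "T powr s = exp (c * s) ^ m" by (simp add: T_def powr_def mult_ac flip: exp_of_nat_mult)
    hence "T powr s * chernoff_sum d N s Z' = x ^ m" by (simp add: Z'(2) x_def power_mult_distrib)
    hence "T powr s * chernoff_sum d N s Z' \<le> \<epsilon>" using M[OF m] by simp
    hence "ereal (log 2 T) \<le> min_D_H SEP_meas d \<epsilon> N"
      unfolding min_D_H_def by (intro INF_greatest lr_test_test[OF d Z'(1)]) (use s in \<open>auto simp: T_def\<close>)
    hence "ereal (1 / real N) * ereal (log 2 T) \<le> ereal (1 / real N) * min_D_H SEP_meas d \<epsilon> N"
      by (rule ereal_mult_left_mono) simp
    thus ?thesis by (simp add: T_def log_def m_def mult_ac)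
  qed
  have "(\<lambda>N. real (N div n) / real N * (c / ln 2)) \<longlonglongrightarrow> 1 / real n * (c / ln 2)"
    by (intro tendsto_intros floor_ratio_tendsto n)
  hence "liminf (\<lambda>N. ereal (real (N div n) / real N * (c / ln 2))) = ereal (1 / real n * (c / ln 2))"
    by (intro lim_imp_Liminf tendsto_ereal) simp_all
  moreover have "liminf (\<lambda>N. ereal (real (N div n) / real N * (c / ln 2))) \<le> liminf (\<lambda>N. ereal (1 / real N) * min_D_H SEP_meas d \<epsilon> N)"
    by (intro Liminf_mono) (use key in \<open>auto simp: eventually_sequentially\<close>)
  ultimately show ?thesis by simp
qed

lemma min_D_H_SEP_lower:
  assumes d: "d \<ge> 2" and n: "n \<ge> 1" and \<epsilon>: "0 < \<epsilon>" and A: "min_mrel d n = ereal A"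
  shows "ereal ((A - (log 2 (4 * (real n + 1)\<^sup>2) + 1)) / real n) \<le> liminf (\<lambda>N. ereal (1 / real N) * min_D_H SEP_meas d \<epsilon> N)"
proof -
  \<comment> \<open>Giving up one bit yields the strict inequality required by
    \<open>lr_test_exists\<close>; after division by \<open>n\<close> it is negligible.\<close>
  have "ereal (A - 1) < min_mrel d n" by (simp add: A)
  then obtain Z where Z: "lr_test d n Z"
    "(A - 1) * ln 2 - ln (4 * (real n + 1)\<^sup>2) < (\<Sum>l\<leftarrow>Z. rho_prob d n (fst l) * ln (snd l))"
    by (rule lr_test_exists[OF d])
  have "((A - 1) * ln 2 - ln (4 * (real n + 1)\<^sup>2)) / (real n * ln 2)
      = (A - (log 2 (4 * (real n + 1)\<^sup>2) + 1)) / real n"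
    using n by (simp add: log_def field_simps)
  with lr_test_exponent[OF d Z(1) n \<epsilon> Z(2)] show ?thesis by simp
qed

text \<open>A crude bound: the minimum is \<open>- 1 / (e * ln 2)\<close>, but any constant
  disappears after division by the number of copies.\<close>

lemma mult_log_ge: "0 \<le> x \<Longrightarrow> - 2 \<le> x * log 2 (x::real)"
proof (cases "x = 0")
  case False
  assume "0 \<le> x"
  hence x: "x > 0" using False by simp
  have "ln (1 / x) \<le> 1 / x - 1" using x by (intro ln_le_minus_one) simp
  hence "- ln x \<le> 1 / x" using x by (simp add: ln_divide_pos)
  hence "x * - ln x \<le> x * (1 / x)" using x by (intro mult_left_mono) auto
  hence "- 1 \<le> x * ln x" using x by simp
  moreover have "(1::real) \<le> 2 * ln 2" using ln_le_minus_one[of "1 / 2 :: real"] by (simp add: ln_divide_pos)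
  ultimately have "- 2 * ln 2 \<le> x * ln x" by linarith
  thus ?thesis using ln_gt_zero[of "2::real"] by (simp add: log_def field_simps)
qed simp

text \<open>The two entropy terms contribute at least \<open>- 2\<close> each by
  \<open>mult_log_ge\<close>, and the cross term with \<open>1 - q\<close> is nonnegative and
  dropped.\<close>

lemma kl_real_two_outcome:
  assumes p: "0 \<le> p" "p \<le> 1" and q: "0 < q" "q \<le> 1" and pq: "q = 1 \<Longrightarrow> p = 1"
    and B: "kl_real p q + kl_real (1 - p) (1 - q) \<le> B"
  shows "p * (- log 2 q) \<le> B + 4"
proof -
  have 1: "kl_real p q \<ge> p * (- log 2 q) - 2"
  proof (cases "p = 0")
    case False
    hence "kl_real p q = p * log 2 p - p * log 2 q" using p q by (simp add: kl_real_def log_divide_pos algebra_simps)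
    thus ?thesis using mult_log_ge[OF p(1)] by simp
  qed (simp add: kl_real_def)
  have 2: "kl_real (1 - p) (1 - q) \<ge> - 2"
  proof (cases "p = 1")
    case False
    hence q1: "0 < 1 - q" "0 < 1 - p" using p q pq by force+
    hence "kl_real (1 - p) (1 - q) = (1 - p) * log 2 (1 - p) - (1 - p) * log 2 (1 - q)"
      by (simp add: kl_real_def log_divide_pos algebra_simps)
    moreover have "(1 - p) * log 2 (1 - q) \<le> 0" using q1 q by (intro mult_nonneg_nonpos) auto
    ultimately show ?thesis using mult_log_ge[of "1 - p"] q1 by simp
  qed (simp add: kl_real_def)
  show ?thesis using 1 2 B by simp
qed

text \<open>Every feasible test is itself a separable measurement with two outcomes, so its
  classical divergence is bounded by \<open>B\<close>. The test that always accepts shows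
  feasibility.\<close>

lemma D_H_weak_converse:
  assumes d: "d \<ge> 2" and \<sigma>: "\<sigma> \<in> sep_states (d ^ n) (d ^ n)" and B: "mrel d n \<sigma> \<le> ereal B" and \<epsilon>: "0 \<le> \<epsilon>" "\<epsilon> < 1"
  shows "D_H (SEP_meas (d ^ n) (d ^ n)) \<epsilon> (rho d n) \<sigma> \<le> ereal ((B + 4) / (1 - \<epsilon>))"
proof -
  let ?N = "d ^ n" and ?D = "d ^ n * d ^ n" and ?b = "2 powr (- ((B + 4) / (1 - \<epsilon>)))"
  have N0: "?N > 0" using d by simp
  note \<sigma>c = sep_states_carrier[OF \<sigma>]
  have tr1: "Re (mat_trace (rho d n)) = 1" "Re (mat_trace \<sigma>) = 1"
    using density_rho[OF d] \<sigma> by (simp_all add: density_def sep_states_iff)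
  have "D_H (SEP_meas ?N ?N) \<epsilon> (rho d n) \<sigma> \<le> ereal (- log 2 ?b)"
  proof (rule D_H_le[OF rho_carrier])
    show "psd ?D (1\<^sub>m ?D)" by (rule psd_one)
    have z: "1\<^sub>m ?D - 1\<^sub>m ?D = (0\<^sub>m ?D ?D :: complex mat)" by (rule eq_matI) auto
    have z': "sep_op ?N ?N (0\<^sub>m ?D ?D)" by (rule sep_op_scale[OF sep_op_one, of 0]) auto
    show "psd ?D (1\<^sub>m ?D - 1\<^sub>m ?D)" unfolding z by (rule sep_op_psd[OF z'])
    show "[1\<^sub>m ?D, 1\<^sub>m ?D - 1\<^sub>m ?D] \<in> SEP_meas ?N ?N"
      unfolding SEP_meas_iff[OF N0 N0] z using sep_op_one z' by (auto simp: sum_mats_def intro!: eq_matI)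
    show "1 - \<epsilon> \<le> Re (mat_trace (1\<^sub>m ?D * rho d n))" using \<epsilon> by (simp add: left_mult_one_mat[OF rho_carrier] tr1)
    show "0 < ?b" by simp
  next
    fix E assume E: "psd ?D E" "psd ?D (1\<^sub>m ?D - E)" "[E, 1\<^sub>m ?D - E] \<in> SEP_meas ?N ?N"
      and acc: "1 - \<epsilon> \<le> Re (mat_trace (E * rho d n))"
    note Ec = psd_carrier[OF E(1)] and E'c = psd_carrier[OF E(2)]
    define p q where "p = Re (mat_trace (rho d n * E))" and "q = Re (mat_trace (\<sigma> * E))"
    have co: "Re (mat_trace (X * (1\<^sub>m ?D - E))) = 1 - Re (mat_trace (X * E))"
      if X: "X \<in> carrier_mat ?D ?D" "Re (mat_trace X) = 1" for X
      by (simp add: mult_minus_distrib_mat[OF X(1) one_carrier_mat Ec] mat_trace_minus[OF X(1) mult_carrier_mat[OF X(1) Ec]] right_mult_one_mat[OF X(1)] X(2))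
    have p': "Re (mat_trace (rho d n * (1\<^sub>m ?D - E))) = 1 - p" unfolding p_def by (rule co[OF rho_carrier tr1(1)])
    have q': "Re (mat_trace (\<sigma> * (1\<^sub>m ?D - E))) = 1 - q" unfolding q_def by (rule co[OF \<sigma>c tr1(2)])
    have pr: "psd ?D (rho d n)" using density_rho[OF d] by (simp add: density_def)
    have p: "0 \<le> p" "p \<le> 1" "1 - \<epsilon> \<le> p" and q0: "0 \<le> q" "q \<le> 1"
      using mat_trace_psd_mult[OF pr E(1)] mat_trace_psd_mult[OF pr E(2)] acc
        mat_trace_psd_mult[OF sep_states_psd[OF \<sigma>] E(1)] mat_trace_psd_mult[OF sep_states_psd[OF \<sigma>] E(2)]
      unfolding p' q' by (auto simp: p_def q_def mat_trace_comm[OF Ec rho_carrier])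
    have "(\<Sum>F\<leftarrow>[E, 1\<^sub>m ?D - E]. kl_term (Re (mat_trace (rho d n * F))) (Re (mat_trace (\<sigma> * F)))) \<le> mrel d n \<sigma>"
      unfolding mrel_def measured_rel_entropy_def by (rule SUP_upper[OF E(3)])
    hence kl: "kl_term p q + kl_term (1 - p) (1 - q) \<le> ereal B"
      using B by (simp only: list.map sum_list.Cons sum_list.Nil p' q' p_def[symmetric] q_def[symmetric]) auto
    have p0: "p > 0" using p \<epsilon> by linarith
    have fin: "kl_term x y \<noteq> - \<infinity>" for x y by (simp add: kl_term_def)
    \<comment> \<open>A finite divergence excludes an outcome that is impossible under \<sigma> but
      possible under \<open>rho d n\<close>; the same argument gives \<open>pq\<close> for the
      second outcome.\<close>
    have q: "q > 0"
    proof (rule ccontr)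
      assume "\<not> q > 0"
      hence "kl_term p q = \<infinity>" using q0 p0 by (simp add: kl_term_def)
      thus False using kl fin[of "1 - p" "1 - q"] by (cases "kl_term (1 - p) (1 - q)") auto
    qed
    have pq: "p = 1" if "q = 1"
    proof (rule ccontr)
      assume "p \<noteq> 1"
      hence "kl_term (1 - p) (1 - q) = \<infinity>" using that by (simp add: kl_term_def)
      thus False using kl fin[of p q] by (cases "kl_term p q") auto
    qed
    have "kl_term p q = ereal (kl_real p q)" "kl_term (1 - p) (1 - q) = ereal (kl_real (1 - p) (1 - q))"
      using q pq by (auto simp: kl_term_def kl_real_def)
    hence "kl_real p q + kl_real (1 - p) (1 - q) \<le> B" using kl by simp
    from kl_real_two_outcome[OF p(1,2) q q0(2) pq this] have k: "p * (- log 2 q) \<le> B + 4" .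
    have "log 2 q \<le> 0" using q q0 by simp
    hence "(1 - \<epsilon>) * (- log 2 q) \<le> p * (- log 2 q)" using p by (intro mult_right_mono) auto
    with k have "- log 2 q \<le> (B + 4) / (1 - \<epsilon>)" using \<epsilon> by (simp add: field_simps)
    hence "- ((B + 4) / (1 - \<epsilon>)) \<le> log 2 q" by linarith
    hence "?b \<le> q" using q by (simp add: le_log_iff)
    thus "?b \<le> Re (mat_trace (E * \<sigma>))" by (simp add: q_def mat_trace_comm[OF Ec \<sigma>c])
  qed
  thus ?thesis by simp
qed

text \<open>\<open>stein_limit\<close> with a logarithmic correction \<kappa>. It yields existence
  of the regularized limit along with its identification.\<close>

theorem D_SEP_reg_eq_stein:
  assumes d: "d \<ge> 2"
  shows "\<exists>D. 0 \<le> D \<and> D \<le> log 2 (1 + 2 / real d) \<and> D_SEP_reg d d (antisym_state d) = ereal D \<and>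
    stein SEP_meas d d (antisym_state d) = ereal D"
proof -
  define A where "A n = real_of_ereal (min_mrel d n)" for n
  have A: "min_mrel d n = ereal (A n)" "0 \<le> A n" "A n \<le> real n * log 2 (1 + 2 / real d)" for n
    using min_mrel_nonneg[OF d, of n] min_mrel_upper[OF d, of n] by (cases "min_mrel d n"; simp add: A_def)+
  define \<kappa> where "\<kappa> n = log 2 (4 * (real n + 1)\<^sup>2) + 1" for n
  have "(\<lambda>n. \<kappa> n / real n) \<longlonglongrightarrow> 0" unfolding \<kappa>_def by real_asymp
  moreover have "ereal ((A n - \<kappa> n) / real n) \<le> liminf (\<lambda>N. ereal (1 / real N) * min_D_H SEP_meas d \<epsilon> N)"
    if "0 < \<epsilon>" "n \<ge> 1" for \<epsilon> n
    unfolding \<kappa>_def by (rule min_D_H_SEP_lower[OF d that(2,1) A(1)])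
  \<comment> \<open>The constant \<open>5\<close> is the \<open>4\<close> of the weak converse plus
    \<open>1\<close> for choosing a nearly optimal \<sigma>.\<close>
  moreover have "min_D_H SEP_meas d \<epsilon> N \<le> ereal ((A N + 5) / (1 - \<epsilon>))" if \<epsilon>: "0 < \<epsilon>" "\<epsilon> < 1" for \<epsilon> N
  proof -
    have "min_mrel d N < ereal (A N + 1)" by (simp add: A)
    then obtain \<sigma> where \<sigma>: "\<sigma> \<in> sep_states (d ^ N) (d ^ N)" "mrel d N \<sigma> < ereal (A N + 1)"
      unfolding min_mrel_def INF_less_iff by blast
    have "D_H (SEP_meas (d ^ N) (d ^ N)) \<epsilon> (rho d N) \<sigma> \<le> ereal ((A N + 1 + 4) / (1 - \<epsilon>))"
      using \<sigma>(2) \<epsilon> by (intro D_H_weak_converse[OF d \<sigma>(1)]) auto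
    thus ?thesis unfolding min_D_H_def using \<sigma>(1) by (intro INF_lower2[of \<sigma>]) (simp_all add: add.assoc)
  qed
  ultimately obtain D where D: "0 \<le> D" "D \<le> log 2 (1 + 2 / real d)" "(\<lambda>n. A n / real n) \<longlonglongrightarrow> D"
    "Lim (at_right 0) (\<lambda>\<epsilon>. liminf (\<lambda>N. ereal (1 / real N) * min_D_H SEP_meas d \<epsilon> N)) = ereal D"
    using stein_limit[of A "log 2 (1 + 2 / real d)" \<kappa> "min_D_H SEP_meas d" 5] A(2,3) by blast
  have "(\<lambda>n. ereal (1 / real n) * min_mrel d n) \<longlonglongrightarrow> ereal D"
    using tendsto_ereal[OF D(3)] by (simp add: A(1))
  hence "D_SEP_reg d d (antisym_state d) = ereal D"
    unfolding D_SEP_reg_def regularized_div_def rho_def[symmetric] mrel_def[symmetric] min_mrel_def[symmetric] by (rule limI)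
  moreover have "stein SEP_meas d d (antisym_state d) = ereal D"
    using D(4) by (simp only: stein_def rho_def[symmetric] min_D_H_def[symmetric])
  ultimately show ?thesis using D by blast
qed

section \<open>Unrestricted measurements\<close>

lemma smult_mult_mat_vec:
  fixes k :: "'a::comm_semiring_1"
  assumes "A \<in> carrier_mat n m" "v \<in> carrier_vec m"
  shows "(k \<cdot>\<^sub>m A) *\<^sub>v v = k \<cdot>\<^sub>v (A *\<^sub>v v)"
  using assms by (intro eq_vecI) (auto simp: scalar_prod_def sum_distrib_left mult.assoc)

text \<open>Continuity of the logarithm replaces attainment of the supremum; a loss of
  \<open>e\<close> bits is allowed and then removed.\<close>

lemma le_minus_log_Sup:
  fixes X :: ereal and V :: "real set"
  assumes V: "V \<noteq> {}" "bdd_above V" "0 < Sup V"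
    and le: "\<And>h. h \<in> V \<Longrightarrow> 0 < h \<Longrightarrow> X \<le> ereal (c - log 2 h)"
  shows "X \<le> ereal (c - log 2 (Sup V))"
proof (rule ereal_le_epsilon2)
  fix e :: real assume e: "0 < e"
  have "Sup V * 2 powr (- e) < Sup V" using V(3) e by (simp add: powr_less_one)
  then obtain h where h: "h \<in> V" "Sup V * 2 powr (- e) < h" using less_cSup_iff[OF V(1,2)] by blast
  have h0: "0 < h" using h(2) V(3) by (smt (verit) mult_pos_pos powr_gt_zero)
  have "log 2 (Sup V * 2 powr (- e)) \<le> log 2 h" using h(2) V(3) by (intro log_mono) auto
  hence "log 2 (Sup V) - e \<le> log 2 h" using V(3) by (simp add: log_mult_pos)
  thus "X \<le> ereal (c - log 2 (Sup V)) + ereal e" using le[OF h(1) h0] by (auto elim!: order_trans)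
qed

definition antisym_overlaps :: "nat \<Rightarrow> nat \<Rightarrow> real set" where
  "antisym_overlaps d n = (\<lambda>\<sigma>. Re (mat_trace (antisym_proj d n * \<sigma>))) ` sep_states (d ^ n) (d ^ n)"

definition max_overlap :: "nat \<Rightarrow> nat \<Rightarrow> real" where "max_overlap d n = Sup (antisym_overlaps d n)"

lemma antisym_proj_idem: "antisym_proj d n * antisym_proj d n = antisym_proj d n"
  unfolding antisym_proj_def type_proj_mult[OF antisym_type_copy_types antisym_type_copy_types] by simp

lemma rho_idem:
  assumes d: "d \<ge> 2"
  shows "rho d n * rho d n = complex_of_real (1 / antisym_rank d n) \<cdot>\<^sub>m rho d n"
  unfolding rho_antisym_proj[OF d]
    mult_smult_assoc_mat[OF antisym_proj_carrier smult_carrier_mat[OF antisym_proj_carrier]]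
    mult_smult_distrib[OF antisym_proj_carrier antisym_proj_carrier] antisym_proj_idem ..

lemma antisym_rank_add: "antisym_rank d (m + n) = antisym_rank d m * antisym_rank d n"
proof -
  have "antisym_rank d k = copy_rank d 2 ^ k" for k unfolding antisym_rank_def type_rank_def antisym_type_def by simp
  thus ?thesis by (simp add: power_add)
qed

lemma trace_antisym_proj: "d \<ge> 2 \<Longrightarrow> mat_trace (antisym_proj d n) = of_real (antisym_rank d n)"
  unfolding antisym_proj_def antisym_rank_def by (rule mat_trace_type_proj[OF antisym_type_copy_types])

lemma antisym_overlaps_props:
  assumes d: "d \<ge> 2"
  shows "antisym_overlaps d n \<noteq> {}" "bdd_above (antisym_overlaps d n)" "0 < max_overlap d n" "max_overlap d n \<le> sqrt ((3 / 4) ^ n)"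
proof -
  let ?N = "d ^ n" and ?D = "d ^ n * d ^ n"
  have N0: "?N > 0" using d by simp
  have le: "x \<le> sqrt ((3 / 4) ^ n)" if "x \<in> antisym_overlaps d n" for x
    using that trace_antisym_proj_sep_le[OF d] by (auto simp: antisym_overlaps_def)
  show ne: "antisym_overlaps d n \<noteq> {}" using sep_states_nonempty[OF N0 N0] by (simp add: antisym_overlaps_def)
  show bdd: "bdd_above (antisym_overlaps d n)" using le by (rule bdd_aboveI)
  show "max_overlap d n \<le> sqrt ((3 / 4) ^ n)" unfolding max_overlap_def by (rule cSup_least[OF ne le])
  \<comment> \<open>The maximally mixed state is separable and has positive overlap, which makes the
    logarithm of the supremum meaningful.\<close>
  define \<tau> where "\<tau> = complex_of_real (1 / real ?D) \<cdot>\<^sub>m (1\<^sub>m ?D :: complex mat)"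
  have "sep_op ?N ?N \<tau>" by (rule sep_op_scale[OF sep_op_one, of "1 / real ?D"]) (auto simp: \<tau>_def)
  moreover have "mat_trace \<tau> = 1" using d by (simp add: \<tau>_def mat_trace_def)
  ultimately have "\<tau> \<in> sep_states ?N ?N" by (simp add: sep_states_iff)
  hence mem: "Re (mat_trace (antisym_proj d n * \<tau>)) \<in> antisym_overlaps d n" by (simp add: antisym_overlaps_def)
  have "mat_trace (antisym_proj d n * \<tau>) = mat_trace (\<tau> * antisym_proj d n)"
    by (rule mat_trace_comm[OF antisym_proj_carrier]) (simp add: \<tau>_def)
  also have "\<dots> = complex_of_real (1 / real ?D) * mat_trace (1\<^sub>m ?D * antisym_proj d n)"
    unfolding \<tau>_def by (rule mat_trace_smult_mult[OF one_carrier_mat antisym_proj_carrier])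
  also have "\<dots> = of_real (antisym_rank d n / real ?D)"
    by (simp add: left_mult_one_mat[OF antisym_proj_carrier] trace_antisym_proj[OF d])
  finally have "Re (mat_trace (antisym_proj d n * \<tau>)) = antisym_rank d n / real ?D" by (metis Re_complex_of_real)
  moreover have "antisym_rank d n / real ?D > 0" using antisym_rank_pos[OF d] d by simp
  ultimately show "0 < max_overlap d n" unfolding max_overlap_def using cSup_upper[OF mem bdd] by linarith
qed

lemma trace_antisym_proj_le_max_overlap:
  assumes "d \<ge> 2" "\<sigma> \<in> sep_states (d ^ n) (d ^ n)"
  shows "Re (mat_trace (antisym_proj d n * \<sigma>)) \<le> max_overlap d n"
  unfolding max_overlap_def by (rule cSup_upper[OF _ antisym_overlaps_props(2)[OF assms(1)]]) (use assms in \<open>simp add: antisym_overlaps_def\<close>)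

text \<open>Products of separable states are separable and overlaps multiply. The two suprema are
  taken one after the other, each time dividing by a positive factor.\<close>

lemma max_overlap_add:
  assumes d: "d \<ge> 2"
  shows "max_overlap d m * max_overlap d n \<le> max_overlap d (m + n)"
proof -
  have 1: "h * h' \<le> max_overlap d (m + n)" if "h \<in> antisym_overlaps d m" "h' \<in> antisym_overlaps d n" for h h'
  proof -
    from that obtain \<sigma> \<tau> where s: "\<sigma> \<in> sep_states (d ^ m) (d ^ m)" "h = Re (mat_trace (antisym_proj d m * \<sigma>))"
      and t: "\<tau> \<in> sep_states (d ^ n) (d ^ n)" "h' = Re (mat_trace (antisym_proj d n * \<tau>))"
      by (auto simp: antisym_overlaps_def)
    let ?X = "box (d ^ m) (d ^ m) (d ^ n) (d ^ n) \<sigma> \<tau>"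
    have X: "?X \<in> sep_states (d ^ (m + n)) (d ^ (m + n))"
      using box_sep_states[OF s(1) t(1)] by (simp add: power_add)
    have "mat_trace (rho d (m + n) * ?X) = mat_trace (rho d m * \<sigma>) * mat_trace (rho d n * \<tau>)"
      unfolding rho_add by (rule mat_trace_box_mult[OF rho_carrier sep_states_carrier[OF s(1)] rho_carrier sep_states_carrier[OF t(1)]])
    hence "mat_trace (antisym_proj d (m + n) * ?X) = mat_trace (antisym_proj d m * \<sigma>) * mat_trace (antisym_proj d n * \<tau>)"
      using antisym_rank_pos[OF d, of m] antisym_rank_pos[OF d, of n]
      unfolding mat_trace_rho_mult[OF d sep_states_carrier[OF X]] mat_trace_rho_mult[OF d sep_states_carrier[OF s(1)]]
        mat_trace_rho_mult[OF d sep_states_carrier[OF t(1)]] antisym_rank_add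
      by (simp add: field_simps)
    moreover have "Im (mat_trace (antisym_proj d m * \<sigma>)) = 0"
      using mat_trace_herm_real[OF psd_antisym_proj sep_states_psd[OF s(1)]] by (metis Im_complex_of_real)
    ultimately have "Re (mat_trace (antisym_proj d (m + n) * ?X)) = h * h'" by (simp add: s t)
    with trace_antisym_proj_le_max_overlap[OF d X] show ?thesis by simp
  qed
  have nn: "0 \<le> h'" if "h' \<in> antisym_overlaps d n" for h' n
    using that mat_trace_psd_mult[OF psd_antisym_proj sep_states_psd] by (auto simp: antisym_overlaps_def)
  have 2: "max_overlap d m * h' \<le> max_overlap d (m + n)" if h': "h' \<in> antisym_overlaps d n" for h'
  proof (cases "h' = 0")
    case False
    hence h0: "h' > 0" using nn[OF h'] by simp
    have "max_overlap d m \<le> max_overlap d (m + n) / h'"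
      unfolding max_overlap_def[of d m] by (rule cSup_least[OF antisym_overlaps_props(1)[OF d]]) (use 1[OF _ h'] h0 in \<open>simp add: field_simps\<close>)
    thus ?thesis using h0 by (simp add: field_simps)
  qed (use antisym_overlaps_props(3)[OF d, of "m + n"] in simp)
  have "max_overlap d n \<le> max_overlap d (m + n) / max_overlap d m"
    unfolding max_overlap_def[of d n] by (rule cSup_least[OF antisym_overlaps_props(1)[OF d]])
      (use 2 antisym_overlaps_props(3)[OF d, of m] in \<open>simp add: field_simps\<close>)
  thus ?thesis using antisym_overlaps_props(3)[OF d, of m] by (simp add: field_simps)
qed

lemma twirl_n_sep_states:
  "d \<ge> 2 \<Longrightarrow> \<sigma> \<in> sep_states (d ^ n) (d ^ n) \<Longrightarrow> twirl_n d n \<sigma> \<in> sep_states (d ^ n) (d ^ n)"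
  using sep_op_twirl_n mat_trace_twirl_n[OF _ sep_states_carrier] unfolding sep_states_iff by metis

text \<open>Upper bound: a twirled state acts as a scalar on the support of \<open>rho d n\<close>,
  so its relative entropy is exactly minus the logarithm of the overlap. Lower bound: Jensen's
  inequality in \<open>rel_entropy_flat_ge\<close>, where the rank cancels.\<close>

lemma INF_rel_entropy_rho:
  assumes d: "d \<ge> 2"
  shows "(INF \<sigma>\<in>sep_states (d ^ n) (d ^ n). rel_entropy (rho d n) \<sigma>) = ereal (- log 2 (max_overlap d n))"
proof (rule antisym)
  let ?N = "d ^ n" and ?D = "d ^ n * d ^ n"
  note K = antisym_rank_pos[OF d, of n] and H = antisym_overlaps_props[OF d, of n]
  have "(INF \<sigma>\<in>sep_states ?N ?N. rel_entropy (rho d n) \<sigma>) \<le> ereal (0 - log 2 (Sup (antisym_overlaps d n)))"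
  proof (rule le_minus_log_Sup[OF H(1,2) H(3)[unfolded max_overlap_def]])
    fix h assume h: "h \<in> antisym_overlaps d n" "0 < h"
    then obtain \<sigma> where \<sigma>: "\<sigma> \<in> sep_states ?N ?N" and he: "h = Re (mat_trace (antisym_proj d n * \<sigma>))"
      by (auto simp: antisym_overlaps_def)
    note t = twirl_n_sep_states[OF d \<sigma>]
    note eig = rho_twirl_n(1)[OF d sep_states_psd[OF \<sigma>], folded he]
    \<comment> \<open>A kernel vector of the twirled state is annihilated by \<open>rho d n\<close>,
      because \<open>h > 0\<close> in the eigenvalue equation.\<close>
    have "mat_supp (rho d n) \<subseteq> mat_supp (twirl_n d n \<sigma>)"
    proof (rule mat_supp_mono[OF rho_carrier twirl_n_carrier])
      fix v :: "complex vec" assume v: "v \<in> carrier_vec ?D" "twirl_n d n \<sigma> *\<^sub>v v = 0\<^sub>v ?D"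
      have "(rho d n * twirl_n d n \<sigma>) *\<^sub>v v = rho d n *\<^sub>v (twirl_n d n \<sigma> *\<^sub>v v)"
        by (rule assoc_mult_mat_vec[OF rho_carrier twirl_n_carrier v(1)])
      also have "\<dots> = 0\<^sub>v ?D" unfolding v(2) by (rule eq_vecI) (simp_all add: scalar_prod_def)
      finally have z: "complex_of_real (h / antisym_rank d n) \<cdot>\<^sub>v (rho d n *\<^sub>v v) = 0\<^sub>v ?D"
        unfolding eig smult_mult_mat_vec[OF rho_carrier v(1)] .
      show "rho d n *\<^sub>v v = 0\<^sub>v ?D"
      proof (rule eq_vecI)
        fix i assume "i < dim_vec (0\<^sub>v ?D :: complex vec)"
        hence i: "i < ?D" by simp
        have "(complex_of_real (h / antisym_rank d n) \<cdot>\<^sub>v (rho d n *\<^sub>v v)) $ i = 0" unfolding z using i by simp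
        thus "(rho d n *\<^sub>v v) $ i = 0\<^sub>v ?D $ i" using i h K by simp
      qed simp
    qed
    hence "rel_entropy (rho d n) (twirl_n d n \<sigma>) = ereal (log 2 (1 / antisym_rank d n) - log 2 (h / antisym_rank d n))"
      by (rule rel_entropy_flat_eigen[OF density_rho[OF d] rho_idem[OF d] sep_states_psd[OF t] eig])
    also have "log 2 (1 / antisym_rank d n) - log 2 (h / antisym_rank d n) = 0 - log 2 h"
      using h K by (simp add: log_divide_pos)
    finally show "(INF \<sigma>\<in>sep_states ?N ?N. rel_entropy (rho d n) \<sigma>) \<le> ereal (0 - log 2 h)"
      using t by (intro INF_lower2[OF t]) simp
  qed
  thus "(INF \<sigma>\<in>sep_states ?N ?N. rel_entropy (rho d n) \<sigma>) \<le> ereal (- log 2 (max_overlap d n))" by (simp add: max_overlap_def)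
  show "ereal (- log 2 (max_overlap d n)) \<le> (INF \<sigma>\<in>sep_states ?N ?N. rel_entropy (rho d n) \<sigma>)"
  proof (rule INF_greatest)
    fix \<sigma> assume \<sigma>: "\<sigma> \<in> sep_states ?N ?N"
    define g where "g = Re (mat_trace (antisym_proj d n * \<sigma>))"
    have tr: "Re (mat_trace (rho d n * \<sigma>)) = g / antisym_rank d n"
      by (simp add: mat_trace_rho_mult[OF d sep_states_carrier[OF \<sigma>]] g_def)
    have "0 < g \<and> - log 2 g = log 2 (1 / antisym_rank d n) - log 2 (g / antisym_rank d n)" if "0 < g / antisym_rank d n"
      using that K by (simp add: log_divide_pos zero_less_divide_iff)
    with rel_entropy_flat_ge[OF density_rho[OF d] rho_idem[OF d] sep_states_psd[OF \<sigma>]]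
    have "0 < g \<and> ereal (- log 2 g) \<le> rel_entropy (rho d n) \<sigma> \<or> rel_entropy (rho d n) \<sigma> = \<infinity>"
      unfolding tr by auto
    moreover have "- log 2 (max_overlap d n) \<le> - log 2 g" if "0 < g"
      using log_mono[OF _ that trace_antisym_proj_le_max_overlap[OF d \<sigma>, folded g_def], of 2] by simp
    ultimately show "ereal (- log 2 (max_overlap d n)) \<le> rel_entropy (rho d n) \<sigma>"
      by (auto elim: order_trans[rotated])
  qed
qed

section \<open>Testing with unrestricted measurements\<close>

lemma ALL_meas_two:
  assumes "psd (a * b) E" "psd (a * b) (1\<^sub>m (a * b) - E)"
  shows "[E, 1\<^sub>m (a * b) - E] \<in> ALL_meas a b"
  unfolding ALL_meas_def using assms psd_carrier[OF assms(1)] by (auto simp: sum_mats_def intro!: eq_matI)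

lemma trace_antisym_proj_rho: "d \<ge> 2 \<Longrightarrow> mat_trace (antisym_proj d n * rho d n) = 1"
  using antisym_rank_pos[of d n]
  by (simp add: mat_trace_comm[OF antisym_proj_carrier rho_carrier] mat_trace_rho_mult antisym_proj_idem trace_antisym_proj)

text \<open>The test is the antisymmetric projection: it accepts \<open>rho d n\<close> with
  certainty.\<close>

lemma min_D_H_ALL_lower:
  assumes d: "d \<ge> 2" and \<epsilon>: "0 \<le> \<epsilon>"
  shows "ereal (- log 2 (max_overlap d n)) \<le> min_D_H ALL_meas d \<epsilon> n"
  unfolding min_D_H_def
proof (rule INF_greatest)
  fix \<sigma> assume \<sigma>: "\<sigma> \<in> sep_states (d ^ n) (d ^ n)"
  show "ereal (- log 2 (max_overlap d n)) \<le> D_H (ALL_meas (d ^ n) (d ^ n)) \<epsilon> (rho d n) \<sigma>"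
    by (rule D_H_ge[OF rho_carrier sep_states_psd[OF \<sigma>] psd_antisym_proj psd_one_minus_antisym_proj ALL_meas_two[OF psd_antisym_proj psd_one_minus_antisym_proj]])
      (use \<epsilon> antisym_overlaps_props(3)[OF d] trace_antisym_proj_le_max_overlap[OF d \<sigma>] in \<open>auto simp: trace_antisym_proj_rho[OF d]\<close>)
qed

text \<open>A twirled state dominates \<open>h\<close> times \<open>rho d n\<close>, so every test
  that accepts the latter with probability at least \<open>1 - \<epsilon>\<close> accepts the former
  with probability at least \<open>h * (1 - \<epsilon>)\<close>.\<close>

lemma min_D_H_ALL_upper:
  assumes d: "d \<ge> 2" and \<epsilon>: "0 \<le> \<epsilon>" "\<epsilon> < 1"
  shows "min_D_H ALL_meas d \<epsilon> n \<le> ereal (- log 2 (1 - \<epsilon>) - log 2 (max_overlap d n))"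
  unfolding max_overlap_def
proof (rule le_minus_log_Sup[OF antisym_overlaps_props(1,2)[OF d] antisym_overlaps_props(3)[OF d, unfolded max_overlap_def]])
  let ?N = "d ^ n" and ?D = "d ^ n * d ^ n"
  fix h assume h: "h \<in> antisym_overlaps d n" "0 < h"
  then obtain \<sigma> where \<sigma>: "\<sigma> \<in> sep_states ?N ?N" and he: "h = Re (mat_trace (antisym_proj d n * \<sigma>))"
    by (auto simp: antisym_overlaps_def)
  note t = twirl_n_sep_states[OF d \<sigma>] and dom = rho_twirl_n(2)[OF d sep_states_psd[OF \<sigma>], folded he]
  have "D_H (ALL_meas ?N ?N) \<epsilon> (rho d n) (twirl_n d n \<sigma>) \<le> ereal (- log 2 (h * (1 - \<epsilon>)))"
  proof (rule D_H_le[OF rho_carrier psd_antisym_proj psd_one_minus_antisym_proj ALL_meas_two[OF psd_antisym_proj psd_one_minus_antisym_proj]])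
    show "1 - \<epsilon> \<le> Re (mat_trace (antisym_proj d n * rho d n))" using \<epsilon> by (simp add: trace_antisym_proj_rho[OF d])
    show "0 < h * (1 - \<epsilon>)" using h \<epsilon> by simp
    fix E assume E: "psd ?D E" and acc: "1 - \<epsilon> \<le> Re (mat_trace (E * rho d n))"
    note Ec = psd_carrier[OF E]
    have "0 \<le> Re (mat_trace (E * (twirl_n d n \<sigma> - complex_of_real h \<cdot>\<^sub>m rho d n)))"
      by (rule mat_trace_psd_mult[OF E dom])
    also have "mat_trace (E * (twirl_n d n \<sigma> - complex_of_real h \<cdot>\<^sub>m rho d n)) =
        mat_trace (E * twirl_n d n \<sigma>) - complex_of_real h * mat_trace (E * rho d n)"
      unfolding mult_minus_distrib_mat[OF Ec twirl_n_carrier smult_carrier_mat[OF rho_carrier]]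
        mat_trace_minus[OF mult_carrier_mat[OF Ec twirl_n_carrier] mult_carrier_mat[OF Ec smult_carrier_mat[OF rho_carrier]]]
        mat_trace_comm[OF Ec smult_carrier_mat[OF rho_carrier]] mat_trace_smult_mult[OF rho_carrier Ec]
        mat_trace_comm[OF rho_carrier Ec] ..
    finally have "h * Re (mat_trace (E * rho d n)) \<le> Re (mat_trace (E * twirl_n d n \<sigma>))" by simp
    moreover have "h * (1 - \<epsilon>) \<le> h * Re (mat_trace (E * rho d n))" using h acc by (intro mult_left_mono) auto
    ultimately show "h * (1 - \<epsilon>) \<le> Re (mat_trace (E * twirl_n d n \<sigma>))" by linarith
  qed
  also have "- log 2 (h * (1 - \<epsilon>)) = - log 2 (1 - \<epsilon>) - log 2 h" using h \<epsilon> by (simp add: log_mult_pos)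
  finally show "min_D_H ALL_meas d \<epsilon> n \<le> ereal (- log 2 (1 - \<epsilon>) - log 2 h)"
    unfolding min_D_H_def by (intro INF_lower2[OF t])
qed

text \<open>Entropy and testing are both governed by the subadditive sequence \<open>B n\<close>.
  Its limit \<open>L\<close> exists by Fekete's lemma, and \<open>B n / n \<ge> b\<close> passes to
  the limit.\<close>

theorem D_reg_eq_stein:
  assumes d: "d \<ge> 2"
  shows "ereal (1 / 2 * log 2 (4 / 3)) \<le> D_reg d d (antisym_state d)"
    and "D_reg d d (antisym_state d) = stein ALL_meas d d (antisym_state d)"
proof -
  define B where "B n = - log 2 (max_overlap d n)" for n
  define b :: real where "b = 1 / 2 * log 2 (4 / 3)"
  note H = antisym_overlaps_props[OF d]
  have b0: "0 \<le> b" by (simp add: b_def)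
  have B_ge: "real n * b \<le> B n" for n
  proof -
    have "log 2 (max_overlap d n) \<le> log 2 (sqrt ((3 / 4) ^ n))" by (intro log_mono H) simp
    also have "\<dots> = real n * (1 / 2 * log 2 (3 / 4))"
      by (simp add: log_def ln_sqrt ln_realpow)
    also have "log 2 (3 / 4) = - log 2 (4 / 3 :: real)" by (simp add: log_divide_pos)
    finally show ?thesis by (simp add: B_def b_def)
  qed
  have B0: "0 \<le> B n" for n using B_ge[of n] b0 by (meson mult_nonneg_nonneg of_nat_0_le_iff order_trans)
  have sub: "B (m + n) \<le> B m + B n" for m n
  proof -
    have "log 2 (max_overlap d m * max_overlap d n) \<le> log 2 (max_overlap d (m + n))" using H(3) by (intro log_mono max_overlap_add[OF d]) auto
    thus ?thesis using H(3)[of m] H(3)[of n] by (simp add: B_def log_mult_pos)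
  qed
  obtain L where L: "(\<lambda>n. B n / real n) \<longlonglongrightarrow> L" using fekete_limit[OF B0 sub] by blast
  have C: "B n \<le> real n * B 1" if "1 \<le> n" for n
    using that
  proof (induction n rule: dec_induct)
    case (step n) thus ?case using sub[of n 1] by (simp add: distrib_right)
  qed simp
  have "L \<ge> b" using L
  proof (rule LIMSEQ_le_const)
    show "\<exists>N. \<forall>n\<ge>N. b \<le> B n / real n"
      using B_ge by (intro exI[of _ 1]) (auto simp: field_simps)
  qed
  \<comment> \<open>The correction is chosen so that the lower bound demanded by
    \<open>stein_limit\<close> becomes the constant \<open>L\<close>, which is already known to
    bound the lower limit.\<close>
  have \<kappa>: "(\<lambda>n. (B n - real n * L) / real n) \<longlonglongrightarrow> 0"
  proof (rule Lim_transform_eventually)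
    show "(\<lambda>n. B n / real n - L) \<longlonglongrightarrow> 0" using tendsto_diff[OF L tendsto_const[of L]] by simp
    show "\<forall>\<^sub>F n in sequentially. B n / real n - L = (B n - real n * L) / real n"
      using eventually_gt_at_top[of 0] by eventually_elim (simp add: field_simps)
  qed
  have lower: "ereal ((B n - (B n - real n * L)) / real n) \<le> liminf (\<lambda>N. ereal (1 / real N) * min_D_H ALL_meas d \<epsilon> N)"
    if \<epsilon>: "0 < \<epsilon>" and n: "1 \<le> n" for \<epsilon> n
  proof -
    have "ereal (B N / real N) \<le> ereal (1 / real N) * min_D_H ALL_meas d \<epsilon> N" for N
    proof -
      have "ereal (1 / real N) * ereal (B N) \<le> ereal (1 / real N) * min_D_H ALL_meas d \<epsilon> N"
        unfolding B_def using \<epsilon> by (intro ereal_mult_left_mono min_D_H_ALL_lower[OF d]) auto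
      thus ?thesis by simp
    qed
    hence "liminf (\<lambda>N. ereal (B N / real N)) \<le> liminf (\<lambda>N. ereal (1 / real N) * min_D_H ALL_meas d \<epsilon> N)"
      by (intro Liminf_mono) simp
    moreover have "liminf (\<lambda>N. ereal (B N / real N)) = ereal L"
      using L by (intro lim_imp_Liminf tendsto_ereal) simp_all
    ultimately show ?thesis using n by simp
  qed
  \<comment> \<open>The additive term \<open>- log 2 (1 - \<epsilon>)\<close> is brought into the
    form of the weak converse by \<open>mult_log_ge\<close>, whence the constant
    \<open>2\<close>.\<close>
  have upper: "min_D_H ALL_meas d \<epsilon> N \<le> ereal ((B N + 2) / (1 - \<epsilon>))" if \<epsilon>: "0 < \<epsilon>" "\<epsilon> < 1" for \<epsilon> N
  proof -
    have "(1 - \<epsilon>) * log 2 (1 - \<epsilon>) \<ge> - 2" using \<epsilon> by (intro mult_log_ge) simp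
    hence "- log 2 (1 - \<epsilon>) \<le> 2 / (1 - \<epsilon>)" using \<epsilon> by (simp add: field_simps)
    moreover have "B N \<le> B N / (1 - \<epsilon>)" using \<epsilon> B0[of N] by (simp add: field_simps)
    ultimately have "- log 2 (1 - \<epsilon>) + B N \<le> (B N + 2) / (1 - \<epsilon>)" by (simp add: add_divide_distrib)
    moreover have "min_D_H ALL_meas d \<epsilon> N \<le> ereal (- log 2 (1 - \<epsilon>) + B N)"
      using min_D_H_ALL_upper[OF d, of \<epsilon> N] \<epsilon> by (simp add: B_def)
    ultimately show ?thesis by (meson ereal_less_eq(3) order_trans)
  qed
  obtain D where D: "(\<lambda>n. B n / real n) \<longlonglongrightarrow> D"
    "Lim (at_right 0) (\<lambda>\<epsilon>. liminf (\<lambda>N. ereal (1 / real N) * min_D_H ALL_meas d \<epsilon> N)) = ereal D"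
    using stein_limit[of B "B 1" "\<lambda>n. B n - real n * L" "min_D_H ALL_meas d" 2, OF B0 C \<kappa> lower upper] by blast
  have "D = L" by (rule LIMSEQ_unique[OF D(1) L])
  have "(\<lambda>n. ereal (1 / real n) * (INF \<sigma>\<in>sep_states (d ^ n) (d ^ n). rel_entropy (rho d n) \<sigma>)) \<longlonglongrightarrow> ereal D"
    unfolding INF_rel_entropy_rho[OF d] B_def[symmetric] using tendsto_ereal[OF D(1)] by simp
  hence reg: "D_reg d d (antisym_state d) = ereal D"
    unfolding D_reg_def regularized_div_def rho_def[symmetric] by (rule limI)
  show "ereal (1 / 2 * log 2 (4 / 3)) \<le> D_reg d d (antisym_state d)"
    using \<open>L \<ge> b\<close> \<open>D = L\<close> by (simp add: reg b_def)
  show "D_reg d d (antisym_state d) = stein ALL_meas d d (antisym_state d)"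
    unfolding reg using D(2) by (simp only: stein_def rho_def[symmetric] min_D_H_def[symmetric])
qed


section \<open>Numerical comparison and conclusion\<close>

lemma log_one_plus_2_over_tendsto_0: "(\<lambda>d::nat. log 2 (1 + 2 / real d)) \<longlonglongrightarrow> 0"
  by real_asymp

text \<open>The origin of \<open>13\<close>: \<open>(15 / 13)\<^sup>2 = 225 / 169\<close> is below
  \<open>4 / 3\<close>, whereas \<open>d = 12\<close> gives \<open>49 / 36\<close>, which exceeds
  it.\<close>

lemma log_one_plus_2_over_less:
  assumes "d \<ge> 13"
  shows "log 2 (1 + 2 / real d) < 1 / 2 * log 2 (4 / 3)"
proof -
  have "2 / real d \<le> 2 / 13" using assms by (intro divide_left_mono) auto
  hence "(1 + 2 / real d)\<^sup>2 \<le> (15 / 13)\<^sup>2" by (intro power_mono) auto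
  also have "\<dots> < 4 / 3" by (simp add: power2_eq_square)
  finally have "log 2 ((1 + 2 / real d)\<^sup>2) < log 2 (4 / 3)"
    by (intro log_less zero_less_power) (simp_all add: add_pos_nonneg)
  moreover have "log 2 ((1 + 2 / real d)\<^sup>2) = 2 * log 2 (1 + 2 / real d)"
    using log_nat_power[of "1 + 2 / real d" 2 2] by simp
  ultimately show ?thesis by simp
qed

theorem theorem3:
  shows "(\<forall>d\<ge>2. D_SEP_reg d d (antisym_state d) \<le> ereal (log 2 (1 + 2 / real d)))
    \<and> (\<lambda>d::nat. log 2 (1 + 2 / real d)) \<longlonglongrightarrow> 0
    \<and> (\<forall>d\<ge>2. ereal (1 / 2 * log 2 (4 / 3)) \<le> D_reg d d (antisym_state d))
    \<and> (\<forall>d\<ge>13. D_SEP_reg d d (antisym_state d) < D_reg d d (antisym_state d))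
    \<and> (\<forall>d\<ge>13. stein SEP_meas d d (antisym_state d) = D_SEP_reg d d (antisym_state d)
          \<and> D_SEP_reg d d (antisym_state d) < ereal (1 / 2 * log 2 (4 / 3))
          \<and> ereal (1 / 2 * log 2 (4 / 3)) \<le> D_reg d d (antisym_state d)
          \<and> D_reg d d (antisym_state d) = stein ALL_meas d d (antisym_state d))
    \<and> (\<lambda>d. stein SEP_meas d d (antisym_state d)) \<longlonglongrightarrow> 0"
proof (intro conjI allI impI)
  \<comment> \<open>Choosing the common value as a function of \<open>d\<close> makes it available
    to the pointwise claims and to the sandwich argument, which needs it eventually only.\<close>
  define D where "D d = (SOME D. 0 \<le> D \<and> D \<le> log 2 (1 + 2 / real d) \<and>
    D_SEP_reg d d (antisym_state d) = ereal D \<and> stein SEP_meas d d (antisym_state d) = ereal D)" for d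
  have D: "0 \<le> D d" "D d \<le> log 2 (1 + 2 / real d)" "D_SEP_reg d d (antisym_state d) = ereal (D d)"
    "stein SEP_meas d d (antisym_state d) = ereal (D d)" if "d \<ge> 2" for d
    using someI_ex[OF D_SEP_reg_eq_stein[OF that], folded D_def] by auto
  have lt: "D_SEP_reg d d (antisym_state d) < ereal (1 / 2 * log 2 (4 / 3))" if "d \<ge> 13" for d
    using D(2,3)[of d] log_one_plus_2_over_less[OF that] that by simp
  show "(\<lambda>d::nat. log 2 (1 + 2 / real d)) \<longlonglongrightarrow> 0" by (rule log_one_plus_2_over_tendsto_0)
  show "(\<lambda>d. stein SEP_meas d d (antisym_state d)) \<longlonglongrightarrow> 0"
  proof (rule tendsto_sandwich)
    show "\<forall>\<^sub>F d in sequentially. 0 \<le> stein SEP_meas d d (antisym_state d)"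
      using eventually_ge_at_top[of 2] by eventually_elim (simp add: D)
    show "\<forall>\<^sub>F d in sequentially. stein SEP_meas d d (antisym_state d) \<le> ereal (log 2 (1 + 2 / real d))"
      using eventually_ge_at_top[of 2] by eventually_elim (simp add: D)
    show "(\<lambda>d. ereal (log 2 (1 + 2 / real d))) \<longlonglongrightarrow> 0"
      using tendsto_ereal[OF log_one_plus_2_over_tendsto_0] by (simp add: zero_ereal_def)
  qed simp
  fix d :: nat
  show "D_SEP_reg d d (antisym_state d) \<le> ereal (log 2 (1 + 2 / real d))" if "2 \<le> d"
    using D(2,3)[OF that] by simp
  show "ereal (1 / 2 * log 2 (4 / 3)) \<le> D_reg d d (antisym_state d)" if "2 \<le> d"
    by (rule D_reg_eq_stein(1)[OF that])
  assume d: "13 \<le> d"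
  hence d2: "2 \<le> d" by simp
  show "ereal (1 / 2 * log 2 (4 / 3)) \<le> D_reg d d (antisym_state d)" by (rule D_reg_eq_stein(1)[OF d2])
  show "D_SEP_reg d d (antisym_state d) < ereal (1 / 2 * log 2 (4 / 3))" by (rule lt[OF d])
  show "D_SEP_reg d d (antisym_state d) < D_reg d d (antisym_state d)"
    using lt[OF d] D_reg_eq_stein(1)[OF d2] by (rule less_le_trans)
  show "stein SEP_meas d d (antisym_state d) = D_SEP_reg d d (antisym_state d)" by (simp add: D[OF d2])
  show "D_reg d d (antisym_state d) = stein ALL_meas d d (antisym_state d)" by (rule D_reg_eq_stein(2)[OF d2])
qed

end
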